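(* Assume $$|H^{0,+}\times[u^0]|^2+|H^{0,-}\times[u^0]|^2<2\,|H^{0,+}\times H^{0,-}|^2 ,$$ $\xi'=(p,q)/\sqrt{p^2+q^2}$ with $(p,q)\in\mathbb Z^2\setminus\{0\}$, $|a^+-a^-|\neq|b^+-b^-|$, $|a^+-a^-|\neq|b^++b^-|$, $(c^+)^2+(c^-)^2=(b^+)^2+(b^-)^2$, and $\tau\neq0$. Let $F^\pm=(F_1^\pm,\dots,F_7^\pm)\in S^\pm$, $F_8^\pm\in S^\pm$ and $G=(G_1,\dots,G_5)\in H^\infty([0,T]\times\mathbb T^2\times\mathbb T)$. Then the fast problem $$\begin{cases}\mathcal L_f^\pm(\partial)U^\pm=F^\pm, & y_3\in I^\pm,\ \pm Y_3>0,\\ \partial_{Y_3}H_3^\pm+\xi_j\partial_\theta H_j^\pm=F_8^\pm, & y_3\in I^\pm,\ \pm Y_3>0,\\ B^+U^+|_{y_3=Y_3=0}+B^-U^-|_{y_3=Y_3=0}+\partial_\theta\psi\,\underline b=G,\end{cases}$$ has a solution $(U^\pm,\psi)\in S^\pm\times H^\infty([0,T]\times\mathbb T^2\times\mathbb T)$ if and only if the following conditions hold: (a) $F_6^+|_{y_3=Y_3=0}=-b^+\partial_\theta G_1+c^+\partial_\theta G_2$ and $F_6^-|_{y_3=Y_3=0}=-b^-\partial_\theta G_3+c^-\partial_\theta G_4$; (b) $\widehat{\underline F}^\pm(t,y,0)=0$ and $\widehat{\underline F}_8^\pm(t,y,0)=0$; (c) for $j=1,2$: $u_j^{0,\pm}\widehat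 F_{7,\star}^\pm(0)-H_j^{0,\pm}\widehat F_{8,\star}^\pm(0)=\widehat F_{j,\star}^\pm(0)$ and $H_j^{0,\pm}\widehat F_{7,\star}^\pm(0)-u_j^{0,\pm}\widehat F_{8,\star}^\pm(0)=\widehat F_{3+j,\star}^\pm(0)$; (d) $\partial_{Y_3}F_6^\pm+\xi_j\partial_\theta F_{3+j}^\pm-\tau\,\partial_\theta F_8^\pm=0$; (e) for all $k\in\mathbb Z\setminus\{0\}$, $$\int_{\mathbb R^+}e^{-|k|Y_3}\,\langle\mathcal L^+(k),\widehat F^+(t,y',0,Y_3,k)\rangle\,dY_3-\int_{\mathbb R^-}e^{|k|Y_3}\,\langle\mathcal L^-(k),\widehat F^-(t,y',0,Y_3,k)\rangle\,dY_3$$ $$+\ell_1^+\widehat G_1(t,y',k)+\ell_2^+\widehat G_2(t,y',k)+\ell_1^-\widehat G_3(t,y',k)+\ell_2^-\widehat G_4(t,y',k)-i\,\tau\,\mathrm{sgn}(k)\,\widehat G_5(t,y',k)=0.$$ If conditions (a)–(e) hold, then the fast problem has a solution of the form $(\mathbb U^\pm,0)$, where $\mathbb U^\pm\in S^\pm$ can be chosen such that $$\Pi\,\widehat{\mathbb U}^\pm(0)=0\quad\text{and}\quad\widehat{\underline{\mathbb U}}^\pm(0)\big|_{y_3=\pm1}=0 .$$ Furthermore, any solution $(U^\pm,\psi)\in S^\pm\times H^\infty([0,T]\times\mathbb T^2\times\mathbb T)$ to the fast problem then reads $$U^\pm(t,y,Y_3,\theta)=\mathbb U^\pm(t,y,Y_3,\theta)+\underline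 U_h^\pm(t,y)+\big(u_{1,\star}^\pm,u_{2,\star}^\pm,0,H_{1,\star}^\pm,H_{2,\star}^\pm,0,0\big)^T(t,y,Y_3)+\sum_{k\in\mathbb Z\setminus\{0\}}\gamma^\pm(t,y,k)\,e^{\mp|k|Y_3+ik\theta}\,\mathcal R^\pm(k),$$ where $\underline U_h^\pm=(\underline u_{h}^\pm,\underline H_{h}^\pm,\underline q_h^\pm)^T\in\underline S^\pm$ is independent of $\theta$; $u_{1,\star}^\pm,u_{2,\star}^\pm,H_{1,\star}^\pm,H_{2,\star}^\pm\in S_\star^\pm$ (independent of $\theta$); the coefficients $\gamma^\pm$ satisfy $\gamma^\pm(t,y',0,k)=\pm|k|\,\widehat\psi(t,y',k)$ for all $(t,y',k)\in[0,T]\times\mathbb T^2\times(\mathbb Z\setminus\{0\})$ and $\gamma^\pm(t,y,-k)=\overline{\gamma^\pm(t,y,k)}$ for all $k\neq0$; and $$\underline u_{h,3}^\pm|_{y_3=0}=\underline H_{h,3}^\pm|_{y_3=0}=0,\qquad \underline q_h^+|_{y_3=0}=\underline q_h^-|_{y_3=0}.$$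
   Context: Statements with $\pm$ hold for both signs; summation over the repeated index $j\in\{1,2\}$ is understood. All source terms and solutions are real valued. Constants. Fix real $u_1^{0,\pm},u_2^{0,\pm},H_1^{0,\pm},H_2^{0,\pm}$; $u^{0,\pm}=(u_1^{0,\pm},u_2^{0,\pm},0)$, $H^{0,\pm}=(H_1^{0,\pm},H_2^{0,\pm},0)$, $[u^0]=u^{0,+}-u^{0,-}$, $U^{0,\pm}=(u^{0,\pm},H^{0,\pm},0)^T\in\mathbb R^7$. Fix $\tau\in\mathbb R$, $\xi'=(\xi_1,\xi_2)\in\mathbb R^2$; $a^\pm=\xi_ju_j^{0,\pm}$, $b^\pm=\xi_jH_j^{0,\pm}$, $c^\pm=\tau+a^\pm$. $\times$ is the cross product in $\mathbb R^3$. Fix $T>0$. Spaces. $\mathbb T=\mathbb R/(2\pi\mathbb Z)$, $I^+=(0,1)$, $I^-=(-1,0)$, $\mathbb R^\pm=\{\pm Y_3>0\}$, $H^\infty=\bigcap_sH^s$, $y=(y',y_3)$, $y'\in\mathbb T^2$. $\underline S^\pm=H^\infty([0,T]\times\mathbb T^2\times I^\pm\times\mathbb T)$ (functions of $(t,y,\theta)$). $S_\star^\pm$: functions $u(t,y,Y_3,\theta)$ in $H^\infty([0,T]\times\mathbb T^2\times I^\pm\times\mathbb R^\pm\times\mathbb T)$ for which there is $\delta>0$ such that for every $\alpha\in\mathbb N^6$ there is $C_\alpha$ with $\|\partial^\alpha u(\cdot,\cdot,Y_3,\cdot)\|_{L^\infty_{t,y,\theta}}\le C_\alpha e^{\mp\delta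 Y_3}$ for all $\pm Y_3>0$. $S^\pm=\underline S^\pm\oplus S_\star^\pm$ (also for vector valued functions), with decomposition denoted $U^\pm=\underline U^\pm+U_\star^\pm$. $\widehat U(k)$ is the $k$-th Fourier coefficient in $\theta$ ($U=\sum_k\widehat U(k)e^{ik\theta}$). $\Pi=\mathrm{diag}(1,1,0,1,1,0,0)$. Operators. Vectors of $\mathbb R^7$ are $U=(u_1,u_2,u_3,H_1,H_2,H_3,q)^T$. For $\alpha=1,2,3$, $f_\alpha:\mathbb R^7\to\mathbb R^7$ has components $(f_\alpha)_i=u_\alpha u_i-H_\alpha H_i+\delta_{i\alpha}q$, $(f_\alpha)_{3+i}=u_\alpha H_i-H_\alpha u_i$ ($i=1,2,3$), $(f_\alpha)_7=u_\alpha$. $A_0=\mathrm{diag}(1,1,1,1,1,1,0)$, $A_\alpha^\pm=\mathrm df_\alpha(U^{0,\pm})$, $\mathcal A^\pm=\tau A_0+\xi_1A_1^\pm+\xi_2A_2^\pm$, $\mathcal L_f^\pm(\partial)=A_3^\pm\partial_{Y_3}+\mathcal A^\pm\partial_\theta$. The boundary operator is, componentwise, $$B^+U^++B^-U^-+\partial_\theta\psi\,\underline b=\big(u_3^+-c^+\partial_\theta\psi,\ H_3^+-b^+\partial_\theta\psi,\ u_3^--c^-\partial_\theta\psi,\ H_3^--b^-\partial_\theta\psi,\ q^+-q^-\big)^T .$$ Vectors. For $k\in\mathbb Z\setminus\{0\}$, $$\mathcal R^\pm(k)=\big(\xi_1c^\pm,\xi_2c^\pm,\pm i\,\mathrm{sgn}(k)c^\pm,\xi_1b^\pm,\xi_2b^\pm,\pm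 i\,\mathrm{sgn}(k)b^\pm,(b^\pm)^2-(c^\pm)^2\big)^T,$$ $$\mathcal L^\pm(k)=\big(\xi_1\tau,\xi_2\tau,\pm i\,\mathrm{sgn}(k)\tau,2\xi_1b^\pm,2\xi_2b^\pm,\pm2i\,\mathrm{sgn}(k)b^\pm,-\tau(a^\pm+c^\pm)\big)^T,$$ $\ell_1^\pm=2(b^\pm)^2-\tau c^\pm$, $\ell_2^\pm=-(a^\pm+c^\pm)b^\pm$, and $\langle X,Y\rangle=\sum_{i=1}^7\overline{X_i}\,Y_i$ for $X,Y\in\mathbb C^7$. *)

theory Defs
  imports "HOL-Analysis.Analysis"
begin

datatype side = Plus | Minus

fun sg :: "side \<Rightarrow> real" where
  "sg Plus = 1"
| "sg Minus = -1"

text \<open>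
  Partial derivative in the direction \<open>b\<close>, relative to the domain \<open>D\<close>: on the boundary of a
  closed box this is the one-sided derivative.
\<close>
definition partial_deriv ::
    "'a::euclidean_space set \<Rightarrow> 'a \<Rightarrow> ('a \<Rightarrow> 'b::real_normed_vector) \<Rightarrow> 'a \<Rightarrow> 'b" where
  "partial_deriv D b f x =
     vector_derivative (\<lambda>h. f (x + h *\<^sub>R b)) (at 0 within {h. x + h *\<^sub>R b \<in> D})"

definition partial_differentiable ::
    "'a::euclidean_space set \<Rightarrow> 'a \<Rightarrow> ('a \<Rightarrow> 'b::real_normed_vector) \<Rightarrow> 'a \<Rightarrow> bool" where
  "partial_differentiable D b f x \<longleftrightarrow>
     (\<lambda>h. f (x + h *\<^sub>R b)) differentiable (at 0 within {h. x + h *\<^sub>R b \<in> D})"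

text \<open>
  A multi-index is represented by the list of the basis directions in which one differentiates;
  for smooth functions only the number of occurrences of each direction matters.
\<close>
fun iter_partial ::
    "'a::euclidean_space set \<Rightarrow> 'a list \<Rightarrow> ('a \<Rightarrow> 'b::real_normed_vector) \<Rightarrow> 'a \<Rightarrow> 'b" where
  "iter_partial D [] f = f"
| "iter_partial D (b # bs) f = partial_deriv D b (iter_partial D bs f)"

definition smooth_up_to :: "'a::euclidean_space set \<Rightarrow> ('a \<Rightarrow> 'b::real_normed_vector) \<Rightarrow> bool" where
  "smooth_up_to D f \<longleftrightarrow>
     (\<forall>bs. set bs \<subseteq> Basis \<longrightarrow>
        continuous_on D (iter_partial D bs f) \<and>
        (\<forall>b\<in>Basis. \<forall>x\<in>D. partial_differentiable D b (iter_partial D bs f) x))"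

text \<open>
  Square integrability of all derivatives of order at most \<open>s\<close>.  Functions of torus variables are
  periodic functions on the line; \<open>C\<close> is the part of \<open>D\<close> lying in one period cell.
\<close>
definition sobolev_finite ::
    "nat \<Rightarrow> 'a::euclidean_space set \<Rightarrow> 'a set \<Rightarrow> ('a \<Rightarrow> 'b::real_normed_vector) \<Rightarrow> bool" where
  "sobolev_finite s D C f \<longleftrightarrow>
     (\<forall>bs. set bs \<subseteq> Basis \<and> length bs \<le> s \<longrightarrow>
        set_integrable lborel C (\<lambda>x. (norm (iter_partial D bs f x))\<^sup>2))"

text \<open>
  The intersection of the spaces \<open>H\<^sup>s\<close> over all \<open>s\<close>.  By Sobolev embedding every class in this
  intersection has exactly one representative on the closed domain \<open>D\<close> which is smooth up to the
  boundary, and elements are identified with that representative, so that traces and derivatives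
  can be taken pointwise.  \<open>Per\<close> is the set of periods.  Values outside \<open>D\<close> are irrelevant.
\<close>
definition Hinf ::
    "'a::euclidean_space set \<Rightarrow> 'a set \<Rightarrow> 'a set \<Rightarrow> ('a \<Rightarrow> 'b::real_normed_vector) set" where
  "Hinf D C Per =
     {f. (\<forall>p\<in>Per. \<forall>x\<in>D. f (x + p) = f x) \<and> smooth_up_to D f \<and> (\<forall>s. sobolev_finite s D C f)}"

definition slab :: "side \<Rightarrow> real set" where
  "slab s = {y. 0 < sg s * y \<and> sg s * y < 1}"

definition cslab :: "side \<Rightarrow> real set" where
  "cslab s = {y. 0 \<le> sg s * y \<and> sg s * y \<le> 1}"

definition half :: "side \<Rightarrow> real set" where
  "half s = {Y. 0 < sg s * Y}"

definition chalf :: "side \<Rightarrow> real set" where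
  "chalf s = {Y. 0 \<le> sg s * Y}"

text \<open>Points: \<open>pt4\<close> is \<open>(t, y1, y2, \<theta>)\<close>, \<open>pt5\<close> is \<open>(t, y1, y2, y3, \<theta>)\<close> and \<open>pt6\<close> is
  \<open>(t, y1, y2, y3, Y3, \<theta>)\<close>.\<close>

type_synonym pt4 = "real \<times> real \<times> real \<times> real"
type_synonym pt5 = "real \<times> real \<times> real \<times> real \<times> real"
type_synonym pt6 = "real \<times> real \<times> real \<times> real \<times> real \<times> real"

definition dom4 :: "real \<Rightarrow> pt4 set" where
  "dom4 T = {0..T} \<times> UNIV \<times> UNIV \<times> UNIV"

definition dom5 :: "real \<Rightarrow> side \<Rightarrow> pt5 set" where
  "dom5 T s = {0..T} \<times> UNIV \<times> UNIV \<times> cslab s \<times> UNIV"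

definition dom6 :: "real \<Rightarrow> side \<Rightarrow> pt6 set" where
  "dom6 T s = {0..T} \<times> UNIV \<times> UNIV \<times> cslab s \<times> chalf s \<times> UNIV"

definition H_bdry :: "real \<Rightarrow> (pt4 \<Rightarrow> 'b::real_normed_vector) set" where
  "H_bdry T = Hinf (dom4 T) ({0..T} \<times> {0..2*pi} \<times> {0..2*pi} \<times> {0..2*pi})
     {(0,2*pi,0,0), (0,0,2*pi,0), (0,0,0,2*pi)}"

definition S_under :: "real \<Rightarrow> side \<Rightarrow> (pt5 \<Rightarrow> 'b::real_normed_vector) set" where
  "S_under T s = Hinf (dom5 T s) ({0..T} \<times> {0..2*pi} \<times> {0..2*pi} \<times> cslab s \<times> {0..2*pi})
     {(0,2*pi,0,0,0), (0,0,2*pi,0,0), (0,0,0,0,2*pi)}"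

text \<open>The sup norm in \<open>(t, y, \<theta>)\<close> is written out as a pointwise bound, the derivatives being
  continuous.\<close>
definition S_star :: "real \<Rightarrow> side \<Rightarrow> (pt6 \<Rightarrow> 'b::real_normed_vector) set" where
  "S_star T s =
     {u \<in> Hinf (dom6 T s)
            ({0..T} \<times> {0..2*pi} \<times> {0..2*pi} \<times> cslab s \<times> chalf s \<times> {0..2*pi})
            {(0,2*pi,0,0,0,0), (0,0,2*pi,0,0,0), (0,0,0,0,0,2*pi)}.
        \<exists>\<delta>>0. \<forall>bs. set bs \<subseteq> Basis \<longrightarrow>
          (\<exists>C. \<forall>t\<in>{0..T}. \<forall>y1 y2. \<forall>y3\<in>slab s. \<forall>Y3\<in>half s. \<forall>\<theta>.
             norm (iter_partial (dom6 T s) bs u (t,y1,y2,y3,Y3,\<theta>)) \<le> C * exp (- sg s * \<delta> * Y3))}"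

text \<open>\<open>U\<close> belongs to \<open>S_under \<oplus> S_star\<close> with components \<open>Ub\<close> and \<open>Us\<close>.  On the domain the
  components are uniquely determined by \<open>U\<close>.\<close>
definition decomposes ::
    "real \<Rightarrow> side \<Rightarrow> (pt6 \<Rightarrow> 'b::real_normed_vector) \<Rightarrow> (pt5 \<Rightarrow> 'b) \<Rightarrow> (pt6 \<Rightarrow> 'b) \<Rightarrow> bool" where
  "decomposes T s U Ub Us \<longleftrightarrow>
     Ub \<in> S_under T s \<and> Us \<in> S_star T s \<and>
     (\<forall>(t,y1,y2,y3,Y3,\<theta>) \<in> dom6 T s.
        U (t,y1,y2,y3,Y3,\<theta>) = Ub (t,y1,y2,y3,\<theta>) + Us (t,y1,y2,y3,Y3,\<theta>))"

definition S_sum :: "real \<Rightarrow> side \<Rightarrow> (pt6 \<Rightarrow> 'b::real_normed_vector) set" where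
  "S_sum T s = {U. \<exists>Ub Us. decomposes T s U Ub Us}"

definition d_Y3 :: "real \<Rightarrow> side \<Rightarrow> (pt6 \<Rightarrow> 'b::real_normed_vector) \<Rightarrow> pt6 \<Rightarrow> 'b" where
  "d_Y3 T s = partial_deriv (dom6 T s) (0,0,0,0,1,0)"

definition d_theta :: "real \<Rightarrow> side \<Rightarrow> (pt6 \<Rightarrow> 'b::real_normed_vector) \<Rightarrow> pt6 \<Rightarrow> 'b" where
  "d_theta T s = partial_deriv (dom6 T s) (0,0,0,0,0,1)"

definition d_theta_bdry :: "real \<Rightarrow> (pt4 \<Rightarrow> 'b::real_normed_vector) \<Rightarrow> pt4 \<Rightarrow> 'b" where
  "d_theta_bdry T = partial_deriv (dom4 T) (0,0,0,1)"

definition fourier :: "(real \<Rightarrow> real) \<Rightarrow> int \<Rightarrow> complex" where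
  "fourier g k =
     of_real (1 / (2 * pi)) * integral {0..2*pi} (\<lambda>\<theta>. of_real (g \<theta>) * exp (- \<i> * of_int k * of_real \<theta>))"

definition vfourier :: "(real \<Rightarrow> real^'n) \<Rightarrow> int \<Rightarrow> complex^'n" where
  "vfourier g k = (\<chi> i. fourier (\<lambda>\<theta>. g \<theta> $ i) k)"

record mhd_params =
  vel1 :: "side \<Rightarrow> real"
  vel2 :: "side \<Rightarrow> real"
  mag1 :: "side \<Rightarrow> real"
  mag2 :: "side \<Rightarrow> real"
  tau :: real
  xi1 :: real
  xi2 :: real

definition u0 :: "mhd_params \<Rightarrow> side \<Rightarrow> real^3" where
  "u0 P s = vector [vel1 P s, vel2 P s, 0]"

definition H0 :: "mhd_params \<Rightarrow> side \<Rightarrow> real^3" where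
  "H0 P s = vector [mag1 P s, mag2 P s, 0]"

definition U0 :: "mhd_params \<Rightarrow> side \<Rightarrow> real^7" where
  "U0 P s = vector [vel1 P s, vel2 P s, 0, mag1 P s, mag2 P s, 0, 0]"

definition a_coef :: "mhd_params \<Rightarrow> side \<Rightarrow> real" where
  "a_coef P s = xi1 P * vel1 P s + xi2 P * vel2 P s"

definition b_coef :: "mhd_params \<Rightarrow> side \<Rightarrow> real" where
  "b_coef P s = xi1 P * mag1 P s + xi2 P * mag2 P s"

definition c_coef :: "mhd_params \<Rightarrow> side \<Rightarrow> real" where
  "c_coef P s = tau P + a_coef P s"

definition flux :: "3 \<Rightarrow> real^7 \<Rightarrow> real^7" where
  "flux \<alpha> U =
     (let u = vector [U$1, U$2, U$3] :: real^3;
          H = vector [U$4, U$5, U$6] :: real^3;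
          q = U$7;
          mom = (\<lambda>i. u$\<alpha> * u$i - H$\<alpha> * H$i + (if i = \<alpha> then q else 0));
          ind = (\<lambda>i. u$\<alpha> * H$i - H$\<alpha> * u$i)
      in vector [mom 1, mom 2, mom 3, ind 1, ind 2, ind 3, u$\<alpha>])"

definition A_op :: "mhd_params \<Rightarrow> side \<Rightarrow> 3 \<Rightarrow> real^7 \<Rightarrow> real^7" where
  "A_op P s \<alpha> = frechet_derivative (flux \<alpha>) (at (U0 P s))"

definition A0_op :: "real^7 \<Rightarrow> real^7" where
  "A0_op V = vector [V$1, V$2, V$3, V$4, V$5, V$6, 0]"

definition A_symbol :: "mhd_params \<Rightarrow> side \<Rightarrow> real^7 \<Rightarrow> real^7" where
  "A_symbol P s V = tau P *\<^sub>R A0_op V + xi1 P *\<^sub>R A_op P s 1 V + xi2 P *\<^sub>R A_op P s 2 V"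

definition fast_op :: "mhd_params \<Rightarrow> real \<Rightarrow> side \<Rightarrow> (pt6 \<Rightarrow> real^7) \<Rightarrow> pt6 \<Rightarrow> real^7" where
  "fast_op P T s U x = A_op P s 3 (d_Y3 T s U x) + A_symbol P s (d_theta T s U x)"

definition fast_div :: "mhd_params \<Rightarrow> real \<Rightarrow> side \<Rightarrow> (pt6 \<Rightarrow> real^7) \<Rightarrow> pt6 \<Rightarrow> real" where
  "fast_div P T s U x =
     d_Y3 T s (\<lambda>z. U z $ 6) x
     + xi1 P * d_theta T s (\<lambda>z. U z $ 4) x + xi2 P * d_theta T s (\<lambda>z. U z $ 5) x"

text \<open>The boundary operator applied to the boundary values \<open>Up\<close>, \<open>Um\<close> of the two states and the
  value \<open>dpsi\<close> of the \<open>\<theta>\<close>-derivative of the front.\<close>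
definition bdry_op :: "mhd_params \<Rightarrow> real^7 \<Rightarrow> real^7 \<Rightarrow> real \<Rightarrow> real^5" where
  "bdry_op P Up Um dpsi = vector
     [Up$3 - c_coef P Plus * dpsi, Up$6 - b_coef P Plus * dpsi,
      Um$3 - c_coef P Minus * dpsi, Um$6 - b_coef P Minus * dpsi,
      Up$7 - Um$7]"

definition fast_problem ::
    "mhd_params \<Rightarrow> real \<Rightarrow> (side \<Rightarrow> pt6 \<Rightarrow> real^7) \<Rightarrow> (side \<Rightarrow> pt6 \<Rightarrow> real) \<Rightarrow> (pt4 \<Rightarrow> real^5) \<Rightarrow>
     (side \<Rightarrow> pt6 \<Rightarrow> real^7) \<Rightarrow> (pt4 \<Rightarrow> real) \<Rightarrow> bool" where
  "fast_problem P T F F8 G U \<psi> \<longleftrightarrow>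
     (\<forall>s. \<forall>t\<in>{0..T}. \<forall>y1 y2. \<forall>y3\<in>slab s. \<forall>Y3\<in>half s. \<forall>\<theta>.
        fast_op P T s (U s) (t,y1,y2,y3,Y3,\<theta>) = F s (t,y1,y2,y3,Y3,\<theta>) \<and>
        fast_div P T s (U s) (t,y1,y2,y3,Y3,\<theta>) = F8 s (t,y1,y2,y3,Y3,\<theta>)) \<and>
     (\<forall>t\<in>{0..T}. \<forall>y1 y2 \<theta>.
        bdry_op P (U Plus (t,y1,y2,0,0,\<theta>)) (U Minus (t,y1,y2,0,0,\<theta>))
          (d_theta_bdry T \<psi> (t,y1,y2,\<theta>)) = G (t,y1,y2,\<theta>))"

definition fast_solution ::
    "mhd_params \<Rightarrow> real \<Rightarrow> (side \<Rightarrow> pt6 \<Rightarrow> real^7) \<Rightarrow> (side \<Rightarrow> pt6 \<Rightarrow> real) \<Rightarrow> (pt4 \<Rightarrow> real^5) \<Rightarrow>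
     (side \<Rightarrow> pt6 \<Rightarrow> real^7) \<Rightarrow> (pt4 \<Rightarrow> real) \<Rightarrow> bool" where
  "fast_solution P T F F8 G U \<psi> \<longleftrightarrow>
     (\<forall>s. U s \<in> S_sum T s) \<and> \<psi> \<in> H_bdry T \<and> fast_problem P T F F8 G U \<psi>"

definition cvec :: "real^'n \<Rightarrow> complex^'n" where
  "cvec V = (\<chi> i. of_real (V $ i))"

definition cinner7 :: "complex^7 \<Rightarrow> complex^7 \<Rightarrow> complex" where
  "cinner7 X Y = (\<Sum>i\<in>UNIV. cnj (X $ i) * Y $ i)"

definition proj_Pi :: "complex^7 \<Rightarrow> complex^7" where
  "proj_Pi V = vector [V$1, V$2, 0, V$4, V$5, 0, 0]"

definition R_vec :: "mhd_params \<Rightarrow> side \<Rightarrow> int \<Rightarrow> complex^7" where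
  "R_vec P s k =
     (let b = b_coef P s; c = c_coef P s; e = \<i> * of_real (sg s) * of_int (sgn k) in
      vector [of_real (xi1 P * c), of_real (xi2 P * c), e * of_real c,
              of_real (xi1 P * b), of_real (xi2 P * b), e * of_real b,
              of_real (b\<^sup>2 - c\<^sup>2)])"

definition L_vec :: "mhd_params \<Rightarrow> side \<Rightarrow> int \<Rightarrow> complex^7" where
  "L_vec P s k =
     (let a = a_coef P s; b = b_coef P s; c = c_coef P s;
          e = \<i> * of_real (sg s) * of_int (sgn k) in
      vector [of_real (xi1 P * tau P), of_real (xi2 P * tau P), e * of_real (tau P),
              of_real (2 * xi1 P * b), of_real (2 * xi2 P * b), 2 * e * of_real b,
              of_real (- tau P * (a + c))])"

definition ell1 :: "mhd_params \<Rightarrow> side \<Rightarrow> real" where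
  "ell1 P s = 2 * (b_coef P s)\<^sup>2 - tau P * c_coef P s"

definition ell2 :: "mhd_params \<Rightarrow> side \<Rightarrow> real" where
  "ell2 P s = - (a_coef P s + c_coef P s) * b_coef P s"

definition cond_a :: "mhd_params \<Rightarrow> real \<Rightarrow> (side \<Rightarrow> pt6 \<Rightarrow> real^7) \<Rightarrow> (pt4 \<Rightarrow> real^5) \<Rightarrow> bool" where
  "cond_a P T F G \<longleftrightarrow>
     (\<forall>t\<in>{0..T}. \<forall>y1 y2 \<theta>.
        F Plus (t,y1,y2,0,0,\<theta>) $ 6 =
          - b_coef P Plus * d_theta_bdry T (\<lambda>z. G z $ 1) (t,y1,y2,\<theta>)
          + c_coef P Plus * d_theta_bdry T (\<lambda>z. G z $ 2) (t,y1,y2,\<theta>) \<and>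
        F Minus (t,y1,y2,0,0,\<theta>) $ 6 =
          - b_coef P Minus * d_theta_bdry T (\<lambda>z. G z $ 3) (t,y1,y2,\<theta>)
          + c_coef P Minus * d_theta_bdry T (\<lambda>z. G z $ 4) (t,y1,y2,\<theta>))"

definition cond_b :: "real \<Rightarrow> (side \<Rightarrow> pt5 \<Rightarrow> real^7) \<Rightarrow> (side \<Rightarrow> pt5 \<Rightarrow> real) \<Rightarrow> bool" where
  "cond_b T Fb F8b \<longleftrightarrow>
     (\<forall>s. \<forall>t\<in>{0..T}. \<forall>y1 y2. \<forall>y3\<in>cslab s.
        vfourier (\<lambda>\<theta>. Fb s (t,y1,y2,y3,\<theta>)) 0 = 0 \<and>
        fourier (\<lambda>\<theta>. F8b s (t,y1,y2,y3,\<theta>)) 0 = 0)"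

definition cond_c ::
    "mhd_params \<Rightarrow> real \<Rightarrow> (side \<Rightarrow> pt6 \<Rightarrow> real^7) \<Rightarrow> (side \<Rightarrow> pt6 \<Rightarrow> real) \<Rightarrow> bool" where
  "cond_c P T Fs F8s \<longleftrightarrow>
     (\<forall>s. \<forall>t\<in>{0..T}. \<forall>y1 y2. \<forall>y3\<in>cslab s. \<forall>Y3\<in>chalf s.
        let Fh = vfourier (\<lambda>\<theta>. Fs s (t,y1,y2,y3,Y3,\<theta>)) 0;
            F8h = fourier (\<lambda>\<theta>. F8s s (t,y1,y2,y3,Y3,\<theta>)) 0
        in of_real (vel1 P s) * Fh$7 - of_real (mag1 P s) * F8h = Fh$1 \<and>
           of_real (vel2 P s) * Fh$7 - of_real (mag2 P s) * F8h = Fh$2 \<and>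
           of_real (mag1 P s) * Fh$7 - of_real (vel1 P s) * F8h = Fh$4 \<and>
           of_real (mag2 P s) * Fh$7 - of_real (vel2 P s) * F8h = Fh$5)"

definition cond_d ::
    "mhd_params \<Rightarrow> real \<Rightarrow> (side \<Rightarrow> pt6 \<Rightarrow> real^7) \<Rightarrow> (side \<Rightarrow> pt6 \<Rightarrow> real) \<Rightarrow> bool" where
  "cond_d P T F F8 \<longleftrightarrow>
     (\<forall>s. \<forall>x\<in>dom6 T s.
        d_Y3 T s (\<lambda>z. F s z $ 6) x
        + xi1 P * d_theta T s (\<lambda>z. F s z $ 4) x + xi2 P * d_theta T s (\<lambda>z. F s z $ 5) x
        - tau P * d_theta T s (F8 s) x = 0)"

definition cond_e :: "mhd_params \<Rightarrow> real \<Rightarrow> (side \<Rightarrow> pt6 \<Rightarrow> real^7) \<Rightarrow> (pt4 \<Rightarrow> real^5) \<Rightarrow> bool" where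
  "cond_e P T F G \<longleftrightarrow>
     (\<forall>t\<in>{0..T}. \<forall>y1 y2. \<forall>k. k \<noteq> 0 \<longrightarrow>
        (let Gh = vfourier (\<lambda>\<theta>. G (t,y1,y2,\<theta>)) k in
         (LINT Y3:half Plus|lborel. of_real (exp (- of_int \<bar>k\<bar> * Y3)) *
            cinner7 (L_vec P Plus k) (vfourier (\<lambda>\<theta>. F Plus (t,y1,y2,0,Y3,\<theta>)) k))
         - (LINT Y3:half Minus|lborel. of_real (exp (of_int \<bar>k\<bar> * Y3)) *
            cinner7 (L_vec P Minus k) (vfourier (\<lambda>\<theta>. F Minus (t,y1,y2,0,Y3,\<theta>)) k))
         + of_real (ell1 P Plus) * Gh$1 + of_real (ell2 P Plus) * Gh$2
         + of_real (ell1 P Minus) * Gh$3 + of_real (ell2 P Minus) * Gh$4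
         - \<i> * of_real (tau P) * of_int (sgn k) * Gh$5 = 0))"

text \<open>
  The pair \<open>(U, \<psi>)\<close> is the particular solution \<open>UU\<close> plus a solution of the homogeneous problem of
  the stated form; the series over \<open>k \<noteq> 0\<close> converges unconditionally at every point.
  Functions independent of \<open>\<theta>\<close> have no \<open>\<theta>\<close> argument.
\<close>
definition represented_by ::
    "mhd_params \<Rightarrow> real \<Rightarrow> (side \<Rightarrow> pt6 \<Rightarrow> real^7) \<Rightarrow> (side \<Rightarrow> pt6 \<Rightarrow> real^7) \<Rightarrow> (pt4 \<Rightarrow> real) \<Rightarrow> bool" where
  "represented_by P T UU U \<psi> \<longleftrightarrow>
     (\<exists>(Uh :: side \<Rightarrow> real \<times> real \<times> real \<times> real \<Rightarrow> real^7)
       (us1 :: side \<Rightarrow> real \<times> real \<times> real \<times> real \<times> real \<Rightarrow> real) us2 Hs1 Hs2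
       (\<gamma> :: side \<Rightarrow> real \<times> real \<times> real \<times> real \<Rightarrow> int \<Rightarrow> complex).
        (\<forall>s. (\<lambda>(t,y1,y2,y3,\<theta>). Uh s (t,y1,y2,y3)) \<in> S_under T s) \<and>
        (\<forall>s. \<forall>v \<in> {us1 s, us2 s, Hs1 s, Hs2 s}.
           (\<lambda>(t,y1,y2,y3,Y3,\<theta>). v (t,y1,y2,y3,Y3)) \<in> S_star T s) \<and>
        (\<forall>s. \<forall>(t,y1,y2,y3,Y3,\<theta>) \<in> dom6 T s.
           ((\<lambda>k. (\<gamma> s (t,y1,y2,y3) k
                    * exp (of_real (- sg s * of_int \<bar>k\<bar> * Y3) + \<i> * of_int k * of_real \<theta>))
                   *s R_vec P s k)
             has_sum
              cvec (U s (t,y1,y2,y3,Y3,\<theta>) - UU s (t,y1,y2,y3,Y3,\<theta>) - Uh s (t,y1,y2,y3)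
                    - vector [us1 s (t,y1,y2,y3,Y3), us2 s (t,y1,y2,y3,Y3), 0,
                              Hs1 s (t,y1,y2,y3,Y3), Hs2 s (t,y1,y2,y3,Y3), 0, 0]))
           (UNIV - {0})) \<and>
        (\<forall>s. \<forall>t\<in>{0..T}. \<forall>y1 y2 k. k \<noteq> 0 \<longrightarrow>
           \<gamma> s (t,y1,y2,0) k =
             of_real (sg s) * of_int \<bar>k\<bar> * fourier (\<lambda>\<theta>. \<psi> (t,y1,y2,\<theta>)) k) \<and>
        (\<forall>s. \<forall>t\<in>{0..T}. \<forall>y1 y2. \<forall>y3\<in>cslab s. \<forall>k. k \<noteq> 0 \<longrightarrow>
           \<gamma> s (t,y1,y2,y3) (- k) = cnj (\<gamma> s (t,y1,y2,y3) k)) \<and>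
        (\<forall>t\<in>{0..T}. \<forall>y1 y2.
           (\<forall>s. Uh s (t,y1,y2,0) $ 3 = 0 \<and> Uh s (t,y1,y2,0) $ 6 = 0) \<and>
           Uh Plus (t,y1,y2,0) $ 7 = Uh Minus (t,y1,y2,0) $ 7))"

end

theory Submission
  imports Defs
begin

text \<open>
 The problem is linear with constant coefficients, so it is decided by the Fourier modes in the fast
 variable \<open>th\<close> and by the mean over \<open>th\<close>. Write \<open>c\<close>, \<open>b\<close> for the coefficients of one side. The
 hypotheses on \<open>a\<close>, \<open>b\<close> and \<open>c\<close> give \<open>c\<^sup>2 \<noteq> b\<^sup>2\<close> on both sides: otherwise \<open>c = \<plusminus>b\<close> would hold on both
 sides. Hence the equations (\<open>interior_iff\<close>) determine the oscillating part of a state from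
 \<open>w = c u\<^sub>3 - b H\<^sub>3\<close> and the pressure \<open>q\<close>, and \<open>w\<close>, \<open>q\<close> solve an inhomogeneous Cauchy-Riemann system
 (\<open>lift_solves\<close>, \<open>solve_cauchy_riemann\<close>). Without sources the bounded modes are
 multiples of \<open>exp (- |k| |Y|)\<close> times the vector \<open>R_vec\<close> (\<open>homogeneous_modes\<close>).

 Necessity. Condition (d) is the symmetry of mixed derivatives, and (a) is the derivative of the
 boundary conditions along the boundary. Averaging over \<open>th\<close> gives (b) and (c), since a function
 independent of \<open>Y\<close> and a decaying one cancel only if both vanish (\<open>decomposition_unique\<close>). One
 combination of the \<open>k\<close>-th modes satisfies an equation with a growing exponential; boundedness
 expresses its boundary value by an integral of the sources (\<open>mode_identity\<close>). In the sum of the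
 two sides the front is multiplied by \<open>c\<^sup>2 - b\<^sup>2\<close> of both sides, which add up to zero, and (e) remains
 (\<open>jump_algebra\<close>).

 Sufficiency. With \<open>\<psi> = 0\<close> each side is solved separately for prescribed boundary values of \<open>u\<^sub>3\<close> and
 \<open>H\<^sub>3\<close> (\<open>particular_solution\<close>). The same integral formula together with (e) and \<open>tau \<noteq> 0\<close> shows that
 the pressure jump has the right oscillating modes; its mean is adjusted by a term that depends only
 on the slow variables (\<open>pressure_jump\<close>). The difference of two solutions has no sources, and its
 Fourier series is the asserted expansion (\<open>solution_represented\<close>).

 The analytic basis is a coinductive notion of families of smooth functions with uniformly weighted
 derivatives. It covers the function spaces, and the families of Fourier coefficients, which may
 then be summed and differentiated term by term.
\<close>

section \<open>One-sided partial derivatives on coordinate boxes\<close>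

text \<open>Only those \<open>h\<close> are used for which the point stays in the domain, so the
 derivative is one-sided on the faces of a box.\<close>

definition has_partial ::
  "'a::euclidean_space set => 'a => ('a => 'b::real_normed_vector) => ('a => 'b) => bool" where
 "has_partial D b f g \<longleftrightarrow>
   (\<forall>x\<in>D. ((%h. f (x + h *\<^sub>R b)) has_vector_derivative g x) (at 0 within {h. x + h *\<^sub>R b \<in> D}))"

definition coord_box :: "'a::euclidean_space set => bool" where
 "coord_box D \<longleftrightarrow> convex D \<and>
   (\<forall>x\<in>D. \<forall>y\<in>D. \<forall>b\<in>Basis. x + ((y - x) \<bullet> b) *\<^sub>R b \<in> D) \<and>
   (\<forall>b\<in>Basis. \<exists>x\<in>D. \<exists>y\<in>D. x \<bullet> b \<noteq> y \<bullet> b)"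

lemma convex_line:
 assumes "convex D"
 shows "convex {h. x + h *\<^sub>R b \<in> D}"
proof (rule convexI)
 fix h k u v :: real
 assume a: "h \<in> {h. x + h *\<^sub>R b \<in> D}" "k \<in> {h. x + h *\<^sub>R b \<in> D}" "0 \<le> u" "0 \<le> v" "u + v = 1"
 have "x + (u * h + v * k) *\<^sub>R b = u *\<^sub>R (x + h *\<^sub>R b) + v *\<^sub>R (x + k *\<^sub>R b)"
  using a(5) by (simp add: algebra_simps flip: scaleR_add_left)
 also have "\<dots> \<in> D"
  using a assms by (auto intro: convexD)
 finally show "u *\<^sub>R h + v *\<^sub>R k \<in> {h. x + h *\<^sub>R b \<in> D}" by simp
qed

lemma coord_box_line_not_bot:
 assumes D: "coord_box D" "b \<in> Basis" "x + h *\<^sub>R b \<in> D"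
 shows "at h within {h. x + h *\<^sub>R b \<in> D} \<noteq> bot"
proof -
 define S where "S = {h. x + h *\<^sub>R b \<in> D}"
 define z where "z = x + h *\<^sub>R b"
 obtain y where y: "y \<in> D" "y \<bullet> b \<noteq> z \<bullet> b"
  using D unfolding coord_box_def by metis
 have "z + ((y - z) \<bullet> b) *\<^sub>R b \<in> D"
  using D y unfolding coord_box_def z_def by blast
 then have "h + (y - z) \<bullet> b \<in> S"
  by (simp add: S_def z_def scaleR_add_left add.assoc)
 moreover have "h + (y - z) \<bullet> b \<noteq> h"
  using y by (simp add: inner_diff_left)
 ultimately have "S \<noteq> {a}" if "h \<in> S" for a
  using that by fastforce
 moreover have "convex S"
  using D unfolding S_def coord_box_def by (intro convex_line) auto
 moreover have "h \<in> S"
  using D by (simp add: S_def)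
 ultimately have "h islimpt S"
  by (intro connected_imp_perfect convex_connected) auto
 then show ?thesis
  unfolding S_def trivial_limit_within by simp
qed

lemma has_partial_line:
 assumes "has_partial D b f g" "x + h *\<^sub>R b \<in> D"
 shows "((%k. f (x + k *\<^sub>R b)) has_vector_derivative g (x + h *\<^sub>R b))
      (at h within {k. x + k *\<^sub>R b \<in> D})"
proof -
 let ?S = "{k. x + k *\<^sub>R b \<in> D}"
 have im: "(%k. k - h) ` ?S = {k. (x + h *\<^sub>R b) + k *\<^sub>R b \<in> D}"
 proof (intro equalityI subsetI)
  fix k assume "k \<in> {k. (x + h *\<^sub>R b) + k *\<^sub>R b \<in> D}"
  then have "k + h \<in> ?S" by (simp add: algebra_simps)
  then show "k \<in> (%k. k - h) ` ?S" by (metis add_diff_cancel_right' image_eqI)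
 qed (auto simp: algebra_simps)
 have 1: "((%k. k - h) has_vector_derivative 1) (at h within ?S)"
  by (auto intro!: derivative_eq_intros)
 have 2: "((%k. f ((x + h *\<^sub>R b) + k *\<^sub>R b)) has_vector_derivative g (x + h *\<^sub>R b))
   (at (h - h) within (%k. k - h) ` ?S)"
  using assms unfolding has_partial_def im by simp
 show ?thesis
  using vector_diff_chain_within[OF 1 2] by (simp add: o_def algebra_simps)
qed

lemma has_partial_imp_partial_deriv:
 assumes "coord_box D" "b \<in> Basis" "has_partial D b f g" "x \<in> D"
 shows "partial_deriv D b f x = g x" "partial_differentiable D b f x"
proof -
 have "at 0 within {h. x + h *\<^sub>R b \<in> D} \<noteq> bot"
  using coord_box_line_not_bot[of D b x 0] assms by simp
 then show "partial_deriv D b f x = g x"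
  unfolding partial_deriv_def using assms
  by (intro vector_derivative_within) (auto simp: has_partial_def)
 show "partial_differentiable D b f x"
  using assms unfolding partial_differentiable_def has_partial_def
  by (metis differentiableI_vector)
qed

lemma has_partial_partial_deriv:
 assumes "!!x. x \<in> D ==> partial_differentiable D b f x"
 shows "has_partial D b f (partial_deriv D b f)"
 using assms unfolding has_partial_def partial_deriv_def partial_differentiable_def
 by (auto simp: vector_derivative_works)

lemma has_partial_unique:
 assumes "coord_box D" "b \<in> Basis" "has_partial D b f g" "has_partial D b f g'" "x \<in> D"
 shows "g x = g' x"
 using has_partial_imp_partial_deriv(1)[OF assms(1,2)] assms(3-) by metis

lemma has_partial_cong:
 assumes "has_partial D b f g" "!!x. x \<in> D ==> f' x = f x" "!!x. x \<in> D ==> g' x = g x"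
 shows "has_partial D b f' g'"
 unfolding has_partial_def
proof
 fix x assume x: "x \<in> D"
 have "((%h. f (x + h *\<^sub>R b)) has_vector_derivative g x) (at 0 within {h. x + h *\<^sub>R b \<in> D})"
  using assms x unfolding has_partial_def by blast
 then show "((%h. f' (x + h *\<^sub>R b)) has_vector_derivative g' x) (at 0 within {h. x + h *\<^sub>R b \<in> D})"
  unfolding assms(3)[OF x]
  by (rule has_vector_derivative_transform_within[where d = 1]) (use x assms in auto)
qed

lemma has_partial_const: "has_partial D b (%_. c) (%_. 0)"
 unfolding has_partial_def by (auto intro!: derivative_eq_intros)

lemma has_partial_add:
 assumes "has_partial D b f f'" "has_partial D b g g'"
 shows "has_partial D b (%x. f x + g x) (%x. f' x + g' x)"
 using assms unfolding has_partial_def by (auto intro!: derivative_eq_intros)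

lemma has_partial_linear:
 assumes "bounded_linear L" "has_partial D b f f'"
 shows "has_partial D b (%x. L (f x)) (%x. L (f' x))"
 using assms unfolding has_partial_def
 by (auto intro: bounded_linear.has_vector_derivative)

lemma has_partial_mult:
 fixes f g :: "'a::euclidean_space => 'b::real_normed_algebra"
 assumes "has_partial D b f f'" "has_partial D b g g'"
 shows "has_partial D b (%x. f x * g x) (%x. f x * g' x + f' x * g x)"
 unfolding has_partial_def
proof
 fix x assume x: "x \<in> D"
 have 1: "((%h. f (x + h *\<^sub>R b)) has_vector_derivative f' x) (at 0 within {h. x + h *\<^sub>R b \<in> D})"
  and 2: "((%h. g (x + h *\<^sub>R b)) has_vector_derivative g' x) (at 0 within {h. x + h *\<^sub>R b \<in> D})"
  using assms x unfolding has_partial_def by blast+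
 show "((%h. f (x + h *\<^sub>R b) * g (x + h *\<^sub>R b)) has_vector_derivative f x * g' x + f' x * g x)
   (at 0 within {h. x + h *\<^sub>R b \<in> D})"
  using has_vector_derivative_mult[OF 1 2] by simp
qed

lemma has_partial_compose:
 assumes f: "has_partial D' b' f g"
  and A: "!!x. x \<in> D ==> A x \<in> D'"
  and step: "!!x h. x \<in> D ==> A (x + h *\<^sub>R b) = A x + (h * c) *\<^sub>R b'"
 shows "has_partial D b (%x. f (A x)) (%x. c *\<^sub>R g (A x))"
 unfolding has_partial_def
proof
 fix x assume x: "x \<in> D"
 let ?S = "{h. x + h *\<^sub>R b \<in> D}"
 have 1: "((%h. h * c) has_vector_derivative c) (at 0 within ?S)"
  by (auto intro!: derivative_eq_intros simp: has_real_derivative_iff_has_vector_derivative[symmetric])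
 have sub: "(%h. h * c) ` ?S \<subseteq> {h. A x + h *\<^sub>R b' \<in> D'}"
  using A step[OF x] by force
 have "((%h. f (A x + h *\<^sub>R b')) has_vector_derivative g (A x)) (at 0 within {h. A x + h *\<^sub>R b' \<in> D'})"
  using f A x unfolding has_partial_def by blast
 then have 2: "((%h. f (A x + h *\<^sub>R b')) has_vector_derivative g (A x)) (at (0 * c) within (%h. h * c) ` ?S)"
  using has_vector_derivative_within_subset[OF _ sub] by simp
 show "((%h. f (A (x + h *\<^sub>R b))) has_vector_derivative c *\<^sub>R g (A x)) (at 0 within ?S)"
  using vector_diff_chain_within[OF 1 2] step[OF x] by (simp add: o_def)
qed

text \<open>Moving from one point of a box to another along the coordinate axes, one axis at a time, stays
 in the box; so bounded partial derivatives alone give a Lipschitz bound, and continuity never has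
 to be proved separately.\<close>

lemma coord_box_lipschitz:
 fixes f :: "'a::euclidean_space => 'b::real_normed_vector"
 assumes D: "coord_box D"
  and f: "!!b. b \<in> Basis ==> has_partial D b f (g b)"
  and C: "!!b x. b \<in> Basis ==> x \<in> D ==> norm (g b x) \<le> C"
  and xy: "x \<in> D" "y \<in> D"
 shows "norm (f y - f x) \<le> C * (\<Sum>b\<in>Basis. \<bar>(y - x) \<bullet> b\<bar>)"
proof -
 define z where "z B = x + (\<Sum>b\<in>B. ((y - x) \<bullet> b) *\<^sub>R b)" for B
 have step: "norm (f (u + k *\<^sub>R b) - f u) \<le> C * \<bar>k\<bar>"
  if "b \<in> Basis" "u \<in> D" "u + k *\<^sub>R b \<in> D" for u b k
 proof -
  have "norm (f (u + k *\<^sub>R b) - f (u + 0 *\<^sub>R b)) \<le> C * norm (k - 0)"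
  proof (rule differentiable_bound)
   show "convex {h. u + h *\<^sub>R b \<in> D}"
    using D unfolding coord_box_def by (intro convex_line) auto
   show "((%h. f (u + h *\<^sub>R b)) has_derivative (%t. t *\<^sub>R g b (u + h *\<^sub>R b)))
     (at h within {h. u + h *\<^sub>R b \<in> D})" if "h \<in> {h. u + h *\<^sub>R b \<in> D}" for h
    using has_partial_line[OF f[OF \<open>b \<in> Basis\<close>]] that by (simp add: has_vector_derivative_def)
   show "onorm (%t. t *\<^sub>R g b (u + h *\<^sub>R b)) \<le> C" if "h \<in> {h. u + h *\<^sub>R b \<in> D}" for h
    using C[OF \<open>b \<in> Basis\<close>, of "u + h *\<^sub>R b"] that
    by (intro onorm_le) (metis abs_ge_zero mem_Collect_eq mult.commute mult_left_mono norm_scaleR real_norm_def)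
  qed (use that in auto)
  then show ?thesis by simp
 qed
 have "z B \<in> D \<and> norm (f (z B) - f x) \<le> C * (\<Sum>b\<in>B. \<bar>(y - x) \<bullet> b\<bar>)" if "B \<subseteq> Basis" for B
  using finite_subset[OF that finite_Basis] that
 proof (induction B rule: finite_induct)
  case empty
  then show ?case using xy by (simp add: z_def)
 next
  case (insert b B)
  then have b: "b \<in> Basis" and zB: "z B \<in> D" by auto
  have zi: "z (insert b B) = z B + ((y - x) \<bullet> b) *\<^sub>R b"
   using insert by (simp add: z_def algebra_simps)
  have "(\<Sum>c\<in>B. ((y - x) \<bullet> c) *\<^sub>R c) \<bullet> b = (\<Sum>c\<in>B. 0)"
   unfolding inner_sum_left using insert
   by (intro sum.cong) (metis b insert.prems inner_not_same_Basis inner_scaleR_left insert_subset mult_zero_right subsetD)+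
  then have "(y - x) \<bullet> b = (y - z B) \<bullet> b"
   by (simp add: z_def inner_diff_left inner_add_left)
  then have zD: "z (insert b B) \<in> D"
   using D zB xy b unfolding coord_box_def zi by metis
  have "norm (f (z (insert b B)) - f (z B)) \<le> C * \<bar>(y - x) \<bullet> b\<bar>"
   using step[OF b zB] zD unfolding zi by blast
  moreover have "norm (f (z B) - f x) \<le> C * (\<Sum>b\<in>B. \<bar>(y - x) \<bullet> b\<bar>)"
   using insert by auto
  ultimately have "norm (f (z (insert b B)) - f x) \<le> C * \<bar>(y - x) \<bullet> b\<bar> + C * (\<Sum>b\<in>B. \<bar>(y - x) \<bullet> b\<bar>)"
   using norm_triangle_le_diff norm_triangle_ineq
   by (smt (verit) add_diff_eq diff_add_cancel)
  then show ?case
   using zD insert by (simp add: algebra_simps)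
 qed
 from this[of Basis] show ?thesis
  by (simp add: z_def euclidean_representation)
qed

section \<open>Differentiation under the integral sign\<close>

lemma has_vector_derivative_quotient:
 "(f has_vector_derivative v) (at x within S) \<longleftrightarrow>
   ((%y. (1 / (y - x)) *\<^sub>R (f y - f x)) \<longlongrightarrow> v) (at x within S)"
proof -
 have eq: "norm ((1 / (y - x)) *\<^sub>R (f y - f x) - v)
   = norm ((1 / norm (y - x)) *\<^sub>R (f y - (f x + (y - x) *\<^sub>R v)))" if "y \<noteq> x" for y
 proof -
  have "(1 / (y - x)) *\<^sub>R (f y - f x) - v = (1 / (y - x)) *\<^sub>R (f y - (f x + (y - x) *\<^sub>R v))"
   using that by (simp add: scaleR_diff_right scaleR_add_right)
  then show ?thesis by simp
 qed
 have "((%y. (1 / (y - x)) *\<^sub>R (f y - f x)) \<longlongrightarrow> v) (at x within S) \<longleftrightarrow>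
   ((%y. norm ((1 / (y - x)) *\<^sub>R (f y - f x) - v)) \<longlongrightarrow> 0) (at x within S)"
  unfolding tendsto_norm_zero_iff by (simp add: LIM_zero_iff)
 also have "\<dots> \<longleftrightarrow> ((%y. norm ((1 / norm (y - x)) *\<^sub>R (f y - (f x + (y - x) *\<^sub>R v)))) \<longlongrightarrow> 0) (at x within S)"
  by (intro filterlim_cong refl) (use eq in \<open>auto simp: eventually_at_filter\<close>)
 also have "\<dots> \<longleftrightarrow> (f has_vector_derivative v) (at x within S)"
  unfolding tendsto_norm_zero_iff has_vector_derivative_def has_derivative_within
  by (auto intro: bounded_linear_scaleR_left)
 finally show ?thesis by blast
qed

lemma has_vector_derivative_integral:
 fixes f :: "real => 'm => 'b::{banach, second_countable_topology}"
 assumes S: "convex S" "h0 \<in> S"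
  and int: "!!h. h \<in> S ==> integrable M (f h)"
  and der: "!!h r. h \<in> S ==> r \<in> space M ==> ((%h. f h r) has_vector_derivative f' h r) (at h within S)"
  and bnd: "!!h r. h \<in> S ==> r \<in> space M ==> norm (f' h r) \<le> B r"
  and B: "integrable M B"
  and meas: "f' h0 \<in> borel_measurable M"
 shows "((%h. \<integral>r. f h r \<partial>M) has_vector_derivative (\<integral>r. f' h0 r \<partial>M)) (at h0 within S)"
proof -
 have lip: "norm (f y r - f x r) \<le> B r * norm (y - x)" if "x \<in> S" "y \<in> S" "r \<in> space M" for x y r
 proof (rule differentiable_bound[OF S(1)])
  show "((%h. f h r) has_derivative (%t. t *\<^sub>R f' h r)) (at h within S)" if "h \<in> S" for h
   using der[OF that \<open>r \<in> space M\<close>] by (simp add: has_vector_derivative_def)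
  show "onorm (%t. t *\<^sub>R f' h r) \<le> B r" if "h \<in> S" for h
   using bnd[OF that \<open>r \<in> space M\<close>]
   by (intro onorm_le) (metis abs_ge_zero mult.commute mult_left_mono norm_scaleR real_norm_def)
 qed (use that in auto)
 have quot: "((%h. (1 / (h - h0)) *\<^sub>R (f h r - f h0 r)) \<longlongrightarrow> f' h0 r) (at h0 within S)"
  if "r \<in> space M" for r
  using der[OF S(2) that] by (simp add: has_vector_derivative_quotient)
 have "((%h. (1 / (h - h0)) *\<^sub>R ((\<integral>r. f h r \<partial>M) - (\<integral>r. f h0 r \<partial>M))) \<longlongrightarrow> (\<integral>r. f' h0 r \<partial>M)) (at h0 within S)"
  unfolding tendsto_at_iff_sequentially
 proof (intro allI impI)
  fix X :: "nat => real" assume X: "\<forall>i. X i \<in> S - {h0}" "X \<longlonglongrightarrow> h0"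
  have "(%n. \<integral>r. (1 / (X n - h0)) *\<^sub>R (f (X n) r - f h0 r) \<partial>M) \<longlonglongrightarrow> (\<integral>r. f' h0 r \<partial>M)"
  proof (rule integral_dominated_convergence[OF meas _ B])
   show "(%r. (1 / (X n - h0)) *\<^sub>R (f (X n) r - f h0 r)) \<in> borel_measurable M" for n
    using int[of "X n"] int[OF S(2)] X(1)
    by (auto intro!: borel_measurable_scaleR borel_measurable_diff)
   show "AE r in M. (%n. (1 / (X n - h0)) *\<^sub>R (f (X n) r - f h0 r)) \<longlonglongrightarrow> f' h0 r"
    using quot X unfolding tendsto_at_iff_sequentially by (intro AE_I2) (auto simp: o_def)
   show "AE r in M. norm ((1 / (X n - h0)) *\<^sub>R (f (X n) r - f h0 r)) \<le> B r" for n
    using lip[OF S(2), of "X n"] X(1) by (intro AE_I2) (auto simp: divide_simps)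
  qed
  also have "(%n. \<integral>r. (1 / (X n - h0)) *\<^sub>R (f (X n) r - f h0 r) \<partial>M)
    = (%h. (1 / (h - h0)) *\<^sub>R ((\<integral>r. f h r \<partial>M) - (\<integral>r. f h0 r \<partial>M))) \<circ> X"
   using int[of "X _"] int[OF S(2)] X(1) by (auto simp: fun_eq_iff)
  finally show "((%h. (1 / (h - h0)) *\<^sub>R ((\<integral>r. f h r \<partial>M) - (\<integral>r. f h0 r \<partial>M))) \<circ> X) \<longlonglongrightarrow> (\<integral>r. f' h0 r \<partial>M)" .
 qed
 then show ?thesis by (simp add: has_vector_derivative_quotient)
qed

text \<open>The mean value inequality along the segment bounds the difference quotients by the bound
 for the derivative, so that dominated convergence applies.\<close>

lemma has_partial_integral:
 fixes \<psi> :: "'m => 'a::euclidean_space => 'b::{banach, second_countable_topology}"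
 assumes D: "coord_box D"
  and der: "!!r. r \<in> space M ==> has_partial D b (\<psi> r) (\<psi>' r)"
  and int: "!!x. x \<in> D ==> integrable M (%r. \<psi> r x)"
  and meas: "!!x. x \<in> D ==> (%r. \<psi>' r x) \<in> borel_measurable M"
  and bnd: "!!r x. r \<in> space M ==> x \<in> D ==> norm (\<psi>' r x) \<le> B r"
  and B: "integrable M B"
 shows "has_partial D b (%x. \<integral>r. \<psi> r x \<partial>M) (%x. \<integral>r. \<psi>' r x \<partial>M)"
 unfolding has_partial_def
proof
 fix x assume x: "x \<in> D"
 let ?S = "{h. x + h *\<^sub>R b \<in> D}"
 have "((%h. \<integral>r. \<psi> r (x + h *\<^sub>R b) \<partial>M) has_vector_derivative (\<integral>r. \<psi>' r (x + 0 *\<^sub>R b) \<partial>M)) (at 0 within ?S)"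
 proof (rule has_vector_derivative_integral[where f' = "%h r. \<psi>' r (x + h *\<^sub>R b)" and B = B])
  show "convex ?S"
   using D unfolding coord_box_def by (intro convex_line) auto
  show "((%h. \<psi> r (x + h *\<^sub>R b)) has_vector_derivative \<psi>' r (x + h *\<^sub>R b)) (at h within ?S)"
   if "h \<in> ?S" "r \<in> space M" for h r
   using has_partial_line[OF der[OF that(2)]] that(1) by simp
 qed (use x int meas bnd B in auto)
 then show "((%h. \<integral>r. \<psi> r (x + h *\<^sub>R b) \<partial>M) has_vector_derivative (\<integral>r. \<psi>' r x \<partial>M)) (at 0 within ?S)"
  by simp
qed

section \<open>Families of smooth functions with uniformly bounded derivatives\<close>

text \<open>Instead of bounding all iterated derivatives, the largest class is taken whose members
 have, in each direction, a derivative in the class. One constant serves the whole family, and the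
 powers of \<open>\<nu>\<close> measure the decay in the index.\<close>

coinductive smooth_family ::
  "'a::euclidean_space set => 'a set => ('i => real) => ('a => real) =>
   ('i => 'a => 'b::real_normed_vector) => bool"
 for D Per \<nu> w where
 smooth_familyI:
  "[|!!n. \<exists>C. \<forall>i. \<forall>x\<in>D. \<nu> i ^ n * norm (\<phi> i x) \<le> C * w x;
   !!p i x. p \<in> Per ==> x \<in> D ==> \<phi> i (x + p) = \<phi> i x;
   !!b. b \<in> Basis ==> \<exists>\<phi>'. smooth_family D Per \<nu> w \<phi>' \<and> (\<forall>i. has_partial D b (\<phi> i) (\<phi>' i))|]
   ==> smooth_family D Per \<nu> w \<phi>"

abbreviation smooth_fun ::
  "'a::euclidean_space set => 'a set => ('a => real) => ('a => 'b::real_normed_vector) => bool" where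
 "smooth_fun D Per w f \<equiv> smooth_family D Per (%_::unit. 1) w (%_. f)"

definition weight :: "'a set => ('a => real) => bool" where
 "weight D w \<longleftrightarrow> (\<forall>x\<in>D. 0 < w x \<and> w x \<le> 1)"

lemma smooth_family_closed:
 assumes "Q \<phi>"
  and "!!\<phi> n. Q \<phi> ==> \<exists>C. \<forall>i. \<forall>x\<in>D. \<nu> i ^ n * norm (\<phi> i x) \<le> C * w x"
  and "!!\<phi> p i x. Q \<phi> ==> p \<in> Per ==> x \<in> D ==> \<phi> i (x + p) = \<phi> i x"
  and "!!\<phi> b. Q \<phi> ==> b \<in> Basis ==> \<exists>\<phi>'. Q \<phi>' \<and> (\<forall>i. has_partial D b (\<phi> i) (\<phi>' i))"
 shows "smooth_family D Per \<nu> w \<phi>"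
 using assms(1)
proof (coinduction arbitrary: \<phi>)
 case smooth_family
 note Q = this
 have "\<exists>\<phi>'. (Q \<phi>' \<or> smooth_family D Per \<nu> w \<phi>') \<and> (\<forall>i. has_partial D b (\<phi> i) (\<phi>' i))" if "b \<in> Basis" for b
  using assms(4)[OF Q that] by fast
 then show ?case
  using assms(2)[OF Q] assms(3)[OF Q] by simp
qed

lemma smooth_family_bound:
 assumes "smooth_family D Per \<nu> w \<phi>" "weight D w"
 obtains C where "C \<ge> 0" "!!i x. x \<in> D ==> \<nu> i ^ n * norm (\<phi> i x) \<le> C * w x"
proof -
 obtain C where C: "\<forall>i. \<forall>x\<in>D. \<nu> i ^ n * norm (\<phi> i x) \<le> C * w x"
  using assms(1) by (metis smooth_family.cases)
 have "\<nu> i ^ n * norm (\<phi> i x) \<le> \<bar>C\<bar> * w x" if "x \<in> D" for i x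
 proof -
  have "C * w x \<le> \<bar>C\<bar> * w x"
   using assms(2) that unfolding weight_def by (intro mult_right_mono) (auto simp: less_imp_le)
  then show ?thesis using C that by (meson order_trans)
 qed
 then show ?thesis using that[of "\<bar>C\<bar>"] by simp
qed

lemma smooth_family_bound0:
 assumes "smooth_family D Per \<nu> w \<phi>" "weight D w"
 obtains C where "C \<ge> 0" "!!i x. x \<in> D ==> norm (\<phi> i x) \<le> C * w x"
proof -
 obtain C where "C \<ge> 0" "!!i x. x \<in> D ==> \<nu> i ^ 0 * norm (\<phi> i x) \<le> C * w x"
  using smooth_family_bound[OF assms, of 0] by metis
 then show ?thesis using that by simp
qed

lemma smooth_family_bound1:
 assumes "smooth_family D Per \<nu> w \<phi>" "weight D w"
 obtains C where "C \<ge> 0" "!!i x. x \<in> D ==> norm (\<phi> i x) \<le> C"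
proof -
 obtain C where C: "C \<ge> 0" "!!i x. x \<in> D ==> norm (\<phi> i x) \<le> C * w x"
  using smooth_family_bound0[OF assms] by metis
 have "norm (\<phi> i x) \<le> C" if "x \<in> D" for i x
  using C(2)[OF that, of i] C(1) assms(2) that unfolding weight_def
  by (metis mult.right_neutral mult_left_mono order_trans)
 then show ?thesis using that C by blast
qed

lemma smooth_family_periodic:
 assumes "smooth_family D Per \<nu> w \<phi>" "p \<in> Per" "x \<in> D"
 shows "\<phi> i (x + p) = \<phi> i x"
 using assms by (metis smooth_family.cases)

lemma smooth_family_deriv:
 assumes "smooth_family D Per \<nu> w \<phi>" "b \<in> Basis"
 obtains \<phi>' where "smooth_family D Per \<nu> w \<phi>'" "!!i. has_partial D b (\<phi> i) (\<phi>' i)"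
 using assms by (metis smooth_family.cases)

lemma smooth_fun_index:
 assumes "smooth_family D Per (%_::unit. 1) w \<phi>"
 shows "smooth_fun D Per w (\<phi> ())"
proof -
 have "(%_. \<phi> ()) = \<phi>" by (simp add: fun_eq_iff)
 then show ?thesis using assms by simp
qed

lemma smooth_fun_deriv:
 assumes "smooth_fun D Per w f" "b \<in> Basis"
 obtains g where "smooth_fun D Per w g" "has_partial D b f g"
 using smooth_family_deriv[OF assms] smooth_fun_index by metis

text \<open>Bounded partial derivatives in all directions make a function Lipschitz continuous on a
 box.\<close>

lemma smooth_family_continuous:
 assumes "smooth_family D Per \<nu> w \<phi>" "weight D w" "coord_box D"
 shows "continuous_on D (\<phi> i)"
proof -
 have "\<exists>\<phi>'. \<forall>b\<in>Basis. smooth_family D Per \<nu> w (\<phi>' b) \<and> (\<forall>i. has_partial D b (\<phi> i) (\<phi>' b i))"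
  by (rule bchoice) (use smooth_family_deriv[OF assms(1)] in metis)
 then obtain \<phi>' where d: "!!b. b \<in> Basis ==> smooth_family D Per \<nu> w (\<phi>' b)"
   "!!b i. b \<in> Basis ==> has_partial D b (\<phi> i) (\<phi>' b i)" by blast
 have "\<exists>C. \<forall>x\<in>D. norm (\<phi>' b i x) \<le> C" if "b \<in> Basis" for b
  using smooth_family_bound1[OF d(1)[OF that] assms(2)] by metis
 then have "\<exists>C. \<forall>b\<in>Basis. \<forall>x\<in>D. norm (\<phi>' b i x) \<le> C b"
  by (intro bchoice) blast
 then obtain C where C: "!!b x. b \<in> Basis ==> x \<in> D ==> norm (\<phi>' b i x) \<le> C b" by blast
 define K where "K = (\<Sum>b\<in>(Basis::'a set). \<bar>C b\<bar>)"
 have CK: "C b \<le> K" if "b \<in> Basis" for b :: 'a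
 proof -
  have "C b \<le> \<bar>C b\<bar>" by simp
  also have "\<dots> \<le> K" unfolding K_def using that by (intro member_le_sum) auto
  finally show ?thesis .
 qed
 have lip: "norm (\<phi> i y - \<phi> i x) \<le> K * (\<Sum>b\<in>Basis. \<bar>(y - x) \<bullet> b\<bar>)" if "x \<in> D" "y \<in> D" for x y
  by (rule coord_box_lipschitz[OF assms(3) d(2)]) (use that C CK order_trans in blast)+
 have K0: "K \<ge> 0" unfolding K_def by (intro sum_nonneg) auto
 show ?thesis
  unfolding continuous_on_def
 proof
  fix x assume x: "x \<in> D"
  have "((%y. \<phi> i y - \<phi> i x) \<longlongrightarrow> 0) (at x within D)"
  proof (rule Lim_null_comparison)
   show "\<forall>\<^sub>F y in at x within D. norm (\<phi> i y - \<phi> i x) \<le> K * (\<Sum>b\<in>Basis. \<bar>(y - x) \<bullet> b\<bar>)"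
    using lip[OF x] by (auto simp: eventually_at_filter)
   show "((%y. K * (\<Sum>b\<in>Basis. \<bar>(y - x) \<bullet> b\<bar>)) \<longlongrightarrow> 0) (at x within D)"
    by (rule tendsto_eq_intros refl | simp)+
  qed
  then show "(\<phi> i \<longlongrightarrow> \<phi> i x) (at x within D)"
   by (simp add: LIM_zero_iff)
 qed
qed

lemma smooth_family_linear:
 fixes D :: "'a::euclidean_space set"
 assumes \<phi>: "smooth_family D Per \<nu> w \<phi>" and w: "weight D w"
  and L: "!!i. bounded_linear (L i)" "!!i v. norm (L i v) \<le> A * \<nu> (j i) ^ N * norm v"
  and \<nu>: "!!i. 0 \<le> \<nu>' i" "!!i. \<nu>' i \<le> \<nu> (j i)" and A: "0 \<le> A"
 shows "smooth_family D Per \<nu>' w (%i x. L i (\<phi> (j i) x))"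
proof (rule smooth_family_closed[where Q = "%\<psi>. \<exists>\<phi>. smooth_family D Per \<nu> w \<phi> \<and> \<psi> = (%i x. L i (\<phi> (j i) x))"])
 show "\<exists>\<phi>'. smooth_family D Per \<nu> w \<phi>' \<and> (%i x. L i (\<phi> (j i) x)) = (%i x. L i (\<phi>' (j i) x))"
  using \<phi> by blast
next
 fix \<psi> n assume "\<exists>\<phi>. smooth_family D Per \<nu> w \<phi> \<and> \<psi> = (%i x. L i (\<phi> (j i) x))"
 then obtain \<phi> where p: "smooth_family D Per \<nu> w \<phi>" "\<psi> = (%i x. L i (\<phi> (j i) x))" by blast
 obtain C where C: "C \<ge> 0" "!!i x. x \<in> D ==> \<nu> i ^ (n + N) * norm (\<phi> i x) \<le> C * w x"
  using smooth_family_bound[OF p(1) w] by metis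
 have "\<nu>' i ^ n * norm (\<psi> i x) \<le> (A * C) * w x" if "x \<in> D" for i x
 proof -
  have "\<nu>' i ^ n * norm (\<psi> i x) \<le> \<nu> (j i) ^ n * (A * \<nu> (j i) ^ N * norm (\<phi> (j i) x))"
   unfolding p(2) using \<nu>[of i] by (intro mult_mono power_mono L) auto
  also have "\<dots> = A * (\<nu> (j i) ^ (n + N) * norm (\<phi> (j i) x))"
   by (simp add: power_add algebra_simps)
  also have "\<dots> \<le> A * (C * w x)"
   using C(2)[OF that] A by (intro mult_left_mono) auto
  finally show ?thesis by (simp add: mult.assoc)
 qed
 then show "\<exists>C. \<forall>i. \<forall>x\<in>D. \<nu>' i ^ n * norm (\<psi> i x) \<le> C * w x" by blast
next
 fix \<psi> and b :: 'a assume "\<exists>\<phi>. smooth_family D Per \<nu> w \<phi> \<and> \<psi> = (%i x. L i (\<phi> (j i) x))" and b: "b \<in> Basis"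
 then obtain \<phi> where p: "smooth_family D Per \<nu> w \<phi>" "\<psi> = (%i x. L i (\<phi> (j i) x))" by blast
 obtain \<phi>' where "smooth_family D Per \<nu> w \<phi>'" "!!i. has_partial D b (\<phi> i) (\<phi>' i)"
  using smooth_family_deriv[OF p(1) b] by metis
 then show "\<exists>\<psi>'. (\<exists>\<phi>. smooth_family D Per \<nu> w \<phi> \<and> \<psi>' = (%i x. L i (\<phi> (j i) x))) \<and>
   (\<forall>i. has_partial D b (\<psi> i) (\<psi>' i))"
  unfolding p(2) using has_partial_linear[OF L(1)] by blast
next
 fix \<psi> p i x assume "\<exists>\<phi>. smooth_family D Per \<nu> w \<phi> \<and> \<psi> = (%i x. L i (\<phi> (j i) x))" "p \<in> Per" "x \<in> D"
 then obtain \<phi> where p: "smooth_family D Per \<nu> w \<phi>" "\<psi> = (%i x. L i (\<phi> (j i) x))" by blast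
 show "\<psi> i (x + p) = \<psi> i x"
  unfolding p(2) by (simp add: smooth_family_periodic[OF p(1) \<open>p \<in> Per\<close> \<open>x \<in> D\<close>])
qed

lemma smooth_fun_linear:
 assumes "bounded_linear L" "smooth_fun D Per w f" "weight D w"
 shows "smooth_fun D Per w (%x. L (f x))"
proof -
 obtain K where K: "K \<ge> 0" "!!x. norm (L x) \<le> norm x * K"
  using bounded_linear.nonneg_bounded[OF assms(1)] by blast
 show ?thesis
  by (rule smooth_family_linear[where \<nu> = "%_::unit. 1" and \<nu>' = "%_::unit. 1" and \<phi> = "%_. f"
     and L = "%_. L" and j = "%i. i" and A = K and N = 0])
    (use assms K in \<open>simp_all add: mult.commute\<close>)
qed

lemma smooth_family_add:
 fixes D :: "'a::euclidean_space set"
 assumes "smooth_family D Per \<nu> w \<phi>" "smooth_family D Per \<nu> w \<psi>" and w: "weight D w"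
 shows "smooth_family D Per \<nu> w (%i x. \<phi> i x + \<psi> i x)"
proof (rule smooth_family_closed[where Q = "%\<zeta>. \<exists>\<phi> \<psi>. smooth_family D Per \<nu> w \<phi> \<and> smooth_family D Per \<nu> w \<psi> \<and> \<zeta> = (%i x. \<phi> i x + \<psi> i x)"])
 show "\<exists>\<phi>' \<psi>'. smooth_family D Per \<nu> w \<phi>' \<and> smooth_family D Per \<nu> w \<psi>' \<and>
   (%i x. \<phi> i x + \<psi> i x) = (%i x. \<phi>' i x + \<psi>' i x)"
  using assms by blast
next
 fix \<zeta> n assume "\<exists>\<phi> \<psi>. smooth_family D Per \<nu> w \<phi> \<and> smooth_family D Per \<nu> w \<psi> \<and> \<zeta> = (%i x. \<phi> i x + \<psi> i x)"
 then obtain \<phi> \<psi> where p: "smooth_family D Per \<nu> w \<phi>" "smooth_family D Per \<nu> w \<psi>" "\<zeta> = (%i x. \<phi> i x + \<psi> i x)" by blast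
 obtain C where C: "C \<ge> 0" "!!i x. x \<in> D ==> \<nu> i ^ (2 * n) * norm (\<phi> i x) \<le> C * w x"
  using smooth_family_bound[OF p(1) w] by metis
 obtain C0 where C0: "C0 \<ge> 0" "!!i x. x \<in> D ==> norm (\<phi> i x) \<le> C0 * w x"
  using smooth_family_bound0[OF p(1) w] by metis
 obtain C' where C': "C' \<ge> 0" "!!i x. x \<in> D ==> \<nu> i ^ (2 * n) * norm (\<psi> i x) \<le> C' * w x"
  using smooth_family_bound[OF p(2) w] by metis
 obtain C0' where C0': "C0' \<ge> 0" "!!i x. x \<in> D ==> norm (\<psi> i x) \<le> C0' * w x"
  using smooth_family_bound0[OF p(2) w] by metis
 have "\<nu> i ^ n * norm (\<zeta> i x) \<le> (C0 + C + C0' + C') * w x" if x: "x \<in> D" for i x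
 proof -
  have "\<nu> i ^ n \<le> 1 + \<nu> i ^ (2 * n)"
  proof -
   have "0 \<le> (\<nu> i ^ n - 1 / 2)\<^sup>2" by simp
   also have "\<dots> = 1 / 4 - \<nu> i ^ n + \<nu> i ^ (2 * n)"
    unfolding power_even_eq by (simp add: power2_eq_square algebra_simps)
   finally show ?thesis by simp
  qed
  then have "\<nu> i ^ n * norm (\<zeta> i x) \<le> (1 + \<nu> i ^ (2 * n)) * norm (\<phi> i x + \<psi> i x)"
   unfolding p(3) by (intro mult_right_mono) auto
  also have "\<dots> \<le> (1 + \<nu> i ^ (2 * n)) * (norm (\<phi> i x) + norm (\<psi> i x))"
   by (intro mult_left_mono norm_triangle_ineq) (simp add: power_mult)
  also have "\<dots> \<le> (C0 + C + C0' + C') * w x"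
   using C(2)[OF x, of i] C0(2)[OF x, of i] C'(2)[OF x, of i] C0'(2)[OF x, of i]
   by (simp add: algebra_simps)
  finally show ?thesis .
 qed
 then show "\<exists>C. \<forall>i. \<forall>x\<in>D. \<nu> i ^ n * norm (\<zeta> i x) \<le> C * w x" by blast
next
 fix \<zeta> and b :: 'a assume "\<exists>\<phi> \<psi>. smooth_family D Per \<nu> w \<phi> \<and> smooth_family D Per \<nu> w \<psi> \<and> \<zeta> = (%i x. \<phi> i x + \<psi> i x)" and b: "b \<in> Basis"
 then obtain \<phi> \<psi> where p: "smooth_family D Per \<nu> w \<phi>" "smooth_family D Per \<nu> w \<psi>" "\<zeta> = (%i x. \<phi> i x + \<psi> i x)" by blast
 obtain \<phi>' where 1: "smooth_family D Per \<nu> w \<phi>'" "!!i. has_partial D b (\<phi> i) (\<phi>' i)"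
  using smooth_family_deriv[OF p(1) b] by metis
 obtain \<psi>' where 2: "smooth_family D Per \<nu> w \<psi>'" "!!i. has_partial D b (\<psi> i) (\<psi>' i)"
  using smooth_family_deriv[OF p(2) b] by metis
 show "\<exists>\<zeta>'. (\<exists>\<phi> \<psi>. smooth_family D Per \<nu> w \<phi> \<and> smooth_family D Per \<nu> w \<psi> \<and> \<zeta>' = (%i x. \<phi> i x + \<psi> i x)) \<and>
   (\<forall>i. has_partial D b (\<zeta> i) (\<zeta>' i))"
  unfolding p(3) using 1 2 has_partial_add by blast
next
 fix \<zeta> p i x assume "\<exists>\<phi> \<psi>. smooth_family D Per \<nu> w \<phi> \<and> smooth_family D Per \<nu> w \<psi> \<and> \<zeta> = (%i x. \<phi> i x + \<psi> i x)" "p \<in> Per" "x \<in> D"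
 then obtain \<phi> \<psi> where p: "smooth_family D Per \<nu> w \<phi>" "smooth_family D Per \<nu> w \<psi>" "\<zeta> = (%i x. \<phi> i x + \<psi> i x)" by blast
 show "\<zeta> i (x + p) = \<zeta> i x"
  unfolding p(3) by (simp add: smooth_family_periodic[OF p(1) \<open>p \<in> Per\<close> \<open>x \<in> D\<close>]
   smooth_family_periodic[OF p(2) \<open>p \<in> Per\<close> \<open>x \<in> D\<close>])
qed

lemma smooth_family_compose:
 fixes D :: "'a::euclidean_space set"
 assumes \<phi>: "smooth_family D' Per' \<nu> w' \<phi>" and w': "weight D' w'"
  and A: "!!x. x \<in> D ==> A x \<in> D'"
  and step: "!!x h b. b \<in> Basis ==> A (x + h *\<^sub>R b) = A x + (h * c b) *\<^sub>R B b"
  and B: "!!b. b \<in> Basis ==> B b \<in> Basis"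
  and per: "!!p x. p \<in> Per ==> x \<in> D ==> A (x + p) = A x \<or> (\<exists>p'\<in>Per'. A (x + p) = A x + p')"
  and w: "!!x. x \<in> D ==> w' (A x) \<le> K * w x"
 shows "smooth_family D Per \<nu> w (%i x. \<phi> i (A x))"
proof (rule smooth_family_closed[where Q = "%\<psi>. \<exists>\<phi> r. smooth_family D' Per' \<nu> w' \<phi> \<and> \<psi> = (%i x. (r::real) *\<^sub>R \<phi> i (A x))"])
 show "\<exists>\<phi>' r. smooth_family D' Per' \<nu> w' \<phi>' \<and> (%i x. \<phi> i (A x)) = (%i x. r *\<^sub>R \<phi>' i (A x))"
  using \<phi> by (intro exI[of _ \<phi>] exI[of _ "1::real"]) simp
next
 fix \<psi> n assume "\<exists>\<phi> r. smooth_family D' Per' \<nu> w' \<phi> \<and> \<psi> = (%i x. (r::real) *\<^sub>R \<phi> i (A x))"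
 then obtain \<phi> r where p: "smooth_family D' Per' \<nu> w' \<phi>" "\<psi> = (%i x. (r::real) *\<^sub>R \<phi> i (A x))" by blast
 obtain C where C: "C \<ge> 0" "!!i x. x \<in> D' ==> \<nu> i ^ n * norm (\<phi> i x) \<le> C * w' x"
  using smooth_family_bound[OF p(1) w'] by metis
 have "\<nu> i ^ n * norm (\<psi> i x) \<le> (\<bar>r\<bar> * C * K) * w x" if x: "x \<in> D" for i x
 proof -
  have "\<nu> i ^ n * norm (\<psi> i x) = \<bar>r\<bar> * (\<nu> i ^ n * norm (\<phi> i (A x)))"
   unfolding p(2) by (simp add: algebra_simps)
  also have "\<dots> \<le> \<bar>r\<bar> * (C * (K * w x))"
   using C(2)[OF A[OF x], of i] mult_left_mono[OF w[OF x] C(1)]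
   by (intro mult_left_mono) auto
  finally show ?thesis by (simp add: algebra_simps)
 qed
 then show "\<exists>C. \<forall>i. \<forall>x\<in>D. \<nu> i ^ n * norm (\<psi> i x) \<le> C * w x" by blast
next
 fix \<psi> p i x assume "\<exists>\<phi> r. smooth_family D' Per' \<nu> w' \<phi> \<and> \<psi> = (%i x. (r::real) *\<^sub>R \<phi> i (A x))"
  and px: "p \<in> Per" "x \<in> D"
 then obtain \<phi> r where p: "smooth_family D' Per' \<nu> w' \<phi>" "\<psi> = (%i x. (r::real) *\<^sub>R \<phi> i (A x))" by blast
 show "\<psi> i (x + p) = \<psi> i x"
  unfolding p(2) using per[OF px] smooth_family_periodic[OF p(1) _ A[OF px(2)]] by fastforce
next
 fix \<psi> and b :: 'a assume "\<exists>\<phi> r. smooth_family D' Per' \<nu> w' \<phi> \<and> \<psi> = (%i x. (r::real) *\<^sub>R \<phi> i (A x))" and b: "b \<in> Basis"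
 then obtain \<phi> r where p: "smooth_family D' Per' \<nu> w' \<phi>" "\<psi> = (%i x. (r::real) *\<^sub>R \<phi> i (A x))" by blast
 obtain \<phi>' where d: "smooth_family D' Per' \<nu> w' \<phi>'" "!!i. has_partial D' (B b) (\<phi> i) (\<phi>' i)"
  using smooth_family_deriv[OF p(1) B[OF b]] by metis
 have "has_partial D b (\<psi> i) (%x. r *\<^sub>R (c b *\<^sub>R \<phi>' i (A x)))" for i
  unfolding p(2) using has_partial_compose[OF d(2) A step[OF b]]
  by (intro has_partial_linear[OF bounded_linear_scaleR_right]) auto
 then show "\<exists>\<psi>'. (\<exists>\<phi> r. smooth_family D' Per' \<nu> w' \<phi> \<and> \<psi>' = (%i x. (r::real) *\<^sub>R \<phi> i (A x))) \<and>
   (\<forall>i. has_partial D b (\<psi> i) (\<psi>' i))"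
  using d(1) by (intro exI[of _ "%i x. (r * c b) *\<^sub>R \<phi>' i (A x)"]) auto
qed

lemma smooth_family_weaken:
 fixes D :: "'a::euclidean_space set" and \<phi> :: "'i => 'a => 'b::real_normed_vector"
 assumes \<phi>: "smooth_family D Per \<nu> w \<phi>" and w: "weight D w"
  and le: "!!x. x \<in> D ==> w x \<le> K * w' x"
 shows "smooth_family D Per \<nu> w' \<phi>"
proof (rule smooth_family_closed[where Q = "smooth_family D Per \<nu> w"])
 fix \<phi> :: "'i => 'a => 'b" and n assume p: "smooth_family D Per \<nu> w \<phi>"
 obtain C where C: "C \<ge> 0" "!!i x. x \<in> D ==> \<nu> i ^ n * norm (\<phi> i x) \<le> C * w x"
  using smooth_family_bound[OF p(1) w] by metis
 have "\<nu> i ^ n * norm (\<phi> i x) \<le> (C * K) * w' x" if "x \<in> D" for i x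
  using C(2)[OF that, of i] mult_left_mono[OF le[OF that] C(1)] by (simp add: mult.assoc)
 then show "\<exists>C. \<forall>i. \<forall>x\<in>D. \<nu> i ^ n * norm (\<phi> i x) \<le> C * w' x" by blast
next
 fix \<phi> :: "'i => 'a => 'b" and b :: 'a assume "smooth_family D Per \<nu> w \<phi>" "b \<in> Basis"
 then show "\<exists>\<phi>'. smooth_family D Per \<nu> w \<phi>' \<and> (\<forall>i. has_partial D b (\<phi> i) (\<phi>' i))"
  using smooth_family_deriv by metis
next
 show "smooth_family D Per \<nu> w \<phi>" by (rule \<phi>)
qed (rule smooth_family_periodic)

lemma smooth_family_const:
 fixes D :: "'a::euclidean_space set" and c :: "'b::real_normed_vector"
 assumes "weight D w" "!!x. x \<in> D ==> 1 \<le> K * w x"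
 shows "smooth_fun D Per w (%_. c)"
proof (rule smooth_family_closed[where Q = "%\<psi>. \<exists>c. \<psi> = (%_ _. c)"])
 fix \<phi> :: "unit => 'a => 'b" and n :: nat assume "\<exists>c. \<phi> = (%_ _. c)"
 then obtain c where c: "\<phi> = (%_ _. c)" by blast
 have "1 ^ n * norm c \<le> (norm c * K) * w x" if "x \<in> D" for x
  using mult_left_mono[OF assms(2)[OF that], of "norm c"] by (simp add: mult.assoc)
 then show "\<exists>C. \<forall>i. \<forall>x\<in>D. 1 ^ n * norm (\<phi> i x) \<le> C * w x" unfolding c by blast
qed (auto intro: has_partial_const)

section \<open>Smooth families and iterated partial derivatives\<close>

lemma smooth_family_iter_partial:
 assumes "coord_box D" "smooth_family D Per \<nu> w \<phi>" "set bs \<subseteq> Basis"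
 shows "\<exists>\<phi>'. smooth_family D Per \<nu> w \<phi>' \<and> (\<forall>i. \<forall>x\<in>D. iter_partial D bs (\<phi> i) x = \<phi>' i x)"
 using assms(3)
proof (induction bs)
 case Nil
 then show ?case using assms(2) by auto
next
 case (Cons b bs)
 then obtain \<phi>' where 1: "smooth_family D Per \<nu> w \<phi>'" "\<forall>i. \<forall>x\<in>D. iter_partial D bs (\<phi> i) x = \<phi>' i x"
  by auto
 obtain \<phi>'' where 2: "smooth_family D Per \<nu> w \<phi>''" "!!i. has_partial D b (\<phi>' i) (\<phi>'' i)"
  using smooth_family_deriv[OF 1(1)] Cons.prems by (metis list.set_intros(1) subset_eq)
 have "has_partial D b (iter_partial D bs (\<phi> i)) (\<phi>'' i)" for i
  by (rule has_partial_cong[OF 2(2)]) (use 1(2) in auto)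
 then have "partial_deriv D b (iter_partial D bs (\<phi> i)) x = \<phi>'' i x" if "x \<in> D" for i x
  using has_partial_imp_partial_deriv(1)[OF assms(1)] Cons.prems that by (metis list.set_intros(1) subset_eq)
 then show ?case
  using 2(1) by (intro exI[of _ \<phi>'']) auto
qed

lemma smooth_family_smooth_up_to:
 assumes "coord_box D" "weight D w" "smooth_family D Per \<nu> w \<phi>"
 shows "smooth_up_to D (\<phi> i)"
 unfolding smooth_up_to_def
proof (intro allI impI conjI ballI)
 fix bs :: "'a list" assume bs: "set bs \<subseteq> Basis"
 obtain \<phi>' where 1: "smooth_family D Per \<nu> w \<phi>'" "\<forall>i. \<forall>x\<in>D. iter_partial D bs (\<phi> i) x = \<phi>' i x"
  using smooth_family_iter_partial[OF assms(1,3) bs] by blast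
 have "continuous_on D (\<phi>' i)"
  using smooth_family_continuous[OF 1(1) assms(2,1)] .
 then show "continuous_on D (iter_partial D bs (\<phi> i))"
  using 1(2) by (auto intro: continuous_on_eq)
 fix b x assume b: "b \<in> (Basis :: 'a set)" and x: "x \<in> D"
 obtain \<phi>'' where 2: "smooth_family D Per \<nu> w \<phi>''" "!!i. has_partial D b (\<phi>' i) (\<phi>'' i)"
  using smooth_family_deriv[OF 1(1) b] by metis
 have "has_partial D b (iter_partial D bs (\<phi> i)) (\<phi>'' i)"
  by (rule has_partial_cong[OF 2(2)]) (use 1(2) in auto)
 then show "partial_differentiable D b (iter_partial D bs (\<phi> i)) x"
  using has_partial_imp_partial_deriv(2)[OF assms(1) b] x by blast
qed

lemma iter_partial_periodic:
 fixes D :: "'a::euclidean_space set" and f :: "'a => 'b::real_normed_vector"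
 assumes per: "!!x. x \<in> D ==> f (x + p) = f x"
  and inv: "!!x. x + p \<in> D \<longleftrightarrow> x \<in> D"
 shows "x \<in> D ==> iter_partial D bs f (x + p) = iter_partial D bs f x"
proof (induction bs arbitrary: x)
 case Nil
 then show ?case using per by simp
next
 case (Cons b bs)
 have eq: "x + p + h *\<^sub>R b = (x + h *\<^sub>R b) + p" for h by (simp add: algebra_simps)
 have S: "{h. x + p + h *\<^sub>R b \<in> D} = {h. x + h *\<^sub>R b \<in> D}"
  unfolding eq using inv by blast
 have "((%h. iter_partial D bs f (x + p + h *\<^sub>R b)) has_vector_derivative d) (at 0 within {h. x + h *\<^sub>R b \<in> D})
  \<longleftrightarrow> ((%h. iter_partial D bs f (x + h *\<^sub>R b)) has_vector_derivative d) (at 0 within {h. x + h *\<^sub>R b \<in> D})"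
  (is "?A \<longleftrightarrow> ?B") for d
 proof
  show ?B if ?A
   using that unfolding eq by (rule has_vector_derivative_transform_within[where d = 1]) (use Cons in auto)
  show ?A if ?B
   using that unfolding eq by (rule has_vector_derivative_transform_within[where d = 1]) (use Cons in auto)
 qed
 then show ?case
  unfolding iter_partial.simps partial_deriv_def vector_derivative_def S by simp
qed

text \<open>The iterated partial derivatives of a function form a class closed under
 differentiation.\<close>

lemma smooth_fun_of_iter_partial:
 fixes D :: "'a::euclidean_space set" and f :: "'a => 'b::real_normed_vector"
 assumes sm: "smooth_up_to D f"
  and per: "!!p x. p \<in> Per ==> x \<in> D ==> f (x + p) = f x"
  and inv: "!!p x. p \<in> Per ==> x + p \<in> D \<longleftrightarrow> x \<in> D"
  and bnd: "!!bs. set bs \<subseteq> Basis ==> \<exists>C. \<forall>x\<in>D. norm (iter_partial D bs f x) \<le> C * w x"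
 shows "smooth_fun D Per w f"
proof -
 have per': "iter_partial D bs f (x + p) = iter_partial D bs f x" if "p \<in> Per" "x \<in> D" for bs p x
  by (rule iter_partial_periodic) (use per inv that in auto)
 show ?thesis
 proof (rule smooth_family_closed[where Q = "%\<psi>. \<exists>bs. set bs \<subseteq> Basis \<and> \<psi> = (%_. iter_partial D bs f)"])
  show "\<exists>bs. set bs \<subseteq> Basis \<and> (%_. f) = (%_. iter_partial D bs f)"
   by (intro exI[of _ "[]"]) auto
 next
  fix \<phi> :: "unit => 'a => 'b" and n :: nat
  assume "\<exists>bs. set bs \<subseteq> Basis \<and> \<phi> = (%_. iter_partial D bs f)"
  then show "\<exists>C. \<forall>i. \<forall>x\<in>D. 1 ^ n * norm (\<phi> i x) \<le> C * w x"
   using bnd by auto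
 next
  fix \<phi> :: "unit => 'a => 'b" and b :: 'a
  assume "\<exists>bs. set bs \<subseteq> Basis \<and> \<phi> = (%_. iter_partial D bs f)" and b: "b \<in> Basis"
  then obtain bs where bs: "set bs \<subseteq> Basis" "\<phi> = (%_. iter_partial D bs f)" by blast
  have "has_partial D b (iter_partial D bs f) (iter_partial D (b # bs) f)"
   unfolding iter_partial.simps
   by (rule has_partial_partial_deriv) (use sm bs b in \<open>auto simp: smooth_up_to_def\<close>)
  then show "\<exists>\<phi>'. (\<exists>bs. set bs \<subseteq> Basis \<and> \<phi>' = (%_. iter_partial D bs f)) \<and> (\<forall>i. has_partial D b (\<phi> i) (\<phi>' i))"
   unfolding bs(2) using bs(1) b
   by (intro exI[of _ "%_. iter_partial D (b # bs) f"] conjI exI[of _ "b # bs"]) auto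
 qed (auto simp: per')
qed

section \<open>The function spaces of the problem\<close>

definition per6 :: "pt6 set" where
 "per6 = {(0,2*pi,0,0,0,0), (0,0,2*pi,0,0,0), (0,0,0,0,0,2*pi)}"

definition decay :: "side => real => pt6 => real" where
 "decay s \<delta> = (%(t,y1,y2,y3,Y,th). exp (- (\<delta> * (sg s * Y))))"

abbreviation smooth6 :: "real => side => real => (pt6 => 'b::real_normed_vector) => bool" where
 "smooth6 T s \<delta> f \<equiv> smooth_fun (dom6 T s) per6 (decay s \<delta>) f"

abbreviation freq :: "int => real" where
 "freq k \<equiv> \<bar>of_int k\<bar>"

abbreviation rapid :: "real => side => real => (int => pt6 => 'b::real_normed_vector) => bool" where
 "rapid T s \<delta> \<phi> \<equiv> smooth_family (dom6 T s) per6 (%k::int. 1 + freq k) (decay s \<delta>) \<phi>"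

abbreviation partial6 :: "real => side => pt6 => (pt6 => 'b::real_normed_vector) => (pt6 => 'b) => bool" where
 "partial6 T s \<equiv> has_partial (dom6 T s)"

abbreviation per4 :: "pt4 set" where
 "per4 \<equiv> {(0,2*pi,0,0), (0,0,2*pi,0), (0,0,0,2*pi)}"

abbreviation per5 :: "pt5 set" where
 "per5 \<equiv> {(0,2*pi,0,0,0), (0,0,2*pi,0,0), (0,0,0,0,2*pi)}"

abbreviation cell4 :: "real => pt4 set" where
 "cell4 T \<equiv> {0..T} \<times> {0..2*pi} \<times> {0..2*pi} \<times> {0..2*pi}"

abbreviation cell5 :: "real => side => pt5 set" where
 "cell5 T s \<equiv> {0..T} \<times> {0..2*pi} \<times> {0..2*pi} \<times> cslab s \<times> {0..2*pi}"

abbreviation cell6 :: "real => side => pt6 set" where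
 "cell6 T s \<equiv> {0..T} \<times> {0..2*pi} \<times> {0..2*pi} \<times> cslab s \<times> chalf s \<times> {0..2*pi}"

abbreviation omit_Y :: "pt6 => pt5" where
 "omit_Y \<equiv> %(t,y1,y2,y3,Y,th). (t,y1,y2,y3,th)"

abbreviation omit_y3_Y :: "pt6 => pt4" where
 "omit_y3_Y \<equiv> %(t,y1,y2,y3,Y,th). (t,y1,y2,th)"

abbreviation at_Y_zero :: "pt5 => pt6" where
 "at_Y_zero \<equiv> %(t,y1,y2,y3,th). (t,y1,y2,y3,0,th)"

lemma sg_square [simp]: "sg s * sg s = 1" "sg s * (sg s * x) = x"
 by (cases s; simp)+

lemma sg_abs [simp]: "\<bar>sg s\<bar> = 1"
 by (cases s; simp)

lemma Basis_pt4: "(Basis :: pt4 set) = {(1,0,0,0), (0,1,0,0), (0,0,1,0), (0,0,0,1)}"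
 by (auto simp: Basis_prod_def zero_prod_def)

lemma Basis_pt5: "(Basis :: pt5 set) = {(1,0,0,0,0), (0,1,0,0,0), (0,0,1,0,0), (0,0,0,1,0), (0,0,0,0,1)}"
 by (auto simp: Basis_prod_def zero_prod_def)

lemma Basis_pt6: "(Basis :: pt6 set) =
  {(1,0,0,0,0,0), (0,1,0,0,0,0), (0,0,1,0,0,0), (0,0,0,1,0,0), (0,0,0,0,1,0), (0,0,0,0,0,1)}"
 by (auto simp: Basis_prod_def zero_prod_def)

lemma cslab_eq: "cslab Plus = {0..1}" "cslab Minus = {-1..0}"
 by (auto simp: cslab_def)

lemma chalf_eq: "chalf Plus = {0..}" "chalf Minus = {..0}"
 by (auto simp: chalf_def)

lemma convex_cslab: "convex (cslab s)" and convex_chalf: "convex (chalf s)"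
 by (cases s; simp add: cslab_eq chalf_eq)+

lemma coord_box_dom4: "T > 0 ==> coord_box (dom4 T)"
 unfolding coord_box_def
proof (intro conjI)
 assume T: "T > 0"
 show "convex (dom4 T)"
  unfolding dom4_def by (intro convex_Times convex_UNIV) auto
 show "\<forall>x\<in>dom4 T. \<forall>y\<in>dom4 T. \<forall>b\<in>Basis. x + ((y - x) \<bullet> b) *\<^sub>R b \<in> dom4 T"
  unfolding Basis_pt4 by (auto simp: dom4_def)
 have "(0,0,0,0) \<in> dom4 T" "(T,1,1,1) \<in> dom4 T" using T by (auto simp: dom4_def)
 then show "\<forall>b\<in>Basis. \<exists>x\<in>dom4 T. \<exists>y\<in>dom4 T. x \<bullet> b \<noteq> y \<bullet> b"
  unfolding Basis_pt4 using T
  by (intro ballI bexI[of _ "(0,0,0,0)"] bexI[of _ "(T,1,1,1)"]) auto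
qed

lemma coord_box_dom5: "T > 0 ==> coord_box (dom5 T s)"
 unfolding coord_box_def
proof (intro conjI)
 assume T: "T > 0"
 show "convex (dom5 T s)"
  unfolding dom5_def by (intro convex_Times convex_UNIV convex_cslab) auto
 show "\<forall>x\<in>dom5 T s. \<forall>y\<in>dom5 T s. \<forall>b\<in>Basis. x + ((y - x) \<bullet> b) *\<^sub>R b \<in> dom5 T s"
  unfolding Basis_pt5 by (auto simp: dom5_def)
 have "(0,0,0,0,0) \<in> dom5 T s" "(T,1,1,sg s,1) \<in> dom5 T s" using T by (auto simp: dom5_def cslab_def)
 then show "\<forall>b\<in>Basis. \<exists>x\<in>dom5 T s. \<exists>y\<in>dom5 T s. x \<bullet> b \<noteq> y \<bullet> b"
  unfolding Basis_pt5 using T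
  by (intro ballI bexI[of _ "(0,0,0,0,0)"] bexI[of _ "(T,1,1,sg s,1)"]; cases s) auto
qed

lemma coord_box_dom6: "T > 0 ==> coord_box (dom6 T s)"
 unfolding coord_box_def
proof (intro conjI)
 assume T: "T > 0"
 show "convex (dom6 T s)"
  unfolding dom6_def by (intro convex_Times convex_UNIV convex_cslab convex_chalf) auto
 show "\<forall>x\<in>dom6 T s. \<forall>y\<in>dom6 T s. \<forall>b\<in>Basis. x + ((y - x) \<bullet> b) *\<^sub>R b \<in> dom6 T s"
  unfolding Basis_pt6 by (auto simp: dom6_def)
 have "(0,0,0,0,0,0) \<in> dom6 T s" "(T,1,1,sg s,sg s,1) \<in> dom6 T s"
  using T by (auto simp: dom6_def cslab_def chalf_def)
 then show "\<forall>b\<in>Basis. \<exists>x\<in>dom6 T s. \<exists>y\<in>dom6 T s. x \<bullet> b \<noteq> y \<bullet> b"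
  unfolding Basis_pt6 using T
  by (intro ballI bexI[of _ "(0,0,0,0,0,0)"] bexI[of _ "(T,1,1,sg s,sg s,1)"]; cases s) auto
qed

lemma weight_decay: "\<delta> \<ge> 0 ==> weight (dom6 T s) (decay s \<delta>)"
 by (auto simp: weight_def decay_def dom6_def chalf_def)

lemma weight_one: "weight D (%_. 1)"
 by (simp add: weight_def)

lemma periodic_int_multiple:
 fixes g :: "'a::real_vector => 'b"
 assumes per: "!!x. x \<in> D ==> g (x + p) = g x" and inv: "!!x. x + p \<in> D \<longleftrightarrow> x \<in> D"
  and x: "x \<in> D"
 shows "x + of_int m *\<^sub>R p \<in> D \<and> g (x + of_int m *\<^sub>R p) = g x"
proof (induction m rule: int_induct[where k = 0])
 case base
 then show ?case using x by simp
next
 case (step1 i)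
 have "x + of_int (i + 1) *\<^sub>R p = (x + of_int i *\<^sub>R p) + p" by (simp add: algebra_simps)
 then show ?case using per inv step1 by metis
next
 case (step2 i)
 have "(x + of_int (i - 1) *\<^sub>R p) + p = x + of_int i *\<^sub>R p" by (simp add: algebra_simps)
 then show ?case using per inv step2 by metis
qed

text \<open>Every derivative is continuous, hence bounded on the compact period cell, and periodic,
 hence bounded everywhere.\<close>

lemma Hinf_smooth_fun:
 assumes f: "f \<in> Hinf D C Per" and C: "compact C" "C \<subseteq> D"
  and inv: "!!p x. p \<in> Per ==> x + p \<in> D \<longleftrightarrow> x \<in> D"
  and cell: "!!(g :: _ => 'b::real_normed_vector) x. x \<in> D ==>
    (!!p z. p \<in> Per ==> z \<in> D ==> g (z + p) = g z) ==> \<exists>z\<in>C. g x = g z"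
 shows "smooth_fun D Per (%_. 1) (f :: _ => 'b)"
proof (rule smooth_fun_of_iter_partial)
 show "smooth_up_to D f" using f by (simp add: Hinf_def)
 show per: "f (x + p) = f x" if "p \<in> Per" "x \<in> D" for p x
  using f that by (simp add: Hinf_def)
 show "x + p \<in> D \<longleftrightarrow> x \<in> D" if "p \<in> Per" for p x
  using inv that by blast
 fix bs :: "'a list" assume bs: "set bs \<subseteq> Basis"
 let ?g = "iter_partial D bs f"
 have "continuous_on D ?g"
  using f bs by (simp add: Hinf_def smooth_up_to_def)
 then have "bounded (?g ` C)"
  using C by (meson compact_continuous_image compact_imp_bounded continuous_on_subset)
 then obtain K where K: "!!z. z \<in> C ==> norm (?g z) \<le> K"
  by (auto simp: bounded_iff)
 have "?g (z + p) = ?g z" if "p \<in> Per" "z \<in> D" for p z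
  by (rule iter_partial_periodic) (use per inv that in auto)
 then have "norm (?g x) \<le> K * 1" if "x \<in> D" for x
  using cell[OF that, of ?g] K by fastforce
 then show "\<exists>C. \<forall>x\<in>D. norm (?g x) \<le> C * 1" by blast
qed

text \<open>The square of a derivative is dominated by a multiple of the weight, which is integrable
 over the cell.\<close>

lemma smooth_fun_Hinf:
 fixes f :: "'a::euclidean_space => 'b::euclidean_space"
 assumes D: "coord_box D" and w: "weight D w" and f: "smooth_fun D Per w f"
  and C: "C \<in> sets borel" "C \<subseteq> D"
  and int: "set_integrable lborel C w"
 shows "f \<in> Hinf D C Per"
 unfolding Hinf_def
proof (intro CollectI conjI ballI allI)
 show "f (x + p) = f x" if "p \<in> Per" "x \<in> D" for p x
  using smooth_family_periodic[OF f that] .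
 show "smooth_up_to D f"
  using smooth_family_smooth_up_to[OF D w f] .
 fix n
 show "sobolev_finite n D C f"
  unfolding sobolev_finite_def
 proof (intro allI impI)
  fix bs :: "'a list" assume "set bs \<subseteq> Basis \<and> length bs \<le> n"
  then obtain \<phi> where \<phi>: "smooth_family D Per (%_::unit. 1) w \<phi>"
    "\<forall>i. \<forall>x\<in>D. iter_partial D bs f x = \<phi> i x"
   using smooth_family_iter_partial[OF D f] by blast
  have cont: "continuous_on C (iter_partial D bs f)"
   using continuous_on_subset[OF smooth_family_continuous[OF \<phi>(1) w D, of "()"] C(2)]
   by (rule continuous_on_eq) (use \<phi>(2) C(2) in auto)
  obtain K where K: "K \<ge> 0" "!!i x. x \<in> D ==> norm (\<phi> i x) \<le> K * w x"
   using smooth_family_bound0[OF \<phi>(1) w] by metis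
  have le: "(norm (iter_partial D bs f x))\<^sup>2 \<le> K\<^sup>2 * w x" if "x \<in> C" for x
  proof -
   have wx: "0 < w x" "w x \<le> 1" using w that C(2) by (auto simp: weight_def)
   have "(norm (iter_partial D bs f x))\<^sup>2 \<le> (K * w x)\<^sup>2"
    using K(2)[of x "()"] \<phi>(2) that C(2) by (intro power_mono) auto
   also have "\<dots> = K\<^sup>2 * (w x * w x)" by (simp add: power2_eq_square)
   also have "\<dots> \<le> K\<^sup>2 * w x"
    using wx by (intro mult_left_mono) (auto simp: mult_left_le)
   finally show ?thesis .
  qed
  show "set_integrable lborel C (%x. (norm (iter_partial D bs f x))\<^sup>2)"
  proof (rule set_integrable_bound)
   show "set_integrable lborel C (%x. K\<^sup>2 * w x)"
    using int by (rule set_integrable_mult_right)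
   have "continuous_on C (%x. (norm (iter_partial D bs f x))\<^sup>2)"
    using cont by (intro continuous_intros)
   then show "set_borel_measurable lborel C (%x. (norm (iter_partial D bs f x))\<^sup>2)"
    unfolding set_borel_measurable_def using C(1) borel_measurable_continuous_on_indicator by fastforce
   show "AE x in lborel. x \<in> C \<longrightarrow> norm ((norm (iter_partial D bs f x))\<^sup>2) \<le> norm (K\<^sup>2 * w x)"
    using le by (intro AE_I2) (auto intro: order_trans[OF _ abs_ge_self])
  qed
 qed
qed

lemma dom4_translate: "p \<in> per4 ==> x + p \<in> dom4 T \<longleftrightarrow> x \<in> dom4 T"
 by (cases x) (auto simp: dom4_def)

lemma dom5_translate: "p \<in> per5 ==> x + p \<in> dom5 T s \<longleftrightarrow> x \<in> dom5 T s"
 by (cases x) (auto simp: dom5_def)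

lemma dom6_translate: "p \<in> per6 ==> x + p \<in> dom6 T s \<longleftrightarrow> x \<in> dom6 T s"
 by (cases x) (auto simp: dom6_def per6_def)

lemma reduce_period:
 obtains m :: int where "0 \<le> y + of_int m * (2 * pi)" "y + of_int m * (2 * pi) \<le> 2 * pi"
proof -
 define m where "m = \<lfloor>y / (2 * pi)\<rfloor>"
 have "of_int m \<le> y / (2 * pi)" "y / (2 * pi) < of_int m + 1"
  unfolding m_def by linarith+
 then have "of_int m * (2 * pi) \<le> y" "y < (of_int m + 1) * (2 * pi)"
  by (simp_all add: pos_le_divide_eq pos_divide_less_eq)
 then show ?thesis
  using that[of "- m"] by (simp add: algebra_simps)
qed

lemma H_bdry_smooth_fun:
 fixes G :: "pt4 => 'b::real_normed_vector"
 assumes "G \<in> H_bdry T"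
 shows "smooth_fun (dom4 T) per4 (%_. 1) G"
proof (rule Hinf_smooth_fun[OF assms[unfolded H_bdry_def]])
 show "compact (cell4 T)"
  by (intro compact_Times) auto
 show "cell4 T \<subseteq> dom4 T"
  by (auto simp: dom4_def)
 show "x + p \<in> dom4 T \<longleftrightarrow> x \<in> dom4 T" if "p \<in> per4" for p x
  using dom4_translate[OF that] .
 fix g :: "pt4 => 'b" and x assume x: "x \<in> dom4 T"
  and per: "!!p z. p \<in> per4 ==> z \<in> dom4 T ==> g (z + p) = g z"
 obtain t a b c where xe: "x = (t,a,b,c)" by (cases x)
 obtain m where m: "0 \<le> a + of_int m * (2 * pi)" "a + of_int m * (2 * pi) \<le> 2 * pi" using reduce_period .
 obtain n where n: "0 \<le> b + of_int n * (2 * pi)" "b + of_int n * (2 * pi) \<le> 2 * pi" using reduce_period .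
 obtain l where l: "0 \<le> c + of_int l * (2 * pi)" "c + of_int l * (2 * pi) \<le> 2 * pi" using reduce_period .
 have D: "(t, a', b', c') \<in> dom4 T" for a' b' c'
  using x by (auto simp: xe dom4_def)
 have "g (t, a + of_int m * (2 * pi), b, c) = g x"
  using periodic_int_multiple[of "dom4 T" g "(0,2*pi,0,0)" x m] per dom4_translate x by (simp add: xe)
 moreover have "g (t, a + of_int m * (2 * pi), b + of_int n * (2 * pi), c) = g (t, a + of_int m * (2 * pi), b, c)"
  using periodic_int_multiple[of "dom4 T" g "(0,0,2*pi,0)" "(t, a + of_int m * (2 * pi), b, c)" n] per dom4_translate D by simp
 moreover have "g (t, a + of_int m * (2 * pi), b + of_int n * (2 * pi), c + of_int l * (2 * pi))
   = g (t, a + of_int m * (2 * pi), b + of_int n * (2 * pi), c)"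
  using periodic_int_multiple[of "dom4 T" g "(0,0,0,2*pi)" "(t, a + of_int m * (2 * pi), b + of_int n * (2 * pi), c)" l] per dom4_translate D by simp
 ultimately show "\<exists>z\<in>cell4 T. g x = g z"
  using m n l x
  by (intro bexI[of _ "(t, a + of_int m * (2 * pi), b + of_int n * (2 * pi), c + of_int l * (2 * pi))"])
    (auto simp: xe dom4_def)
qed

lemma S_under_smooth_fun:
 fixes f :: "pt5 => 'b::real_normed_vector"
 assumes "f \<in> S_under T s"
 shows "smooth_fun (dom5 T s) per5 (%_. 1) f"
proof (rule Hinf_smooth_fun[OF assms[unfolded S_under_def]])
 have "compact (cslab s)" by (cases s) (auto simp: cslab_eq)
 then show "compact (cell5 T s)"
  by (intro compact_Times) auto
 show "cell5 T s \<subseteq> dom5 T s"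
  by (auto simp: dom5_def)
 show "x + p \<in> dom5 T s \<longleftrightarrow> x \<in> dom5 T s" if "p \<in> per5" for p x
  using dom5_translate[OF that] .
 fix g :: "pt5 => 'b" and x assume x: "x \<in> dom5 T s"
  and per: "!!p z. p \<in> per5 ==> z \<in> dom5 T s ==> g (z + p) = g z"
 obtain t a b e c where xe: "x = (t,a,b,e,c)" by (cases x)
 obtain m where m: "0 \<le> a + of_int m * (2 * pi)" "a + of_int m * (2 * pi) \<le> 2 * pi" using reduce_period .
 obtain n where n: "0 \<le> b + of_int n * (2 * pi)" "b + of_int n * (2 * pi) \<le> 2 * pi" using reduce_period .
 obtain l where l: "0 \<le> c + of_int l * (2 * pi)" "c + of_int l * (2 * pi) \<le> 2 * pi" using reduce_period .
 have D: "(t, a', b', e, c') \<in> dom5 T s" for a' b' c'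
  using x by (auto simp: xe dom5_def)
 have "g (t, a + of_int m * (2 * pi), b, e, c) = g x"
  using periodic_int_multiple[of "dom5 T s" g "(0,2*pi,0,0,0)" x m] per dom5_translate x by (simp add: xe)
 moreover have "g (t, a + of_int m * (2 * pi), b + of_int n * (2 * pi), e, c) = g (t, a + of_int m * (2 * pi), b, e, c)"
  using periodic_int_multiple[of "dom5 T s" g "(0,0,2*pi,0,0)" "(t, a + of_int m * (2 * pi), b, e, c)" n] per dom5_translate D by simp
 moreover have "g (t, a + of_int m * (2 * pi), b + of_int n * (2 * pi), e, c + of_int l * (2 * pi))
   = g (t, a + of_int m * (2 * pi), b + of_int n * (2 * pi), e, c)"
  using periodic_int_multiple[of "dom5 T s" g "(0,0,0,0,2*pi)" "(t, a + of_int m * (2 * pi), b + of_int n * (2 * pi), e, c)" l] per dom5_translate D by simp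
 ultimately show "\<exists>z\<in>cell5 T s. g x = g z"
  using m n l x
  by (intro bexI[of _ "(t, a + of_int m * (2 * pi), b + of_int n * (2 * pi), e, c + of_int l * (2 * pi))"])
    (auto simp: xe dom5_def)
qed

lemma S_under_smooth6:
 fixes f :: "pt5 => 'b::real_normed_vector"
 assumes "f \<in> S_under T s"
 shows "smooth6 T s 0 (%(t,y1,y2,y3,Y,th). f (t,y1,y2,y3,th))"
proof -
 have "smooth6 T s 0 (%x. f (omit_Y x))"
 proof (rule smooth_family_compose[OF S_under_smooth_fun[OF assms] weight_one,
    where c = "%(t,y1,y2,y3,Y,th). if Y = 0 then 1 else 0"
     and B = "%(t,y1,y2,y3,Y,th). if Y = 0 then (t,y1,y2,y3,th) else (1,0,0,0,0)" and K = 1])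
  show "omit_Y x \<in> dom5 T s" if "x \<in> dom6 T s" for x :: pt6
   using that by (cases x) (auto simp: dom6_def dom5_def)
  show "omit_Y (x + h *\<^sub>R b) = omit_Y x + (h * (%(t,y1,y2,y3,Y,th). if Y = 0 then 1 else 0) b) *\<^sub>R (%(t,y1,y2,y3,Y,th). if Y = 0 then (t,y1,y2,y3,th) else (1,0,0,0,0)) b"
   if "b \<in> Basis" for x b :: pt6 and h
   using that by (cases x) (auto simp: Basis_pt6)
  show "(%(t,y1,y2,y3,Y,th). if Y = 0 then (t,y1,y2,y3,th) else (1,0,0,0,0)) b \<in> Basis" if "b \<in> Basis" for b :: pt6
   using that by (auto simp: Basis_pt6 Basis_pt5)
  show "omit_Y (x + p) = omit_Y x \<or> (\<exists>p'\<in>per5. omit_Y (x + p) = omit_Y x + p')"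
   if "p \<in> per6" "x \<in> dom6 T s" for p x :: pt6
   using that by (cases x) (auto simp: per6_def)
  show "1 \<le> 1 * decay s 0 x" if "x \<in> dom6 T s" for x :: pt6
   by (cases x) (auto simp: decay_def)
 qed
 then show ?thesis by (simp add: case_prod_unfold)
qed

lemma H_bdry_smooth6:
 fixes G :: "pt4 => 'b::real_normed_vector"
 assumes "G \<in> H_bdry T"
 shows "smooth6 T s 0 (%(t,y1,y2,y3,Y,th). G (t,y1,y2,th))"
proof -
 have "smooth6 T s 0 (%x. G (omit_y3_Y x))"
 proof (rule smooth_family_compose[OF H_bdry_smooth_fun[OF assms] weight_one,
    where c = "%(t,y1,y2,y3,Y,th). if Y = 0 \<and> y3 = 0 then 1 else 0"
     and B = "%(t,y1,y2,y3,Y,th). if Y = 0 \<and> y3 = 0 then (t,y1,y2,th) else (1,0,0,0)" and K = 1])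
  show "omit_y3_Y x \<in> dom4 T" if "x \<in> dom6 T s" for x :: pt6
   using that by (cases x) (auto simp: dom6_def dom4_def)
  show "omit_y3_Y (x + h *\<^sub>R b) = omit_y3_Y x + (h * (%(t,y1,y2,y3,Y,th). if Y = 0 \<and> y3 = 0 then 1 else 0) b) *\<^sub>R (%(t,y1,y2,y3,Y,th). if Y = 0 \<and> y3 = 0 then (t,y1,y2,th) else (1,0,0,0)) b"
   if "b \<in> Basis" for x b :: pt6 and h
   using that by (cases x) (auto simp: Basis_pt6)
  show "(%(t,y1,y2,y3,Y,th). if Y = 0 \<and> y3 = 0 then (t,y1,y2,th) else (1,0,0,0)) b \<in> Basis" if "b \<in> Basis" for b :: pt6
   using that by (auto simp: Basis_pt6 Basis_pt4)
  show "omit_y3_Y (x + p) = omit_y3_Y x \<or> (\<exists>p'\<in>per4. omit_y3_Y (x + p) = omit_y3_Y x + p')"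
   if "p \<in> per6" "x \<in> dom6 T s" for p x :: pt6
   using that by (cases x) (auto simp: per6_def)
  show "1 \<le> 1 * decay s 0 x" if "x \<in> dom6 T s" for x :: pt6
   by (cases x) (auto simp: decay_def)
 qed
 then show ?thesis by (simp add: case_prod_unfold)
qed

lemma smooth6_S_under:
 fixes f :: "pt6 => 'b::euclidean_space"
 assumes T: "T > 0" and f: "smooth6 T s 0 f"
 shows "(%(t,y1,y2,y3,th). f (t,y1,y2,y3,0,th)) \<in> S_under T s"
proof -
 have sm: "smooth_fun (dom5 T s) per5 (%_. 1)
   (%x. f (at_Y_zero x))"
 proof (rule smooth_family_compose[OF f weight_decay[OF order_refl],
    where c = "%_. 1" and B = "%(t,y1,y2,y3,th). (t,y1,y2,y3,0::real,th)" and K = 1])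
  show "at_Y_zero x \<in> dom6 T s" if "x \<in> dom5 T s" for x :: pt5
   using that by (cases x) (auto simp: dom6_def dom5_def chalf_def)
  show "at_Y_zero (x + h *\<^sub>R b) = at_Y_zero x + (h * (%_. 1) b) *\<^sub>R at_Y_zero b"
   if "b \<in> Basis" for x b :: pt5 and h
   using that by (cases x) (auto simp: Basis_pt5)
  show "at_Y_zero b \<in> Basis" if "b \<in> Basis" for b :: pt5
   using that by (auto simp: Basis_pt5 Basis_pt6)
  show "at_Y_zero (x + p) = at_Y_zero x \<or> (\<exists>p'\<in>per6. at_Y_zero (x + p) = at_Y_zero x + p')"
   if "p \<in> per5" "x \<in> dom5 T s" for p x :: pt5
   using that by (cases x) (auto simp: per6_def)
  show "decay s 0 (at_Y_zero x) \<le> 1 * 1" if "x \<in> dom5 T s" for x :: pt5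
   by (cases x) (auto simp: decay_def)
 qed
 have "compact (cslab s)" by (cases s) (auto simp: cslab_eq)
 then have C: "compact (cell5 T s)"
  by (intro compact_Times) auto
 show ?thesis
  unfolding S_under_def
 proof (rule smooth_fun_Hinf[OF coord_box_dom5[OF T] weight_one])
  show "smooth_fun (dom5 T s) per5 (%_. 1)
   (%(t,y1,y2,y3,th). f (t,y1,y2,y3,0,th))"
   using sm by (simp add: case_prod_unfold)
  show "cell5 T s \<in> sets borel"
   using C by (intro borel_closed compact_imp_closed)
  show "cell5 T s \<subseteq> dom5 T s"
   by (auto simp: dom5_def)
  show "set_integrable lborel (cell5 T s) (%_. 1::real)"
   unfolding set_integrable_def by (rule borel_integrable_compact[OF C]) auto
 qed
qed

lemma zero_in_H_bdry:
 assumes T: "T > 0"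
 shows "(%_. 0 :: real) \<in> H_bdry T"
 unfolding H_bdry_def
proof (rule smooth_fun_Hinf[OF coord_box_dom4[OF T] weight_one])
 have C: "compact (cell4 T)"
  by (intro compact_Times) auto
 show "smooth_fun (dom4 T) per4 (%_. 1) (%_. 0)"
  by (rule smooth_family_const[OF weight_one, where K = 1]) auto
 show "cell4 T \<in> sets borel"
  using C by (intro borel_closed compact_imp_closed)
 show "cell4 T \<subseteq> dom4 T"
  by (auto simp: dom4_def)
 show "set_integrable lborel (cell4 T) (%_. 1::real)"
  unfolding set_integrable_def by (rule borel_integrable_compact[OF C]) auto
qed

lemma integrable_lborel_product:
 fixes f :: "'a::euclidean_space => real" and g :: "'b::euclidean_space => real"
 assumes f: "integrable lborel f" and g: "integrable lborel g"
 shows "integrable lborel (%z. f (fst z) * g (snd z))"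
proof -
 have [measurable]: "f \<in> borel_measurable borel" "g \<in> borel_measurable borel"
  using borel_measurable_integrable[OF f] borel_measurable_integrable[OF g] by auto
 have "integrable (lborel \<Otimes>\<^sub>M lborel) (%z. f (fst z) * g (snd z))"
 proof (rule lborel_pair.Fubini_integrable)
  show "(%z. f (fst z) * g (snd z)) \<in> borel_measurable (lborel \<Otimes>\<^sub>M lborel)"
   by measurable
  show "integrable lborel (%x. LINT y|lborel. norm (f (fst (x, y)) * g (snd (x, y))))"
   using integrable_norm[OF f] integrable_norm[OF g] by (simp add: abs_mult)
  show "AE x in lborel. integrable lborel (%y. f (fst (x, y)) * g (snd (x, y)))"
   using g by simp
 qed
 then show ?thesis by (simp add: lborel_prod)
qed

lemma set_integrable_exp_half:
 assumes "\<delta> > 0"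
 shows "set_integrable lborel {0..} (%r::real. exp (- (\<delta> * r)))"
proof -
 have "(\<integral>\<^sup>+ r. ennreal (exp (- (\<delta> * r))) * indicator {0..} r \<partial>lborel) = 0 - (- exp (- (\<delta> * 0)) / \<delta>)"
 proof (rule nn_integral_FTC_atLeast)
  show "DERIV (%r. - exp (- (\<delta> * r)) / \<delta>) r :> exp (- (\<delta> * r))" for r
   using assms by (auto intro!: derivative_eq_intros)
  have "((%r. exp (- (\<delta> * r))) \<longlongrightarrow> 0) at_top"
   by (rule filterlim_compose[OF exp_at_bot])
     (auto simp: filterlim_uminus_at_bot intro!: filterlim_tendsto_pos_mult_at_top[OF tendsto_const assms] filterlim_ident)
  then show "((%r. - exp (- (\<delta> * r)) / \<delta>) \<longlongrightarrow> 0) at_top"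
   using tendsto_divide[OF tendsto_minus tendsto_const, of "%r. exp (- (\<delta> * r))" 0 at_top \<delta>] assms by simp
 qed auto
 also have "\<dots> < \<infinity>" by simp
 finally have fin: "(\<integral>\<^sup>+ r. ennreal (exp (- (\<delta> * r))) * indicator {0..} r \<partial>lborel) < \<infinity>" .
 show ?thesis
  unfolding set_integrable_def
 proof (rule integrableI_bounded)
  have "(\<integral>\<^sup>+ r. ennreal (norm (indicat_real {0..} r *\<^sub>R exp (- (\<delta> * r)))) \<partial>lborel)
    = (\<integral>\<^sup>+ r. ennreal (exp (- (\<delta> * r))) * indicator {0..} r \<partial>lborel)"
   by (intro nn_integral_cong) (auto simp: indicator_def)
  then show "(\<integral>\<^sup>+ r. ennreal (norm (indicat_real {0..} r *\<^sub>R exp (- (\<delta> * r)))) \<partial>lborel) < \<infinity>"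
   using fin by simp
 qed measurable
qed

lemma integrable_decay:
 assumes "\<delta> > 0"
 shows "set_integrable lborel (cell6 T s) (decay s \<delta>)"
proof -
 have I: "integrable lborel (indicat_real {a..b})" for a b :: real
  by (auto intro: integrable_real_indicator simp: emeasure_lborel_Icc_eq)
 have S: "integrable lborel (indicat_real (cslab s))"
  by (cases s) (simp_all add: cslab_eq I)
 have P: "integrable lborel (%Y. indicat_real {0..} Y * exp (- (\<delta> * Y)))"
  using set_integrable_exp_half[OF assms] by (simp add: set_integrable_def)
 have H: "integrable lborel (%Y. indicat_real (chalf s) Y * exp (- (\<delta> * (sg s * Y))))"
 proof (cases s)
  case Plus
  then show ?thesis using P by (simp add: chalf_eq)
 next
  case Minus
  have "integrable lborel (%Y. indicat_real {0..} (0 + (-1) * Y) * exp (- (\<delta> * (0 + (-1) * Y))))"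
   by (rule lborel_integrable_real_affine[OF P]) auto
  moreover have "indicat_real {0..} (0 + (-1) * Y) = indicat_real (chalf Minus) Y" for Y
   by (auto simp: chalf_eq indicator_def)
  ultimately show ?thesis using Minus by simp
 qed
 have "integrable lborel (%z::pt6. indicat_real {0..T} (fst z) * (indicat_real {0..2*pi} (fst (snd z)) *
   (indicat_real {0..2*pi} (fst (snd (snd z))) * (indicat_real (cslab s) (fst (snd (snd (snd z)))) *
   ((indicat_real (chalf s) (fst (snd (snd (snd (snd z))))) * exp (- (\<delta> * (sg s * fst (snd (snd (snd (snd z)))))))) *
    indicat_real {0..2*pi} (snd (snd (snd (snd (snd z))))))))))"
  using integrable_lborel_product[OF I integrable_lborel_product[OF I integrable_lborel_product[OF I
     integrable_lborel_product[OF S integrable_lborel_product[OF H I]]]]] .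
 then show ?thesis
  unfolding set_integrable_def
  by (rule back_subst[of "integrable lborel"]) (auto simp: fun_eq_iff indicator_def decay_def)
qed

lemma smooth6_S_star:
 fixes f :: "pt6 => 'b::euclidean_space"
 assumes T: "T > 0" and \<delta>: "\<delta> > 0" and f: "smooth6 T s \<delta> f"
 shows "f \<in> S_star T s"
 unfolding S_star_def
proof (intro CollectI conjI)
 have w: "weight (dom6 T s) (decay s \<delta>)" using \<delta> by (intro weight_decay) auto
 have cl: "closed (chalf s)" "closed (cslab s)" by (cases s; auto simp: chalf_eq cslab_eq)+
 show "f \<in> Hinf (dom6 T s) (cell6 T s)
   {(0,2*pi,0,0,0,0), (0,0,2*pi,0,0,0), (0,0,0,0,0,2*pi)}"
  using smooth_fun_Hinf[OF coord_box_dom6[OF T] w f, of "cell6 T s"]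
   integrable_decay[OF \<delta>, of T s] cl
  by (auto simp: per6_def dom6_def intro!: borel_closed closed_Times)
 have "\<exists>C. \<forall>t\<in>{0..T}. \<forall>y1 y2. \<forall>y3\<in>slab s. \<forall>Y3\<in>half s. \<forall>th.
       norm (iter_partial (dom6 T s) bs f (t,y1,y2,y3,Y3,th)) \<le> C * exp (- sg s * \<delta> * Y3)"
  if "set bs \<subseteq> Basis" for bs
 proof -
 from that obtain \<phi> where \<phi>: "smooth_family (dom6 T s) per6 (%_::unit. 1) (decay s \<delta>) \<phi>"
   "\<forall>i. \<forall>x\<in>dom6 T s. iter_partial (dom6 T s) bs f x = \<phi> i x"
  using smooth_family_iter_partial[OF coord_box_dom6[OF T] f] by blast
 obtain K where K: "!!i x. x \<in> dom6 T s ==> norm (\<phi> i x) \<le> K * decay s \<delta> x"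
  using smooth_family_bound0[OF \<phi>(1) w] by metis
 show ?thesis
 proof (intro exI[of _ K] ballI allI)
  fix t y1 y2 y3 Y3 th assume "t \<in> {0..T}" "y3 \<in> slab s" "Y3 \<in> half s"
  then have "(t,y1,y2,y3,Y3,th) \<in> dom6 T s"
   by (auto simp: dom6_def slab_def half_def cslab_def chalf_def)
  then show "norm (iter_partial (dom6 T s) bs f (t,y1,y2,y3,Y3,th)) \<le> K * exp (- sg s * \<delta> * Y3)"
   using K[of "(t,y1,y2,y3,Y3,th)" "()"] \<phi>(2) by (auto simp: decay_def algebra_simps)
 qed
 qed
 then show "\<exists>\<delta>>0. \<forall>bs. set bs \<subseteq> Basis \<longrightarrow> (\<exists>C. \<forall>t\<in>{0..T}. \<forall>y1 y2. \<forall>y3\<in>slab s. \<forall>Y3\<in>half s. \<forall>th.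
       norm (iter_partial (dom6 T s) bs f (t,y1,y2,y3,Y3,th)) \<le> C * exp (- sg s * \<delta> * Y3))"
  using \<delta> by blast
qed

lemma interior_approx:
 assumes "(t,y1,y2,y3,Y,th) \<in> dom6 T s"
 obtains X where "!!n. X n \<in> {0..T} \<times> UNIV \<times> UNIV \<times> slab s \<times> half s \<times> UNIV"
  "X \<longlonglongrightarrow> (t,y1,y2,y3,Y,th)" "!!n. X n \<in> dom6 T s"
proof
 define X where "X n = (t, y1, y2, y3 + inverse (real (Suc n)) * (sg s / 2 - y3), Y + inverse (real (Suc n)) * sg s, th)" for n
 have *: "sg s * (y3 + r * (sg s / 2 - y3)) = (1 - r) * (sg s * y3) + r / 2" for r
  by (cases s) (auto simp: algebra_simps)
 have **: "sg s * (Y + r * sg s) = sg s * Y + r" for r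
  by (cases s) (auto simp: algebra_simps)
 show X: "X n \<in> {0..T} \<times> UNIV \<times> UNIV \<times> slab s \<times> half s \<times> UNIV" for n
 proof -
  define r where "r = inverse (real (Suc n))"
  have r: "0 < r" "r \<le> 1" by (auto simp: r_def field_simps)
  have z: "0 \<le> sg s * y3" "sg s * y3 \<le> 1" "0 \<le> sg s * Y" using assms by (auto simp: dom6_def cslab_def chalf_def)
  have "(1 - r) * (sg s * y3) \<le> 1 - r" "0 \<le> (1 - r) * (sg s * y3)"
   using r z by (auto simp: mult_left_le)
  then have "0 < (1 - r) * (sg s * y3) + r / 2" "(1 - r) * (sg s * y3) + r / 2 < 1"
   using r by linarith+
  then show ?thesis
   unfolding X_def r_def[symmetric] using assms r z
   by (auto simp: slab_def half_def dom6_def * **)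
 qed
 show "X n \<in> dom6 T s" for n
  using X[of n] by (auto simp: dom6_def slab_def half_def cslab_def chalf_def)
 have "X \<longlonglongrightarrow> (t, y1, y2, y3 + 0 * (sg s / 2 - y3), Y + 0 * sg s, th)"
  unfolding X_def by (intro tendsto_intros LIMSEQ_inverse_real_of_nat)
 then show "X \<longlonglongrightarrow> (t,y1,y2,y3,Y,th)" by simp
qed

text \<open>The decay bounds are given on the open domain only; the derivatives are continuous on
 the closed one, so the bounds extend.\<close>

lemma S_star_smooth6:
 fixes f :: "pt6 => 'b::real_normed_vector"
 assumes "f \<in> S_star T s"
 obtains \<delta> where "\<delta> > 0" "smooth6 T s \<delta> f"
proof -
 obtain \<delta> where \<delta>: "\<delta> > 0" and bnd: "!!bs. set bs \<subseteq> Basis ==>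
     (\<exists>C. \<forall>t\<in>{0..T}. \<forall>y1 y2. \<forall>y3\<in>slab s. \<forall>Y3\<in>half s. \<forall>th.
       norm (iter_partial (dom6 T s) bs f (t,y1,y2,y3,Y3,th)) \<le> C * exp (- sg s * \<delta> * Y3))"
  and H: "f \<in> Hinf (dom6 T s)
      (cell6 T s) per6"
  using assms unfolding S_star_def per6_def by auto
 have "smooth6 T s \<delta> f"
 proof (rule smooth_fun_of_iter_partial)
  show "smooth_up_to (dom6 T s) f" using H by (simp add: Hinf_def)
  show "f (x + p) = f x" if "p \<in> per6" "x \<in> dom6 T s" for p x
   using H that by (simp add: Hinf_def)
  show "x + p \<in> dom6 T s \<longleftrightarrow> x \<in> dom6 T s" if "p \<in> per6" for p x
   using dom6_translate[OF that] .
  fix bs :: "pt6 list" assume bs: "set bs \<subseteq> Basis"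
  let ?g = "iter_partial (dom6 T s) bs f"
  have cont: "continuous_on (dom6 T s) ?g"
   using H bs by (simp add: Hinf_def smooth_up_to_def)
  obtain C where C0: "\<forall>t\<in>{0..T}. \<forall>y1 y2. \<forall>y3\<in>slab s. \<forall>Y3\<in>half s. \<forall>th.
    norm (?g (t,y1,y2,y3,Y3,th)) \<le> C * exp (- sg s * \<delta> * Y3)"
   using bnd[OF bs] by blast
  have C: "norm (?g x) \<le> C * decay s \<delta> x" if "x \<in> {0..T} \<times> UNIV \<times> UNIV \<times> slab s \<times> half s \<times> UNIV" for x
  proof -
   obtain t y1 y2 y3 Y th where xe: "x = (t,y1,y2,y3,Y,th)" by (cases x)
   have "norm (?g x) \<le> C * exp (- sg s * \<delta> * Y)"
    using C0 that unfolding xe by auto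
   moreover have "- sg s * \<delta> * Y = - (\<delta> * (sg s * Y))" by simp
   ultimately show ?thesis unfolding xe decay_def by (simp only: prod.case)
  qed
  have cd: "continuous_on UNIV (decay s \<delta>)"
   unfolding decay_def case_prod_unfold by (intro continuous_intros)
  have "norm (?g x) \<le> C * decay s \<delta> x" if x: "x \<in> dom6 T s" for x
  proof -
   obtain t y1 y2 y3 Y th where xe: "x = (t,y1,y2,y3,Y,th)" by (cases x)
   obtain X where X: "!!n. X n \<in> {0..T} \<times> UNIV \<times> UNIV \<times> slab s \<times> half s \<times> UNIV"
    "X \<longlonglongrightarrow> x" "!!n. X n \<in> dom6 T s"
    using interior_approx[OF x[unfolded xe]] unfolding xe by metis
   have 1: "(%n. norm (?g (X n))) \<longlonglongrightarrow> norm (?g x)"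
    using X x by (intro tendsto_norm continuous_on_tendsto_compose[OF cont]) auto
   have 2: "(%n. C * decay s \<delta> (X n)) \<longlonglongrightarrow> C * decay s \<delta> x"
    using X by (intro tendsto_mult tendsto_const continuous_on_tendsto_compose[OF cd]) auto
   show ?thesis
    by (rule LIMSEQ_le[OF 1 2]) (use C X(1) in auto)
  qed
  then show "\<exists>C. \<forall>x\<in>dom6 T s. norm (?g x) \<le> C * decay s \<delta> x" by blast
 qed
 then show ?thesis using that \<delta> by blast
qed

section \<open>Fourier series of periodic functions\<close>

definition mode :: "int => real => complex" where
 "mode k th = exp (\<i> * of_int k * of_real th)"

definition cfour :: "(real => complex) => int => complex" where
 "cfour g k = of_real (1 / (2 * pi)) * integral {0..2*pi} (%th. g th * mode (- k) th)"

lemma fourier_eq_cfour: "fourier g k = cfour (%th. of_real (g th)) k"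
 by (simp add: fourier_def cfour_def mode_def)

lemma mode_add: "mode j th * mode k th = mode (j + k) th"
 by (simp add: mode_def exp_add[symmetric] algebra_simps)

lemma mode_zero [simp]: "mode 0 th = 1"
 by (simp add: mode_def)

lemma mode_cnj: "cnj (mode k th) = mode (- k) th"
 by (simp add: mode_def exp_cnj)

lemma norm_mode [simp]: "norm (mode k th) = 1"
 by (simp add: mode_def)

lemma mode_periodic [simp]: "mode k (th + 2 * pi) = mode k th"
proof -
 have "mode k (th + 2 * pi) = mode k th * exp (2 * of_int k * pi * \<i>)"
  by (simp add: mode_def exp_add[symmetric] algebra_simps)
 also have "exp (2 * of_int k * pi * \<i>) = 1"
  by (rule exp_integer_2pi) simp
 finally show ?thesis by simp
qed

lemma mode_2pi [simp]: "mode k (2 * pi) = 1"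
 using mode_periodic[of k 0] by (simp add: mode_def)

lemma mode_2pi' [simp]: "mode k (pi * 2) = 1"
 using mode_2pi[of k] by (simp add: mult.commute)

lemma mode_0 [simp]: "mode k 0 = 1"
 by (simp add: mode_def)

lemma continuous_mode [continuous_intros]: "continuous_on S (mode k)"
 unfolding mode_def by (intro continuous_intros)

lemma mode_has_vector_derivative:
 "(mode k has_vector_derivative (\<i> * of_int k * mode k th)) (at th within S)"
proof -
 have "((%z. exp (\<i> * of_int k * z)) has_field_derivative (\<i> * of_int k * exp (\<i> * of_int k * of_real th))) (at (of_real th))"
  by (auto intro!: derivative_eq_intros)
 then have "((%th. exp (\<i> * of_int k * of_real th)) has_vector_derivative (\<i> * of_int k * exp (\<i> * of_int k * of_real th))) (at th within S)"
  by (rule has_vector_derivative_real_field)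
 then show ?thesis
  unfolding mode_def[abs_def] .
qed

lemma cfour_integrable:
 assumes "continuous_on UNIV g"
 shows "(%th. g th * mode (- k) th) integrable_on {0..2*pi}"
 by (intro integrable_continuous_real continuous_on_mult continuous_mode continuous_on_subset[OF assms]) auto

lemma cfour_add:
 assumes "continuous_on UNIV f" "continuous_on UNIV g"
 shows "cfour (%th. f th + g th) k = cfour f k + cfour g k"
 unfolding cfour_def
 by (simp add: distrib_right distrib_left integral_add cfour_integrable assms)

lemma cfour_cmult: "cfour (%th. c * g th) k = c * cfour g k"
 unfolding cfour_def by (simp add: mult.assoc)

lemma cfour_diff:
 assumes "continuous_on UNIV f" "continuous_on UNIV g"
 shows "cfour (%th. f th - g th) k = cfour f k - cfour g k"
 using cfour_add[OF assms(1) continuous_on_minus[OF assms(2)], of k] cfour_cmult[of "-1" g k] by simp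

lemma cfour_cong: "(!!th. f th = g th) ==> cfour f k = cfour g k"
 by (simp add: cfour_def)

lemma norm_cfour_le:
 assumes "continuous_on UNIV g" "!!th. norm (g th) \<le> C"
 shows "norm (cfour g k) \<le> C"
proof -
 have "norm (integral {0..2*pi} (%th. g th * mode (- k) th)) \<le> C * (2 * pi - 0)"
  by (intro integral_bound continuous_on_mult continuous_mode continuous_on_subset[OF assms(1)])
    (auto simp: norm_mult assms(2))
 then show ?thesis
  unfolding cfour_def norm_mult by (simp add: norm_divide field_simps)
qed

lemma cfour_deriv:
 assumes der: "!!th. (g has_vector_derivative g' th) (at th)" and per: "!!th. g (th + 2 * pi) = g th"
  and cont: "continuous_on UNIV g'"
 shows "cfour g' k = \<i> * of_int k * cfour g k"
proof -
 have cg: "continuous_on UNIV g"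
  using der by (intro continuous_at_imp_continuous_on) (metis has_vector_derivative_continuous)
 have "((%th. g th * (\<i> * of_int (- k) * mode (- k) th) + g' th * mode (- k) th) has_integral
   (g (2*pi) * mode (- k) (2*pi) - g 0 * mode (- k) 0)) {0..2*pi}"
  by (intro fundamental_theorem_of_calculus has_vector_derivative_mult mode_has_vector_derivative
     has_vector_derivative_at_within[OF der]) simp
 moreover have "g (2*pi) = g 0" using per[of 0] by simp
 ultimately have 0: "integral {0..2*pi} (%th. (\<i> * of_int (- k)) * (g th * mode (- k) th) + g' th * mode (- k) th) = 0"
  by (simp add: integral_unique algebra_simps)
 have i1: "(%th. (\<i> * of_int (- k)) * (g th * mode (- k) th)) integrable_on {0..2*pi}"
  by (intro integrable_on_mult_right cfour_integrable cg)
 have "(\<i> * of_int (- k)) * integral {0..2*pi} (%th. g th * mode (- k) th)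
   + integral {0..2*pi} (%th. g' th * mode (- k) th) = 0"
  using 0 unfolding integral_add[OF i1 cfour_integrable[OF cont]] integral_mult_right .
 then show ?thesis
  unfolding cfour_def by (simp add: algebra_simps add_eq_0_iff2)
qed

lemma cfour_mode: "cfour (mode j) k = (if j = k then 1 else 0)"
proof (cases "j = k")
 case True
 then show ?thesis by (simp add: cfour_def mode_add scaleR_conv_of_real)
next
 case False
 have "cfour (%th. (\<i> * of_int j) * mode j th) k = \<i> * of_int k * cfour (mode j) k"
  by (rule cfour_deriv) (auto intro!: mode_has_vector_derivative continuous_intros)
 then have "of_int (j - k) * cfour (mode j) k = 0"
  by (simp add: cfour_cmult algebra_simps)
 then show ?thesis using False by simp
qed

lemma cfour_const: "cfour (%_. c) k = (if k = 0 then c else 0)"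
 using cfour_cmult[of c "mode 0" k] cfour_mode[of 0 k] by (simp add: mode_def[abs_def])

lemma cfour_cnj: "cfour (%th. cnj (g th)) k = cnj (cfour g (- k))"
proof -
 have "(%th. cnj (g th) * mode (- k) th) = (%th. cnj (g th * mode k th))"
  by (simp add: mode_cnj)
 then show ?thesis
  unfolding cfour_def by (simp add: integral_cnj)
qed

inductive trig_poly :: "(real => complex) => bool" where
 trig_mode: "trig_poly (%th. c * mode k th)"
| trig_add: "trig_poly f ==> trig_poly g ==> trig_poly (%th. f th + g th)"

lemma trig_poly_mult_mode: "trig_poly f ==> trig_poly (%th. f th * (c * mode k th))"
proof (induction rule: trig_poly.induct)
 case (trig_mode d j)
 have "(%th. d * mode j th * (c * mode k th)) = (%th. (d * c) * mode (j + k) th)"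
  by (auto simp: mode_add[symmetric])
 then show ?case using trig_poly.trig_mode by simp
next
 case (trig_add f g)
 then show ?case by (auto simp: distrib_right intro: trig_poly.trig_add)
qed

lemma trig_poly_mult: "trig_poly g ==> trig_poly f ==> trig_poly (%th. f th * g th)"
proof (induction rule: trig_poly.induct)
 case (trig_mode d j)
 then show ?case by (intro trig_poly_mult_mode)
next
 case (trig_add g h)
 then show ?case by (auto simp: distrib_left intro: trig_poly.trig_add)
qed

lemma trig_poly_const: "trig_poly (%_. c)"
 using trig_mode[of c 0] by simp

lemma trig_poly_cis_real_polynomial:
 assumes "real_polynomial_function r"
 shows "trig_poly (%th. of_real (r (cis th)))"
 using assms
proof (induction rule: real_polynomial_function.induct)
 case (linear f)
 interpret f: bounded_linear f by fact
 have "complex_of_real (f (cis th)) = (of_real ((f 1)/2) * mode 1 th + of_real ((f 1)/2) * mode (-1) th)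
     + ((-\<i> * of_real ((f \<i>)/2)) * mode 1 th + (\<i> * of_real ((f \<i>)/2)) * mode (-1) th)" for th
 proof -
  have m: "mode 1 th = cis th" "mode (-1) th = cis (-th)"
   by (auto simp: mode_def cis_conv_exp)
  have "cis th = cos th *\<^sub>R 1 + sin th *\<^sub>R \<i>" by (simp add: complex_eq_iff)
  then have "f (cis th) = cos th * f 1 + sin th * f \<i>"
   by (simp only: f.add f.scaleR) simp
  then show ?thesis unfolding m by (simp add: complex_eq_iff)
 qed
 then show ?case by (simp only:) (intro trig_add trig_mode)
next
 case (const c)
 then show ?case by (rule trig_poly_const)
next
 case (add f g)
 then show ?case by (auto intro: trig_add)
next
 case (mult f g)
 then show ?case by (auto intro: trig_poly_mult)
qed

text \<open>Identifying the circle with a subset of \<open>complex\<close>, the Weierstrass theorem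
 provides polynomials in cosine and sine.\<close>

lemma trig_poly_approx:
 fixes h :: "real => complex"
 assumes cont: "continuous_on UNIV h" and per: "!!th. h (th + 2 * pi) = h th" and e: "e > 0"
 obtains p where "trig_poly p" "!!th. th \<in> {0..2*pi} ==> norm (h th - p th) < e"
proof -
 define q where "q u = h (2 * pi * u)" for u
 have q: "path q"
  unfolding path_def q_def by (intro continuous_on_compose2[OF cont] continuous_intros) auto
 have "homotopic_loops UNIV q q"
  using q per[of 0] by (simp add: homotopic_loops_refl pathstart_def pathfinish_def q_def)
 then have "continuous_on (sphere 0 1) (q \<circ> (%z. Arg2pi z / (2 * pi)))"
  using homotopic_with_imp_continuous[OF homotopic_loops_imp_homotopic_circlemaps] by blast
 then have hc: "continuous_on (sphere 0 1) (%z. h (Arg2pi z))"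
  by (simp add: q_def o_def)
 obtain g where g: "polynomial_function g" "!!z. z \<in> sphere 0 1 ==> norm (h (Arg2pi z) - g z) < e"
  using Stone_Weierstrass_polynomial_function[OF compact_sphere hc e] by auto
 have h: "h (Arg2pi (cis th)) = h th" if "th \<in> {0..2*pi}" for th
 proof (cases "th = 2 * pi")
  case True
  have "Arg2pi 1 = 0" by (rule Arg2pi_unique[of 1]) auto
  then show ?thesis using True per[of 0] by simp
 next
  case False
  then have "Arg2pi (cis th) = th"
   using that Arg2pi_unique[of 1 th "cis th"] by (auto simp: cis_conv_exp mult.commute)
  then show ?thesis by simp
 qed
 have "real_polynomial_function (Re \<circ> g)" "real_polynomial_function (Im \<circ> g)"
  using g(1) bounded_linear_Re bounded_linear_Im unfolding polynomial_function_def by blast+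
 then have "trig_poly (%th. of_real ((Re \<circ> g) (cis th)) + \<i> * of_real ((Im \<circ> g) (cis th)))"
  by (intro trig_add trig_poly_mult trig_poly_const trig_poly_cis_real_polynomial)
 moreover have "of_real ((Re \<circ> g) z) + \<i> * of_real ((Im \<circ> g) z) = g z" for z
  by (simp add: complex_eq_iff)
 ultimately have "trig_poly (%th. g (cis th))" by simp
 moreover have "norm (h th - g (cis th)) < e" if "th \<in> {0..2*pi}" for th
  using g(2)[of "cis th"] h[OF that] by simp
 ultimately show ?thesis using that by blast
qed

lemma trig_poly_continuous: "trig_poly p ==> continuous_on UNIV p"
 by (induction rule: trig_poly.induct) (auto intro!: continuous_intros)

text \<open>A continuous function all of whose Fourier coefficients vanish is orthogonal to every
 trigonometric polynomial; approximating its own conjugate by such polynomials shows that it is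
 orthogonal to itself.\<close>

lemma fourier_uniqueness:
 fixes g :: "real => complex"
 assumes cont: "continuous_on UNIV g" and per: "!!th. g (th + 2 * pi) = g th"
  and zero: "!!k. cfour g k = 0"
 shows "g th = 0"
proof -
 have orth: "integral {0..2*pi} (%th. g th * p th) = 0" if "trig_poly p" for p
  using that
 proof (induction rule: trig_poly.induct)
  case (trig_mode c k)
  have "integral {0..2*pi} (%th. g th * mode k th) = 0"
   using zero[of "- k"] by (simp add: cfour_def)
  then have "integral {0..2*pi} (%th. c * (g th * mode k th)) = 0"
   by (subst integral_mult_right) simp
  then show ?case by (simp add: mult_ac)
 next
  case (trig_add f h)
  have "(%th. g th * f th) integrable_on {0..2*pi}" "(%th. g th * h th) integrable_on {0..2*pi}"
   using trig_add trig_poly_continuous cont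
   by (auto intro!: integrable_continuous_real continuous_intros intro: continuous_on_subset)
  then show ?case using trig_add by (simp add: distrib_left integral_add)
 qed
 have "bounded (g ` {0..2*pi})"
  by (intro compact_imp_bounded compact_continuous_image continuous_on_subset[OF cont]) auto
 then obtain C where "\<forall>x\<in>g ` {0..2*pi}. norm x \<le> C"
  unfolding bounded_iff by blast
 then have C: "norm (g th) \<le> C" if "th \<in> {0..2*pi}" for th
  using that by blast
 then have C0: "C \<ge> 0" using order_trans[OF norm_ge_zero C[of 0]] by simp
 let ?I = "integral {0..2*pi} (%th. g th * cnj (g th))"
 have intg: "(%th. g th * cnj (g th)) integrable_on {0..2*pi}"
  by (intro integrable_continuous_real continuous_intros continuous_on_subset[OF cont]) auto
 have cc: "continuous_on UNIV (%th. cnj (g th))"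
  by (intro continuous_intros cont)
 have small: "norm ?I \<le> C * e * (2 * pi)" if e: "e > 0" for e
 proof -
  obtain p where p: "trig_poly p" "!!th. th \<in> {0..2*pi} ==> norm (cnj (g th) - p th) < e"
   using trig_poly_approx[OF cc _ e] per by metis
  have ip: "(%th. g th * p th) integrable_on {0..2*pi}"
   by (intro integrable_continuous_real continuous_intros continuous_on_subset[OF cont]
     continuous_on_subset[OF trig_poly_continuous[OF p(1)]]) auto
  have "?I = integral {0..2*pi} (%th. g th * (cnj (g th) - p th))"
   using orth[OF p(1)] integral_diff[OF intg ip] by (simp add: right_diff_distrib)
  also have "norm \<dots> \<le> (C * e) * (2 * pi - 0)"
  proof (rule integral_bound)
   show "continuous_on {0..2*pi} (%th. g th * (cnj (g th) - p th))"
    by (intro continuous_intros continuous_on_subset[OF cont]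
      continuous_on_subset[OF trig_poly_continuous[OF p(1)]]) auto
   show "norm (g th * (cnj (g th) - p th)) \<le> C * e" if "th \<in> {0..2*pi}" for th
    unfolding norm_mult using C[OF that] p(2)[OF that] C0 by (intro mult_mono) auto
  qed simp
  finally show ?thesis by simp
 qed
 have "norm ?I \<le> e" if "e > 0" for e
 proof -
  have pos: "(C + 1) * (2 * pi) > 0" using C0 by simp
  have "norm ?I \<le> C * (e / ((C + 1) * (2 * pi))) * (2 * pi)"
   using that pos by (intro small) simp
  also have "\<dots> = (C / (C + 1)) * e"
  proof -
   have "C * (e / (a * b)) * b = (C / a) * e" if "a \<noteq> 0" "b \<noteq> 0" for a b :: real
    using that by (simp add: field_simps)
   then show ?thesis using C0 by simp
  qed
  also have "\<dots> \<le> 1 * e" using C0 that by (intro mult_right_mono) auto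
  finally show ?thesis by simp
 qed
 then have I0: "?I = 0"
  using field_le_epsilon[of "norm ?I" 0] by simp
 have "((%th. g th * cnj (g th)) has_integral 0) {0..2*pi}"
  using integrable_integral[OF intg] I0 by simp
 then have "((%th. Re (g th * cnj (g th))) has_integral Re 0) {0..2*pi}"
  by (rule has_integral_Re)
 then have hi: "((%th. (norm (g th))\<^sup>2) has_integral 0) (cbox 0 (2*pi))"
  by (simp add: complex_mult_cnj cmod_power2)
 have z: "g th = 0" if "th \<in> {0..2*pi}" for th
 proof -
  have "continuous_on (cbox 0 (2*pi)) (%th. (norm (g th))\<^sup>2)"
   by (intro continuous_intros continuous_on_subset[OF cont]) auto
  then have "(norm (g th))\<^sup>2 = 0"
   by (rule has_integral_0_cbox_imp_0[where f = "%th. (norm (g th))\<^sup>2", OF _ _ hi])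
     (use that pi_gt_zero in \<open>simp_all add: not_le del: pi_gt_zero\<close>)
  then show ?thesis by simp
 qed
 obtain m where m: "0 \<le> th + of_int m * (2 * pi)" "th + of_int m * (2 * pi) \<le> 2 * pi" using reduce_period .
 have "g (th + of_int m * (2 * pi)) = g th"
  using periodic_int_multiple[of UNIV g "2 * pi" th m] per by simp
 then show ?thesis using z m by simp
qed

text \<open>The uniform limit of the partial sums is continuous and has the coefficients of the
 given function, so the two agree by uniqueness.\<close>

lemma fourier_inversion:
 fixes g :: "real => complex"
 assumes cont: "continuous_on UNIV g" and per: "!!th. g (th + 2 * pi) = g th"
  and sum: "(%k. norm (cfour g k)) summable_on UNIV"
 shows "((%k. cfour g k * mode k th) has_sum g th) UNIV"
proof -
 define S where "S th = (\<Sum>\<^sub>\<infinity>k. cfour g k * mode k th)" for th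
 have ul: "uniform_limit UNIV (%X th. \<Sum>k\<in>X. cfour g k * mode k th) S (finite_subsets_at_top UNIV)"
  unfolding S_def using sum by (intro Weierstrass_m_test_general) (auto simp: norm_mult)
 have contS: "continuous_on UNIV S"
  by (rule uniform_limit_theorem[OF _ ul]) (auto intro!: always_eventually continuous_intros)
 have summ: "(%k. cfour g k * mode k th) summable_on UNIV" for th
  by (rule abs_summable_summable) (use sum in \<open>simp add: norm_mult\<close>)
 have coefS: "cfour S j = cfour g j" for j
 proof -
  have lim: "((%X. cfour (%th. \<Sum>k\<in>X. cfour g k * mode k th) j) \<longlongrightarrow> cfour S j) (finite_subsets_at_top UNIV)"
   unfolding tendsto_iff
  proof (intro allI impI)
   fix e :: real assume e: "e > 0"
   have "\<forall>\<^sub>F X in finite_subsets_at_top UNIV. \<forall>th\<in>UNIV. dist (\<Sum>k\<in>X. cfour g k * mode k th) (S th) < e / 2"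
    using uniform_limitD[OF ul, of "e / 2"] e by simp
   then show "\<forall>\<^sub>F X in finite_subsets_at_top UNIV. dist (cfour (%th. \<Sum>k\<in>X. cfour g k * mode k th) j) (cfour S j) < e"
   proof eventually_elim
    case (elim X)
    have c: "continuous_on UNIV (%th. \<Sum>k\<in>X. cfour g k * mode k th)"
     by (intro continuous_intros)
    have "norm (cfour (%th. (\<Sum>k\<in>X. cfour g k * mode k th) - S th) j) \<le> e / 2"
     using elim by (intro norm_cfour_le continuous_on_diff c contS) (auto simp: dist_norm less_imp_le)
    then show ?case using e by (simp add: cfour_diff c contS dist_norm)
   qed
  qed
  have val: "cfour (%th. \<Sum>k\<in>X. cfour g k * mode k th) j = (if j \<in> X then cfour g j else 0)" if "finite X" for X
   using that
  proof (induction X rule: finite_induct)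
   case empty
   then show ?case using cfour_const[of 0 j] by simp
  next
   case (insert i X)
   have c: "continuous_on UNIV (%th. \<Sum>k\<in>X. cfour g k * mode k th)"
    by (intro continuous_intros)
   have "cfour (%th. \<Sum>k\<in>insert i X. cfour g k * mode k th) j
     = cfour (%th. cfour g i * mode i th + (\<Sum>k\<in>X. cfour g k * mode k th)) j"
    using insert by simp
   also have "\<dots> = cfour g i * cfour (mode i) j + (if j \<in> X then cfour g j else 0)"
    by (subst cfour_add) (auto intro!: continuous_intros simp: cfour_cmult insert)
   finally show ?case using insert by (auto simp: cfour_mode)
  qed
  have "\<forall>\<^sub>F X in finite_subsets_at_top UNIV. cfour (%th. \<Sum>k\<in>X. cfour g k * mode k th) j = cfour g j"
   unfolding eventually_finite_subsets_at_top by (intro exI[of _ "{j}"]) (auto simp: val)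
  then have "((%X. cfour (%th. \<Sum>k\<in>X. cfour g k * mode k th) j) \<longlongrightarrow> cfour g j) (finite_subsets_at_top UNIV)"
   by (rule tendsto_eventually)
  then show ?thesis using tendsto_unique[OF _ lim] by simp
 qed
 have "g th - S th = 0"
 proof (rule fourier_uniqueness[of "%th. g th - S th"])
  show "continuous_on UNIV (%th. g th - S th)" by (intro continuous_on_diff cont contS)
  show "g (th + 2 * pi) - S (th + 2 * pi) = g th - S th" for th
   by (simp add: S_def per)
  show "cfour (%th. g th - S th) k = 0" for k
   by (simp add: cfour_diff cont contS coefS)
 qed
 then show ?thesis using has_sum_infsum[OF summ, of th] by (simp add: S_def)
qed

lemma summable_inverse_square_int: "(%k::int. 1 / (1 + \<bar>real_of_int k\<bar>)\<^sup>2) summable_on UNIV"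
proof -
 have "summable (%n. 1 / (real (Suc n))\<^sup>2)"
  using inverse_power_summable[of 2, where ?'a = real] summable_Suc_iff[of "%n. inverse ((real n)\<^sup>2)"]
  by (simp add: field_simps)
 then have nat1: "(%n. 1 / (real (Suc n))\<^sup>2) summable_on UNIV"
  by (intro norm_summable_imp_summable_on) simp
 have "summable (%n. 1 / (real (Suc (Suc n)))\<^sup>2)"
  using \<open>summable (%n. 1 / (real (Suc n))\<^sup>2)\<close> summable_Suc_iff[of "%n. 1 / (real (Suc n))\<^sup>2"] by simp
 then have nat2: "(%n. 1 / (real (Suc (Suc n)))\<^sup>2) summable_on UNIV"
  by (intro norm_summable_imp_summable_on) simp
 have U: "UNIV = range int \<union> range (%n. - int (Suc n))"
 proof (intro equalityI subsetI)
  fix k :: int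
  show "k \<in> range int \<union> range (%n. - int (Suc n))"
   by (cases k) auto
 qed auto
 have "(%k::int. 1 / (1 + \<bar>real_of_int k\<bar>)\<^sup>2) summable_on range int"
 proof (subst summable_on_reindex)
  show "inj_on int UNIV" by (simp add: inj_on_def)
  have "(%k::int. 1 / (1 + \<bar>real_of_int k\<bar>)\<^sup>2) \<circ> int = (%n. 1 / (real (Suc n))\<^sup>2)"
   by (simp add: fun_eq_iff)
  then show "(%k::int. 1 / (1 + \<bar>real_of_int k\<bar>)\<^sup>2) \<circ> int summable_on UNIV"
   using nat1 by metis
 qed
 moreover have "(%k::int. 1 / (1 + \<bar>real_of_int k\<bar>)\<^sup>2) summable_on range (%n. - int (Suc n))"
 proof (subst summable_on_reindex)
  show "inj_on (%n. - int (Suc n)) UNIV" by (simp add: inj_on_def)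
  have "(%k::int. 1 / (1 + \<bar>real_of_int k\<bar>)\<^sup>2) \<circ> (%n. - int (Suc n)) = (%n. 1 / (real (Suc (Suc n)))\<^sup>2)"
   by (simp add: fun_eq_iff)
  then show "(%k::int. 1 / (1 + \<bar>real_of_int k\<bar>)\<^sup>2) \<circ> (%n. - int (Suc n)) summable_on UNIV"
   using nat2 by metis
 qed
 ultimately show ?thesis
  unfolding U by (intro summable_on_Un_disjoint) auto
qed

section \<open>Fourier coefficients in the fast variable\<close>

definition e_Y :: pt6 where "e_Y = (0,0,0,0,1,0)"
definition e_theta :: pt6 where "e_theta = (0,0,0,0,0,1)"

definition theta_of :: "pt6 => real" where
 "theta_of = (%(t,y1,y2,y3,Y,th). th)"

definition at_theta :: "real => pt6 => pt6" where
 "at_theta r = (%(t,y1,y2,y3,Y,th). (t,y1,y2,y3,Y,r))"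

definition coef :: "(pt6 => complex) => int => pt6 => complex" where
 "coef f k x = cfour (%r. f (at_theta r x)) k"

definition modulate :: "(int => pt6 => complex) => int => pt6 => complex" where
 "modulate \<phi> k x = \<phi> k x * mode k (theta_of x)"

lemma at_theta_dom6 [simp]: "at_theta r x \<in> dom6 T s \<longleftrightarrow> x \<in> dom6 T s"
 by (cases x) (auto simp: at_theta_def dom6_def)

lemma at_theta_at_theta [simp]: "at_theta r (at_theta r' x) = at_theta r x"
 by (cases x) (auto simp: at_theta_def)

lemma at_theta_theta_of [simp]: "at_theta (theta_of x) x = x"
 by (cases x) (auto simp: at_theta_def theta_of_def)

lemma theta_of_at_theta [simp]: "theta_of (at_theta r x) = r"
 by (cases x) (auto simp: at_theta_def theta_of_def)

lemma at_theta_line: "at_theta r x = at_theta 0 x + r *\<^sub>R e_theta"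
 by (cases x) (auto simp: at_theta_def e_theta_def)

lemma at_theta_add_e_theta [simp]: "at_theta r (x + h *\<^sub>R e_theta) = at_theta r x"
 by (cases x) (auto simp: at_theta_def e_theta_def)

lemma at_theta_add_Basis:
 "b \<in> Basis ==> b \<noteq> e_theta ==> at_theta r (x + h *\<^sub>R b) = at_theta r x + h *\<^sub>R b"
 by (cases x) (auto simp: at_theta_def Basis_pt6 e_theta_def)

lemma theta_of_add_Basis:
 "b \<in> Basis ==> theta_of (x + h *\<^sub>R b) = theta_of x + (if b = e_theta then h else 0)"
 by (cases x) (auto simp: theta_of_def Basis_pt6 e_theta_def)

lemma decay_at_theta [simp]: "decay s \<delta> (at_theta r x) = decay s \<delta> x"
 by (cases x) (auto simp: at_theta_def decay_def)

lemma Basis_e [simp]: "e_Y \<in> Basis" "e_theta \<in> Basis"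
 by (auto simp: Basis_pt6 e_Y_def e_theta_def)

lemma coef_at_theta [simp]: "coef f k (at_theta r x) = coef f k x"
 by (simp add: coef_def)

lemma slice_has_vector_derivative:
 assumes "partial6 T s e_theta f f'" "x \<in> dom6 T s"
 shows "((%r. f (at_theta r x)) has_vector_derivative f' (at_theta r x)) (at r)"
proof -
 have "{k. at_theta 0 x + k *\<^sub>R e_theta \<in> dom6 T s} = UNIV"
  using assms(2) by (auto simp flip: at_theta_line)
 then show ?thesis
  using has_partial_line[OF assms(1), of "at_theta 0 x" r] assms(2) by (simp flip: at_theta_line)
qed

context
 fixes T :: real and s :: side and \<delta> :: real
 assumes T: "T > 0" and \<delta>: "\<delta> \<ge> 0"
begin

lemmas box6 = coord_box_dom6[OF T, of s]
lemmas weight6 = weight_decay[OF \<delta>, of T s]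

lemma slice_continuous:
 assumes "smooth6 T s \<delta> f" "x \<in> dom6 T s"
 shows "continuous_on UNIV (%r. f (at_theta r x))"
proof -
 have "continuous_on UNIV (%r. at_theta 0 x + r *\<^sub>R e_theta)"
  by (intro continuous_intros)
 then have "continuous_on UNIV (%r. at_theta r x)"
  by (simp flip: at_theta_line)
 then show ?thesis
  using assms(2) by (intro continuous_on_compose2[OF smooth_family_continuous[OF assms(1) weight6 box6]]) auto
qed

lemma slice_periodic:
 assumes "smooth6 T s \<delta> f" "x \<in> dom6 T s"
 shows "f (at_theta (r + 2 * pi) x) = f (at_theta r x)"
proof -
 have "at_theta (r + 2 * pi) x = at_theta r x + (0,0,0,0,0,2*pi)"
  by (cases x) (auto simp: at_theta_def)
 then show ?thesis
  using smooth_family_periodic[OF assms(1), of "(0,0,0,0,0,2*pi)" "at_theta r x"] assms(2)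
  by (simp add: per6_def)
qed

lemma coef_e_theta: "partial6 T s e_theta (coef f k) (%_. 0)"
 unfolding has_partial_def by (auto simp: coef_def intro!: derivative_eq_intros)

lemma has_partial_coef:
 assumes f: "smooth6 T s \<delta> f" and f': "smooth6 T s \<delta> f'"
  and der: "partial6 T s b f f'" and b: "b \<in> Basis" "b \<noteq> e_theta"
 shows "partial6 T s b (coef f k) (coef f' k)"
proof -
 define \<psi> where "\<psi> g r x = indicat_real {0..2*pi} r *\<^sub>R (of_real (1 / (2 * pi)) * (g (at_theta r x) * mode (- k) r))"
  for g :: "pt6 => complex" and r x
 have int: "integrable lborel (%r. \<psi> g r x)" and eq: "coef g k x = (LINT r|lborel. \<psi> g r x)"
  if g: "smooth6 T s \<delta> g" and x: "x \<in> dom6 T s" for g x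
 proof -
  have c: "continuous_on {0..2*pi} (%r. of_real (1 / (2 * pi)) * (g (at_theta r x) * mode (- k) r))"
   by (intro continuous_intros continuous_on_subset[OF slice_continuous[OF g x]]) auto
  then have si: "set_integrable lborel {0..2*pi} (%r. of_real (1 / (2 * pi)) * (g (at_theta r x) * mode (- k) r))"
   unfolding set_integrable_def by (intro borel_integrable_compact) auto
  then show "integrable lborel (%r. \<psi> g r x)"
   by (simp only: \<psi>_def set_integrable_def)
  have "coef g k x = integral {0..2*pi} (%r. of_real (1 / (2 * pi)) * (g (at_theta r x) * mode (- k) r))"
   by (simp only: coef_def cfour_def integral_mult_right)
  then show "coef g k x = (LINT r|lborel. \<psi> g r x)"
   using set_borel_integral_eq_integral(2)[OF si] by (simp only: \<psi>_def set_lebesgue_integral_def)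
 qed
 obtain C where C: "C \<ge> 0" "!!x. x \<in> dom6 T s ==> norm (f' x) \<le> C"
  using smooth_family_bound1[OF f' weight6] by metis
 have "partial6 T s b (%x. LINT r|lborel. \<psi> f r x) (%x. LINT r|lborel. \<psi> f' r x)"
 proof (rule has_partial_integral[OF box6])
  fix r
  have "partial6 T s b (%x. f (at_theta r x)) (%x. 1 *\<^sub>R f' (at_theta r x))"
   by (rule has_partial_compose[OF der]) (auto simp: at_theta_add_Basis b)
  then have "partial6 T s b (%x. c * f (at_theta r x)) (%x. c * f' (at_theta r x))" for c
   using has_partial_linear[OF bounded_linear_mult_right] by (simp only: scaleR_one)
  moreover have "\<psi> g r = (%x. (of_real (indicat_real {0..2*pi} r) * of_real (1 / (2 * pi)) * mode (- k) r) * g (at_theta r x))" for g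
   by (simp add: \<psi>_def fun_eq_iff scaleR_conv_of_real mult_ac)
  ultimately show "partial6 T s b (\<psi> f r) (\<psi> f' r)"
   by (simp only:)
 next
  show "integrable lborel (%r. \<psi> f r x)" if "x \<in> dom6 T s" for x
   using int[OF f that] .
  show "(%r. \<psi> f' r x) \<in> borel_measurable lborel" if "x \<in> dom6 T s" for x
   using int[OF f' that] by (rule borel_measurable_integrable)
  show "norm (\<psi> f' r x) \<le> indicat_real {0..2*pi} r * C" if "x \<in> dom6 T s" for r x
  proof -
   have "norm (of_real (1 / (2 * pi)) * (f' (at_theta r x) * mode (- k) r)) = norm (f' (at_theta r x)) / (2 * pi)"
    by (simp add: norm_mult norm_divide)
   also have "\<dots> \<le> norm (f' (at_theta r x)) / 1"
    using pi_gt3 by (intro divide_left_mono) auto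
   also have "\<dots> \<le> C" using C(2)[of "at_theta r x"] that by simp
   finally show ?thesis by (auto simp: \<psi>_def indicator_def)
  qed
  show "integrable lborel (%r. indicat_real {0..2*pi} r * C)"
   by (intro integrable_mult_left integrable_real_indicator) (auto simp: emeasure_lborel_Icc_eq)
 qed
 then show ?thesis
  by (rule has_partial_cong) (use eq f f' in auto)
qed

lemma coef_theta:
 assumes f: "smooth6 T s \<delta> f" "smooth6 T s \<delta> f'" "partial6 T s e_theta f f'" "x \<in> dom6 T s"
 shows "coef f' k x = \<i> * of_int k * coef f k x"
 unfolding coef_def
 by (rule cfour_deriv) (auto intro: slice_has_vector_derivative[OF f(3,4)] slice_periodic[OF f(1,4)] slice_continuous[OF f(2,4)])

lemma coef_bound:
 assumes "smooth6 T s \<delta> f"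
 shows "\<exists>C\<ge>0. \<forall>k. \<forall>x\<in>dom6 T s. (1 + freq k) ^ n * norm (coef f k x) \<le> C * decay s \<delta> x"
 using assms
proof (induction n arbitrary: f)
 case 0
 obtain C where C: "C \<ge> 0" "!!x. x \<in> dom6 T s ==> norm (f x) \<le> C * decay s \<delta> x"
  using smooth_family_bound0[OF 0 weight6] by metis
 have "norm (coef f k x) \<le> C * decay s \<delta> x" if "x \<in> dom6 T s" for k x
  unfolding coef_def using C(2)[of "at_theta _ x"] that
  by (intro norm_cfour_le slice_continuous[OF 0 that]) auto
 then show ?case using C(1) by auto
next
 case (Suc n)
 obtain f' where f': "smooth6 T s \<delta> f'" "partial6 T s e_theta f f'"
  using smooth_fun_deriv[OF Suc.prems] Basis_e(2) by metis
 obtain C where C: "C \<ge> 0" "!!k x. x \<in> dom6 T s ==> (1 + freq k) ^ n * norm (coef f k x) \<le> C * decay s \<delta> x"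
  using Suc.IH[OF Suc.prems] by auto
 obtain C' where C': "C' \<ge> 0" "!!k x. x \<in> dom6 T s ==> (1 + freq k) ^ n * norm (coef f' k x) \<le> C' * decay s \<delta> x"
  using Suc.IH[OF f'(1)] by auto
 have "(1 + freq k) ^ Suc n * norm (coef f k x) \<le> (C + C') * decay s \<delta> x" if x: "x \<in> dom6 T s" for k x
 proof -
  have e: "norm (coef f' k x) = freq k * norm (coef f k x)"
   using coef_theta[OF Suc.prems f' x, of k] by (simp add: norm_mult)
  have "(1 + freq k) ^ Suc n * norm (coef f k x)
    = (1 + freq k) ^ n * norm (coef f k x) + (1 + freq k) ^ n * norm (coef f' k x)"
   unfolding e by (simp add: algebra_simps)
  then show ?thesis
   unfolding distrib_right using C(2)[OF x, of k] C'(2)[OF x, of k] by linarith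
 qed
 then show ?case using C(1) C'(1) by (intro exI[of _ "C + C'"]) auto
qed

lemma coef_shift:
 assumes f: "smooth6 T s \<delta> f" and p: "p \<in> per6" and x: "x \<in> dom6 T s"
 shows "coef f k (x + p) = coef f k x"
proof (cases "p = (0,0,0,0,0,2*pi)")
 case True
 then have "at_theta r (x + p) = at_theta r x" for r
  by (cases x) (auto simp: at_theta_def)
 then show ?thesis by (simp add: coef_def)
next
 case False
 then have "at_theta r (x + p) = at_theta r x + p" for r
  using p by (cases x) (auto simp: at_theta_def per6_def)
 then show ?thesis
  using smooth_family_periodic[OF f p] x by (simp add: coef_def)
qed

lemma rapid_coef:
 assumes "smooth6 T s \<delta> f"
 shows "rapid T s \<delta> (coef f)"
proof (rule smooth_family_closed[where Q = "%\<psi>. \<exists>f. smooth6 T s \<delta> f \<and> \<psi> = coef f"])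
 show "\<exists>g. smooth6 T s \<delta> g \<and> coef f = coef g" using assms by blast
next
 fix \<psi> and n :: nat assume "\<exists>f. smooth6 T s \<delta> f \<and> \<psi> = coef f"
 then show "\<exists>C. \<forall>i. \<forall>x\<in>dom6 T s. (1 + freq i) ^ n * norm (\<psi> i x) \<le> C * decay s \<delta> x"
  using coef_bound by blast
next
 fix \<psi> p i x assume "\<exists>f. smooth6 T s \<delta> f \<and> \<psi> = coef f" "p \<in> per6" "x \<in> dom6 T s"
 then show "\<psi> i (x + p) = \<psi> i x" using coef_shift by blast
next
 fix \<psi> and b :: pt6 assume "\<exists>f. smooth6 T s \<delta> f \<and> \<psi> = coef f" and b: "b \<in> Basis"
 then obtain f where f: "smooth6 T s \<delta> f" "\<psi> = coef f" by blast
 obtain f' where f': "smooth6 T s \<delta> f'" "partial6 T s b f f'"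
  using smooth_fun_deriv[OF f(1) b] by metis
 show "\<exists>\<psi>'. (\<exists>f. smooth6 T s \<delta> f \<and> \<psi>' = coef f) \<and> (\<forall>i. partial6 T s b (\<psi> i) (\<psi>' i))"
 proof (cases "b = e_theta")
  case True
  have "smooth6 T s \<delta> (%x. 0 * f x)"
   using smooth_fun_linear[OF bounded_linear_mult_right f(1) weight6] .
  moreover have "coef (%x. 0 * f x) = (%k x. 0)"
   by (simp add: coef_def fun_eq_iff cfour_const)
  moreover have "partial6 T s b (\<psi> i) (%x. 0)" for i
   unfolding f(2) True by (rule coef_e_theta)
  ultimately show ?thesis
   by (intro exI[of _ "coef (%x. 0 * f x)"] conjI exI[of _ "%x. 0 * f x"]) simp_all
 next
  case False
  then show ?thesis using has_partial_coef[OF f(1) f' b] f'(1) unfolding f(2) by blast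
 qed
qed

lemma rapid_multiplier:
 fixes \<phi> :: "int => pt6 => complex"
 assumes "rapid T s \<delta> \<phi>" "!!k. norm (a k) \<le> A * (1 + freq k) ^ N" "0 \<le> A"
 shows "rapid T s \<delta> (%k x. a k * \<phi> k x)"
 by (rule smooth_family_linear[OF assms(1) weight6, where j = "%k. k" and A = A and N = N])
   (use assms(2,3) in \<open>auto simp: norm_mult intro!: bounded_linear_mult_right mult_right_mono\<close>)

lemma has_partial_modulate:
 assumes "partial6 T s b (\<phi> k) (\<phi>' k)" "b \<in> Basis"
 shows "partial6 T s b (modulate \<phi> k)
   (modulate (%k x. \<phi>' k x + (if b = e_theta then \<i> * of_int k else 0) * \<phi> k x) k)"
proof -
 have m: "partial6 T s b (%x. mode k (theta_of x))
   (%x. (if b = e_theta then \<i> * of_int k else 0) * mode k (theta_of x))"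
  unfolding has_partial_def
 proof
  fix x assume "x \<in> dom6 T s"
  show "((%h. mode k (theta_of (x + h *\<^sub>R b))) has_vector_derivative
    (if b = e_theta then \<i> * of_int k else 0) * mode k (theta_of x)) (at 0 within {h. x + h *\<^sub>R b \<in> dom6 T s})"
  proof (cases "b = e_theta")
   case True
   have "((%h. theta_of x + h) has_vector_derivative 1) (at 0 within {h. x + h *\<^sub>R b \<in> dom6 T s})"
    by (auto intro!: derivative_eq_intros)
   from vector_diff_chain_within[OF this mode_has_vector_derivative]
   show ?thesis using True by (simp add: o_def theta_of_add_Basis assms(2))
  next
   case False
   then show ?thesis by (simp add: theta_of_add_Basis assms(2))
  qed
 qed
 show ?thesis
  using has_partial_mult[OF assms(1) m] unfolding modulate_def
  by (simp add: algebra_simps)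
qed

lemma rapid_modulate:
 assumes "rapid T s \<delta> \<phi>"
 shows "rapid T s \<delta> (modulate \<phi>)"
proof (rule smooth_family_closed[where Q = "%\<psi>. \<exists>\<phi>. rapid T s \<delta> \<phi> \<and> \<psi> = modulate \<phi>"])
 show "\<exists>g. rapid T s \<delta> g \<and> modulate \<phi> = modulate g" using assms by blast
next
 fix \<psi> and n :: nat assume "\<exists>\<phi>. rapid T s \<delta> \<phi> \<and> \<psi> = modulate \<phi>"
 then obtain \<phi> where p: "rapid T s \<delta> \<phi>" "\<psi> = modulate \<phi>" by blast
 obtain C where "!!i x. x \<in> dom6 T s ==> (1 + freq i) ^ n * norm (\<phi> i x) \<le> C * decay s \<delta> x"
  using smooth_family_bound[OF p(1) weight6] by metis
 then show "\<exists>C. \<forall>i. \<forall>x\<in>dom6 T s. (1 + freq i) ^ n * norm (\<psi> i x) \<le> C * decay s \<delta> x"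
  unfolding p(2) modulate_def norm_mult norm_mode mult_1_right by blast
next
 fix \<psi> p i x assume "\<exists>\<phi>. rapid T s \<delta> \<phi> \<and> \<psi> = modulate \<phi>" and px: "p \<in> per6" "x \<in> dom6 T s"
 then obtain \<phi> where p: "rapid T s \<delta> \<phi>" "\<psi> = modulate \<phi>" by blast
 have "mode i (theta_of (x + p)) = mode i (theta_of x)"
  using px(1) by (cases x) (auto simp: theta_of_def per6_def)
 then show "\<psi> i (x + p) = \<psi> i x"
  unfolding p(2) modulate_def using smooth_family_periodic[OF p(1) px] by simp
next
 fix \<psi> and b :: pt6 assume "\<exists>\<phi>. rapid T s \<delta> \<phi> \<and> \<psi> = modulate \<phi>" and b: "b \<in> Basis"
 then obtain \<phi> where p: "rapid T s \<delta> \<phi>" "\<psi> = modulate \<phi>" by blast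
 obtain \<phi>' where d: "rapid T s \<delta> \<phi>'" "!!i. partial6 T s b (\<phi> i) (\<phi>' i)"
  using smooth_family_deriv[OF p(1) b] by metis
 have "rapid T s \<delta> (%k x. \<phi>' k x + (if b = e_theta then \<i> * of_int k else 0) * \<phi> k x)"
  by (intro smooth_family_add[OF d(1) rapid_multiplier[OF p(1), of _ 1 1] weight6]) (auto simp: norm_mult)
 then show "\<exists>\<psi>'. (\<exists>\<phi>. rapid T s \<delta> \<phi> \<and> \<psi>' = modulate \<phi>) \<and> (\<forall>i. partial6 T s b (\<psi> i) (\<psi>' i))"
  unfolding p(2) using has_partial_modulate[where \<phi> = \<phi> and \<phi>' = \<phi>', OF d(2) b] by blast
qed

lemma rapid_abs_summable:
 assumes "rapid T s \<delta> (\<phi> :: int => pt6 => complex)"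
 obtains C where "C \<ge> 0" "!!k x. x \<in> dom6 T s ==> norm (\<phi> k x) \<le> C * decay s \<delta> x * (1 / (1 + freq k)\<^sup>2)"
  "!!x. x \<in> dom6 T s ==> (%k. norm (\<phi> k x)) summable_on UNIV"
  "!!x. x \<in> dom6 T s ==> (%k. \<phi> k x) summable_on UNIV"
proof -
 obtain C where C: "C \<ge> 0" "!!k x. x \<in> dom6 T s ==> (1 + freq k)\<^sup>2 * norm (\<phi> k x) \<le> C * decay s \<delta> x"
  using smooth_family_bound[OF assms weight6] by metis
 have 1: "norm (\<phi> k x) \<le> C * decay s \<delta> x * (1 / (1 + freq k)\<^sup>2)" if "x \<in> dom6 T s" for k x
  using C(2)[OF that, of k] by (simp add: field_simps)
 have 2: "(%k. norm (\<phi> k x)) summable_on UNIV" if "x \<in> dom6 T s" for x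
  by (rule Infinite_Sum.abs_summable_on_comparison_test'[OF _ 1[OF that]])
    (intro summable_on_cmult_right summable_inverse_square_int)
 show ?thesis
  by (rule that[OF C(1) 1 2 abs_summable_summable[OF 2]])
qed

lemma infsum_eq_integral:
 fixes f :: "int => complex"
 assumes "(%k. norm (f k)) summable_on UNIV"
 shows "infsum f UNIV = (LINT k|count_space UNIV. f k)" "integrable (count_space UNIV) f"
proof -
 have a: "Infinite_Set_Sum.abs_summable_on f UNIV"
  using assms by (simp add: abs_summable_equivalent)
 then show "infsum f UNIV = (LINT k|count_space UNIV. f k)"
  using infsetsum_infsum[OF a] by (simp add: infsetsum_def)
 show "integrable (count_space UNIV) f"
  using a by (simp add: Infinite_Set_Sum.abs_summable_on_def)
qed

lemma has_partial_infsum: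
 assumes p: "rapid T s \<delta> (\<phi> :: int => pt6 => complex)" and p': "rapid T s \<delta> \<phi>'"
  and der: "!!k. partial6 T s b (\<phi> k) (\<phi>' k)"
 shows "partial6 T s b (%x. \<Sum>\<^sub>\<infinity>k. \<phi> k x) (%x. \<Sum>\<^sub>\<infinity>k. \<phi>' k x)"
proof -
 obtain C where C: "C \<ge> 0" "!!k x. x \<in> dom6 T s ==> norm (\<phi>' k x) \<le> C * decay s \<delta> x * (1 / (1 + freq k)\<^sup>2)"
  using rapid_abs_summable[OF p'] by metis
 note s = rapid_abs_summable[OF p] and s' = rapid_abs_summable[OF p']
 have "partial6 T s b (%x. LINT k|count_space UNIV. \<phi> k x) (%x. LINT k|count_space UNIV. \<phi>' k x)"
 proof (rule has_partial_integral[OF box6 der])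
  show "integrable (count_space UNIV) (%k. \<phi> k x)" if "x \<in> dom6 T s" for x
   using infsum_eq_integral(2) s that by metis
  show "norm (\<phi>' k x) \<le> C * (1 / (1 + freq k)\<^sup>2)" if "x \<in> dom6 T s" for k x
  proof -
   have "decay s \<delta> x \<le> 1" using weight6 that by (simp add: weight_def)
   then have "C * decay s \<delta> x * (1 / (1 + freq k)\<^sup>2) \<le> C * 1 * (1 / (1 + freq k)\<^sup>2)"
    using C(1) by (intro mult_right_mono mult_left_mono) auto
   then show ?thesis using C(2)[OF that, of k] by simp
  qed
  have "Infinite_Set_Sum.abs_summable_on (%k::int. C * (1 / (1 + \<bar>real_of_int k\<bar>)\<^sup>2)) UNIV"
   unfolding abs_summable_equivalent[symmetric]
   using summable_on_cmult_right[OF summable_inverse_square_int, of C] C(1) by (simp add: abs_mult)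
  then show "integrable (count_space UNIV) (%k::int. C * (1 / (1 + \<bar>real_of_int k\<bar>)\<^sup>2))"
   by (simp add: Infinite_Set_Sum.abs_summable_on_def)
 qed auto
 then show ?thesis
  by (rule has_partial_cong) (metis infsum_eq_integral(1) s, metis infsum_eq_integral(1) s')
qed

lemma smooth6_infsum:
 assumes "rapid T s \<delta> (\<phi> :: int => pt6 => complex)"
 shows "smooth6 T s \<delta> (%x. \<Sum>\<^sub>\<infinity>k. \<phi> k x)"
proof (rule smooth_family_closed[where Q = "%\<psi>. \<exists>\<phi>. rapid T s \<delta> \<phi> \<and> \<psi> = (%_ x. \<Sum>\<^sub>\<infinity>k. (\<phi> k x :: complex))"])
 show "\<exists>g. rapid T s \<delta> g \<and> (%_ x. \<Sum>\<^sub>\<infinity>k. \<phi> k x) = (%_ x. \<Sum>\<^sub>\<infinity>k. g k x)" using assms by blast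
next
 fix \<psi> :: "unit => pt6 => complex" and n :: nat
 assume "\<exists>\<phi>. rapid T s \<delta> \<phi> \<and> \<psi> = (%_ x. \<Sum>\<^sub>\<infinity>k. \<phi> k x)"
 then obtain \<phi> where p: "rapid T s \<delta> \<phi>" "\<psi> = (%_ x. \<Sum>\<^sub>\<infinity>k. \<phi> k x)" by blast
 obtain C where C: "C \<ge> 0" "!!k x. x \<in> dom6 T s ==> norm (\<phi> k x) \<le> C * decay s \<delta> x * (1 / (1 + freq k)\<^sup>2)"
  "!!x. x \<in> dom6 T s ==> (%k. norm (\<phi> k x)) summable_on UNIV"
  using rapid_abs_summable[OF p(1)] by metis
 define K where "K = (\<Sum>\<^sub>\<infinity>k::int. 1 / (1 + \<bar>real_of_int k\<bar>)\<^sup>2)"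
 have "norm (\<Sum>\<^sub>\<infinity>k. \<phi> k x) \<le> (C * K) * decay s \<delta> x" if x: "x \<in> dom6 T s" for x
 proof -
  have "norm (\<Sum>\<^sub>\<infinity>k. \<phi> k x) \<le> (\<Sum>\<^sub>\<infinity>k. norm (\<phi> k x))"
   using C(3)[OF x] by (rule norm_infsum_bound)
  also have "\<dots> \<le> (\<Sum>\<^sub>\<infinity>k. C * decay s \<delta> x * (1 / (1 + freq k)\<^sup>2))"
   by (intro infsum_mono C(3) C(2) x summable_on_cmult_right summable_inverse_square_int)
  also have "\<dots> = C * decay s \<delta> x * K"
   unfolding K_def by (rule infsum_cmult_right) (rule summable_inverse_square_int)
  finally show ?thesis by (simp add: mult_ac)
 qed
 then show "\<exists>C. \<forall>i. \<forall>x\<in>dom6 T s. 1 ^ n * norm (\<psi> i x) \<le> C * decay s \<delta> x"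
  unfolding p(2) power_one mult_1_left by blast
next
 fix \<psi> :: "unit => pt6 => complex" and p i x
 assume "\<exists>\<phi>. rapid T s \<delta> \<phi> \<and> \<psi> = (%_ x. \<Sum>\<^sub>\<infinity>k. \<phi> k x)" and px: "p \<in> per6" "x \<in> dom6 T s"
 then obtain \<phi> where p: "rapid T s \<delta> \<phi>" "\<psi> = (%_ x. \<Sum>\<^sub>\<infinity>k. \<phi> k x)" by blast
 show "\<psi> i (x + p) = \<psi> i x"
  unfolding p(2) by (simp add: smooth_family_periodic[OF p(1) px])
next
 fix \<psi> :: "unit => pt6 => complex" and b :: pt6
 assume "\<exists>\<phi>. rapid T s \<delta> \<phi> \<and> \<psi> = (%_ x. \<Sum>\<^sub>\<infinity>k. \<phi> k x)" and b: "b \<in> Basis"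
 then obtain \<phi> where p: "rapid T s \<delta> \<phi>" "\<psi> = (%_ x. \<Sum>\<^sub>\<infinity>k. \<phi> k x)" by blast
 obtain \<phi>' where d: "rapid T s \<delta> \<phi>'" "!!i. partial6 T s b (\<phi> i) (\<phi>' i)"
  using smooth_family_deriv[OF p(1) b] by metis
 show "\<exists>\<psi>'. (\<exists>\<phi>. rapid T s \<delta> \<phi> \<and> \<psi>' = (%_ x. \<Sum>\<^sub>\<infinity>k. \<phi> k x)) \<and>
   (\<forall>i. partial6 T s b (\<psi> i) (\<psi>' i))"
  unfolding p(2) using has_partial_infsum[OF p(1) d] d(1) by blast
qed

lemma coef_inversion:
 assumes f: "smooth6 T s \<delta> f" and x: "x \<in> dom6 T s"
 shows "((%k. modulate (coef f) k x) has_sum f x) UNIV"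
proof -
 have "(%k. norm (coef f k x)) summable_on UNIV"
  using rapid_abs_summable[OF rapid_coef[OF f]] x by metis
 then have "(%k. norm (cfour (%r. f (at_theta r x)) k)) summable_on UNIV"
  by (simp add: coef_def)
 from fourier_inversion[OF slice_continuous[OF f x] slice_periodic[OF f x] this, of "theta_of x"]
 show ?thesis by (simp add: modulate_def coef_def)
qed

lemma coef_add:
 assumes "smooth6 T s \<delta> f" "smooth6 T s \<delta> g" "x \<in> dom6 T s"
 shows "coef (%x. f x + g x) k x = coef f k x + coef g k x"
 unfolding coef_def by (intro cfour_add slice_continuous assms)

lemma coef_uniqueness:
 assumes f: "smooth6 T s \<delta> f" "smooth6 T s \<delta> g" and x: "x \<in> dom6 T s"
  and eq: "!!k. coef f k x = coef g k x"
 shows "f x = g x"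
proof -
 have "((%k. modulate (coef f) k x) has_sum g x) UNIV"
  using coef_inversion[OF f(2) x] by (simp add: modulate_def eq)
 then show ?thesis using coef_inversion[OF f(1) x] infsumI by metis
qed

end

lemma coef_cmult: "coef (%x. c * f x) k x = c * coef f k x"
 unfolding coef_def by (rule cfour_cmult)

lemma coef_cong: "(!!x. x \<in> dom6 T s ==> f x = g x) ==> x \<in> dom6 T s ==> coef f k x = coef g k x"
 unfolding coef_def by (intro cfour_cong) simp

section \<open>Ordinary differential equations in the normal variable\<close>

definition Y_of :: "pt6 => real" where
 "Y_of = (%(t,y1,y2,y3,Y,th). Y)"

abbreviation ray :: "side => pt6 => real => pt6" where
 "ray s x r \<equiv> x + (sg s * r) *\<^sub>R e_Y"

definition at_Y :: "real => pt6 => pt6" where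
 "at_Y r = (%(t,y1,y2,y3,Y,th). (t,y1,y2,y3,r,th))"

lemma at_Y_line: "at_Y r x = at_Y 0 x + r *\<^sub>R e_Y"
 by (cases x) (auto simp: at_Y_def e_Y_def)

lemma at_Y_add_e_Y [simp]: "at_Y r (x + h *\<^sub>R e_Y) = at_Y r x"
 by (cases x) (auto simp: at_Y_def e_Y_def)

lemma at_Y_add_Basis: "b \<in> Basis ==> b \<noteq> e_Y ==> at_Y r (x + h *\<^sub>R b) = at_Y r x + h *\<^sub>R b"
 by (cases x) (auto simp: at_Y_def Basis_pt6 e_Y_def)

lemma Y_of_add_Basis: "b \<in> Basis ==> Y_of (x + h *\<^sub>R b) = Y_of x + (if b = e_Y then h else 0)"
 by (cases x) (auto simp: Y_of_def Basis_pt6 e_Y_def)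

lemma at_Y_at_Y [simp]: "at_Y r (at_Y r' x) = at_Y r x"
 by (cases x) (auto simp: at_Y_def)

lemma at_Y_Y_of [simp]: "at_Y (Y_of x) x = x"
 by (cases x) (auto simp: at_Y_def Y_of_def)

lemma Y_of_at_Y [simp]: "Y_of (at_Y r x) = r"
 by (cases x) (auto simp: at_Y_def Y_of_def)

lemma at_theta_at_Y: "at_theta r (at_Y r' x) = at_Y r' (at_theta r x)"
 by (cases x) (auto simp: at_theta_def at_Y_def)

lemma theta_of_at_Y [simp]: "theta_of (at_Y r x) = theta_of x"
 by (cases x) (auto simp: at_Y_def theta_of_def)

lemma Y_of_at_theta [simp]: "Y_of (at_theta r x) = Y_of x"
 by (cases x) (auto simp: at_theta_def Y_of_def)

lemma at_Y_dom6: "x \<in> dom6 T s ==> at_Y r x \<in> dom6 T s \<longleftrightarrow> 0 \<le> sg s * r"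
 by (cases x) (auto simp: at_Y_def dom6_def chalf_def)

lemma Y_of_dom6: "x \<in> dom6 T s ==> 0 \<le> sg s * Y_of x"
 by (cases x) (auto simp: Y_of_def dom6_def chalf_def)

lemma decay_alt: "decay s \<delta> x = exp (- (\<delta> * (sg s * Y_of x)))"
 by (cases x) (auto simp: decay_def Y_of_def)

lemma e_Y_neq_e_theta [simp]: "e_Y \<noteq> e_theta" "e_theta \<noteq> e_Y"
 by (auto simp: e_Y_def e_theta_def)

lemma Y_of_shift: "Y_of (x + r *\<^sub>R e_Y) = Y_of x + r"
 by (cases x) (auto simp: Y_of_def e_Y_def)

lemma at_theta_shift: "at_theta r (x + h *\<^sub>R e_Y) = at_theta r x + h *\<^sub>R e_Y"
 by (rule at_theta_add_Basis) auto

lemma shift_dom6: "x \<in> dom6 T s ==> 0 \<le> r ==> ray s x r \<in> dom6 T s"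
 by (cases x) (auto simp: dom6_def chalf_def e_Y_def distrib_left)

lemma theta_free_has_partial:
 assumes "!!r x. f (at_theta r x) = f x"
 shows "has_partial D e_theta f (%_. 0)"
proof -
 have "f (x + h *\<^sub>R e_theta) = f (at_theta 0 x)" for x h
  using assms[of 0 "x + h *\<^sub>R e_theta"] by simp
 then show ?thesis unfolding has_partial_def by simp
qed

lemma Y_free_has_partial:
 assumes "!!r x. f (at_Y r x) = f x"
 shows "has_partial D e_Y f (%_. 0)"
proof -
 have "f (x + h *\<^sub>R e_Y) = f (at_Y 0 x)" for x h
  using assms[of 0 "x + h *\<^sub>R e_Y"] by simp
 then show ?thesis unfolding has_partial_def by simp
qed

lemma integral_derivative_to_infinity:
 fixes G G' :: "real => complex"
 assumes der: "!!r. 0 \<le> r ==> (G has_vector_derivative G' r) (at r within {0..})"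
  and int: "set_integrable lborel {0..} G'" and lim: "(G \<longlongrightarrow> 0) at_top"
 shows "(LINT r:{0..}|lborel. G' r) = - G 0"
proof -
 have eq: "(LINT r:{0..b}|lborel. G' r) = G b - G 0" if "0 \<le> b" for b
 proof -
  have "set_integrable lborel {0..b} G'"
   by (rule set_integrable_subset[OF int]) auto
  then have "(LINT r:{0..b}|lborel. G' r) = integral {0..b} G'"
   by (rule set_borel_integral_eq_integral)
  also have "\<dots> = G b - G 0"
   by (rule integral_unique[OF fundamental_theorem_of_calculus[OF that]])
     (rule has_vector_derivative_within_subset[OF der]; auto)
  finally show ?thesis .
 qed
 have "((%b. LINT r:{0..b}|lborel. G' r) \<longlongrightarrow> (LINT r:{0..}|lborel. G' r)) at_top"
  using int by (intro tendsto_set_lebesgue_integral_at_top) auto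
 then have "((%b. G b - G 0) \<longlongrightarrow> (LINT r:{0..}|lborel. G' r)) at_top"
  by (rule Lim_transform_eventually) (use eq in \<open>auto simp: eventually_at_top_linorder\<close>)
 moreover have "((%b. G b - G 0) \<longlongrightarrow> 0 - G 0) at_top"
  by (intro tendsto_diff lim tendsto_const)
 ultimately show ?thesis
  using tendsto_unique[OF _] by (metis trivial_limit_at_top_linorder diff_0)
qed

lemma set_integrable_exp_bound:
 fixes g :: "real => complex"
 assumes cont: "continuous_on {0..} g" and \<delta>: "\<delta> > 0"
  and bnd: "!!r. 0 \<le> r ==> norm (g r) \<le> C * exp (- (\<delta> * r))"
 shows "set_integrable lborel {0..} g"
proof (rule set_integrable_bound)
 show "set_integrable lborel {0..} (%r. C * exp (- (\<delta> * r)))"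
  by (intro set_integrable_mult_right set_integrable_exp_half \<delta>)
 show "set_borel_measurable lborel {0..} g"
  unfolding set_borel_measurable_def
  using borel_measurable_continuous_on_indicator[OF _ cont] by simp
 show "AE r in lborel. r \<in> {0..} \<longrightarrow> norm (g r) \<le> norm (C * exp (- (\<delta> * r)))"
  using bnd by (intro AE_I2) (auto intro: order_trans[OF _ abs_ge_self])
qed

lemma tendsto_exp_bound:
 fixes g :: "real => complex"
 assumes \<delta>: "\<delta> > 0" and bnd: "!!r. 0 \<le> r ==> norm (g r) \<le> C * exp (- (\<delta> * r))"
 shows "(g \<longlongrightarrow> 0) at_top"
proof (rule Lim_null_comparison)
 show "\<forall>\<^sub>F r in at_top. norm (g r) \<le> C * exp (- (\<delta> * r))"
  using bnd by (auto simp: eventually_at_top_linorder)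
 have "((%r. exp (- (\<delta> * r))) \<longlongrightarrow> 0) at_top"
  by (rule filterlim_compose[OF exp_at_bot])
    (auto simp: filterlim_uminus_at_bot intro!: filterlim_tendsto_pos_mult_at_top[OF tendsto_const \<delta>] filterlim_ident)
 then show "((%r. C * exp (- (\<delta> * r))) \<longlongrightarrow> 0) at_top"
  using tendsto_mult_right_zero by blast
qed

text \<open>For \<open>k \<noteq> 0\<close> the bounded solution of \<open>sg s * z\<^sub>Y = |k| z
 - \<phi>\<close>: the homogeneous solutions grow, so the value is obtained by integration from
 infinity.\<close>

definition backward :: "side => (int => pt6 => complex) => int => pt6 => complex" where
 "backward s \<phi> k x =
   (LINT r:{0..}|lborel. of_real (exp (- (freq k * r))) * \<phi> k (ray s x r))"

text \<open>The maximum keeps the exponential decay uniform in \<open>k\<close>.\<close>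

definition rate :: "int => real" where
 "rate k = max 1 (freq k)"

text \<open>The solution of \<open>sg s * z\<^sub>Y = \<phi> - rate k * z\<close> that vanishes for
 \<open>Y = 0\<close>.\<close>

definition forward :: "side => (int => pt6 => complex) => int => pt6 => complex" where
 "forward s \<phi> k x =
   (LINT r:{0..sg s * Y_of x}|lborel.
    of_real (exp (- (rate k * (sg s * Y_of x - r)))) * \<phi> k (at_Y (sg s * r) x))"

text \<open>For \<open>\<phi>\<close> independent of \<open>Y\<close>, the decaying solution of
 \<open>sg s * z\<^sub>Y = - rate k * z\<close> with boundary values \<open>\<phi>\<close>.\<close>

definition poisson :: "side => (int => pt6 => complex) => int => pt6 => complex" where
 "poisson s \<phi> k x = of_real (exp (- (rate k * (sg s * Y_of x)))) * \<phi> k x"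

lemma rate_bounds: "1 \<le> rate k" "freq k \<le> rate k" "rate k \<le> 1 + freq k"
 by (auto simp: rate_def)

lemma abs_rate [simp]: "\<bar>rate k\<bar> = rate k"
 by (simp add: rate_def)

lemma rate_nonzero: "k \<noteq> 0 ==> rate k = freq k"
 by (auto simp: rate_def)

context
 fixes T :: real and s :: side and \<delta> :: real
 assumes T: "T > 0" and \<delta>: "\<delta> > 0"
begin

lemma \<delta>0: "\<delta> \<ge> 0" using \<delta> by simp

lemma ray_continuous:
 assumes p: "rapid T s \<delta> (\<phi> :: int => pt6 => complex)" and x: "x \<in> dom6 T s"
 shows "continuous_on {0..} (%r. \<phi> k (ray s x r))"
proof (rule continuous_on_compose2[OF smooth_family_continuous[OF p weight6[OF T \<delta>0] box6[OF T \<delta>0]]])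
 show "(%r. ray s x r) ` {0..} \<subseteq> dom6 T s"
  using shift_dom6[OF x] by (simp add: image_subset_iff)
qed (intro continuous_intros)

lemma ray_bound:
 assumes p: "rapid T s \<delta> (\<phi> :: int => pt6 => complex)"
 obtains C where "C \<ge> 0" "!!k x r. x \<in> dom6 T s ==> 0 \<le> r ==>
   (1 + freq k) ^ n * norm (\<phi> k (ray s x r)) \<le> C * decay s \<delta> x * exp (- (\<delta> * r))"
proof -
 obtain C where C: "C \<ge> 0" "!!i x. x \<in> dom6 T s ==> (1 + freq i) ^ n * norm (\<phi> i x) \<le> C * decay s \<delta> x"
  using smooth_family_bound[OF p weight6[OF T \<delta>0]] by metis
 have "decay s \<delta> (ray s x r) = decay s \<delta> x * exp (- (\<delta> * r))" for x r
  by (simp add: decay_alt Y_of_shift distrib_left exp_add[symmetric])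
 then show ?thesis
  using C shift_dom6 by (intro that[of C]) (metis mult.assoc)+
qed

lemma backward_integrable:
 assumes p: "rapid T s \<delta> (\<phi> :: int => pt6 => complex)" and x: "x \<in> dom6 T s"
 shows "set_integrable lborel {0..} (%r. of_real (exp (- (freq k * r))) * \<phi> k (ray s x r))"
proof -
 obtain C where C: "C \<ge> 0" "!!k x r. x \<in> dom6 T s ==> 0 \<le> r ==>
   (1 + freq k) ^ 0 * norm (\<phi> k (ray s x r)) \<le> C * decay s \<delta> x * exp (- (\<delta> * r))"
  using ray_bound[OF p] by metis
 show ?thesis
 proof (rule set_integrable_exp_bound[OF _ \<delta>])
  show "continuous_on {0..} (%r. of_real (exp (- (freq k * r))) * \<phi> k (ray s x r))"
   by (intro continuous_intros ray_continuous[OF p x])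
  fix r :: real assume r: "0 \<le> r"
  have "norm (of_real (exp (- (freq k * r))) * \<phi> k (ray s x r))
    \<le> 1 * norm (\<phi> k (ray s x r))"
   unfolding norm_mult using r by (intro mult_right_mono) auto
  also have "\<dots> \<le> C * decay s \<delta> x * exp (- (\<delta> * r))" using C(2)[OF x r, of k] by simp
  finally show "norm (of_real (exp (- (freq k * r))) * \<phi> k (ray s x r))
    \<le> C * decay s \<delta> x * exp (- (\<delta> * r))" .
 qed
qed

lemma has_partial_backward:
 assumes p: "rapid T s \<delta> (\<phi> :: int => pt6 => complex)" and p': "rapid T s \<delta> \<phi>'"
  and der: "partial6 T s b (\<phi> k) (\<phi>' k)"
 shows "partial6 T s b (backward s \<phi> k) (backward s \<phi>' k)"
proof -
 obtain C where C: "C \<ge> 0" "!!k x r. x \<in> dom6 T s ==> 0 \<le> r ==>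
   (1 + freq k) ^ 0 * norm (\<phi>' k (ray s x r)) \<le> C * decay s \<delta> x * exp (- (\<delta> * r))"
  using ray_bound[OF p'] by metis
 have "partial6 T s b
   (%x. LINT r|lborel. indicat_real {0..} r *\<^sub>R (of_real (exp (- (freq k * r))) * \<phi> k (ray s x r)))
   (%x. LINT r|lborel. indicat_real {0..} r *\<^sub>R (of_real (exp (- (freq k * r))) * \<phi>' k (ray s x r)))"
 proof (rule has_partial_integral[OF box6[OF T \<delta>0]])
  fix r :: real
  show "partial6 T s b
    (%x. indicat_real {0..} r *\<^sub>R (of_real (exp (- (freq k * r))) * \<phi> k (ray s x r)))
    (%x. indicat_real {0..} r *\<^sub>R (of_real (exp (- (freq k * r))) * \<phi>' k (ray s x r)))"
  proof (cases "0 \<le> r")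
   case True
   have "partial6 T s b (%x. \<phi> k (ray s x r)) (%x. 1 *\<^sub>R \<phi>' k (ray s x r))"
    by (rule has_partial_compose[OF der]) (use True shift_dom6 in \<open>auto simp: algebra_simps\<close>)
   then have "partial6 T s b (%x. c * \<phi> k (ray s x r)) (%x. c * \<phi>' k (ray s x r))" for c
    using has_partial_linear[OF bounded_linear_mult_right] by (simp only: scaleR_one)
   then show ?thesis using True by (simp add: indicator_def)
  next
   case False
   then show ?thesis by (simp add: has_partial_const)
  qed
 next
  fix x assume x: "x \<in> dom6 T s"
  show "integrable lborel (%r. indicat_real {0..} r *\<^sub>R (of_real (exp (- (freq k * r))) * \<phi> k (ray s x r)))"
   using backward_integrable[OF p x] by (simp only: set_integrable_def)
  show "(%r. indicat_real {0..} r *\<^sub>R (of_real (exp (- (freq k * r))) * \<phi>' k (ray s x r))) \<in> borel_measurable lborel"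
   using backward_integrable[OF p' x] unfolding set_integrable_def by (rule borel_measurable_integrable)
  fix r :: real
  show "norm (indicat_real {0..} r *\<^sub>R (of_real (exp (- (freq k * r))) * \<phi>' k (ray s x r)))
    \<le> C * (indicat_real {0..} r *\<^sub>R exp (- (\<delta> * r)))"
  proof (cases "0 \<le> r")
   case True
   have "decay s \<delta> x \<le> 1" using weight6[OF T \<delta>0] x by (simp add: weight_def)
   then have "C * decay s \<delta> x * exp (- (\<delta> * r)) \<le> C * 1 * exp (- (\<delta> * r))"
    using C(1) by (intro mult_right_mono mult_left_mono) auto
   moreover have "norm (of_real (exp (- (freq k * r))) * \<phi>' k (ray s x r))
     \<le> 1 * norm (\<phi>' k (ray s x r))"
    unfolding norm_mult using True by (intro mult_right_mono) auto
   ultimately show ?thesis using C(2)[OF x True, of k] True by simp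
  qed auto
 next
  show "integrable lborel (%r. C * (indicat_real {0..} r *\<^sub>R exp (- (\<delta> * r))))"
   using set_integrable_exp_half[OF \<delta>] unfolding set_integrable_def by (rule integrable_mult_right)
 qed
 then show ?thesis by (simp only: backward_def[abs_def] set_lebesgue_integral_def)
qed

lemma rapid_backward:
 assumes "rapid T s \<delta> \<phi>"
 shows "rapid T s \<delta> (backward s \<phi>)"
proof (rule smooth_family_closed[where Q = "%\<psi>. \<exists>\<phi>. rapid T s \<delta> \<phi> \<and> \<psi> = backward s \<phi>"])
 show "\<exists>g. rapid T s \<delta> g \<and> backward s \<phi> = backward s g" using assms by blast
next
 fix \<psi> and n :: nat assume "\<exists>\<phi>. rapid T s \<delta> \<phi> \<and> \<psi> = backward s \<phi>"
 then obtain \<phi> where p: "rapid T s \<delta> \<phi>" "\<psi> = backward s \<phi>" by blast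
 obtain C where C: "C \<ge> 0" "!!k x r. x \<in> dom6 T s ==> 0 \<le> r ==>
   (1 + freq k) ^ n * norm (\<phi> k (ray s x r)) \<le> C * decay s \<delta> x * exp (- (\<delta> * r))"
  using ray_bound[OF p(1)] by metis
 define K where "K = (LINT r:{0..}|lborel. exp (- (\<delta> * r)))"
 have "(1 + freq k) ^ n * norm (\<psi> k x) \<le> (C * K) * decay s \<delta> x" if x: "x \<in> dom6 T s" for k x
 proof -
  let ?g = "%r. of_real (exp (- (freq k * r))) * \<phi> k (ray s x r)"
  have ind: "norm (indicat_real {0..} r *\<^sub>R ?g r) \<le> C * decay s \<delta> x / (1 + freq k) ^ n * (indicat_real {0..} r *\<^sub>R exp (- (\<delta> * r)))" for r
  proof (cases "0 \<le> r")
   case True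
   have "norm (?g r) \<le> 1 * norm (\<phi> k (ray s x r))"
    unfolding norm_mult using True by (intro mult_right_mono) auto
   also have "\<dots> \<le> C * decay s \<delta> x * exp (- (\<delta> * r)) / (1 + freq k) ^ n"
    using C(2)[OF x True, of k] by (simp add: pos_le_divide_eq mult.commute)
   finally show ?thesis using True by simp
  qed auto
  have "norm (\<psi> k x) \<le> (LINT r|lborel. norm (indicat_real {0..} r *\<^sub>R ?g r))"
   unfolding p(2) backward_def set_lebesgue_integral_def by (rule integral_norm_bound)
  also have "\<dots> \<le> (LINT r|lborel. C * decay s \<delta> x / (1 + freq k) ^ n * (indicat_real {0..} r *\<^sub>R exp (- (\<delta> * r))))"
  proof (rule integral_mono[OF _ _ ind])
   show "integrable lborel (%r. norm (indicat_real {0..} r *\<^sub>R ?g r))"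
    using backward_integrable[OF p(1) x] unfolding set_integrable_def by (rule integrable_norm)
   show "integrable lborel (%r. C * decay s \<delta> x / (1 + freq k) ^ n * (indicat_real {0..} r *\<^sub>R exp (- (\<delta> * r))))"
    using set_integrable_exp_half[OF \<delta>] unfolding set_integrable_def by (rule integrable_mult_right)
  qed
  also have "\<dots> = C * decay s \<delta> x / (1 + freq k) ^ n * K"
   unfolding K_def set_lebesgue_integral_def by (rule integral_mult_right_zero)
  finally show ?thesis by (simp add: field_simps)
 qed
 then show "\<exists>C. \<forall>i. \<forall>x\<in>dom6 T s. (1 + freq i) ^ n * norm (\<psi> i x) \<le> C * decay s \<delta> x" by blast
next
 fix \<psi> p i x assume "\<exists>\<phi>. rapid T s \<delta> \<phi> \<and> \<psi> = backward s \<phi>" and px: "p \<in> per6" "x \<in> dom6 T s"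
 then obtain \<phi> where p: "rapid T s \<delta> \<phi>" "\<psi> = backward s \<phi>" by blast
 have "\<phi> i (x + p + (sg s * r) *\<^sub>R e_Y) = \<phi> i (ray s x r)" if "0 \<le> r" for r
  using smooth_family_periodic[OF p(1) px(1) shift_dom6[OF px(2) that], of i] by (simp add: add_ac)
 then show "\<psi> i (x + p) = \<psi> i x"
  unfolding p(2) backward_def by (intro set_lebesgue_integral_cong) auto
next
 fix \<psi> and b :: pt6 assume "\<exists>\<phi>. rapid T s \<delta> \<phi> \<and> \<psi> = backward s \<phi>" and b: "b \<in> Basis"
 then obtain \<phi> where p: "rapid T s \<delta> \<phi>" "\<psi> = backward s \<phi>" by blast
 obtain \<phi>' where d: "rapid T s \<delta> \<phi>'" "!!i. partial6 T s b (\<phi> i) (\<phi>' i)"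
  using smooth_family_deriv[OF p(1) b] by metis
 show "\<exists>\<psi>'. (\<exists>\<phi>. rapid T s \<delta> \<phi> \<and> \<psi>' = backward s \<phi>) \<and> (\<forall>i. partial6 T s b (\<psi> i) (\<psi>' i))"
  unfolding p(2) using has_partial_backward[OF p(1) d] d(1) by blast
qed

lemma ray_derivative:
 assumes der: "partial6 T s e_Y f f'" and x: "x \<in> dom6 T s" and r: "0 \<le> r"
 shows "((%r. f (ray s x r)) has_vector_derivative sg s *\<^sub>R f' (ray s x r)) (at r within {0..})"
proof -
 let ?S = "{h. x + h *\<^sub>R e_Y \<in> dom6 T s}"
 have 1: "((%r. sg s * r) has_vector_derivative sg s) (at r within {0..})"
  by (auto intro!: derivative_eq_intros simp: has_real_derivative_iff_has_vector_derivative[symmetric])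
 have sub: "(%r. sg s * r) ` {0..} \<subseteq> ?S" using shift_dom6[OF x] by (simp add: image_subset_iff)
 have 2: "((%h. f (x + h *\<^sub>R e_Y)) has_vector_derivative f' (ray s x r)) (at (sg s * r) within (%r. sg s * r) ` {0..})"
  using has_vector_derivative_within_subset[OF has_partial_line[OF der shift_dom6[OF x r]] sub] .
 show ?thesis using vector_diff_chain_within[OF 1 2] by (simp add: o_def)
qed

text \<open>Integration by parts along the ray; the boundary term at infinity vanishes.\<close>

lemma backward_ode:
 assumes p: "rapid T s \<delta> \<phi>"
 shows "partial6 T s e_Y (backward s \<phi> k)
   (%x. of_real (sg s) * (of_real (freq k) * backward s \<phi> k x - \<phi> k x))"
proof -
 obtain \<phi>' where d: "rapid T s \<delta> \<phi>'" "!!i. partial6 T s e_Y (\<phi> i) (\<phi>' i)"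
  using smooth_family_deriv[OF p Basis_e(1)] by metis
 have eq: "of_real (sg s) * (of_real (freq k) * backward s \<phi> k x - \<phi> k x) = backward s \<phi>' k x" if x: "x \<in> dom6 T s" for x
 proof -
  define E :: "real => complex" where "E r = of_real (exp (- (freq k * r)))" for r
  define G where "G r = E r * \<phi> k (ray s x r)" for r
  define H where "H r = E r * \<phi>' k (ray s x r)" for r
  have dE: "(E has_vector_derivative of_real (- freq k) * E r) (at r within {0..})" for r
  proof -
   have "((%r. exp (- (freq k * r))) has_real_derivative (- freq k) * exp (- (freq k * r))) (at r within {0..})"
    by (auto intro!: derivative_eq_intros)
   then show ?thesis unfolding E_def of_real_mult[symmetric]
    by (intro has_vector_derivative_of_real) (simp add: has_real_derivative_iff_has_vector_derivative)
  qed
  obtain C where C: "C \<ge> 0" "!!k x r. x \<in> dom6 T s ==> 0 \<le> r ==>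
   (1 + freq k) ^ 0 * norm (\<phi> k (ray s x r)) \<le> C * decay s \<delta> x * exp (- (\<delta> * r))"
   using ray_bound[OF p] by metis
  have iG: "set_integrable lborel {0..} G" and iH: "set_integrable lborel {0..} H"
   unfolding G_def H_def E_def using backward_integrable[OF p x] backward_integrable[OF d(1) x] by blast+
  have i1: "set_integrable lborel {0..} (%r. of_real (- freq k) * G r)"
   and i2: "set_integrable lborel {0..} (%r. of_real (sg s) * H r)"
   by (intro set_integrable_mult_right iG iH)+
  have "(LINT r:{0..}|lborel. of_real (- freq k) * G r + of_real (sg s) * H r) = - G 0"
  proof (rule integral_derivative_to_infinity)
   show "(G has_vector_derivative of_real (- freq k) * G r + of_real (sg s) * H r) (at r within {0..})" if "0 \<le> r" for r
    using has_vector_derivative_mult[OF dE ray_derivative[OF d(2) x that]]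
    unfolding G_def H_def by (simp add: scaleR_conv_of_real algebra_simps)
   show "set_integrable lborel {0..} (%r. of_real (- freq k) * G r + of_real (sg s) * H r)"
    by (rule set_integral_add(1)[OF i1 i2])
   show "(G \<longlongrightarrow> 0) at_top"
   proof (rule tendsto_exp_bound[OF \<delta>])
    fix r :: real assume r: "0 \<le> r"
    have "norm (G r) \<le> 1 * norm (\<phi> k (ray s x r))"
     unfolding G_def E_def norm_mult using r by (intro mult_right_mono) auto
    then show "norm (G r) \<le> C * decay s \<delta> x * exp (- (\<delta> * r))" using C(2)[OF x r, of k] by simp
   qed
  qed
  moreover have "(LINT r:{0..}|lborel. of_real (- freq k) * G r + of_real (sg s) * H r)
    = of_real (- freq k) * backward s \<phi> k x + of_real (sg s) * backward s \<phi>' k x"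
  proof -
   have "backward s \<phi> k x = (LINT r:{0..}|lborel. G r)" "backward s \<phi>' k x = (LINT r:{0..}|lborel. H r)"
    by (simp_all add: backward_def G_def H_def E_def)
   then show ?thesis
    using set_integral_add(2)[OF i1 i2] by (simp only: set_integral_mult_right)
  qed
  moreover have "G 0 = \<phi> k x" by (simp add: G_def E_def)
  ultimately have "of_real (sg s) * backward s \<phi>' k x = of_real (freq k) * backward s \<phi> k x - \<phi> k x"
   by (simp add: algebra_simps eq_diff_eq)
  then have "of_real (sg s) * (of_real (sg s) * backward s \<phi>' k x) = of_real (sg s) * (of_real (freq k) * backward s \<phi> k x - \<phi> k x)"
   by simp
  moreover have "of_real (sg s) * (of_real (sg s) * backward s \<phi>' k x) = backward s \<phi>' k x"
   by (cases s) auto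
  ultimately show ?thesis by simp
 qed
 show ?thesis
  by (rule has_partial_cong[OF has_partial_backward[OF p d]]) (use eq in auto)
qed

lemma backward_at_theta:
 assumes "!!k r x. \<phi> k (at_theta r x) = \<phi> k x"
 shows "backward s \<phi> k (at_theta r x) = backward s \<phi> k x"
proof -
 have "\<phi> k (at_theta r x + h *\<^sub>R e_Y) = \<phi> k (x + h *\<^sub>R e_Y)" for h
  using assms[of k r "x + h *\<^sub>R e_Y"] by (simp add: at_theta_shift)
 then show ?thesis by (simp add: backward_def)
qed

lemma poisson_bound:
 assumes "\<delta> \<le> 1" "x \<in> dom6 T s"
 shows "exp (- (rate k * (sg s * Y_of x))) \<le> decay s \<delta> x"
 unfolding decay_alt using Y_of_dom6[OF assms(2)] rate_bounds(1)[of k] assms(1)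
 by (auto intro!: mult_right_mono)

lemma has_partial_poisson:
 assumes der: "partial6 T s b (\<phi> k) (\<phi>' k)" and b: "b \<in> Basis"
 shows "partial6 T s b (poisson s \<phi> k)
   (poisson s (%k x. \<phi>' k x + (if b = e_Y then - of_real (sg s * rate k) else 0) * \<phi> k x) k)"
proof -
 have E: "partial6 T s b (%x. complex_of_real (exp (- (rate k * (sg s * Y_of x)))))
   (%x. (if b = e_Y then - of_real (sg s * rate k) else 0) * of_real (exp (- (rate k * (sg s * Y_of x)))))"
  unfolding has_partial_def
 proof
  fix x assume "x \<in> dom6 T s"
  let ?F = "at 0 within {h. x + h *\<^sub>R b \<in> dom6 T s}"
  show "((%h. complex_of_real (exp (- (rate k * (sg s * Y_of (x + h *\<^sub>R b)))))) has_vector_derivative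
    (if b = e_Y then - of_real (sg s * rate k) else 0) * of_real (exp (- (rate k * (sg s * Y_of x))))) ?F"
  proof (cases "b = e_Y")
   case True
   have "((%h. exp (- (rate k * (sg s * (Y_of x + h))))) has_real_derivative
     - (sg s * rate k) * exp (- (rate k * (sg s * Y_of x)))) ?F"
    by (auto intro!: derivative_eq_intros)
   then have "((%h. complex_of_real (exp (- (rate k * (sg s * (Y_of x + h)))))) has_vector_derivative
     of_real (- (sg s * rate k) * exp (- (rate k * (sg s * Y_of x))))) ?F"
    by (intro has_vector_derivative_of_real) (simp add: has_real_derivative_iff_has_vector_derivative)
   then show ?thesis using True by (simp add: Y_of_shift)
  next
   case False
   then show ?thesis by (simp add: Y_of_add_Basis b)
  qed
 qed
 show ?thesis
  using has_partial_mult[OF E der] unfolding poisson_def by (simp add: algebra_simps)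
qed

lemma rapid_poisson:
 assumes "rapid T s 0 \<phi>" and \<delta>1: "\<delta> \<le> 1"
 shows "rapid T s \<delta> (poisson s \<phi>)"
proof (rule smooth_family_closed[where Q = "%\<psi>. \<exists>\<phi>. rapid T s 0 \<phi> \<and> \<psi> = poisson s \<phi>"])
 show "\<exists>g. rapid T s 0 g \<and> poisson s \<phi> = poisson s g" using assms by blast
next
 fix \<psi> and n :: nat assume "\<exists>\<phi>. rapid T s 0 \<phi> \<and> \<psi> = poisson s \<phi>"
 then obtain \<phi> where p: "rapid T s 0 \<phi>" "\<psi> = poisson s \<phi>" by blast
 obtain C where C: "C \<ge> 0" "!!i x. x \<in> dom6 T s ==> (1 + freq i) ^ n * norm (\<phi> i x) \<le> C * decay s 0 x"
  using smooth_family_bound[OF p(1) weight6[OF T order_refl]] by metis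
 have "(1 + freq k) ^ n * norm (\<psi> k x) \<le> C * decay s \<delta> x" if x: "x \<in> dom6 T s" for k x
 proof -
  have "(1 + freq k) ^ n * norm (\<psi> k x)
    = exp (- (rate k * (sg s * Y_of x))) * ((1 + freq k) ^ n * norm (\<phi> k x))"
   unfolding p(2) poisson_def by (simp add: norm_mult)
  also have "\<dots> \<le> decay s \<delta> x * C"
   using C(2)[OF x, of k] C(1) poisson_bound[OF \<delta>1 x] by (intro mult_mono) (auto simp: decay_alt)
  finally show ?thesis by (simp add: mult.commute)
 qed
 then show "\<exists>C. \<forall>i. \<forall>x\<in>dom6 T s. (1 + freq i) ^ n * norm (\<psi> i x) \<le> C * decay s \<delta> x" by blast
next
 fix \<psi> p i x assume "\<exists>\<phi>. rapid T s 0 \<phi> \<and> \<psi> = poisson s \<phi>" and px: "p \<in> per6" "x \<in> dom6 T s"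
 then obtain \<phi> where p: "rapid T s 0 \<phi>" "\<psi> = poisson s \<phi>" by blast
 have "Y_of (x + p) = Y_of x" using px(1) by (cases x) (auto simp: Y_of_def per6_def)
 then show "\<psi> i (x + p) = \<psi> i x"
  unfolding p(2) poisson_def using smooth_family_periodic[OF p(1) px] by simp
next
 fix \<psi> and b :: pt6 assume "\<exists>\<phi>. rapid T s 0 \<phi> \<and> \<psi> = poisson s \<phi>" and b: "b \<in> Basis"
 then obtain \<phi> where p: "rapid T s 0 \<phi>" "\<psi> = poisson s \<phi>" by blast
 obtain \<phi>' where d: "rapid T s 0 \<phi>'" "!!i. partial6 T s b (\<phi> i) (\<phi>' i)"
  using smooth_family_deriv[OF p(1) b] by metis
 have "rapid T s 0 (%k x. \<phi>' k x + (if b = e_Y then - of_real (sg s * rate k) else 0) * \<phi> k x)"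
  using rate_bounds
  by (intro smooth_family_add[OF d(1) rapid_multiplier[OF T order_refl p(1), of _ 1 1] weight6[OF T order_refl]])
    (auto simp: norm_mult abs_mult intro: order_trans[OF _ rate_bounds(3)])
 then show "\<exists>\<psi>'. (\<exists>\<phi>. rapid T s 0 \<phi> \<and> \<psi>' = poisson s \<phi>) \<and> (\<forall>i. partial6 T s b (\<psi> i) (\<psi>' i))"
  unfolding p(2) using has_partial_poisson[where \<phi> = \<phi> and \<phi>' = \<phi>', OF d(2) b] by blast
qed

lemma segment_eq: "at_Y (sg s * r) x = at_Y 0 x + (sg s * r) *\<^sub>R e_Y"
 by (rule at_Y_line)

lemma at_Y0_dom6: "x \<in> dom6 T s ==> at_Y 0 x \<in> dom6 T s"
 by (simp add: at_Y_dom6)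

text \<open>Since the rate is at least one and \<open>\<delta> \<le> 1/2\<close>, the decay
 \<open>exp (- \<delta> u)\<close> can be split off and a factor remains whose integral is bounded
 independently of \<open>u\<close>.\<close>

lemma forward_integrand_bound:
 assumes p: "rapid T s \<delta> (\<phi> :: int => pt6 => complex)" and \<delta>1: "\<delta> \<le> 1 / 2"
 obtains C where "C \<ge> 0" "!!k x r. x \<in> dom6 T s ==> 0 \<le> r ==> r \<le> sg s * Y_of x ==>
   norm (of_real (exp (- (rate k * (sg s * Y_of x - r)))) * \<phi> k (at_Y (sg s * r) x))
    \<le> C / (1 + freq k) ^ n * decay s \<delta> x * exp (- ((sg s * Y_of x - r) / 2))"
proof -
 obtain C where C: "C \<ge> 0" "!!k x r. x \<in> dom6 T s ==> 0 \<le> r ==>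
   (1 + freq k) ^ n * norm (\<phi> k (ray s x r)) \<le> C * decay s \<delta> x * exp (- (\<delta> * r))"
  using ray_bound[OF p] by metis
 show ?thesis
 proof (rule that[OF C(1)])
  fix k x r assume x: "x \<in> dom6 T s" and r: "0 \<le> r" "r \<le> sg s * Y_of x"
  define u where "u = sg s * Y_of x"
  have u: "r \<le> u" using r by (simp add: u_def)
  have "(1 + freq k) ^ n * norm (\<phi> k (at_Y (sg s * r) x)) \<le> C * exp (- (\<delta> * r))"
   using C(2)[OF at_Y0_dom6[OF x] r(1), of k] unfolding segment_eq by (simp add: decay_alt)
  then have 1: "norm (\<phi> k (at_Y (sg s * r) x)) \<le> C / (1 + freq k) ^ n * exp (- (\<delta> * r))"
   by (simp add: pos_le_divide_eq mult.commute)
  have "rate k * (u - r) \<ge> 1 * (u - r)" using u rate_bounds(1)[of k] by (intro mult_right_mono) auto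
  moreover have "\<delta> * (u - r) \<le> 1 / 2 * (u - r)" using u \<delta>1 by (intro mult_right_mono) auto
  moreover have "\<delta> * (u - r) = \<delta> * u - \<delta> * r" by (rule right_diff_distrib)
  ultimately have "- (rate k * (u - r)) - \<delta> * r \<le> - (\<delta> * u) - (u - r) / 2"
   by linarith
  then have 2: "exp (- (rate k * (u - r))) * exp (- (\<delta> * r)) \<le> exp (- (\<delta> * u)) * exp (- ((u - r) / 2))"
   unfolding exp_add[symmetric] by simp
  have "norm (of_real (exp (- (rate k * (u - r)))) * \<phi> k (at_Y (sg s * r) x))
    \<le> exp (- (rate k * (u - r))) * (C / (1 + freq k) ^ n * exp (- (\<delta> * r)))"
   unfolding norm_mult using 1 by (intro mult_mono) auto
  also have "\<dots> = C / (1 + freq k) ^ n * (exp (- (rate k * (u - r))) * exp (- (\<delta> * r)))"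
   by simp
  also have "\<dots> \<le> C / (1 + freq k) ^ n * (exp (- (\<delta> * u)) * exp (- ((u - r) / 2)))"
   using C(1) by (intro mult_left_mono 2) auto
  finally show "norm (of_real (exp (- (rate k * (sg s * Y_of x - r)))) * \<phi> k (at_Y (sg s * r) x))
    \<le> C / (1 + freq k) ^ n * decay s \<delta> x * exp (- ((sg s * Y_of x - r) / 2))"
   by (simp add: u_def decay_alt mult.assoc)
 qed
qed

lemma segment_continuous:
 assumes p: "rapid T s \<delta> (\<phi> :: int => pt6 => complex)" and x: "x \<in> dom6 T s"
 shows "continuous_on {0..} (%r. \<phi> k (at_Y (sg s * r) x))"
 unfolding segment_eq using ray_continuous[OF p at_Y0_dom6[OF x]] .

lemma forward_integrable:
 assumes p: "rapid T s \<delta> (\<phi> :: int => pt6 => complex)" and x: "x \<in> dom6 T s"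
 shows "set_integrable lborel {0..u} (%r. of_real (exp (- (rate k * (c - r)))) * \<phi> k (at_Y (sg s * r) x))"
 unfolding set_integrable_def
 by (intro borel_integrable_compact continuous_intros continuous_on_subset[OF segment_continuous[OF p x]]) auto

lemma has_partial_forward:
 assumes p: "rapid T s \<delta> (\<phi> :: int => pt6 => complex)" and p': "rapid T s \<delta> \<phi>'"
  and der: "partial6 T s b (\<phi> k) (\<phi>' k)" and b: "b \<in> Basis" "b \<noteq> e_Y"
 shows "partial6 T s b (forward s \<phi> k) (forward s \<phi>' k)"
proof -
 define \<kappa> :: "real => pt6 => complex"
  where "\<kappa> r x = (if r \<in> {0..sg s * Y_of x} then of_real (exp (- (rate k * (sg s * Y_of x - r)))) else 0)" for r x
 have fw: "forward s \<psi> k x = (LINT r|lborel. \<kappa> r x * \<psi> k (at_Y (sg s * r) x))" for \<psi> x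
  unfolding forward_def set_lebesgue_integral_def
  by (intro Bochner_Integration.integral_cong) (auto simp: \<kappa>_def indicator_def)
 have int: "integrable lborel (%r. \<kappa> r x * \<psi> k (at_Y (sg s * r) x))" if "rapid T s \<delta> \<psi>" "x \<in> dom6 T s" for \<psi> x
 proof -
  have "(%r. \<kappa> r x * \<psi> k (at_Y (sg s * r) x)) = (%r. indicat_real {0..sg s * Y_of x} r *\<^sub>R
    (of_real (exp (- (rate k * (sg s * Y_of x - r)))) * \<psi> k (at_Y (sg s * r) x)))"
   by (auto simp: \<kappa>_def indicator_def)
  then show ?thesis
   using forward_integrable[OF that] by (simp only: set_integrable_def)
 qed
 obtain C where C: "C \<ge> 0" "!!k x r. x \<in> dom6 T s ==> 0 \<le> r ==>
   (1 + freq k) ^ 0 * norm (\<phi>' k (ray s x r)) \<le> C * decay s \<delta> x * exp (- (\<delta> * r))"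
  using ray_bound[OF p'] by metis
 have "partial6 T s b (%x. LINT r|lborel. \<kappa> r x * \<phi> k (at_Y (sg s * r) x))
   (%x. LINT r|lborel. \<kappa> r x * \<phi>' k (at_Y (sg s * r) x))"
 proof (rule has_partial_integral[OF box6[OF T \<delta>0]])
  fix r :: real
  show "partial6 T s b (%x. \<kappa> r x * \<phi> k (at_Y (sg s * r) x)) (%x. \<kappa> r x * \<phi>' k (at_Y (sg s * r) x))"
  proof (cases "0 \<le> r")
   case True
   have 1: "partial6 T s b (%x. \<phi> k (at_Y (sg s * r) x)) (%x. 1 *\<^sub>R \<phi>' k (at_Y (sg s * r) x))"
    by (rule has_partial_compose[OF der]) (use True in \<open>auto simp: at_Y_add_Basis b at_Y_dom6\<close>)
   have 2: "partial6 T s b (\<kappa> r) (%_. 0)"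
   proof -
    have "\<kappa> r (x + h *\<^sub>R b) = \<kappa> r x" for x h
     by (simp add: \<kappa>_def Y_of_add_Basis[OF b(1)] b(2))
    then show ?thesis unfolding has_partial_def by simp
   qed
   show ?thesis using has_partial_mult[OF 2 1] by simp
  next
   case False
   then show ?thesis by (simp add: \<kappa>_def has_partial_const)
  qed
 next
  fix x assume x: "x \<in> dom6 T s"
  show "integrable lborel (%r. \<kappa> r x * \<phi> k (at_Y (sg s * r) x))" using int[OF p x] .
  show "(%r. \<kappa> r x * \<phi>' k (at_Y (sg s * r) x)) \<in> borel_measurable lborel"
   using int[OF p' x] by (rule borel_measurable_integrable)
  fix r :: real
  show "norm (\<kappa> r x * \<phi>' k (at_Y (sg s * r) x)) \<le> C * (indicat_real {0..} r *\<^sub>R exp (- (\<delta> * r)))"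
  proof (cases "0 \<le> r")
   case True
   have "norm (\<kappa> r x * \<phi>' k (at_Y (sg s * r) x)) \<le> 1 * norm (\<phi>' k (at_Y (sg s * r) x))"
    unfolding norm_mult using rate_bounds(1)[of k] by (intro mult_right_mono) (auto simp: \<kappa>_def)
   also have "\<dots> \<le> C * exp (- (\<delta> * r))"
    using C(2)[OF at_Y0_dom6[OF x] True, of k] unfolding segment_eq by (simp add: decay_alt)
   finally show ?thesis using True by simp
  qed (auto simp: \<kappa>_def)
 next
  show "integrable lborel (%r. C * (indicat_real {0..} r *\<^sub>R exp (- (\<delta> * r))))"
   using set_integrable_exp_half[OF \<delta>] unfolding set_integrable_def by (rule integrable_mult_right)
 qed
 then show ?thesis by (simp only: fw[abs_def])
qed

lemma forward_ode:
 assumes p: "rapid T s \<delta> (\<phi> :: int => pt6 => complex)"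
 shows "partial6 T s e_Y (forward s \<phi> k)
   (%x. of_real (sg s) * (\<phi> k x - of_real (rate k) * forward s \<phi> k x))"
 unfolding has_partial_def
proof
 fix x assume x: "x \<in> dom6 T s"
 define \<sigma> where "\<sigma> = sg s"
 define u where "u = \<sigma> * Y_of x"
 define S where "S = {h. x + h *\<^sub>R e_Y \<in> dom6 T s}"
 define g :: "real => complex" where "g r = of_real (exp (rate k * r)) * \<phi> k (at_Y (\<sigma> * r) x)" for r
 define E :: "real => complex" where "E h = of_real (exp (- (rate k * (u + \<sigma> * h))))" for h
 have \<sigma>: "\<sigma> * \<sigma> = 1" by (simp add: \<sigma>_def)
 have u0: "0 \<le> u" using Y_of_dom6[OF x] by (simp add: u_def \<sigma>_def)
 have gc: "continuous_on {0..} g"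
  unfolding g_def \<sigma>_def by (intro continuous_intros segment_continuous[OF p x])
 have Y: "\<sigma> * Y_of (x + h *\<^sub>R e_Y) = u + \<sigma> * h" for h
  by (simp add: Y_of_shift u_def distrib_left)
 have Sle: "0 \<le> u + \<sigma> * h" if "h \<in> S" for h
  using that Y_of_dom6[of "x + h *\<^sub>R e_Y" T s] Y[of h] by (simp add: S_def \<sigma>_def)
 have fw: "forward s \<phi> k (x + h *\<^sub>R e_Y) = E h * integral {0..u + \<sigma> * h} g" for h
 proof -
  have si: "set_integrable lborel {0..u + \<sigma> * h} g"
   unfolding set_integrable_def by (intro borel_integrable_compact continuous_on_subset[OF gc]) auto
  have "forward s \<phi> k (x + h *\<^sub>R e_Y) = (LINT r:{0..u + \<sigma> * h}|lborel. E h * g r)"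
   unfolding forward_def Y[unfolded \<sigma>_def] \<sigma>_def
   by (intro set_lebesgue_integral_cong)
     (auto simp: E_def g_def \<sigma>_def exp_add[symmetric] of_real_mult[symmetric] algebra_simps simp del: of_real_mult)
  also have "\<dots> = E h * integral {0..u + \<sigma> * h} g"
   using set_borel_integral_eq_integral(2)[OF si] by simp
  finally show ?thesis .
 qed
 have H: "((%v. integral {0..v} g) has_vector_derivative g u) (at u within {0..})"
 proof -
  have "((%v. integral {0..v} g) has_vector_derivative g u) (at u within {0..u+1})"
   using u0 by (intro integral_has_vector_derivative continuous_on_subset[OF gc]) auto
  moreover have "at u within {0..} = at u within {0..u+1}"
   by (rule at_within_nhd[of _ "{..<u+1}"]) (use u0 in auto)
  ultimately show ?thesis by simp
 qed
 have lin: "((%h. u + \<sigma> * h) has_vector_derivative \<sigma>) (at 0 within S)"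
  by (auto intro!: derivative_eq_intros simp: has_real_derivative_iff_has_vector_derivative[symmetric])
 have sub: "(%h. u + \<sigma> * h) ` S \<subseteq> {0..}" using Sle by auto
 have dI: "((%h. integral {0..u + \<sigma> * h} g) has_vector_derivative \<sigma> *\<^sub>R g u) (at 0 within S)"
  using vector_diff_chain_within[OF lin, of "%v. integral {0..v} g" "g u"]
   has_vector_derivative_within_subset[OF H sub] by (simp add: o_def)
 have dE: "(E has_vector_derivative of_real (- (\<sigma> * rate k)) * E 0) (at 0 within S)"
 proof -
  have "((%h. exp (- (rate k * (u + \<sigma> * h)))) has_real_derivative - (\<sigma> * rate k) * exp (- (rate k * (u + \<sigma> * 0)))) (at 0 within S)"
   by (auto intro!: derivative_eq_intros)
  then show ?thesis unfolding E_def of_real_mult[symmetric]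
   by (intro has_vector_derivative_of_real) (simp add: has_real_derivative_iff_has_vector_derivative)
 qed
 have "E 0 * g u = \<phi> k x"
 proof -
  have "\<sigma> * u = Y_of x" using \<sigma> by (simp add: u_def mult.assoc[symmetric])
  then have "g u = of_real (exp (rate k * u)) * \<phi> k x" by (simp add: g_def)
  then show ?thesis
   by (simp add: E_def mult.assoc[symmetric] of_real_mult[symmetric] exp_add[symmetric] del: of_real_mult)
 qed
 moreover have "forward s \<phi> k x = E 0 * integral {0..u} g" using fw[of 0] by simp
 ultimately have "of_real \<sigma> * (\<phi> k x - of_real (rate k) * forward s \<phi> k x)
   = E 0 * (\<sigma> *\<^sub>R g u) + of_real (- (\<sigma> * rate k)) * E 0 * integral {0..u + \<sigma> * 0} g"
  by (simp add: scaleR_conv_of_real algebra_simps)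
 then show "((%h. forward s \<phi> k (x + h *\<^sub>R e_Y)) has_vector_derivative
   of_real (sg s) * (\<phi> k x - of_real (rate k) * forward s \<phi> k x)) (at 0 within {h. x + h *\<^sub>R e_Y \<in> dom6 T s})"
  unfolding fw S_def[symmetric] \<sigma>_def[symmetric]
  using has_vector_derivative_mult[OF dE dI] by simp
qed

lemma forward_bound:
 assumes p: "rapid T s \<delta> (\<phi> :: int => pt6 => complex)" and \<delta>1: "\<delta> \<le> 1 / 2"
 obtains C where "C \<ge> 0" "!!k x. x \<in> dom6 T s ==>
   (1 + freq k) ^ n * norm (forward s \<phi> k x) \<le> C * decay s \<delta> x"
proof -
 obtain C where C: "C \<ge> 0" "!!k x r. x \<in> dom6 T s ==> 0 \<le> r ==> r \<le> sg s * Y_of x ==>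
   norm (of_real (exp (- (rate k * (sg s * Y_of x - r)))) * \<phi> k (at_Y (sg s * r) x))
    \<le> C / (1 + freq k) ^ n * decay s \<delta> x * exp (- ((sg s * Y_of x - r) / 2))"
  using forward_integrand_bound[OF p \<delta>1] by metis
 have "(1 + freq k) ^ n * norm (forward s \<phi> k x) \<le> (C * 2) * decay s \<delta> x" if x: "x \<in> dom6 T s" for k x
 proof -
  define u where "u = sg s * Y_of x"
  define A where "A = C / (1 + freq k) ^ n * decay s \<delta> x"
  have A0: "A \<ge> 0" using C(1) by (simp add: A_def decay_alt)
  let ?g = "%r. of_real (exp (- (rate k * (u - r)))) * \<phi> k (at_Y (sg s * r) x)"
  have u0: "0 \<le> u" using Y_of_dom6[OF x] by (simp add: u_def)
  have "norm (forward s \<phi> k x) = norm (integral {0..u} ?g)"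
   unfolding forward_def u_def[symmetric]
   using set_borel_integral_eq_integral(2)[OF forward_integrable[OF p x]] by simp
  also have "\<dots> \<le> integral {0..u} (%r. A * exp (- ((u - r) / 2)))"
  proof (rule integral_norm_bound_integral)
   show "?g integrable_on {0..u}"
    using set_borel_integral_eq_integral(1)[OF forward_integrable[OF p x]] .
   show "(%r. A * exp (- ((u - r) / 2))) integrable_on {0..u}"
    by (intro integrable_continuous_real continuous_intros) auto
   show "norm (?g r) \<le> A * exp (- ((u - r) / 2))" if "r \<in> {0..u}" for r
    using C(2)[OF x, of r k] that by (simp add: u_def A_def)
  qed
  also have "\<dots> = A * (2 - 2 * exp (- (u / 2)))"
  proof -
   have "((%r. A * exp (- ((u - r) / 2))) has_integral (2 * A * exp (- ((u - u) / 2)) - 2 * A * exp (- ((u - 0) / 2)))) {0..u}"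
   proof (rule fundamental_theorem_of_calculus[OF u0])
    have "((%r. 2 * A * exp (- ((u - r) / 2))) has_real_derivative A * exp (- ((u - r) / 2))) (at r within {0..u})" for r
     by (rule derivative_eq_intros refl | simp)+
    then show "((%r. 2 * A * exp (- ((u - r) / 2))) has_vector_derivative A * exp (- ((u - r) / 2))) (at r within {0..u})" for r
     by (simp only: has_real_derivative_iff_has_vector_derivative)
   qed
   then have "integral {0..u} (%r. A * exp (- ((u - r) / 2))) = 2 * A * exp (- ((u - u) / 2)) - 2 * A * exp (- ((u - 0) / 2))"
    by (rule integral_unique)
   also have "\<dots> = A * (2 - 2 * exp (- (u / 2)))" by (simp add: algebra_simps)
   finally show ?thesis .
  qed
  also have "\<dots> \<le> A * 2" using A0 by (intro mult_left_mono) auto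
  finally have "(1 + freq k) ^ n * norm (forward s \<phi> k x) \<le> (1 + freq k) ^ n * (A * 2)"
   by (intro mult_left_mono) auto
  also have "\<dots> = (C * 2) * decay s \<delta> x" by (simp add: A_def)
  finally show ?thesis .
 qed
 then show ?thesis using that[of "C * 2"] C(1) by auto
qed

lemma forward_cmult:
 "forward s (%k x. a k * \<phi> k x) k x = a k * forward s \<phi> k x"
 unfolding forward_def by (subst set_integral_mult_right[symmetric]) (simp add: mult_ac)

text \<open>The normal derivative of a forward integral is a forward integral plus a multiple of the
 integrand, so the class closed under differentiation consists of sums of the two kinds.\<close>

lemma rapid_forward:
 assumes "rapid T s \<delta> \<phi>" and \<delta>1: "\<delta> \<le> 1 / 2"
 shows "rapid T s \<delta> (forward s \<phi>)"
proof (rule smooth_family_closed[where Q = "%\<zeta>. \<exists>\<phi> \<psi>. rapid T s \<delta> \<phi> \<and> rapid T s \<delta> \<psi> \<and> \<zeta> = (%k x. forward s \<phi> k x + \<psi> k x)"])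
 have "rapid T s \<delta> (%k x. 0 * \<phi> k x)"
  by (rule rapid_multiplier[OF T \<delta>0 assms(1), of "%_. 0" 0 0]) auto
 then show "\<exists>\<phi>' \<psi>. rapid T s \<delta> \<phi>' \<and> rapid T s \<delta> \<psi> \<and> forward s \<phi> = (%k x. forward s \<phi>' k x + \<psi> k x)"
  using assms(1) by (intro exI[of _ \<phi>] exI[of _ "%k x. 0 * \<phi> k x"]) auto
next
 fix \<zeta> and n :: nat
 assume "\<exists>\<phi> \<psi>. rapid T s \<delta> \<phi> \<and> rapid T s \<delta> \<psi> \<and> \<zeta> = (%k x. forward s \<phi> k x + \<psi> k x)"
 then obtain \<phi> \<psi> where p: "rapid T s \<delta> \<phi>" "rapid T s \<delta> \<psi>" "\<zeta> = (%k x. forward s \<phi> k x + \<psi> k x)" by blast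
 obtain C where C: "!!k x. x \<in> dom6 T s ==> (1 + freq k) ^ n * norm (forward s \<phi> k x) \<le> C * decay s \<delta> x"
  using forward_bound[OF p(1) \<delta>1] by metis
 obtain C' where C': "!!k x. x \<in> dom6 T s ==> (1 + freq k) ^ n * norm (\<psi> k x) \<le> C' * decay s \<delta> x"
  using smooth_family_bound[OF p(2) weight6[OF T \<delta>0]] by metis
 have "(1 + freq k) ^ n * norm (\<zeta> k x) \<le> (C + C') * decay s \<delta> x" if x: "x \<in> dom6 T s" for k x
 proof -
  have "(1 + freq k) ^ n * norm (\<zeta> k x) \<le> (1 + freq k) ^ n * (norm (forward s \<phi> k x) + norm (\<psi> k x))"
   unfolding p(3) by (intro mult_left_mono norm_triangle_ineq) auto
  then show ?thesis using C[OF x, of k] C'[OF x, of k] by (simp add: distrib_left distrib_right)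
 qed
 then show "\<exists>C. \<forall>i. \<forall>x\<in>dom6 T s. (1 + freq i) ^ n * norm (\<zeta> i x) \<le> C * decay s \<delta> x" by blast
next
 fix \<zeta> p i x assume "\<exists>\<phi> \<psi>. rapid T s \<delta> \<phi> \<and> rapid T s \<delta> \<psi> \<and> \<zeta> = (%k x. forward s \<phi> k x + \<psi> k x)"
  and px: "p \<in> per6" "x \<in> dom6 T s"
 then obtain \<phi> \<psi> where p: "rapid T s \<delta> \<phi>" "rapid T s \<delta> \<psi>" "\<zeta> = (%k x. forward s \<phi> k x + \<psi> k x)" by blast
 have Y: "Y_of (x + p) = Y_of x" using px(1) by (cases x) (auto simp: Y_of_def per6_def)
 have "at_Y r (x + p) = at_Y r x + p" for r using px(1) by (cases x) (auto simp: at_Y_def per6_def)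
 then have "\<phi> i (at_Y (sg s * r) (x + p)) = \<phi> i (at_Y (sg s * r) x)" if "0 \<le> r" for r
  using smooth_family_periodic[OF p(1) px(1)] at_Y_dom6[OF px(2)] that by simp
 then have "forward s \<phi> i (x + p) = forward s \<phi> i x"
  unfolding forward_def Y by (intro set_lebesgue_integral_cong) auto
 then show "\<zeta> i (x + p) = \<zeta> i x"
  unfolding p(3) using smooth_family_periodic[OF p(2) px] by simp
next
 fix \<zeta> and b :: pt6 assume "\<exists>\<phi> \<psi>. rapid T s \<delta> \<phi> \<and> rapid T s \<delta> \<psi> \<and> \<zeta> = (%k x. forward s \<phi> k x + \<psi> k x)"
  and b: "b \<in> Basis"
 then obtain \<phi> \<psi> where p: "rapid T s \<delta> \<phi>" "rapid T s \<delta> \<psi>" "\<zeta> = (%k x. forward s \<phi> k x + \<psi> k x)" by blast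
 obtain \<phi>' where d: "rapid T s \<delta> \<phi>'" "!!i. partial6 T s b (\<phi> i) (\<phi>' i)"
  using smooth_family_deriv[OF p(1) b] by metis
 obtain \<psi>' where d': "rapid T s \<delta> \<psi>'" "!!i. partial6 T s b (\<psi> i) (\<psi>' i)"
  using smooth_family_deriv[OF p(2) b] by metis
 show "\<exists>\<zeta>'. (\<exists>\<phi> \<psi>. rapid T s \<delta> \<phi> \<and> rapid T s \<delta> \<psi> \<and> \<zeta>' = (%k x. forward s \<phi> k x + \<psi> k x)) \<and>
   (\<forall>i. partial6 T s b (\<zeta> i) (\<zeta>' i))"
 proof (cases "b = e_Y")
  case False
  then have "partial6 T s b (\<zeta> i) (%x. forward s \<phi>' i x + \<psi>' i x)" for i
   unfolding p(3) using b by (intro has_partial_add has_partial_forward[OF p(1) d] d') auto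
  then show ?thesis using d(1) d'(1) by (intro exI[of _ "%k x. forward s \<phi>' k x + \<psi>' k x"]) auto
 next
  case True
  define \<phi>2 where "\<phi>2 = (%k x. of_real (- (sg s * rate k)) * \<phi> k x)"
  define \<psi>2 where "\<psi>2 = (%k x. of_real (sg s) * \<phi> k x + \<psi>' k x)"
  have 1: "rapid T s \<delta> \<phi>2"
   unfolding \<phi>2_def by (rule rapid_multiplier[OF T \<delta>0 p(1), of _ 1 1])
    (use rate_bounds in \<open>auto simp: norm_mult abs_mult intro: order_trans[OF _ rate_bounds(3)]\<close>)
  have 2: "rapid T s \<delta> \<psi>2"
   unfolding \<psi>2_def by (intro smooth_family_add[OF rapid_multiplier[OF T \<delta>0 p(1), of _ 1 0] d'(1) weight6[OF T \<delta>0]]) auto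
  have "partial6 T s b (\<zeta> i) (%x. forward s \<phi>2 i x + \<psi>2 i x)" for i
  proof -
   have "(%x. forward s \<phi>2 i x + \<psi>2 i x)
     = (%x. of_real (sg s) * (\<phi> i x - of_real (rate i) * forward s \<phi> i x) + \<psi>' i x)"
    unfolding \<phi>2_def \<psi>2_def forward_cmult by (simp add: fun_eq_iff algebra_simps)
   then show ?thesis
    unfolding p(3) True using has_partial_add[OF forward_ode[OF p(1)] d'(2)[unfolded True]] by simp
  qed
  then show ?thesis using 1 2 by (intro exI[of _ "%k x. forward s \<phi>2 k x + \<psi>2 k x"]) auto
 qed
qed

lemma forward_at_theta:
 assumes "!!k r x. \<phi> k (at_theta r x) = \<phi> k x"
 shows "forward s \<phi> k (at_theta r x) = forward s \<phi> k x"
 unfolding forward_def using assms by (simp add: at_theta_at_Y[symmetric])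

lemma forward_at_Y0: "forward s \<phi> k (at_Y 0 x) = 0"
proof -
 have "(LINT r:{0}|lborel. f r) = 0" for f :: "real => complex"
  unfolding set_lebesgue_integral_def
  by (rule integral_eq_zero_AE) (use AE_lborel_singleton[of 0] in \<open>auto elim: eventually_mono\<close>)
 then show ?thesis by (simp add: forward_def)
qed

lemma poisson_at_theta:
 assumes "!!k r x. \<phi> k (at_theta r x) = \<phi> k x"
 shows "poisson s \<phi> k (at_theta r x) = poisson s \<phi> k x"
 unfolding poisson_def using assms by simp

end

section \<open>Inverting the fast derivative on functions of mean zero\<close>

abbreviation cplx :: "(pt6 => real) => pt6 => complex" where
 "cplx f \<equiv> %x. of_real (f x)"

definition mean :: "(pt6 => real) => pt6 => real" where
 "mean f x = Re (coef (cplx f) 0 x)"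

text \<open>The Fourier multiplier \<open>1 / (\<i> k)\<close>; its value for \<open>k = 0\<close>
 is zero, which selects the primitive of mean zero.\<close>

definition theta_prim :: "(pt6 => real) => pt6 => real" where
 "theta_prim f x = Re (\<Sum>\<^sub>\<infinity>k. modulate (%k x. inverse (\<i> * of_int k) * coef (cplx f) k x) k x)"

lemma i_int_inverse:
 "\<i> * of_int k * (inverse (\<i> * of_int k) * z) = (if k = 0 then 0 else z)"
 "inverse (\<i> * of_int k) * (\<i> * of_int k * z) = (if k = 0 then 0 else z)"
proof -
 have "a \<noteq> 0 ==> a * (inverse a * z) = z" "a \<noteq> 0 ==> inverse a * (a * z) = z" for a :: complex
  by simp_all
 from this[of "\<i> * of_int k"]
 show "\<i> * of_int k * (inverse (\<i> * of_int k) * z) = (if k = 0 then 0 else z)"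
  "inverse (\<i> * of_int k) * (\<i> * of_int k * z) = (if k = 0 then 0 else z)"
  by auto
qed

lemma coef_cnj_real: "coef (cplx f) (- k) x = cnj (coef (cplx f) k x)"
 using cfour_cnj[of "%r. of_real (f (at_theta r x))" "- k"] by (simp add: coef_def)

lemma coef_mean: "coef (cplx f) 0 x = of_real (mean f x)"
 using coef_cnj_real[of f 0 x] by (simp add: mean_def complex_eq_iff)

lemma mean_at_theta [simp]: "mean f (at_theta r x) = mean f x"
 by (simp add: mean_def)

lemma theta_free_coef:
 assumes "!!r x. f (at_theta r x) = f x"
 shows "coef f k x = (if k = 0 then f x else 0)"
 unfolding coef_def assms by (rule cfour_const)

lemma theta_free_mean:
 assumes "!!r x. f (at_theta r x) = f x"
 shows "mean f x = f x"
proof -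
 have "coef (cplx f) 0 x = of_real (f x)"
  by (subst theta_free_coef) (simp_all add: assms)
 then show ?thesis by (simp add: mean_def)
qed

lemma has_partial_cplx:
 assumes "has_partial D b f f'"
 shows "has_partial D b (cplx f) (cplx f')"
 using has_partial_linear[OF bounded_linear_of_real assms] .

lemma has_partial_Re:
 assumes "has_partial D b f f'"
 shows "has_partial D b (%x. Re (f x)) (%x. Re (f' x))"
 using has_partial_linear[OF bounded_linear_Re assms] .

lemma has_partial_Im:
 assumes "has_partial D b f f'"
 shows "has_partial D b (%x. Im (f x)) (%x. Im (f' x))"
 using has_partial_linear[OF bounded_linear_Im assms] .

lemma mean_at_Y:
 assumes "!!x. f (at_Y r x) = f x"
 shows "mean f (at_Y r x) = mean f x"
 unfolding mean_def coef_def at_theta_at_Y assms ..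

lemma theta_prim_at_Y:
 assumes "!!x. f (at_Y r x) = f x"
 shows "theta_prim f (at_Y r x) = theta_prim f x"
 unfolding theta_prim_def modulate_def coef_def at_theta_at_Y assms by simp

context
 fixes T :: real and s :: side and \<delta> :: real
 assumes T: "T > 0" and \<delta>0: "\<delta> \<ge> 0"
begin

lemmas box7 = box6[OF T \<delta>0, of s]
lemmas weight7 = weight6[OF T \<delta>0, of s]

lemma smooth6_cplx:
 assumes "smooth6 T s \<delta> f"
 shows "smooth6 T s \<delta> (cplx f)"
 using smooth_fun_linear[OF bounded_linear_of_real assms weight7] .

lemma smooth6_Re:
 assumes "smooth6 T s \<delta> f"
 shows "smooth6 T s \<delta> (%x. Re (f x))"
 using smooth_fun_linear[OF bounded_linear_Re assms weight7] .

lemma smooth6_Im: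
 assumes "smooth6 T s \<delta> f"
 shows "smooth6 T s \<delta> (%x. Im (f x))"
 using smooth_fun_linear[OF bounded_linear_Im assms weight7] .

lemma smooth6_add:
 assumes "smooth6 T s \<delta> f" "smooth6 T s \<delta> g"
 shows "smooth6 T s \<delta> (%x. f x + g x)"
 using smooth_family_add[OF assms weight7] .

lemma smooth6_cmult:
 fixes c :: "'a::real_normed_algebra"
 assumes "smooth6 T s \<delta> f"
 shows "smooth6 T s \<delta> (%x. c * f x)"
 using smooth_fun_linear[OF bounded_linear_mult_right assms weight7] .

lemma rapid_component:
 assumes "rapid T s \<delta> \<phi>"
 shows "smooth6 T s \<delta> (\<phi> k)"
 by (rule smooth_family_linear[OF assms weight7, where L = "%_ v. v" and j = "%_::unit. k" and A = 1 and N = 0])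
   (auto intro: bounded_linear_ident)

lemma smooth6_mean:
 assumes "smooth6 T s \<delta> f"
 shows "smooth6 T s \<delta> (mean f)"
 unfolding mean_def[abs_def]
 by (intro smooth6_Re rapid_component rapid_coef[OF T \<delta>0] smooth6_cplx assms)

lemma mean_e_theta: "partial6 T s e_theta (mean f) (%_. 0)"
 by (rule theta_free_has_partial) simp

lemma has_partial_mean:
 assumes "smooth6 T s \<delta> f" "smooth6 T s \<delta> f'" "partial6 T s b f f'" "b \<in> Basis" "b \<noteq> e_theta"
 shows "partial6 T s b (mean f) (mean f')"
 unfolding mean_def[abs_def]
 by (intro has_partial_Re has_partial_coef[OF T \<delta>0] smooth6_cplx has_partial_cplx assms)

lemma mean_theta_derivative:
 assumes "smooth6 T s \<delta> f" "smooth6 T s \<delta> f'" "partial6 T s e_theta f f'" "x \<in> dom6 T s"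
 shows "mean f' x = 0"
 unfolding mean_def
 using coef_theta[OF T \<delta>0 smooth6_cplx[OF assms(1)] smooth6_cplx[OF assms(2)] has_partial_cplx[OF assms(3)] assms(4), of 0]
 by simp

lemma mean_add:
 assumes "smooth6 T s \<delta> f" "smooth6 T s \<delta> g" "x \<in> dom6 T s"
 shows "mean (%x. f x + g x) x = mean f x + mean g x"
 unfolding mean_def
 using coef_add[OF T \<delta>0 smooth6_cplx[OF assms(1)] smooth6_cplx[OF assms(2)] assms(3), of 0] by simp

lemma mean_cmult: "mean (%x. c * f x) x = c * mean f x"
 unfolding mean_def using coef_cmult[of "of_real c" "cplx f" 0 x] by simp

text \<open>A family without dependence on the fast variable is a family of Fourier coefficients: its
 sum is differentiated in the fast variable by multiplying the coefficients.\<close>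

lemma has_partial_synthesis:
 assumes p: "rapid T s \<delta> \<phi>" and free: "!!k r x. \<phi> k (at_theta r x) = \<phi> k x"
 shows "partial6 T s e_theta (%x. \<Sum>\<^sub>\<infinity>k. modulate \<phi> k x)
   (%x. \<Sum>\<^sub>\<infinity>k. modulate (%k x. \<i> * of_int k * \<phi> k x) k x)"
proof (rule has_partial_infsum[OF T \<delta>0])
 show "rapid T s \<delta> (modulate \<phi>)" by (rule rapid_modulate[OF T \<delta>0 p])
 show "rapid T s \<delta> (modulate (%k x. \<i> * of_int k * \<phi> k x))"
  by (intro rapid_modulate[OF T \<delta>0] rapid_multiplier[OF T \<delta>0 p, where A = 1 and N = 1]) (auto simp: norm_mult)
 show "partial6 T s e_theta (modulate \<phi> k) (modulate (%k x. \<i> * of_int k * \<phi> k x) k)" for k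
  using has_partial_modulate[OF T \<delta>0, where b = e_theta and \<phi> = \<phi> and k = k and \<phi>' = "%_ _. 0"] theta_free_has_partial[of "\<phi> k"] free by simp
qed

lemma has_partial_synthesis_normal:
 assumes p: "rapid T s \<delta> \<phi>" "rapid T s \<delta> \<phi>'" and b: "b \<in> Basis" "b \<noteq> e_theta"
  and der: "!!k. partial6 T s b (\<phi> k) (\<phi>' k)"
 shows "partial6 T s b (%x. \<Sum>\<^sub>\<infinity>k. modulate \<phi> k x) (%x. \<Sum>\<^sub>\<infinity>k. modulate \<phi>' k x)"
proof (rule has_partial_infsum[OF T \<delta>0])
 show "rapid T s \<delta> (modulate \<phi>)" "rapid T s \<delta> (modulate \<phi>')" by (rule rapid_modulate[OF T \<delta>0 p(1)], rule rapid_modulate[OF T \<delta>0 p(2)])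
 show "partial6 T s b (modulate \<phi> k) (modulate \<phi>' k)" for k
  using has_partial_modulate[OF T \<delta>0 _ b(1), where \<phi> = \<phi> and k = k and \<phi>' = \<phi>'] der b(2) by simp
qed

lemma smooth6_synthesis: "rapid T s \<delta> \<phi> ==> smooth6 T s \<delta> (%x. \<Sum>\<^sub>\<infinity>k. modulate \<phi> k x)"
 by (intro smooth6_infsum[OF T \<delta>0] rapid_modulate[OF T \<delta>0])

lemma synthesis_has_sum:
 assumes "rapid T s \<delta> \<phi>" "x \<in> dom6 T s"
 shows "((%k. modulate \<phi> k x) has_sum (\<Sum>\<^sub>\<infinity>k. modulate \<phi> k x)) UNIV"
 using rapid_abs_summable[OF T \<delta>0 rapid_modulate[OF T \<delta>0 assms(1)]] assms(2) has_sum_infsum by metis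

lemma synthesis_mean_zero:
 assumes p: "rapid T s \<delta> \<phi>" and free: "!!k r x. \<phi> k (at_theta r x) = \<phi> k x"
  and zero: "!!x. \<phi> 0 x = 0" and x: "x \<in> dom6 T s"
 shows "coef (%x. \<Sum>\<^sub>\<infinity>k. modulate \<phi> k x) 0 x = 0"
proof -
 define \<psi> where "\<psi> = (%k x. inverse (\<i> * of_int k) * \<phi> k x)"
 have 1: "rapid T s \<delta> \<psi>"
  unfolding \<psi>_def by (rule rapid_multiplier[OF T \<delta>0 p, where A = 1 and N = 0]) (auto simp: norm_mult norm_inverse inverse_le_1_iff)
 have 2: "(%k x. \<i> * of_int k * \<psi> k x) = \<phi>"
  unfolding \<psi>_def i_int_inverse by (intro ext) (simp add: zero)
 have "partial6 T s e_theta (%x. \<Sum>\<^sub>\<infinity>k. modulate \<psi> k x) (%x. \<Sum>\<^sub>\<infinity>k. modulate \<phi> k x)"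
  using has_partial_synthesis[OF 1] free unfolding 2 by (simp add: \<psi>_def)
 from coef_theta[OF T \<delta>0 smooth6_synthesis[OF 1] smooth6_synthesis[OF p] this x, of 0]
 show ?thesis by simp
qed

lemma inversion_without_mean:
 assumes f: "smooth6 T s \<delta> f" and x: "x \<in> dom6 T s"
 shows "((%k. modulate (%k x. (if k = 0 then 0 else 1) * coef f k x) k x) has_sum (f x - coef f 0 x)) UNIV"
proof -
 have 1: "((%k. if k = 0 then - coef f 0 x else 0) has_sum (- coef f 0 x)) (UNIV :: int set)"
  by (rule has_sum_finite_neutralI[of "{0}"]) auto
 have "(%k. modulate (%k x. (if k = 0 then 0 else 1) * coef f k x) k x)
   = (%k. modulate (coef f) k x + (if k = 0 then - coef f 0 x else 0))"
  by (auto simp: modulate_def fun_eq_iff)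
 then show ?thesis
  using has_sum_add[OF coef_inversion[OF T \<delta>0 f x] 1] by simp
qed

lemma rapid_prim:
 assumes "smooth6 T s \<delta> f"
 shows "rapid T s \<delta> (%k x. inverse (\<i> * of_int k) * coef (cplx f) k x)"
 by (rule rapid_multiplier[OF T \<delta>0 rapid_coef[OF T \<delta>0 smooth6_cplx[OF assms]], where A = 1 and N = 0])
   (auto simp: norm_mult norm_inverse inverse_le_1_iff)

lemma smooth6_theta_prim:
 assumes "smooth6 T s \<delta> f"
 shows "smooth6 T s \<delta> (theta_prim f)"
 unfolding theta_prim_def[abs_def] by (intro smooth6_Re smooth6_synthesis rapid_prim assms)

lemma theta_prim_e_theta:
 assumes f: "smooth6 T s \<delta> f"
 shows "partial6 T s e_theta (theta_prim f) (%x. f x - mean f x)"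
proof (rule has_partial_cong)
 show "partial6 T s e_theta (theta_prim f)
   (%x. Re (\<Sum>\<^sub>\<infinity>k. modulate (%k x. \<i> * of_int k * (inverse (\<i> * of_int k) * coef (cplx f) k x)) k x))"
  unfolding theta_prim_def[abs_def]
  by (intro has_partial_Re has_partial_synthesis rapid_prim f) simp
 fix x assume x: "x \<in> dom6 T s"
 have "modulate (%k x. \<i> * of_int k * (inverse (\<i> * of_int k) * coef (cplx f) k x)) k x
   = modulate (%k x. (if k = 0 then 0 else 1) * coef (cplx f) k x) k x" for k
  unfolding modulate_def i_int_inverse by simp
 then have "(\<Sum>\<^sub>\<infinity>k. modulate (%k x. \<i> * of_int k * (inverse (\<i> * of_int k) * coef (cplx f) k x)) k x)
   = of_real (f x) - coef (cplx f) 0 x"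
  using infsumI[OF inversion_without_mean[OF smooth6_cplx[OF f] x]] by simp
 then show "f x - mean f x = Re (\<Sum>\<^sub>\<infinity>k. modulate (%k x. \<i> * of_int k * (inverse (\<i> * of_int k) * coef (cplx f) k x)) k x)"
  by (simp add: mean_def)
qed auto

lemma has_partial_theta_prim:
 assumes f: "smooth6 T s \<delta> f" "smooth6 T s \<delta> f'" "partial6 T s b f f'" and b: "b \<in> Basis" "b \<noteq> e_theta"
 shows "partial6 T s b (theta_prim f) (theta_prim f')"
 unfolding theta_prim_def[abs_def]
 by (intro has_partial_Re has_partial_synthesis_normal rapid_prim f(1,2) b
   has_partial_linear[OF bounded_linear_mult_right] has_partial_coef[OF T \<delta>0] smooth6_cplx has_partial_cplx f(3))

lemma mean_theta_prim:
 assumes f: "smooth6 T s \<delta> f" and x: "x \<in> dom6 T s"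
 shows "mean (theta_prim f) x = 0"
proof -
 define \<psi> where "\<psi> = (%k x. inverse (\<i> * of_int k) * (inverse (\<i> * of_int k) * coef (cplx f) k x))"
 have 1: "rapid T s \<delta> \<psi>"
  unfolding \<psi>_def by (rule rapid_multiplier[OF T \<delta>0 rapid_prim[OF f], where A = 1 and N = 0]) (auto simp: norm_mult norm_inverse inverse_le_1_iff)
 have 2: "(%k x. \<i> * of_int k * \<psi> k x) = (%k x. inverse (\<i> * of_int k) * coef (cplx f) k x)"
  unfolding \<psi>_def i_int_inverse by (intro ext) simp
 have "partial6 T s e_theta (%x. Re (\<Sum>\<^sub>\<infinity>k. modulate \<psi> k x)) (theta_prim f)"
  unfolding theta_prim_def[abs_def] 2[symmetric]
  by (intro has_partial_Re has_partial_synthesis 1) (simp add: \<psi>_def)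
 from mean_theta_derivative[OF smooth6_Re[OF smooth6_synthesis[OF 1]] smooth6_theta_prim[OF f] this x]
 show ?thesis .
qed

lemma theta_prim_of_derivative:
 assumes f: "smooth6 T s \<delta> f" "smooth6 T s \<delta> f'" "partial6 T s e_theta f f'" and x: "x \<in> dom6 T s"
 shows "theta_prim f' x = f x - mean f x"
proof -
 have "((%k. modulate (%k x. inverse (\<i> * of_int k) * coef (cplx f') k x) k x) has_sum (of_real (f x) - coef (cplx f) 0 x)) UNIV"
 proof -
  have "modulate (%k x. inverse (\<i> * of_int k) * coef (cplx f') k x) k x
    = modulate (%k x. (if k = 0 then 0 else 1) * coef (cplx f) k x) k x" for k
   using coef_theta[OF T \<delta>0 smooth6_cplx[OF f(1)] smooth6_cplx[OF f(2)] has_partial_cplx[OF f(3)] x, of k]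
   unfolding modulate_def by (simp only: i_int_inverse) simp
  then show ?thesis using inversion_without_mean[OF smooth6_cplx[OF f(1)] x] by simp
 qed
 from infsumI[OF this] show ?thesis by (simp add: theta_prim_def mean_def)
qed

text \<open>Mixed derivatives in the normal and the fast variable commute, because both orders have the
 same Fourier coefficients.\<close>

lemma mixed_partials_commute:
 assumes sm: "smooth6 T s \<delta> f" "smooth6 T s \<delta> fY" "smooth6 T s \<delta> fth" "smooth6 T s \<delta> fYth" "smooth6 T s \<delta> fthY"
  and d: "partial6 T s e_Y f fY" "partial6 T s e_theta f fth"
   "partial6 T s e_theta fY fYth" "partial6 T s e_Y fth fthY"
  and x: "x \<in> dom6 T s"
 shows "fthY x = (fYth x :: real)"
proof -
 note c = smooth6_cplx
 have "coef (cplx fthY) k x = coef (cplx fYth) k x" for k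
 proof -
  have 1: "partial6 T s e_Y (coef (cplx fth) k) (coef (cplx fthY) k)"
   by (rule has_partial_coef[OF T \<delta>0 c[OF sm(3)] c[OF sm(5)] has_partial_cplx[OF d(4)]]) auto
  have "partial6 T s e_Y (coef (cplx f) k) (coef (cplx fY) k)"
   by (rule has_partial_coef[OF T \<delta>0 c[OF sm(1)] c[OF sm(2)] has_partial_cplx[OF d(1)]]) auto
  then have "partial6 T s e_Y (%x. \<i> * of_int k * coef (cplx f) k x) (%x. \<i> * of_int k * coef (cplx fY) k x)"
   by (rule has_partial_linear[OF bounded_linear_mult_right])
  then have 2: "partial6 T s e_Y (coef (cplx fth) k) (coef (cplx fYth) k)"
   by (rule has_partial_cong)
    (auto intro: coef_theta[OF T \<delta>0 c[OF sm(1)] c[OF sm(3)] has_partial_cplx[OF d(2)]]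
     coef_theta[OF T \<delta>0 c[OF sm(2)] c[OF sm(4)] has_partial_cplx[OF d(3)]])
  show ?thesis by (rule has_partial_unique[OF box7 Basis_e(1) 1 2 x])
 qed
 then have "cplx fthY x = cplx fYth x"
  by (rule coef_uniqueness[OF T \<delta>0 c[OF sm(5)] c[OF sm(4)] x])
 then show ?thesis by simp
qed

end

lemma smooth6_mono:
 assumes "smooth6 T s \<delta> f" "0 \<le> \<delta>'" "\<delta>' \<le> \<delta>"
 shows "smooth6 T s \<delta>' f"
proof (rule smooth_family_weaken[OF assms(1) weight_decay, where K = 1])
 show "0 \<le> \<delta>" using assms by simp
 show "decay s \<delta> x \<le> 1 * decay s \<delta>' x" if "x \<in> dom6 T s" for x
  using Y_of_dom6[OF that] assms(3) by (simp add: decay_alt mult_right_mono)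
qed

lemma smooth_at_Y0:
 assumes f: "smooth_family (dom6 T s) per6 \<nu> (decay s \<delta>) \<phi>" and \<delta>: "\<delta> \<ge> 0"
 shows "smooth_family (dom6 T s) per6 \<nu> (decay s 0) (%k x. \<phi> k (at_Y 0 x))"
proof (rule smooth_family_compose[OF f weight_decay[OF \<delta>], where c = "%b. if b = e_Y then 0 else 1" and B = "%b. b" and K = 1])
 show "at_Y 0 x \<in> dom6 T s" if "x \<in> dom6 T s" for x using that by (simp add: at_Y_dom6)
 show "at_Y 0 (x + h *\<^sub>R b) = at_Y 0 x + (h * (if b = e_Y then 0 else 1)) *\<^sub>R b" if "b \<in> Basis" for x h b
  using that at_Y_add_Basis[OF that, of 0 x h] by simp
 show "at_Y 0 (x + p) = at_Y 0 x \<or> (\<exists>p'\<in>per6. at_Y 0 (x + p) = at_Y 0 x + p')" if "p \<in> per6" "x \<in> dom6 T s" for p x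
  using that by (cases x) (auto simp: per6_def at_Y_def)
qed (auto simp: decay_alt)

section \<open>The Cauchy-Riemann system in a half strip\<close>

text \<open>In the complex unknown \<open>z = w + i sg s q\<close> the first-order system for \<open>w\<close> and \<open>q\<close> is the
 equation \<open>sg s * z\<^sub>Y + i * z\<^sub>th = M\<close>, whose Fourier coefficients satisfy
 \<open>sg s * z\<^sub>k' = k * z\<^sub>k + M\<^sub>k\<close>. For \<open>k > 0\<close> decay at infinity determines \<open>z\<^sub>k\<close>, for \<open>k < 0\<close> the
 boundary value is free, and it is used to prescribe the real part of \<open>z\<close> on the boundary.\<close>

lemma solve_cauchy_riemann:
 assumes T: "T > 0" and \<delta>: "\<delta> > 0" "\<delta> \<le> 1 / 2"
  and M: "smooth6 T s \<delta> M" and w0: "smooth6 T s 0 w0"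
 obtains z zY zth where "smooth6 T s \<delta> z" "smooth6 T s \<delta> zY" "smooth6 T s \<delta> zth"
  "partial6 T s e_Y z zY" "partial6 T s e_theta z zth"
  "!!x. x \<in> dom6 T s ==> of_real (sg s) * zY x + \<i> * zth x = M x - coef M 0 x"
  "!!x. x \<in> dom6 T s ==> coef z 0 x = 0"
  "!!x. x \<in> dom6 T s ==> Re (z (at_Y 0 x)) = w0 (at_Y 0 x) - mean w0 (at_Y 0 x)"
proof -
 have \<delta>0: "\<delta> \<ge> 0" and \<delta>1: "\<delta> \<le> 1" using \<delta> by auto
 note w\<delta> = weight7[OF T \<delta>0, of s]
 define m where "m = coef M"
 define \<beta> where "\<beta> = backward s m"
 define \<eta> where "\<eta> = (%k x. 2 * coef (cplx w0) k (at_Y 0 x) + cnj (\<beta> (- k) (at_Y 0 x)))"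
 define pos neg non :: "int => complex"
  where "pos k = (if k > 0 then - 1 else 0)" and "neg k = (if k < 0 then 1 else 0)"
   and "non k = (if k = 0 then 0 else 1)" for k
 define \<zeta> where "\<zeta> = (%k x. pos k * \<beta> k x + neg k * (poisson s \<eta> k x + forward s m k x))"
 define \<zeta>Y where "\<zeta>Y = (%k x. of_real (sg s) * of_int k * \<zeta> k x + of_real (sg s) * non k * m k x)"
 have rm: "rapid T s \<delta> m" unfolding m_def by (rule rapid_coef[OF T \<delta>0 M])
 have r\<beta>: "rapid T s \<delta> \<beta>" unfolding \<beta>_def by (rule rapid_backward[OF T \<delta>(1) rm])
 have r\<beta>': "rapid T s \<delta> (%k x. cnj (\<beta> (- k) x))"
  by (rule smooth_family_linear[OF r\<beta> w\<delta>, where L = "%_. cnj" and A = 1 and N = 0 and j = uminus])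
    (auto intro: bounded_linear_cnj)
 have r\<beta>0: "rapid T s 0 (%k x. cnj (\<beta> (- k) (at_Y 0 x)))"
  using smooth_at_Y0[OF r\<beta>' \<delta>0] .
 have rw: "rapid T s 0 (%k x. coef (cplx w0) k (at_Y 0 x))"
  by (rule smooth_at_Y0[OF rapid_coef[OF T order_refl smooth6_cplx[OF T order_refl w0]]]) simp
 have r\<eta>: "rapid T s 0 \<eta>"
  unfolding \<eta>_def
  by (intro smooth_family_add[OF rapid_multiplier[OF T order_refl rw, where A = 2 and N = 0] r\<beta>0 weight7[OF T order_refl]]) auto
 have r\<zeta>: "rapid T s \<delta> \<zeta>"
  unfolding \<zeta>_def
  by (intro smooth_family_add[OF _ _ w\<delta>] rapid_multiplier[OF T \<delta>0, where A = 1 and N = 0] r\<beta>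
     rapid_poisson[OF T \<delta>(1) r\<eta> \<delta>1] rapid_forward[OF T \<delta>(1) rm \<delta>(2)])
    (auto simp: pos_def neg_def)
 have r\<zeta>Y: "rapid T s \<delta> \<zeta>Y"
  unfolding \<zeta>Y_def
  by (intro smooth_family_add[OF rapid_multiplier[OF T \<delta>0 r\<zeta>, where A = 1 and N = 1] rapid_multiplier[OF T \<delta>0 rm, where A = 1 and N = 0] w\<delta>])
    (auto simp: norm_mult non_def)
 have fm: "m k (at_theta r x) = m k x" for k r x by (simp add: m_def)
 have f\<beta>: "\<beta> k (at_theta r x) = \<beta> k x" for k r x
  unfolding \<beta>_def by (rule backward_at_theta[OF T \<delta>(1) fm])
 have f\<eta>: "\<eta> k (at_theta r x) = \<eta> k x" for k r x
  by (simp add: \<eta>_def f\<beta> at_theta_at_Y[symmetric])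
 have f\<zeta>: "\<zeta> k (at_theta r x) = \<zeta> k x" for k r x
  unfolding \<zeta>_def using f\<beta> poisson_at_theta[OF T \<delta>(1), where \<phi> = \<eta>] forward_at_theta[OF T \<delta>(1), where \<phi> = m] f\<eta> fm by simp
 have \<zeta>0: "\<zeta> 0 x = 0" for x by (simp add: \<zeta>_def pos_def neg_def)
 have ode: "partial6 T s e_Y (\<zeta> k) (\<zeta>Y k)" for k
 proof -
  have 1: "partial6 T s e_Y (%x. pos k * \<beta> k x)
    (%x. pos k * (of_real (sg s) * (of_real (freq k) * \<beta> k x - m k x)))"
   unfolding \<beta>_def by (intro has_partial_linear[OF bounded_linear_mult_right] backward_ode[OF T \<delta>(1) rm])
  have "partial6 T s e_Y (\<eta> k) (%_. 0)"
   by (rule Y_free_has_partial) (simp add: \<eta>_def)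
  from has_partial_poisson[OF T \<delta>(1), where b = e_Y and \<phi> = \<eta> and k = k and \<phi>' = "%_ _. 0", OF this]
  have 2: "partial6 T s e_Y (poisson s \<eta> k) (%x. - of_real (sg s * rate k) * poisson s \<eta> k x)"
   by (simp add: poisson_def[abs_def] mult_ac)
  have 3: "partial6 T s e_Y (%x. neg k * (poisson s \<eta> k x + forward s m k x))
    (%x. neg k * (- of_real (sg s * rate k) * poisson s \<eta> k x
      + of_real (sg s) * (m k x - of_real (rate k) * forward s m k x)))"
   by (intro has_partial_linear[OF bounded_linear_mult_right] has_partial_add 2 forward_ode[OF T \<delta>(1) rm])
  have eq: "\<zeta>Y k x = pos k * (of_real (sg s) * (of_real (freq k) * \<beta> k x - m k x))
    + neg k * (- of_real (sg s * rate k) * poisson s \<eta> k x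
      + of_real (sg s) * (m k x - of_real (rate k) * forward s m k x))" for x
  proof -
   consider "k > 0" | "k < 0" | "k = 0" by linarith
   then show ?thesis
    by cases (simp_all add: \<zeta>Y_def \<zeta>_def pos_def neg_def non_def rate_nonzero algebra_simps)
  qed
  show ?thesis
   using has_partial_add[OF 1 3] by (rule has_partial_cong) (simp_all add: \<zeta>_def eq)
 qed
 define z where "z x = (\<Sum>\<^sub>\<infinity>k. modulate \<zeta> k x)" for x
 define zY where "zY x = (\<Sum>\<^sub>\<infinity>k. modulate \<zeta>Y k x)" for x
 define zth where "zth x = (\<Sum>\<^sub>\<infinity>k. modulate (%k x. \<i> * of_int k * \<zeta> k x) k x)" for x
 have r\<zeta>th: "rapid T s \<delta> (%k x. \<i> * of_int k * \<zeta> k x)"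
  by (intro rapid_multiplier[OF T \<delta>0 r\<zeta>, where A = 1 and N = 1]) (auto simp: norm_mult)
 show ?thesis
 proof (rule that[of z zY zth])
  show "smooth6 T s \<delta> z" "smooth6 T s \<delta> zY" "smooth6 T s \<delta> zth"
   unfolding z_def[abs_def] zY_def[abs_def] zth_def[abs_def]
   by (intro smooth6_synthesis[OF T \<delta>0] r\<zeta> r\<zeta>Y r\<zeta>th)+
  show "partial6 T s e_Y z zY"
   unfolding z_def[abs_def] zY_def[abs_def]
   by (rule has_partial_synthesis_normal[OF T \<delta>0 r\<zeta> r\<zeta>Y _ _ ode]) auto
  show "partial6 T s e_theta z zth"
   unfolding z_def[abs_def] zth_def[abs_def]
   by (rule has_partial_synthesis[OF T \<delta>0 r\<zeta> f\<zeta>])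
  fix x assume x: "x \<in> dom6 T s"
  show "coef z 0 x = 0"
   unfolding z_def[abs_def] by (rule synthesis_mean_zero[OF T \<delta>0 r\<zeta> f\<zeta> \<zeta>0 x])
  have "((%k. of_real (sg s) * modulate \<zeta>Y k x + \<i> * modulate (%k x. \<i> * of_int k * \<zeta> k x) k x)
    has_sum (of_real (sg s) * zY x + \<i> * zth x)) UNIV"
   unfolding zY_def zth_def
   by (intro has_sum_add has_sum_cmult_right synthesis_has_sum[OF T \<delta>0 _ x] r\<zeta>Y r\<zeta>th)
  moreover have "of_real (sg s) * modulate \<zeta>Y k x + \<i> * modulate (%k x. \<i> * of_int k * \<zeta> k x) k x
    = modulate (%k x. (if k = 0 then 0 else 1) * coef M k x) k x" for k
   by (cases s) (simp_all add: modulate_def \<zeta>Y_def non_def m_def algebra_simps)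
  ultimately show "of_real (sg s) * zY x + \<i> * zth x = M x - coef M 0 x"
   using inversion_without_mean[OF T \<delta>0 M x] has_sum_unique by fastforce
  define x0 where "x0 = at_Y 0 x"
  have x0: "x0 \<in> dom6 T s" using x by (simp add: x0_def at_Y_dom6)
  have S: "((%k. modulate \<zeta> k x0) has_sum z x0) UNIV"
   unfolding z_def by (rule synthesis_has_sum[OF T \<delta>0 r\<zeta> x0])
  have "((%k. cnj (modulate \<zeta> k x0)) has_sum cnj (z x0)) UNIV" using S by simp
  then have "((%k. cnj (modulate \<zeta> (- k) x0)) has_sum cnj (z x0)) UNIV"
   by (subst has_sum_reindex_bij_witness[where i = uminus and j = uminus and T = UNIV and h = "%k. cnj (modulate \<zeta> k x0)"]) auto
  from has_sum_add[OF S this]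
  have "((%k. modulate \<zeta> k x0 + cnj (modulate \<zeta> (- k) x0)) has_sum of_real (2 * Re (z x0))) UNIV"
   by (simp add: complex_add_cnj)
  moreover have "modulate \<zeta> k x0 + cnj (modulate \<zeta> (- k) x0)
    = 2 * modulate (%k x. (if k = 0 then 0 else 1) * coef (cplx w0) k x) k x0" for k
  proof -
   have F: "forward s m j x0 = 0" for j unfolding x0_def by (rule forward_at_Y0[OF T \<delta>(1)])
   have P: "poisson s \<eta> j x0 = 2 * coef (cplx w0) j x0 + cnj (\<beta> (- j) x0)" for j
    by (simp add: poisson_def \<eta>_def x0_def)
   have mc: "cnj (mode (- k) th) = mode k th" for th by (simp add: mode_cnj)
   consider "k > 0" | "k < 0" | "k = 0" by linarith
   then show ?thesis
    by cases (simp_all add: modulate_def \<zeta>_def pos_def neg_def F P mc coef_cnj_real algebra_simps)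
  qed
  ultimately have "((%k. 2 * modulate (%k x. (if k = 0 then 0 else 1) * coef (cplx w0) k x) k x0)
    has_sum of_real (2 * Re (z x0))) UNIV" by simp
  moreover have "((%k. 2 * modulate (%k x. (if k = 0 then 0 else 1) * coef (cplx w0) k x) k x0)
    has_sum 2 * (cplx w0 x0 - coef (cplx w0) 0 x0)) UNIV"
   by (intro has_sum_cmult_right inversion_without_mean[OF T order_refl smooth6_cplx[OF T order_refl w0] x0])
  ultimately have "complex_of_real (2 * Re (z x0)) = 2 * (cplx w0 x0 - coef (cplx w0) 0 x0)"
   by (rule has_sum_unique)
  then have "2 * Re (z x0) = 2 * (w0 x0 - mean w0 x0)"
   by (simp add: coef_mean complex_eq_iff)
  then show "Re (z (at_Y 0 x)) = w0 (at_Y 0 x) - mean w0 (at_Y 0 x)"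
   by (simp add: x0_def)
 qed
qed

section \<open>The linearized operators in components\<close>

lemma exhaust_5:
 fixes x :: 5
 shows "x = 1 \<or> x = 2 \<or> x = 3 \<or> x = 4 \<or> x = 5"
proof (induct x)
 case (of_int z)
 then have "z = 0 \<or> z = 1 \<or> z = 2 \<or> z = 3 \<or> z = 4" by fastforce
 then show ?case by auto
qed

lemma exhaust_7:
 fixes x :: 7
 shows "x = 1 \<or> x = 2 \<or> x = 3 \<or> x = 4 \<or> x = 5 \<or> x = 6 \<or> x = 7"
proof (induct x)
 case (of_int z)
 then have "z = 0 \<or> z = 1 \<or> z = 2 \<or> z = 3 \<or> z = 4 \<or> z = 5 \<or> z = 6" by fastforce
 then show ?case by auto
qed

lemma forall_5: "(\<forall>i::5. P i) \<longleftrightarrow> P 1 \<and> P 2 \<and> P 3 \<and> P 4 \<and> P 5"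
 by (metis exhaust_5)

lemma forall_7: "(\<forall>i::7. P i) \<longleftrightarrow> P 1 \<and> P 2 \<and> P 3 \<and> P 4 \<and> P 5 \<and> P 6 \<and> P 7"
 by (metis exhaust_7)

lemma UNIV_7: "(UNIV :: 7 set) = {1, 2, 3, 4, 5, 6, 7}"
 using exhaust_7 by auto

lemma sum_7: "sum f (UNIV :: 7 set) = f 1 + f 2 + f 3 + f 4 + f 5 + f 6 + f 7"
 unfolding UNIV_7 by (simp add: ac_simps)

lemma vector_5 [simp]:
 "(vector [x1,x2,x3,x4,x5] :: ('a::zero)^5) $ 1 = x1"
 "(vector [x1,x2,x3,x4,x5] :: ('a::zero)^5) $ 2 = x2"
 "(vector [x1,x2,x3,x4,x5] :: ('a::zero)^5) $ 3 = x3"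
 "(vector [x1,x2,x3,x4,x5] :: ('a::zero)^5) $ 4 = x4"
 "(vector [x1,x2,x3,x4,x5] :: ('a::zero)^5) $ 5 = x5"
 unfolding vector_def by auto

lemma vector_7 [simp]:
 "(vector [x1,x2,x3,x4,x5,x6,x7] :: ('a::zero)^7) $ 1 = x1"
 "(vector [x1,x2,x3,x4,x5,x6,x7] :: ('a::zero)^7) $ 2 = x2"
 "(vector [x1,x2,x3,x4,x5,x6,x7] :: ('a::zero)^7) $ 3 = x3"
 "(vector [x1,x2,x3,x4,x5,x6,x7] :: ('a::zero)^7) $ 4 = x4"
 "(vector [x1,x2,x3,x4,x5,x6,x7] :: ('a::zero)^7) $ 5 = x5"
 "(vector [x1,x2,x3,x4,x5,x6,x7] :: ('a::zero)^7) $ 6 = x6"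
 "(vector [x1,x2,x3,x4,x5,x6,x7] :: ('a::zero)^7) $ 7 = x7"
 unfolding vector_def by auto

lemma has_derivative_vec7:
 fixes f :: "'a::real_normed_vector => real^7"
 assumes "\<forall>i. ((%x. f x $ i) has_derivative (%h. f' h $ i)) (at a)"
 shows "(f has_derivative f') (at a)"
 unfolding has_derivative_componentwise_within[of f f' a UNIV]
proof
 fix b :: "real^7" assume "b \<in> Basis"
 then obtain i where "b = axis i 1" by (auto simp: Basis_vec_def)
 then show "((%x. f x \<bullet> b) has_derivative (%x. f' x \<bullet> b)) (at a)"
  using assms by (simp add: inner_axis)
qed

lemma has_derivative_nth: "((%U. U $ i) has_derivative (%V. V $ i)) (at a)"
 by (rule bounded_linear_imp_has_derivative) (rule bounded_linear_vec_nth)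

lemma has_derivative_nth_mult:
 "((%U. U $ i * U $ j) has_derivative (%V. a $ i * V $ j + V $ i * a $ j)) (at (a :: real^7))"
 by (rule has_derivative_mult) (rule has_derivative_nth)+

lemma flux_nth:
 "flux 1 U $ 1 = U$1 * U$1 - U$4 * U$4 + U$7" "flux 1 U $ 2 = U$1 * U$2 - U$4 * U$5"
 "flux 1 U $ 3 = U$1 * U$3 - U$4 * U$6" "flux 1 U $ 4 = 0"
 "flux 1 U $ 5 = U$1 * U$5 - U$4 * U$2" "flux 1 U $ 6 = U$1 * U$6 - U$4 * U$3" "flux 1 U $ 7 = U$1"
 "flux 2 U $ 1 = U$2 * U$1 - U$5 * U$4" "flux 2 U $ 2 = U$2 * U$2 - U$5 * U$5 + U$7"
 "flux 2 U $ 3 = U$2 * U$3 - U$5 * U$6" "flux 2 U $ 4 = U$2 * U$4 - U$5 * U$1"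
 "flux 2 U $ 5 = 0" "flux 2 U $ 6 = U$2 * U$6 - U$5 * U$3" "flux 2 U $ 7 = U$2"
 "flux 3 U $ 1 = U$3 * U$1 - U$6 * U$4" "flux 3 U $ 2 = U$3 * U$2 - U$6 * U$5"
 "flux 3 U $ 3 = U$3 * U$3 - U$6 * U$6 + U$7" "flux 3 U $ 4 = U$3 * U$4 - U$6 * U$1"
 "flux 3 U $ 5 = U$3 * U$5 - U$6 * U$2" "flux 3 U $ 6 = 0" "flux 3 U $ 7 = U$3"
 by (simp_all add: flux_def Let_def)

lemma U0_nth: "U0 P s $ 1 = vel1 P s" "U0 P s $ 2 = vel2 P s" "U0 P s $ 3 = 0" "U0 P s $ 4 = mag1 P s"
 "U0 P s $ 5 = mag2 P s" "U0 P s $ 6 = 0" "U0 P s $ 7 = 0"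
 by (simp_all add: U0_def)

lemma A_op_1:
 "A_op P s 1 V = vector
   [2 * vel1 P s * V$1 - 2 * mag1 P s * V$4 + V$7,
   V$1 * vel2 P s + vel1 P s * V$2 - V$4 * mag2 P s - mag1 P s * V$5,
   vel1 P s * V$3 - mag1 P s * V$6,
   0,
   V$1 * mag2 P s + vel1 P s * V$5 - V$4 * vel2 P s - mag1 P s * V$2,
   vel1 P s * V$6 - mag1 P s * V$3,
   V$1]"
proof -
 have "(flux 1 has_derivative (%V. vector
   [2 * vel1 P s * V$1 - 2 * mag1 P s * V$4 + V$7,
   V$1 * vel2 P s + vel1 P s * V$2 - V$4 * mag2 P s - mag1 P s * V$5,
   vel1 P s * V$3 - mag1 P s * V$6,
   0,
   V$1 * mag2 P s + vel1 P s * V$5 - V$4 * vel2 P s - mag1 P s * V$2,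
   vel1 P s * V$6 - mag1 P s * V$3,
   V$1])) (at (U0 P s))"
  by (rule has_derivative_vec7, unfold forall_7 flux_nth vector_7, intro conjI;
    rule has_derivative_eq_rhs,
    (rule has_derivative_diff has_derivative_add has_derivative_nth_mult has_derivative_nth has_derivative_const)+,
    simp add: U0_nth fun_eq_iff)
 from frechet_derivative_at[OF this] show ?thesis
  unfolding A_op_def by (rule fun_cong[OF sym])
qed

lemma A_op_2:
 "A_op P s 2 V = vector
   [V$2 * vel1 P s + vel2 P s * V$1 - V$5 * mag1 P s - mag2 P s * V$4,
   2 * vel2 P s * V$2 - 2 * mag2 P s * V$5 + V$7,
   vel2 P s * V$3 - mag2 P s * V$6,
   V$2 * mag1 P s + vel2 P s * V$4 - V$5 * vel1 P s - mag2 P s * V$1,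
   0,
   vel2 P s * V$6 - mag2 P s * V$3,
   V$2]"
proof -
 have "(flux 2 has_derivative (%V. vector
   [V$2 * vel1 P s + vel2 P s * V$1 - V$5 * mag1 P s - mag2 P s * V$4,
   2 * vel2 P s * V$2 - 2 * mag2 P s * V$5 + V$7,
   vel2 P s * V$3 - mag2 P s * V$6,
   V$2 * mag1 P s + vel2 P s * V$4 - V$5 * vel1 P s - mag2 P s * V$1,
   0,
   vel2 P s * V$6 - mag2 P s * V$3,
   V$2])) (at (U0 P s))"
  by (rule has_derivative_vec7, unfold forall_7 flux_nth vector_7, intro conjI;
    rule has_derivative_eq_rhs,
    (rule has_derivative_diff has_derivative_add has_derivative_nth_mult has_derivative_nth has_derivative_const)+,
    simp add: U0_nth fun_eq_iff)
 from frechet_derivative_at[OF this] show ?thesis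
  unfolding A_op_def by (rule fun_cong[OF sym])
qed

lemma A_op_3:
 "A_op P s 3 V = vector
   [V$3 * vel1 P s - V$6 * mag1 P s,
   V$3 * vel2 P s - V$6 * mag2 P s,
   V$7,
   V$3 * mag1 P s - V$6 * vel1 P s,
   V$3 * mag2 P s - V$6 * vel2 P s,
   0,
   V$3]"
proof -
 have "(flux 3 has_derivative (%V. vector
   [V$3 * vel1 P s - V$6 * mag1 P s,
   V$3 * vel2 P s - V$6 * mag2 P s,
   V$7,
   V$3 * mag1 P s - V$6 * vel1 P s,
   V$3 * mag2 P s - V$6 * vel2 P s,
   0,
   V$3])) (at (U0 P s))"
  by (rule has_derivative_vec7, unfold forall_7 flux_nth vector_7, intro conjI;
    rule has_derivative_eq_rhs,
    (rule has_derivative_diff has_derivative_add has_derivative_nth_mult has_derivative_nth has_derivative_const)+,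
    simp add: U0_nth fun_eq_iff)
 from frechet_derivative_at[OF this] show ?thesis
  unfolding A_op_def by (rule fun_cong[OF sym])
qed

text \<open>The interior equations in terms of the derivatives \<open>VY\<close> and \<open>Vth\<close>. The two divergence
 equations are used to remove the normal derivatives from the tangential components.\<close>

definition interior_eq :: "mhd_params => side => real^7 => real^7 => real^7 => real => bool" where
 "interior_eq P s VY Vth F F8 \<longleftrightarrow>
   A_op P s 3 VY + A_symbol P s Vth = F \<and> VY$6 + xi1 P * Vth$4 + xi2 P * Vth$5 = F8"

lemma interior_iff:
 "interior_eq P s VY Vth F F8 \<longleftrightarrow>
   (let c = c_coef P s; b = b_coef P s in
   c * Vth$1 - b * Vth$4 + xi1 P * Vth$7 = F$1 - vel1 P s * F$7 + mag1 P s * F8 \<and>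
   c * Vth$2 - b * Vth$5 + xi2 P * Vth$7 = F$2 - vel2 P s * F$7 + mag2 P s * F8 \<and>
   VY$7 + c * Vth$3 - b * Vth$6 = F$3 \<and>
   c * Vth$4 - b * Vth$1 = F$4 - mag1 P s * F$7 + vel1 P s * F8 \<and>
   c * Vth$5 - b * Vth$2 = F$5 - mag2 P s * F$7 + vel2 P s * F8 \<and>
   c * Vth$6 - b * Vth$3 = F$6 \<and>
   VY$3 + xi1 P * Vth$1 + xi2 P * Vth$2 = F$7 \<and>
   VY$6 + xi1 P * Vth$4 + xi2 P * Vth$5 = F8)"
proof -
 let ?c = "c_coef P s" and ?b = "b_coef P s"
 define A where "A = A_op P s 3 VY + A_symbol P s Vth"
 have A: "A$1 = vel1 P s * (VY$3 + xi1 P * Vth$1 + xi2 P * Vth$2) - mag1 P s * (VY$6 + xi1 P * Vth$4 + xi2 P * Vth$5)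
    + (?c * Vth$1 - ?b * Vth$4 + xi1 P * Vth$7)"
  "A$2 = vel2 P s * (VY$3 + xi1 P * Vth$1 + xi2 P * Vth$2) - mag2 P s * (VY$6 + xi1 P * Vth$4 + xi2 P * Vth$5)
    + (?c * Vth$2 - ?b * Vth$5 + xi2 P * Vth$7)"
  "A$3 = VY$7 + ?c * Vth$3 - ?b * Vth$6"
  "A$4 = mag1 P s * (VY$3 + xi1 P * Vth$1 + xi2 P * Vth$2) - vel1 P s * (VY$6 + xi1 P * Vth$4 + xi2 P * Vth$5)
    + (?c * Vth$4 - ?b * Vth$1)"
  "A$5 = mag2 P s * (VY$3 + xi1 P * Vth$1 + xi2 P * Vth$2) - vel2 P s * (VY$6 + xi1 P * Vth$4 + xi2 P * Vth$5)
    + (?c * Vth$5 - ?b * Vth$2)"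
  "A$6 = ?c * Vth$6 - ?b * Vth$3"
  "A$7 = VY$3 + xi1 P * Vth$1 + xi2 P * Vth$2"
  by (simp_all add: A_def A_symbol_def A0_op_def A_op_1 A_op_2 A_op_3 c_coef_def a_coef_def b_coef_def algebra_simps)
 have eq: "A = F \<longleftrightarrow> A$1 = F$1 \<and> A$2 = F$2 \<and> A$3 = F$3 \<and> A$4 = F$4 \<and> A$5 = F$5 \<and> A$6 = F$6 \<and> A$7 = F$7"
  by (simp add: vec_eq_iff forall_7)
 show ?thesis
  unfolding interior_eq_def A_def[symmetric] eq Let_def
  by (auto simp: A)
qed

lemma interior_add:
 assumes "interior_eq P s VY Vth F F8" "interior_eq P s VY' Vth' F' F8'"
 shows "interior_eq P s (VY + VY') (Vth + Vth') (F + F') (F8 + F8')"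
 using assms unfolding interior_iff Let_def
 by (auto simp: algebra_simps)

lemma interior_diff:
 assumes "interior_eq P s VY Vth F F8" "interior_eq P s VY' Vth' F' F8'"
 shows "interior_eq P s (VY - VY') (Vth - Vth') (F - F') (F8 - F8')"
 using assms unfolding interior_iff Let_def
 by (auto simp: algebra_simps)

lemma has_partial_nth:
 assumes "has_partial D b f f'"
 shows "has_partial D b (%x. f x $ i) (%x. f' x $ i)"
 using has_partial_linear[OF bounded_linear_vec_nth assms] .

lemma smooth6_nth:
 assumes "smooth6 T s \<delta> f" "\<delta> \<ge> 0"
 shows "smooth6 T s \<delta> (%x. f x $ i)"
 using smooth_fun_linear[OF bounded_linear_vec_nth assms(1) weight_decay[OF assms(2)]] .

lemma smooth6_vector7:
 fixes f1 :: "pt6 => real"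
 assumes "\<delta> \<ge> 0" "smooth6 T s \<delta> f1" "smooth6 T s \<delta> f2" "smooth6 T s \<delta> f3" "smooth6 T s \<delta> f4"
  "smooth6 T s \<delta> f5" "smooth6 T s \<delta> f6" "smooth6 T s \<delta> f7"
 shows "smooth6 T s \<delta> (%x. vector [f1 x, f2 x, f3 x, f4 x, f5 x, f6 x, f7 x] :: real^7)"
proof -
 note w = weight_decay[OF assms(1), of T s]
 have "smooth6 T s \<delta> (%x. f x *\<^sub>R (axis i 1 :: real^7))" if "smooth6 T s \<delta> f" for f and i :: 7
  using smooth_fun_linear[OF bounded_linear_scaleR_left that w] .
 then have "smooth6 T s \<delta> (%x. f1 x *\<^sub>R (axis 1 1 :: real^7) + f2 x *\<^sub>R axis 2 1 + f3 x *\<^sub>R axis 3 1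
   + f4 x *\<^sub>R axis 4 1 + f5 x *\<^sub>R axis 5 1 + f6 x *\<^sub>R axis 6 1 + f7 x *\<^sub>R axis 7 1)"
  using assms by (intro smooth_family_add[OF _ _ w]) auto
 moreover have "(%x. f1 x *\<^sub>R (axis 1 1 :: real^7) + f2 x *\<^sub>R axis 2 1 + f3 x *\<^sub>R axis 3 1
   + f4 x *\<^sub>R axis 4 1 + f5 x *\<^sub>R axis 5 1 + f6 x *\<^sub>R axis 6 1 + f7 x *\<^sub>R axis 7 1)
   = (%x. vector [f1 x, f2 x, f3 x, f4 x, f5 x, f6 x, f7 x])"
  by (simp add: fun_eq_iff vec_eq_iff forall_7 axis_def)
 ultimately show ?thesis by simp
qed

text \<open>The normal and fast derivatives of a function on the closed domain, as they enter the
 problem.\<close>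

lemma d_Y3_eq:
 assumes "T > 0" "partial6 T s e_Y f f'" "x \<in> dom6 T s"
 shows "d_Y3 T s f x = f' x"
 using has_partial_imp_partial_deriv(1)[OF coord_box_dom6[OF assms(1)] Basis_e(1) assms(2,3)]
 by (simp add: d_Y3_def e_Y_def)

lemma d_theta_eq:
 assumes "T > 0" "partial6 T s e_theta f f'" "x \<in> dom6 T s"
 shows "d_theta T s f x = f' x"
 using has_partial_imp_partial_deriv(1)[OF coord_box_dom6[OF assms(1)] Basis_e(2) assms(2,3)]
 by (simp add: d_theta_def e_theta_def)

lemma fast_interior:
 assumes T: "T > 0" and d: "partial6 T s e_Y U UY" "partial6 T s e_theta U Uth"
  and x: "x \<in> dom6 T s"
 shows "fast_op P T s U x = F \<and> fast_div P T s U x = F8 \<longleftrightarrow> interior_eq P s (UY x) (Uth x) F F8"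
 unfolding fast_op_def fast_div_def interior_eq_def d_Y3_eq[OF T d(1) x] d_theta_eq[OF T d(2) x]
  d_Y3_eq[OF T has_partial_nth[OF d(1)] x] d_theta_eq[OF T has_partial_nth[OF d(2)] x] ..

text \<open>The part of a solution with mean zero in the fast variable is recovered from \<open>w = c u\<^sub>3 - b H\<^sub>3\<close>
 and \<open>q\<close>: the third components from \<open>w\<close> and the sixth equation, the tangential ones from \<open>q\<close> and
 the tangential equations, by inverting a two by two matrix of determinant \<open>c\<^sup>2 - b\<^sup>2\<close>.\<close>

definition lift ::
  "mhd_params => side => (pt6 => real^7) => (pt6 => real) => (pt6 => real) => (pt6 => real) => pt6 => real^7" where
 "lift P s F F8 w q x =
  (let c = c_coef P s; b = b_coef P s; \<Delta> = c\<^sup>2 - b\<^sup>2;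
     \<alpha>1 = theta_prim (%x. F x $ 1 - vel1 P s * F x $ 7 + mag1 P s * F8 x) x - xi1 P * q x;
     \<alpha>2 = theta_prim (%x. F x $ 2 - vel2 P s * F x $ 7 + mag2 P s * F8 x) x - xi2 P * q x;
     \<beta>1 = theta_prim (%x. F x $ 4 - mag1 P s * F x $ 7 + vel1 P s * F8 x) x;
     \<beta>2 = theta_prim (%x. F x $ 5 - mag2 P s * F x $ 7 + vel2 P s * F8 x) x;
     \<beta>3 = theta_prim (%x. F x $ 6) x
   in vector [(c * \<alpha>1 + b * \<beta>1) / \<Delta>, (c * \<alpha>2 + b * \<beta>2) / \<Delta>, (c * w x + b * \<beta>3) / \<Delta>,
        (c * \<beta>1 + b * \<alpha>1) / \<Delta>, (c * \<beta>2 + b * \<alpha>2) / \<Delta>, (c * \<beta>3 + b * w x) / \<Delta>, q x])"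

lemma two_by_two:
 fixes b c p q :: real
 assumes "c\<^sup>2 - b\<^sup>2 \<noteq> 0"
 shows "c * ((c * p + b * q) / (c\<^sup>2 - b\<^sup>2)) - b * ((c * q + b * p) / (c\<^sup>2 - b\<^sup>2)) = p"
proof -
 have "c * ((c * p + b * q) / (c\<^sup>2 - b\<^sup>2)) - b * ((c * q + b * p) / (c\<^sup>2 - b\<^sup>2)) = (c\<^sup>2 - b\<^sup>2) * p / (c\<^sup>2 - b\<^sup>2)"
  by (simp add: diff_divide_distrib[symmetric] power2_eq_square algebra_simps)
 then show ?thesis using assms by simp
qed

section \<open>Solving the interior equations\<close>

lemma coef_lincomb:
 assumes T: "T > 0" and \<delta>: "\<delta> \<ge> 0"
  and sm: "\<forall>p\<in>set L. smooth6 T s \<delta> (snd p)"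
  and eq: "!!y. y \<in> dom6 T s ==> (\<Sum>p\<leftarrow>L. fst p * snd p y) = 0" and x: "x \<in> dom6 T s"
 shows "(\<Sum>p\<leftarrow>L. of_real (fst p) * coef (cplx (snd p)) k x) = 0"
proof -
 have gen: "smooth6 T s \<delta> (%y. complex_of_real (\<Sum>p\<leftarrow>L. fst p * snd p y)) \<and>
   coef (%y. of_real (\<Sum>p\<leftarrow>L. fst p * snd p y)) k x = (\<Sum>p\<leftarrow>L. of_real (fst p) * coef (cplx (snd p)) k x)"
  if "\<forall>p\<in>set L. smooth6 T s \<delta> (snd p)" for L :: "(real \<times> (pt6 => real)) list"
  using that
 proof (induction L)
  case Nil
  have "smooth6 T s \<delta> (%_. 0 :: complex)"
   by (rule smooth_family_closed[where Q = "%\<phi>. \<phi> = (%_ _. 0)"])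
     (auto intro: has_partial_const exI[of _ 0])
  then show ?case by (simp add: coef_def cfour_const)
 next
  case (Cons p L)
  obtain a f where p: "p = (a, f)" by (cases p)
  have 1: "smooth6 T s \<delta> (%y. of_real a * cplx f y)"
   using Cons.prems by (intro smooth6_cmult[OF T \<delta>] smooth6_cplx[OF T \<delta>]) (simp add: p)
  note 2 = Cons.IH[THEN conjunct1] Cons.IH[THEN conjunct2]
  have IH: "smooth6 T s \<delta> (%y. complex_of_real (\<Sum>p\<leftarrow>L. fst p * snd p y))"
   "coef (%y. of_real (\<Sum>p\<leftarrow>L. fst p * snd p y)) k x = (\<Sum>p\<leftarrow>L. of_real (fst p) * coef (cplx (snd p)) k x)"
   using 2 Cons.prems by auto
  have e: "(%y. complex_of_real (\<Sum>p\<leftarrow>p # L. fst p * snd p y))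
    = (%y. of_real a * cplx f y + complex_of_real (\<Sum>p\<leftarrow>L. fst p * snd p y))"
   by (simp add: p)
  show ?case
   unfolding e coef_add[OF T \<delta> 1 IH(1) x] IH(2)
   using smooth6_add[OF T \<delta> 1 IH(1)] by (simp add: p coef_cmult)
 qed
 have "coef (%y. of_real (\<Sum>p\<leftarrow>L. fst p * snd p y)) k x = coef (%_. 0) k x"
  by (rule coef_cong[OF _ x]) (simp add: eq)
 then show ?thesis using gen[OF sm] by (simp add: coef_def cfour_const)
qed

lemma mean_lincomb:
 assumes T: "T > 0" and \<delta>: "\<delta> \<ge> 0"
  and sm: "\<forall>p\<in>set L. smooth6 T s \<delta> (snd p)"
  and eq: "!!y. y \<in> dom6 T s ==> (\<Sum>p\<leftarrow>L. fst p * snd p y) = 0" and x: "x \<in> dom6 T s"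
 shows "(\<Sum>p\<leftarrow>L. fst p * mean (snd p) x) = 0"
proof -
 have "Re (\<Sum>p\<leftarrow>L. of_real (fst p) * coef (cplx (snd p)) 0 x) = (\<Sum>p\<leftarrow>L. fst p * mean (snd p) x)"
  by (induction L) (simp_all add: mean_def)
 then show ?thesis using coef_lincomb[OF assms, of 0] by simp
qed

lemma smooth6_diff:
 assumes "\<delta> \<ge> 0" "smooth6 T s \<delta> f" "smooth6 T s \<delta> g"
 shows "smooth6 T s \<delta> (%x. f x - g x)"
 using smooth_family_add[OF assms(2) smooth_fun_linear[OF bounded_linear_minus[OF bounded_linear_ident] assms(3) weight_decay[OF assms(1)]] weight_decay[OF assms(1)]]
 by simp

lemma smooth6_lincomb2:
 assumes "T > 0" "\<delta> \<ge> 0" "smooth6 T s \<delta> f" "smooth6 T s \<delta> g"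
 shows "smooth6 T s \<delta> (%x. (p * f x + r * g x) / (d :: real))"
proof -
 have "smooth6 T s \<delta> (%x. (p / d) * f x + (r / d) * g x)"
  by (intro smooth6_add[OF assms(1,2)] smooth6_cmult[OF assms(1,2)] assms(3,4))
 then show ?thesis by (simp add: add_divide_distrib)
qed

lemma has_partial_cmult:
 fixes c :: "'b::real_normed_algebra"
 assumes "has_partial D b f f'"
 shows "has_partial D b (%x. c * f x) (%x. c * f' x)"
 using has_partial_linear[OF bounded_linear_mult_right assms] .

lemma has_partial_diff:
 assumes "has_partial D b f f'" "has_partial D b g g'"
 shows "has_partial D b (%x. f x - g x) (%x. f' x - g' x)"
 using assms unfolding has_partial_def by (auto intro!: derivative_eq_intros)

lemma has_partial_lincomb2:
 assumes "has_partial D b f f'" "has_partial D b g g'"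
 shows "has_partial D b (%x. (p * f x + r * g x) / (d :: real)) (%x. (p * f' x + r * g' x) / d)"
proof -
 have "has_partial D b (%x. (p / d) * f x + (r / d) * g x) (%x. (p / d) * f' x + (r / d) * g' x)"
  by (intro has_partial_add has_partial_cmult assms)
 then show ?thesis by (simp add: add_divide_distrib)
qed

definition mean_vec :: "(pt6 => real^7) => pt6 => real^7" where
 "mean_vec F x = (\<chi> i. mean (%z. F z $ i) x)"

text \<open>Condition (d) on one side, for an arbitrary pair of sources.\<close>

definition compatible :: "mhd_params => real => side => (pt6 => real^7) => (pt6 => real) => bool" where
 "compatible P T s F F8 \<longleftrightarrow> (\<forall>x\<in>dom6 T s.
   d_Y3 T s (%z. F z $ 6) x + xi1 P * d_theta T s (%z. F z $ 4) x + xi2 P * d_theta T s (%z. F z $ 5) x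
    - tau P * d_theta T s F8 x = 0)"

text \<open>This is what remains on the right when the tangential components are eliminated from the
 equation for the normal derivative of \<open>w = c u\<^sub>3 - b H\<^sub>3\<close>.\<close>

definition source :: "mhd_params => side => (pt6 => real^7) => (pt6 => real) => pt6 => real" where
 "source P s F F8 x = (c_coef P s + a_coef P s) * F x $ 7 - 2 * b_coef P s * F8 x - xi1 P * F x $ 1 - xi2 P * F x $ 2"

lemma smooth6_source:
 assumes "T > 0" "\<delta> \<ge> 0" "smooth6 T s \<delta> F" "smooth6 T s \<delta> F8"
 shows "smooth6 T s \<delta> (source P s F F8)"
 unfolding source_def[abs_def]
 by (intro smooth6_diff[OF assms(2)] smooth6_cmult[OF assms(1,2)] smooth6_nth[OF assms(3,2)] assms(4))

text \<open>Compatibility expresses the normal derivative of the sixth source by derivatives along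
 \<open>th\<close>, and these are undone by the primitive.\<close>

lemma compatible_prim:
 assumes T: "T > 0" and \<delta>: "\<delta> \<ge> 0" and F: "smooth6 T s \<delta> F" and F8: "smooth6 T s \<delta> F8"
  and comp: "compatible P T s F F8"
 obtains F6Y where "smooth6 T s \<delta> F6Y" "partial6 T s e_Y (%z. F z $ 6) F6Y"
  "!!x. x \<in> dom6 T s ==> theta_prim F6Y x = tau P * (F8 x - mean F8 x)
    - xi1 P * (F x $ 4 - mean (%z. F z $ 4) x) - xi2 P * (F x $ 5 - mean (%z. F z $ 5) x)"
proof -
 note n = smooth6_nth[OF F \<delta>]
 obtain F6Y where Y: "smooth6 T s \<delta> F6Y" "partial6 T s e_Y (%z. F z $ 6) F6Y"
  using smooth_fun_deriv[OF n Basis_e(1)] by metis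
 obtain F4 where 4: "smooth6 T s \<delta> F4" "partial6 T s e_theta (%z. F z $ 4) F4"
  using smooth_fun_deriv[OF n Basis_e(2)] by metis
 obtain F5 where 5: "smooth6 T s \<delta> F5" "partial6 T s e_theta (%z. F z $ 5) F5"
  using smooth_fun_deriv[OF n Basis_e(2)] by metis
 obtain F8th where 8: "smooth6 T s \<delta> F8th" "partial6 T s e_theta F8 F8th"
  using smooth_fun_deriv[OF F8 Basis_e(2)] by metis
 define H where "H x = tau P * F8 x - xi1 P * F x $ 4 - xi2 P * F x $ 5" for x
 have H: "smooth6 T s \<delta> H"
  unfolding H_def[abs_def] by (intro smooth6_diff[OF \<delta>] smooth6_cmult[OF T \<delta>] n F8)
 have Hd: "partial6 T s e_theta H (%x. tau P * F8th x - xi1 P * F4 x - xi2 P * F5 x)"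
  unfolding H_def[abs_def] by (intro has_partial_diff has_partial_cmult 4 5 8)
 have F6Yx: "F6Y x = tau P * F8th x - xi1 P * F4 x - xi2 P * F5 x" if x: "x \<in> dom6 T s" for x
  using comp x d_Y3_eq[OF T Y(2) x] d_theta_eq[OF T 4(2) x] d_theta_eq[OF T 5(2) x] d_theta_eq[OF T 8(2) x]
  unfolding compatible_def by force
 have Hth: "partial6 T s e_theta H F6Y"
  by (rule has_partial_cong[OF Hd refl F6Yx])
 have "theta_prim F6Y x = tau P * (F8 x - mean F8 x)
    - xi1 P * (F x $ 4 - mean (%z. F z $ 4) x) - xi2 P * (F x $ 5 - mean (%z. F z $ 5) x)" if x: "x \<in> dom6 T s" for x
 proof -
  have "theta_prim F6Y x = H x - mean H x"
   by (rule theta_prim_of_derivative[OF T \<delta> H Y(1) Hth x])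
  moreover have "(\<Sum>p\<leftarrow>[(1, H), (- tau P, F8), (xi1 P, %z. F z $ 4), (xi2 P, %z. F z $ 5)]. fst p * mean (snd p) x) = 0"
   by (rule mean_lincomb[OF T \<delta> _ _ x]) (use H F8 n in \<open>auto simp: H_def\<close>)
  ultimately show ?thesis by (simp add: H_def algebra_simps)
 qed
 then show ?thesis using that Y by blast
qed

lemma lift_nth:
 "lift P s F F8 w q x $ 1 = (c_coef P s * (theta_prim (%x. F x $ 1 - vel1 P s * F x $ 7 + mag1 P s * F8 x) x - xi1 P * q x)
   + b_coef P s * theta_prim (%x. F x $ 4 - mag1 P s * F x $ 7 + vel1 P s * F8 x) x) / ((c_coef P s)\<^sup>2 - (b_coef P s)\<^sup>2)"
 "lift P s F F8 w q x $ 2 = (c_coef P s * (theta_prim (%x. F x $ 2 - vel2 P s * F x $ 7 + mag2 P s * F8 x) x - xi2 P * q x)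
   + b_coef P s * theta_prim (%x. F x $ 5 - mag2 P s * F x $ 7 + vel2 P s * F8 x) x) / ((c_coef P s)\<^sup>2 - (b_coef P s)\<^sup>2)"
 "lift P s F F8 w q x $ 3 = (c_coef P s * w x + b_coef P s * theta_prim (%x. F x $ 6) x) / ((c_coef P s)\<^sup>2 - (b_coef P s)\<^sup>2)"
 "lift P s F F8 w q x $ 4 = (c_coef P s * theta_prim (%x. F x $ 4 - mag1 P s * F x $ 7 + vel1 P s * F8 x) x
   + b_coef P s * (theta_prim (%x. F x $ 1 - vel1 P s * F x $ 7 + mag1 P s * F8 x) x - xi1 P * q x)) / ((c_coef P s)\<^sup>2 - (b_coef P s)\<^sup>2)"
 "lift P s F F8 w q x $ 5 = (c_coef P s * theta_prim (%x. F x $ 5 - mag2 P s * F x $ 7 + vel2 P s * F8 x) x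
   + b_coef P s * (theta_prim (%x. F x $ 2 - vel2 P s * F x $ 7 + mag2 P s * F8 x) x - xi2 P * q x)) / ((c_coef P s)\<^sup>2 - (b_coef P s)\<^sup>2)"
 "lift P s F F8 w q x $ 6 = (c_coef P s * theta_prim (%x. F x $ 6) x + b_coef P s * w x) / ((c_coef P s)\<^sup>2 - (b_coef P s)\<^sup>2)"
 "lift P s F F8 w q x $ 7 = q x"
 by (simp_all add: lift_def Let_def)

lemma smooth6_lift:
 assumes T: "T > 0" and \<delta>: "\<delta> \<ge> 0" and F: "smooth6 T s \<delta> F" and F8: "smooth6 T s \<delta> F8"
  and w: "smooth6 T s \<delta> w" and q: "smooth6 T s \<delta> q"
 shows "smooth6 T s \<delta> (lift P s F F8 w q)"
proof -
 note n = smooth6_nth[OF F \<delta>]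
 show ?thesis
  unfolding lift_def[abs_def] Let_def
  by (intro smooth6_vector7[OF \<delta>] smooth6_lincomb2[OF T \<delta>] smooth6_diff[OF \<delta>] smooth6_theta_prim[OF T \<delta>]
    smooth6_add[OF T \<delta>] smooth6_cmult[OF T \<delta>] n F8 w q)
qed

lemma lift_at_Y:
 assumes "!!x. F (at_Y r x) = F x" "!!x. F8 (at_Y r x) = F8 x" "!!x. w (at_Y r x) = w x" "!!x. q (at_Y r x) = q x"
 shows "lift P s F F8 w q (at_Y r x) = lift P s F F8 w q x"
 unfolding lift_def Let_def using assms by (simp add: theta_prim_at_Y)

lemma lift_mean_zero:
 assumes T: "T > 0" and \<delta>: "\<delta> \<ge> 0" and F: "smooth6 T s \<delta> F" and F8: "smooth6 T s \<delta> F8"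
  and w: "smooth6 T s \<delta> w" and q: "smooth6 T s \<delta> q" and x: "x \<in> dom6 T s"
  and mw: "mean w x = 0" and mq: "mean q x = 0"
 shows "mean_vec (lift P s F F8 w q) x = 0"
proof -
 note n = smooth6_nth[OF F \<delta>]
 note i = smooth6_theta_prim[OF T \<delta>] mean_theta_prim[OF T \<delta> _ x]
 have lin: "mean (%z. (p * f z + r * g z) / d) x = 0"
  if "smooth6 T s \<delta> f" "smooth6 T s \<delta> g" "mean f x = 0" "mean g x = 0" for f g p r d
  using mean_lincomb[OF T \<delta> _ _ x, where L = "[(1, %z. (p * f z + r * g z) / d), (- p / d, f), (- r / d, g)]"]
   smooth6_lincomb2[OF T \<delta> that(1,2)] that by (simp add: add_divide_distrib)
 have dif: "mean (%z. f z - c * q z) x = 0" if "smooth6 T s \<delta> f" "mean f x = 0" for f c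
  using mean_lincomb[OF T \<delta> _ _ x, where L = "[(1, %z. f z - c * q z), (- 1, f), (c, q)]"]
   smooth6_diff[OF \<delta> that(1) smooth6_cmult[OF T \<delta> q]] that q mq by simp
 have sd: "smooth6 T s \<delta> (%z. f z - c * q z)" if "smooth6 T s \<delta> f" for f c
  using smooth6_diff[OF \<delta> that smooth6_cmult[OF T \<delta> q]] .
 have sf: "smooth6 T s \<delta> (%z. F z $ i - c * F z $ j + d * F8 z)" for i j c d
  by (intro smooth6_diff[OF \<delta>] smooth6_add[OF T \<delta>] smooth6_cmult[OF T \<delta>] n F8)
 note I = i(1)[OF sf] and M = i(2)[OF sf] and I6 = i(1)[OF n] and M6 = i(2)[OF n]
 have "mean (%z. lift P s F F8 w q z $ 1) x = 0" "mean (%z. lift P s F F8 w q z $ 2) x = 0"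
  unfolding lift_nth by (rule lin[OF sd[OF I] I dif[OF I M] M])+
 moreover have "mean (%z. lift P s F F8 w q z $ 4) x = 0" "mean (%z. lift P s F F8 w q z $ 5) x = 0"
  unfolding lift_nth by (rule lin[OF I sd[OF I] M dif[OF I M]])+
 moreover have "mean (%z. lift P s F F8 w q z $ 3) x = 0" "mean (%z. lift P s F F8 w q z $ 6) x = 0"
  unfolding lift_nth by (rule lin[OF w I6 mw M6], rule lin[OF I6 w M6 mw])
 moreover have "mean (%z. lift P s F F8 w q z $ 7) x = 0"
  unfolding lift_nth by (rule mq)
 ultimately have "\<forall>i. mean (%z. lift P s F F8 w q z $ i) x = 0"
  by (simp only: forall_7)
 then show ?thesis by (simp add: mean_vec_def vec_eq_iff)
qed

text \<open>The equations without normal derivatives hold because each pair of components solves a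
 system with matrix \<open>(c, -b; -b, c)\<close>. The two divergence equations are then equivalent
 to the Cauchy-Riemann equation for \<open>w\<^sub>Y\<close> and to compatibility.\<close>

lemma lift_solves:
 assumes T: "T > 0" and \<delta>: "\<delta> \<ge> 0" and F: "smooth6 T s \<delta> F" and F8: "smooth6 T s \<delta> F8"
  and w: "smooth6 T s \<delta> w" and q: "smooth6 T s \<delta> q"
  and dw: "partial6 T s e_Y w wY" "partial6 T s e_theta w wth"
  and dq: "partial6 T s e_Y q qY" "partial6 T s e_theta q qth"
  and comp: "compatible P T s F F8"
  and cr: "!!x. x \<in> dom6 T s ==> wY x - qth x = source P s F F8 x - mean (source P s F F8) x"
   "!!x. x \<in> dom6 T s ==> qY x + wth x = F x $ 3 - mean (%z. F z $ 3) x"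
  and \<Delta>: "(c_coef P s)\<^sup>2 - (b_coef P s)\<^sup>2 \<noteq> 0" and \<xi>: "(xi1 P)\<^sup>2 + (xi2 P)\<^sup>2 = 1"
  and UY: "partial6 T s e_Y (lift P s F F8 w q) UY"
  and Uth: "partial6 T s e_theta (lift P s F F8 w q) Uth"
  and x: "x \<in> dom6 T s"
 shows "interior_eq P s (UY x) (Uth x) (F x - mean_vec F x) (F8 x - mean F8 x)"
proof -
 define c where "c = c_coef P s"
 define b where "b = b_coef P s"
 define a where "a = a_coef P s"
 define u1 u2 h1 h2 where "u1 = vel1 P s" and "u2 = vel2 P s" and "h1 = mag1 P s" and "h2 = mag2 P s"
 define x1 x2 where "x1 = xi1 P" and "x2 = xi2 P"
 define d where "d = c\<^sup>2 - b\<^sup>2"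
 note n = smooth6_nth[OF F \<delta>]
 note box = box7[OF T \<delta>, of s]
 have d0: "c\<^sup>2 - b\<^sup>2 \<noteq> 0" using \<Delta> by (simp add: c_def b_def)
 have a: "a = x1 * u1 + x2 * u2" and b: "b = x1 * h1 + x2 * h2" and c: "c = tau P + a"
  by (simp_all add: a_def b_def c_def x1_def x2_def u1_def u2_def h1_def h2_def a_coef_def b_coef_def c_coef_def)
 have sf: "smooth6 T s \<delta> (%z. F z $ i - c * F z $ j + d * F8 z)" for i j c d
  by (intro smooth6_diff[OF \<delta>] smooth6_add[OF T \<delta>] smooth6_cmult[OF T \<delta>] n F8)
 define I where "I i y r x = theta_prim (%x. F x $ i - y * F x $ 7 + r * F8 x) x" for i y r x
 define mF where "mF i = mean (%z. F z $ i) x" for i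
 define F' where "F' i = F x $ i - mF i" for i
 define F8' where "F8' = F8 x - mean F8 x"
 have Ith: "partial6 T s e_theta (I i y r)
   (%x. (F x $ i - y * F x $ 7 + r * F8 x) - mean (%x. F x $ i - y * F x $ 7 + r * F8 x) x)" for i y r
  unfolding I_def[abs_def] by (rule theta_prim_e_theta[OF T \<delta> sf])
 have mI: "(F x $ i - y * F x $ 7 + r * F8 x) - mean (%x. F x $ i - y * F x $ 7 + r * F8 x) x
   = F' i - y * F' 7 + r * F8'" for i y r
 proof -
  have "(\<Sum>p\<leftarrow>[(1, %x. F x $ i - y * F x $ 7 + r * F8 x), (- 1, %x. F x $ i), (y, %x. F x $ 7), (- r, F8)]. fst p * mean (snd p) x) = 0"
   by (rule mean_lincomb[OF T \<delta> _ _ x]) (use sf n F8 in auto)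
  then show ?thesis by (simp add: F'_def mF_def F8'_def algebra_simps)
 qed
 have uq: "g x = g' x" if "partial6 T s b f g" "partial6 T s b f g'" "b \<in> Basis"
  for b and f g g' :: "pt6 => real"
  using has_partial_unique[OF box that(3,1,2) x] .
 have F6: "partial6 T s e_theta (theta_prim (%z. F z $ 6)) (%x. F x $ 6 - mean (%z. F z $ 6) x)"
  by (rule theta_prim_e_theta[OF T \<delta> n])
 define \<alpha>1 where "\<alpha>1 = F' 1 - u1 * F' 7 + h1 * F8' - x1 * qth x"
 define \<alpha>2 where "\<alpha>2 = F' 2 - u2 * F' 7 + h2 * F8' - x2 * qth x"
 define \<beta>1 where "\<beta>1 = F' 4 - h1 * F' 7 + u1 * F8'"
 define \<beta>2 where "\<beta>2 = F' 5 - h2 * F' 7 + u2 * F8'"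
 note fold = c_def[symmetric] b_def[symmetric] u1_def[symmetric] u2_def[symmetric] h1_def[symmetric] h2_def[symmetric]
  x1_def[symmetric] x2_def[symmetric] I_def[symmetric]
 note nthth = has_partial_nth[OF Uth] and nthY = has_partial_nth[OF UY]
 have t1: "Uth x $ 1 = (c * \<alpha>1 + b * \<beta>1) / (c\<^sup>2 - b\<^sup>2)"
  using uq[OF nthth[of 1, unfolded lift_nth fold]
    has_partial_lincomb2[OF has_partial_diff[OF Ith has_partial_cmult[OF dq(2)]] Ith] Basis_e(2)]
  by (simp only: mI \<alpha>1_def \<beta>1_def)
 have t2: "Uth x $ 2 = (c * \<alpha>2 + b * \<beta>2) / (c\<^sup>2 - b\<^sup>2)"
  using uq[OF nthth[of 2, unfolded lift_nth fold]
    has_partial_lincomb2[OF has_partial_diff[OF Ith has_partial_cmult[OF dq(2)]] Ith] Basis_e(2)]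
  by (simp only: mI \<alpha>2_def \<beta>2_def)
 have t3: "Uth x $ 3 = (c * wth x + b * F' 6) / (c\<^sup>2 - b\<^sup>2)"
  using uq[OF nthth[of 3, unfolded lift_nth fold] has_partial_lincomb2[OF dw(2) F6] Basis_e(2)]
  by (simp only: F'_def mF_def)
 have t4: "Uth x $ 4 = (c * \<beta>1 + b * \<alpha>1) / (c\<^sup>2 - b\<^sup>2)"
  using uq[OF nthth[of 4, unfolded lift_nth fold]
    has_partial_lincomb2[OF Ith has_partial_diff[OF Ith has_partial_cmult[OF dq(2)]]] Basis_e(2)]
  by (simp only: mI \<alpha>1_def \<beta>1_def)
 have t5: "Uth x $ 5 = (c * \<beta>2 + b * \<alpha>2) / (c\<^sup>2 - b\<^sup>2)"
  using uq[OF nthth[of 5, unfolded lift_nth fold]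
    has_partial_lincomb2[OF Ith has_partial_diff[OF Ith has_partial_cmult[OF dq(2)]]] Basis_e(2)]
  by (simp only: mI \<alpha>2_def \<beta>2_def)
 have t6: "Uth x $ 6 = (c * F' 6 + b * wth x) / (c\<^sup>2 - b\<^sup>2)"
  using uq[OF nthth[of 6, unfolded lift_nth fold] has_partial_lincomb2[OF F6 dw(2)] Basis_e(2)]
  by (simp only: F'_def mF_def)
 have t7: "Uth x $ 7 = qth x"
  using uq[OF nthth[of 7, unfolded lift_nth] dq(2) Basis_e(2)] .
 obtain F6Y where F6Y: "smooth6 T s \<delta> F6Y" "partial6 T s e_Y (%z. F z $ 6) F6Y"
  "!!x. x \<in> dom6 T s ==> theta_prim F6Y x = tau P * (F8 x - mean F8 x)
    - xi1 P * (F x $ 4 - mean (%z. F z $ 4) x) - xi2 P * (F x $ 5 - mean (%z. F z $ 5) x)"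
  using compatible_prim[OF T \<delta> F F8 comp] by metis
 have I6Y: "partial6 T s e_Y (theta_prim (%z. F z $ 6)) (theta_prim F6Y)"
  by (rule has_partial_theta_prim[OF T \<delta> n F6Y(1,2)]) auto
 define \<kappa> where "\<kappa> = tau P * F8' - x1 * F' 4 - x2 * F' 5"
 have \<kappa>: "theta_prim F6Y x = \<kappa>"
  using F6Y(3)[OF x] by (simp add: \<kappa>_def F8'_def F'_def mF_def x1_def x2_def)
 have y3: "UY x $ 3 = (c * wY x + b * \<kappa>) / (c\<^sup>2 - b\<^sup>2)"
  using uq[OF nthY[of 3, unfolded lift_nth fold] has_partial_lincomb2[OF dw(1) I6Y] Basis_e(1)]
  by (simp only: \<kappa>)
 have y6: "UY x $ 6 = (c * \<kappa> + b * wY x) / (c\<^sup>2 - b\<^sup>2)"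
  using uq[OF nthY[of 6, unfolded lift_nth fold] has_partial_lincomb2[OF I6Y dw(1)] Basis_e(1)]
  by (simp only: \<kappa>)
 have y7: "UY x $ 7 = qY x"
  using uq[OF nthY[of 7, unfolded lift_nth] dq(1) Basis_e(1)] .
 have src: "wY x - qth x = (c + a) * F' 7 - 2 * b * F8' - x1 * F' 1 - x2 * F' 2"
 proof -
  have "(\<Sum>p\<leftarrow>[(1, source P s F F8), (- (c + a), %x. F x $ 7), (2 * b, F8), (x1, %x. F x $ 1), (x2, %x. F x $ 2)]. fst p * mean (snd p) x) = 0"
   by (rule mean_lincomb[OF T \<delta> _ _ x])
     (use smooth6_source[OF T \<delta> F F8] n F8 in \<open>auto simp: source_def a_def b_def c_def x1_def x2_def algebra_simps\<close>)
  then show ?thesis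
   unfolding cr(1)[OF x] by (simp add: source_def F'_def mF_def F8'_def a_def b_def c_def x1_def x2_def algebra_simps)
 qed
 have e3: "qY x + wth x = F' 3" using cr(2)[OF x] by (simp add: F'_def mF_def)
 have \<xi>2: "x1 * (x1 * z) + x2 * (x2 * z) = z" for z
  using \<xi> by (simp add: x1_def x2_def power2_eq_square distrib_right[symmetric] mult.assoc[symmetric])
 have k1: "wY x + x1 * \<alpha>1 + x2 * \<alpha>2 = c * F' 7 - b * F8'"
 proof -
  have "wY x = qth x + ((c + a) * F' 7 - 2 * b * F8' - x1 * F' 1 - x2 * F' 2)" using src by simp
  moreover have "x1 * \<alpha>1 + x2 * \<alpha>2 = x1 * F' 1 + x2 * F' 2 - a * F' 7 + b * F8' - (x1 * (x1 * qth x) + x2 * (x2 * qth x))"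
   by (simp add: \<alpha>1_def \<alpha>2_def a b algebra_simps)
  ultimately show ?thesis unfolding \<xi>2 by (simp add: algebra_simps)
 qed
 have k2: "\<kappa> + x1 * \<beta>1 + x2 * \<beta>2 = c * F8' - b * F' 7"
  by (simp add: \<kappa>_def \<beta>1_def \<beta>2_def a b c algebra_simps)
 have comb: "UY x $ 3 + x1 * Uth x $ 1 + x2 * Uth x $ 2 = F' 7"
  "UY x $ 6 + x1 * Uth x $ 4 + x2 * Uth x $ 5 = F8'"
 proof -
  have "UY x $ 3 + x1 * Uth x $ 1 + x2 * Uth x $ 2
    = (c * (wY x + x1 * \<alpha>1 + x2 * \<alpha>2) + b * (\<kappa> + x1 * \<beta>1 + x2 * \<beta>2)) / (c\<^sup>2 - b\<^sup>2)"
   unfolding y3 t1 t2 by (simp add: add_divide_distrib[symmetric] algebra_simps)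
  also have "\<dots> = (c\<^sup>2 - b\<^sup>2) * F' 7 / (c\<^sup>2 - b\<^sup>2)"
   unfolding k1 k2 by (simp add: power2_eq_square algebra_simps)
  finally show "UY x $ 3 + x1 * Uth x $ 1 + x2 * Uth x $ 2 = F' 7" using d0 by simp
  have "UY x $ 6 + x1 * Uth x $ 4 + x2 * Uth x $ 5
    = (b * (wY x + x1 * \<alpha>1 + x2 * \<alpha>2) + c * (\<kappa> + x1 * \<beta>1 + x2 * \<beta>2)) / (c\<^sup>2 - b\<^sup>2)"
   unfolding y6 t4 t5 by (simp add: add_divide_distrib[symmetric] algebra_simps)
  also have "\<dots> = (c\<^sup>2 - b\<^sup>2) * F8' / (c\<^sup>2 - b\<^sup>2)"
   unfolding k1 k2 by (simp add: power2_eq_square algebra_simps)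
  finally show "UY x $ 6 + x1 * Uth x $ 4 + x2 * Uth x $ 5 = F8'" using d0 by simp
 qed
 note tt = two_by_two[OF d0]
 show ?thesis
  unfolding interior_iff Let_def
 proof (intro conjI)
  have nth: "(F x - mean_vec F x) $ i = F' i" for i by (simp add: mean_vec_def F'_def mF_def)
  note R = nth F8'_def[symmetric] c_def[symmetric] b_def[symmetric] u1_def[symmetric] u2_def[symmetric] h1_def[symmetric] h2_def[symmetric]
   x1_def[symmetric] x2_def[symmetric]
  show "c_coef P s * Uth x $ 1 - b_coef P s * Uth x $ 4 + xi1 P * Uth x $ 7
    = (F x - mean_vec F x) $ 1 - vel1 P s * (F x - mean_vec F x) $ 7 + mag1 P s * (F8 x - mean F8 x)"
   unfolding R t1 t4 t7 tt by (simp add: \<alpha>1_def)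
  show "c_coef P s * Uth x $ 2 - b_coef P s * Uth x $ 5 + xi2 P * Uth x $ 7
    = (F x - mean_vec F x) $ 2 - vel2 P s * (F x - mean_vec F x) $ 7 + mag2 P s * (F8 x - mean F8 x)"
   unfolding R t2 t5 t7 tt by (simp add: \<alpha>2_def)
  show "UY x $ 7 + c_coef P s * Uth x $ 3 - b_coef P s * Uth x $ 6 = (F x - mean_vec F x) $ 3"
   using tt[of "wth x" "F' 6"] e3 unfolding R t3 t6 y7 by linarith
  show "c_coef P s * Uth x $ 4 - b_coef P s * Uth x $ 1
    = (F x - mean_vec F x) $ 4 - mag1 P s * (F x - mean_vec F x) $ 7 + vel1 P s * (F8 x - mean F8 x)"
   unfolding R t1 t4 tt by (simp add: \<beta>1_def)
  show "c_coef P s * Uth x $ 5 - b_coef P s * Uth x $ 2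
    = (F x - mean_vec F x) $ 5 - mag2 P s * (F x - mean_vec F x) $ 7 + vel2 P s * (F8 x - mean F8 x)"
   unfolding R t2 t5 tt by (simp add: \<beta>2_def)
  show "c_coef P s * Uth x $ 6 - b_coef P s * Uth x $ 3 = (F x - mean_vec F x) $ 6"
   unfolding R t3 t6 tt ..
  show "UY x $ 3 + xi1 P * Uth x $ 1 + xi2 P * Uth x $ 2 = (F x - mean_vec F x) $ 7"
   unfolding R comb ..
  show "UY x $ 6 + xi1 P * Uth x $ 4 + xi2 P * Uth x $ 5 = F8 x - mean F8 x"
   unfolding R comb ..
 qed
qed

text \<open>The primitive of the mean in the normal variable that vanishes at infinity.\<close>

definition decay_prim :: "side => (pt6 => real) => pt6 => real" where
 "decay_prim s f x = - sg s * Re (backward s (coef (cplx f)) 0 x)"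

lemma decay_prim:
 assumes T: "T > 0" and \<delta>: "\<delta> > 0" and f: "smooth6 T s \<delta> f"
 shows "smooth6 T s \<delta> (decay_prim s f)" "partial6 T s e_Y (decay_prim s f) (mean f)"
  "decay_prim s f (at_theta r x) = decay_prim s f x"
proof -
 have \<delta>0: "\<delta> \<ge> 0" using \<delta> by simp
 have r: "rapid T s \<delta> (coef (cplx f))"
  by (rule rapid_coef[OF T \<delta>0 smooth6_cplx[OF T \<delta>0 f]])
 show "smooth6 T s \<delta> (decay_prim s f)"
  unfolding decay_prim_def[abs_def]
  by (intro smooth6_cmult[OF T \<delta>0] smooth6_Re[OF T \<delta>0] rapid_component[OF T \<delta>0] rapid_backward[OF T \<delta> r])
 have "partial6 T s e_Y (decay_prim s f)
   (%x. - sg s * Re (of_real (sg s) * (of_real \<bar>of_int 0\<bar> * backward s (coef (cplx f)) 0 x - coef (cplx f) 0 x)))"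
  unfolding decay_prim_def[abs_def] by (intro has_partial_cmult has_partial_Re backward_ode[OF T \<delta> r])
 then show "partial6 T s e_Y (decay_prim s f) (mean f)"
  by (rule has_partial_cong) (auto simp: mean_def)
 show "decay_prim s f (at_theta r x) = decay_prim s f x"
  unfolding decay_prim_def by (subst backward_at_theta[OF T \<delta>]) auto
qed

section \<open>Fourier modes of a solution\<close>

lemma Y_constant:
 fixes f :: "pt6 => 'b::real_normed_vector"
 assumes d: "partial6 T s e_Y f f'" and z: "!!x. x \<in> dom6 T s ==> f' x = 0"
  and x: "x \<in> dom6 T s" and r: "0 \<le> sg s * r"
 shows "f (at_Y r x) = f x"
proof -
 let ?S = "{h. at_Y 0 x + h *\<^sub>R e_Y \<in> dom6 T s}"
 have mem: "h \<in> ?S \<longleftrightarrow> 0 \<le> sg s * h" for h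
  using at_Y_dom6[OF x] by (simp flip: at_Y_line)
 have "convex ?S"
 proof -
  have "?S = chalf s" using mem by (auto simp: chalf_def)
  then show ?thesis using convex_chalf by simp
 qed
 moreover have "((%h. f (at_Y h x)) has_vector_derivative 0) (at h within ?S)" if "h \<in> ?S" for h
  using has_partial_line[OF d, of "at_Y 0 x" h] that z by (simp flip: at_Y_line)
 ultimately have "\<exists>c. \<forall>h\<in>?S. f (at_Y h x) = c"
  by (intro has_derivative_zero_constant) (auto simp: has_vector_derivative_def)
 then have "f (at_Y r x) = f (at_Y (Y_of x) x)"
  using mem r Y_of_dom6[OF x] by (metis (no_types, lifting))
 then show ?thesis by simp
qed

text \<open>A constant along the ray is bounded by every value of the decaying weight.\<close>

lemma decaying_constant_zero:
 fixes f :: "pt6 => 'b::real_normed_vector"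
 assumes \<delta>: "\<delta> > 0" and f: "smooth6 T s \<delta> f" and x: "x \<in> dom6 T s"
  and const: "!!r. 0 \<le> r ==> f (at_Y (sg s * r) x) = f x"
 shows "f x = 0"
proof -
 obtain C where C: "C \<ge> 0" "!!y. y \<in> dom6 T s ==> norm (f y) \<le> C * decay s \<delta> y"
  using smooth_family_bound0[OF f weight_decay] \<delta> by (metis less_imp_le)
 have "norm (f x) \<le> C * exp (- (\<delta> * r))" if "0 \<le> r" for r
  using C(2)[of "at_Y (sg s * r) x"] const[OF that] that x by (simp add: at_Y_dom6 decay_alt)
 then have "\<forall>\<^sub>F r in at_top. norm (f x) \<le> C * exp (- (\<delta> * r))"
  by (auto simp: eventually_at_top_linorder)
 moreover have "((%r. C * exp (- (\<delta> * r))) \<longlongrightarrow> 0) at_top"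
 proof -
  have "((%r. exp (- (\<delta> * r))) \<longlongrightarrow> 0) at_top"
   by (rule filterlim_compose[OF exp_at_bot])
     (auto simp: filterlim_uminus_at_bot intro!: filterlim_tendsto_pos_mult_at_top[OF tendsto_const \<delta>] filterlim_ident)
  then show ?thesis using tendsto_mult_right_zero by blast
 qed
 ultimately have "norm (f x) \<le> 0"
  by (intro tendsto_lowerbound[where F = at_top]) auto
 then show ?thesis by simp
qed

text \<open>The sum of the two functions vanishes, so the decaying one is constant in
 \<open>Y\<close>.\<close>

lemma decomposition_unique:
 fixes f g :: "pt6 => 'b::real_normed_vector"
 assumes \<delta>: "\<delta> > 0" and g: "smooth6 T s \<delta> g"
  and f: "!!r x. x \<in> dom6 T s ==> 0 \<le> r ==> f (at_Y (sg s * r) x) = f x"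
  and sum: "!!x. x \<in> dom6 T s ==> f x + g x = 0" and x: "x \<in> dom6 T s"
 shows "f x = 0" "g x = 0"
proof -
 show g0: "g x = 0"
 proof (rule decaying_constant_zero[OF \<delta> g x])
  fix r :: real assume r: "0 \<le> r"
  have "at_Y (sg s * r) x \<in> dom6 T s" using x r by (simp add: at_Y_dom6)
  then have "g (at_Y (sg s * r) x) = - f (at_Y (sg s * r) x)" using sum by (metis minus_unique)
  also have "\<dots> = g x" using f[OF x r] sum[OF x] by (metis minus_unique)
  finally show "g (at_Y (sg s * r) x) = g x" .
 qed
 show "f x = 0" using sum[OF x] g0 by simp
qed

text \<open>A bounded solution of \<open>sg s * z\<^sub>Y = \<kappa> z + N\<close> with \<open>\<kappa> > 0\<close> has no free constant.\<close>

lemma bounded_growing_mode: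
 fixes z zY N :: "pt6 => complex"
 assumes T: "T > 0" and z: "smooth6 T s 0 z" and N: "smooth6 T s 0 N"
  and d: "partial6 T s e_Y z zY" and \<kappa>: "\<kappa> > 0"
  and ode: "!!x. x \<in> dom6 T s ==> of_real (sg s) * zY x = of_real \<kappa> * z x + N x"
  and x: "x \<in> dom6 T s"
 shows "z x = - (LINT r:{0..}|lborel. of_real (exp (- (\<kappa> * r))) * N (ray s x r))"
proof -
 define E :: "real => complex" where "E r = of_real (exp (- (\<kappa> * r)))" for r
 define G where "G r = E r * z (ray s x r)" for r
 have D: "ray s x r \<in> dom6 T s" if "0 \<le> r" for r
  using shift_dom6[OF x that] .
 have dE: "(E has_vector_derivative of_real (- \<kappa>) * E r) (at r within {0..})" for r
 proof -
  have "((%r. exp (- (\<kappa> * r))) has_real_derivative (- \<kappa>) * exp (- (\<kappa> * r))) (at r within {0..})"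
   by (auto intro!: derivative_eq_intros)
  then show ?thesis unfolding E_def of_real_mult[symmetric]
   by (intro has_vector_derivative_of_real) (simp add: has_real_derivative_iff_has_vector_derivative)
 qed
 obtain Cz where Cz: "Cz \<ge> 0" "!!y. y \<in> dom6 T s ==> norm (z y) \<le> Cz"
  using smooth_family_bound1[OF z weight_decay[OF order_refl]] by metis
 obtain CN where CN: "CN \<ge> 0" "!!y. y \<in> dom6 T s ==> norm (N y) \<le> CN"
  using smooth_family_bound1[OF N weight_decay[OF order_refl]] by metis
 have "(LINT r:{0..}|lborel. E r * N (ray s x r)) = - G 0"
 proof (rule integral_derivative_to_infinity)
  fix r :: real assume r: "0 \<le> r"
  have "of_real (sg s) * zY (ray s x r) = of_real \<kappa> * z (ray s x r) + N (ray s x r)"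
   using ode[OF D[OF r]] .
  then have "E r * (sg s *\<^sub>R zY (ray s x r)) + of_real (- \<kappa>) * E r * z (ray s x r)
    = E r * N (ray s x r)"
   by (simp add: scaleR_conv_of_real distrib_left)
  then show "(G has_vector_derivative E r * N (ray s x r)) (at r within {0..})"
   using has_vector_derivative_mult[OF dE ray_derivative[OF T zero_less_one d x r]] unfolding G_def by simp
 next
  show "set_integrable lborel {0..} (%r. E r * N (ray s x r))"
  proof (rule set_integrable_exp_bound[OF _ \<kappa>])
   have "continuous_on {0..} (%r. N (ray s x r))"
   proof (rule continuous_on_compose2[OF smooth_family_continuous[OF N weight_decay[OF order_refl] coord_box_dom6[OF T]]])
    show "(%r. ray s x r) ` {0..} \<subseteq> dom6 T s" using D by (simp add: image_subset_iff)
   qed (intro continuous_intros)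
   then show "continuous_on {0..} (%r. E r * N (ray s x r))"
    unfolding E_def by (intro continuous_intros)
   show "norm (E r * N (ray s x r)) \<le> CN * exp (- (\<kappa> * r))" if "0 \<le> r" for r
    using CN(2)[OF D[OF that]] unfolding norm_mult E_def by (simp add: mult.commute)
  qed
  show "(G \<longlongrightarrow> 0) at_top"
  proof (rule tendsto_exp_bound[OF \<kappa>])
   show "norm (G r) \<le> Cz * exp (- (\<kappa> * r))" if "0 \<le> r" for r
    using Cz(2)[OF D[OF that]] unfolding G_def norm_mult E_def by (simp add: mult.commute)
  qed
 qed
 then show ?thesis by (simp add: E_def G_def)
qed

abbreviation mode_integral :: "mhd_params => side => (pt6 => real^7) => int => pt6 => complex" where
 "mode_integral P s F k x \<equiv> (LINT r:{0..}|lborel. of_real (exp (- (freq k * r))) *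
   cinner7 (L_vec P s k) (\<chi> i. coef (cplx (%z. F z $ i)) k (ray s x r)))"

lemma cinner7_L_vec:
 "cinner7 (L_vec P s k) X = of_real (tau P) * (xi1 P * X$1 + xi2 P * X$2)
   - \<i> * of_real (sg s) * of_int (sgn k) * of_real (tau P) * X$3
   + 2 * of_real (b_coef P s) * (xi1 P * X$4 + xi2 P * X$5)
   - 2 * \<i> * of_real (sg s) * of_int (sgn k) * of_real (b_coef P s) * X$6
   - of_real (tau P * (a_coef P s + c_coef P s)) * X$7"
 by (simp add: cinner7_def sum_7 L_vec_def Let_def algebra_simps)

text \<open>Contracting the first two pairs of equations with the unit vector \<open>(xi1,
 xi2)\<close> eliminates the tangential components; the compatibility condition removes
 \<open>F8\<close>.\<close>

lemma mode_algebra: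
 fixes W1 W2 W3 W4 W5 W6 W7 V3 V6 V7 F1 F2 F3 F4 F5 F6 F7 F8 F6Y :: complex
  and \<tau> a b c x1 x2 u1 u2 h1 h2 :: real and k :: int
 assumes r1: "c * (\<i> * of_int k * W1) - b * (\<i> * of_int k * W4) + x1 * (\<i> * of_int k * W7) = F1 - u1 * F7 + h1 * F8"
  and r2: "c * (\<i> * of_int k * W2) - b * (\<i> * of_int k * W5) + x2 * (\<i> * of_int k * W7) = F2 - u2 * F7 + h2 * F8"
  and r3: "V7 + c * (\<i> * of_int k * W3) - b * (\<i> * of_int k * W6) = F3"
  and r7: "V3 + x1 * (\<i> * of_int k * W1) + x2 * (\<i> * of_int k * W2) = F7"
  and r8: "V6 + x1 * (\<i> * of_int k * W4) + x2 * (\<i> * of_int k * W5) = F8"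
  and d: "F6Y + x1 * (\<i> * of_int k * F4) + x2 * (\<i> * of_int k * F5) - \<tau> * (\<i> * of_int k * F8) = 0"
  and a: "a = x1 * u1 + x2 * u2" and b: "b = x1 * h1 + x2 * h2" and \<xi>: "x1\<^sup>2 + x2\<^sup>2 = 1" and k: "k \<noteq> 0"
 shows "of_real (sg s) * (\<tau> * (c * V3 - b * V6 + \<i> * of_real (sg s) * of_int (sgn k) * V7) - 2 * b * \<i> / of_int k * F6Y)
  = of_real (freq k) * (\<tau> * (c * W3 - b * W6 + \<i> * of_real (sg s) * of_int (sgn k) * W7) - 2 * b * \<i> / of_int k * F6)
   - of_real (sg s) * (\<tau> * (x1 * F1 + x2 * F2) - \<i> * of_real (sg s) * of_int (sgn k) * \<tau> * F3
    + 2 * b * (x1 * F4 + x2 * F5) - 2 * \<i> * of_real (sg s) * of_int (sgn k) * b * F6 - of_real (\<tau> * (a + c)) * F7)"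
proof -
 define K :: complex where "K = of_int k"
 have K0: "K \<noteq> 0" using k by (simp add: K_def)
 have \<xi>': "of_real x1 * (of_real x1 * z) + of_real x2 * (of_real x2 * z) = (z :: complex)" for z
 proof -
  have "of_real x1 * (of_real x1 * z) + of_real x2 * (of_real x2 * z) = of_real (x1\<^sup>2 + x2\<^sup>2) * z"
   by (simp add: power2_eq_square algebra_simps)
  then show ?thesis by (simp add: \<xi>)
 qed
 define w where "w = c * W3 - b * W6"
 have s1: "c * V3 - b * V6 = \<i> * K * W7 + (a + c) * F7 - 2 * b * F8 - x1 * F1 - x2 * F2"
 proof -
  have "c * V3 - b * V6 = c * F7 - b * F8 - x1 * (c * (\<i> * K * W1) - b * (\<i> * K * W4)) - x2 * (c * (\<i> * K * W2) - b * (\<i> * K * W5))"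
   unfolding r7[symmetric] r8[symmetric] K_def by (simp add: algebra_simps)
  also have "c * (\<i> * K * W1) - b * (\<i> * K * W4) = F1 - u1 * F7 + h1 * F8 - x1 * (\<i> * K * W7)"
   using r1 by (simp add: K_def algebra_simps)
  also have "c * (\<i> * K * W2) - b * (\<i> * K * W5) = F2 - u2 * F7 + h2 * F8 - x2 * (\<i> * K * W7)"
   using r2 by (simp add: K_def algebra_simps)
  also have "c * F7 - b * F8 - x1 * (F1 - u1 * F7 + h1 * F8 - x1 * (\<i> * K * W7)) - x2 * (F2 - u2 * F7 + h2 * F8 - x2 * (\<i> * K * W7))
    = c * F7 - b * F8 - x1 * F1 - x2 * F2 + a * F7 - b * F8 + (of_real x1 * (of_real x1 * (\<i> * K * W7)) + of_real x2 * (of_real x2 * (\<i> * K * W7)))"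
   by (simp add: a b algebra_simps)
  finally show ?thesis unfolding \<xi>' by (simp add: algebra_simps)
 qed
 have s2: "V7 = F3 - \<i> * K * w" using r3 by (simp add: w_def K_def algebra_simps)
 have s3: "2 * b * \<i> / K * F6Y = 2 * b * (x1 * F4 + x2 * F5 - \<tau> * F8)"
 proof -
  have "F6Y = \<i> * K * (\<tau> * F8 - x1 * F4 - x2 * F5)" using d by (simp add: K_def algebra_simps add_eq_0_iff)
  then have "2 * b * \<i> / K * F6Y = (2 * b * \<i> / K * (\<i> * K)) * (\<tau> * F8 - x1 * F4 - x2 * F5)"
   by (simp only: mult.assoc)
  also have "2 * b * \<i> / K * (\<i> * K) = - (2 * complex_of_real b)" using K0 by (simp add: field_simps)
  finally show ?thesis by (simp add: algebra_simps)
 qed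
 have s4: "of_real (freq k) * (2 * b * \<i> / K * F6) = of_int (sgn k) * (2 * b * \<i> * F6)"
  using K0 k by (cases k "0::int" rule: linorder_cases) (simp_all add: K_def field_simps)
 have "of_real (freq k) = of_int (sgn k) * K" using k by (cases k "0::int" rule: linorder_cases) (simp_all add: K_def)
 note sk = this
 have ss: "of_int (sgn k) * (of_int (sgn k) * z) = (z :: complex)" for z using k by (cases k "0::int" rule: linorder_cases) auto
 have sg2: "of_real (sg s) * (of_real (sg s) * z) = (z :: complex)" for z by (cases s) auto
 have "of_real (sg s) * (\<tau> * (c * V3 - b * V6 + \<i> * of_real (sg s) * of_int (sgn k) * V7) - 2 * b * \<i> / K * F6Y)
  = of_real (freq k) * (\<tau> * (w + \<i> * of_real (sg s) * of_int (sgn k) * W7)) - of_real (freq k) * (2 * b * \<i> / K * F6)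
   - of_real (sg s) * (\<tau> * (x1 * F1 + x2 * F2) - \<i> * of_real (sg s) * of_int (sgn k) * \<tau> * F3
    + 2 * b * (x1 * F4 + x2 * F5) - 2 * \<i> * of_real (sg s) * of_int (sgn k) * b * F6 - of_real (\<tau> * (a + c)) * F7)"
  unfolding s1 s2 s3 s4 sk using k K0
  by (cases k "0::int" rule: linorder_cases; cases s) (simp_all add: algebra_simps)
 then show ?thesis by (simp add: w_def K_def right_diff_distrib)
qed

lemma coef_nth_smooth:
 assumes "T > 0" "smooth6 T s 0 (U :: pt6 => real^7)"
 shows "smooth6 T s 0 (coef (cplx (%z. U z $ i)) k)"
 by (intro rapid_component[OF assms(1) order_refl] rapid_coef[OF assms(1) order_refl]
   smooth6_cplx[OF assms(1) order_refl] smooth6_nth[OF assms(2)]) simp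

lemma coef_nth_e_Y:
 assumes "T > 0" "smooth6 T s 0 (U :: pt6 => real^7)" "smooth6 T s 0 U'" "partial6 T s e_Y U U'"
 shows "partial6 T s e_Y (coef (cplx (%z. U z $ i)) k) (coef (cplx (%z. U' z $ i)) k)"
 by (rule has_partial_coef[OF assms(1) order_refl])
   (auto intro!: smooth6_cplx[OF assms(1) order_refl] smooth6_nth assms has_partial_cplx has_partial_nth)

lemma coef_nth_e_theta:
 assumes "T > 0" "smooth6 T s 0 (U :: pt6 => real^7)" "smooth6 T s 0 U'" "partial6 T s e_theta U U'" "x \<in> dom6 T s"
 shows "coef (cplx (%z. U' z $ i)) k x = \<i> * of_int k * coef (cplx (%z. U z $ i)) k x"
 by (rule coef_theta[OF assms(1) order_refl])
   (auto intro!: smooth6_cplx[OF assms(1) order_refl] smooth6_nth assms has_partial_cplx has_partial_nth)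

lemma interior_modes:
 fixes W V f :: "7 => complex" and f8 :: complex
 assumes T: "T > 0" and U: "smooth6 T s 0 U" "smooth6 T s 0 UY" "smooth6 T s 0 Uth"
  and dY: "partial6 T s e_Y U UY" and dth: "partial6 T s e_theta U Uth"
  and F: "smooth6 T s 0 F" and F8: "smooth6 T s 0 F8"
  and int: "!!x. x \<in> dom6 T s ==> interior_eq P s (UY x) (Uth x) (F x) (F8 x)"
  and x: "x \<in> dom6 T s"
  and W_def: "!!i. W i = coef (cplx (%z. U z $ i)) k x"
  and V_def: "!!i. V i = coef (cplx (%z. UY z $ i)) k x"
  and f_def: "!!i. f i = coef (cplx (%z. F z $ i)) k x" and f8_def: "f8 = coef (cplx F8) k x"
 shows "c_coef P s * (\<i> * of_int k * W 1) - b_coef P s * (\<i> * of_int k * W 4) + xi1 P * (\<i> * of_int k * W 7)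
   = f 1 - vel1 P s * f 7 + mag1 P s * f8"
  "c_coef P s * (\<i> * of_int k * W 2) - b_coef P s * (\<i> * of_int k * W 5) + xi2 P * (\<i> * of_int k * W 7)
   = f 2 - vel2 P s * f 7 + mag2 P s * f8"
  "V 7 + c_coef P s * (\<i> * of_int k * W 3) - b_coef P s * (\<i> * of_int k * W 6) = f 3"
  "c_coef P s * (\<i> * of_int k * W 4) - b_coef P s * (\<i> * of_int k * W 1) = f 4 - mag1 P s * f 7 + vel1 P s * f8"
  "c_coef P s * (\<i> * of_int k * W 5) - b_coef P s * (\<i> * of_int k * W 2) = f 5 - mag2 P s * f 7 + vel2 P s * f8"
  "c_coef P s * (\<i> * of_int k * W 6) - b_coef P s * (\<i> * of_int k * W 3) = f 6"
  "V 3 + xi1 P * (\<i> * of_int k * W 1) + xi2 P * (\<i> * of_int k * W 2) = f 7"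
  "V 6 + xi1 P * (\<i> * of_int k * W 4) + xi2 P * (\<i> * of_int k * W 5) = f8"
proof -
 note t = coef_nth_e_theta[OF T U(1,3) dth x, of _ k]
 note n = smooth6_nth[OF U(2) order_refl] smooth6_nth[OF U(3) order_refl] smooth6_nth[OF F order_refl] F8
 note I = int[unfolded interior_iff Let_def]
 note L = coef_lincomb[OF T order_refl _ _ x, where k = k]
 have 1: "(\<Sum>p\<leftarrow>[(c_coef P s, %z. Uth z $ 1), (- b_coef P s, %z. Uth z $ 4), (xi1 P, %z. Uth z $ 7), (- 1, %z. F z $ 1),
   (vel1 P s, %z. F z $ 7), (- mag1 P s, F8)]. of_real (fst p) * coef (cplx (snd p)) k x) = 0"
  by (rule L, simp add: n, drule I, elim conjE,
    simp only: list.map sum_list.Cons sum_list.Nil fst_conv snd_conv; linarith)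
 show "c_coef P s * (\<i> * of_int k * W 1) - b_coef P s * (\<i> * of_int k * W 4) + xi1 P * (\<i> * of_int k * W 7)
   = f 1 - vel1 P s * f 7 + mag1 P s * f8"
  using 1 by (simp add: t W_def f_def f8_def algebra_simps eq_diff_eq)
 have 2: "(\<Sum>p\<leftarrow>[(c_coef P s, %z. Uth z $ 2), (- b_coef P s, %z. Uth z $ 5), (xi2 P, %z. Uth z $ 7), (- 1, %z. F z $ 2),
   (vel2 P s, %z. F z $ 7), (- mag2 P s, F8)]. of_real (fst p) * coef (cplx (snd p)) k x) = 0"
  by (rule L, simp add: n, drule I, elim conjE,
    simp only: list.map sum_list.Cons sum_list.Nil fst_conv snd_conv; linarith)
 show "c_coef P s * (\<i> * of_int k * W 2) - b_coef P s * (\<i> * of_int k * W 5) + xi2 P * (\<i> * of_int k * W 7)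
   = f 2 - vel2 P s * f 7 + mag2 P s * f8"
  using 2 by (simp add: t W_def f_def f8_def algebra_simps eq_diff_eq)
 have 3: "(\<Sum>p\<leftarrow>[(1, %z. UY z $ 7), (c_coef P s, %z. Uth z $ 3), (- b_coef P s, %z. Uth z $ 6), (- 1, %z. F z $ 3)].
   of_real (fst p) * coef (cplx (snd p)) k x) = 0"
  by (rule L, simp add: n, drule I, elim conjE,
    simp only: list.map sum_list.Cons sum_list.Nil fst_conv snd_conv; linarith)
 show "V 7 + c_coef P s * (\<i> * of_int k * W 3) - b_coef P s * (\<i> * of_int k * W 6) = f 3"
  using 3 by (simp add: t W_def f_def V_def algebra_simps eq_diff_eq)
 have 4: "(\<Sum>p\<leftarrow>[(c_coef P s, %z. Uth z $ 4), (- b_coef P s, %z. Uth z $ 1), (- 1, %z. F z $ 4),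
   (mag1 P s, %z. F z $ 7), (- vel1 P s, F8)]. of_real (fst p) * coef (cplx (snd p)) k x) = 0"
  by (rule L, simp add: n, drule I, elim conjE,
    simp only: list.map sum_list.Cons sum_list.Nil fst_conv snd_conv; linarith)
 show "c_coef P s * (\<i> * of_int k * W 4) - b_coef P s * (\<i> * of_int k * W 1) = f 4 - mag1 P s * f 7 + vel1 P s * f8"
  using 4 by (simp add: t W_def f_def f8_def algebra_simps eq_diff_eq)
 have 5: "(\<Sum>p\<leftarrow>[(c_coef P s, %z. Uth z $ 5), (- b_coef P s, %z. Uth z $ 2), (- 1, %z. F z $ 5),
   (mag2 P s, %z. F z $ 7), (- vel2 P s, F8)]. of_real (fst p) * coef (cplx (snd p)) k x) = 0"
  by (rule L, simp add: n, drule I, elim conjE,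
    simp only: list.map sum_list.Cons sum_list.Nil fst_conv snd_conv; linarith)
 show "c_coef P s * (\<i> * of_int k * W 5) - b_coef P s * (\<i> * of_int k * W 2) = f 5 - mag2 P s * f 7 + vel2 P s * f8"
  using 5 by (simp add: t W_def f_def f8_def algebra_simps eq_diff_eq)
 have 6: "(\<Sum>p\<leftarrow>[(c_coef P s, %z. Uth z $ 6), (- b_coef P s, %z. Uth z $ 3), (- 1, %z. F z $ 6)].
   of_real (fst p) * coef (cplx (snd p)) k x) = 0"
  by (rule L, simp add: n, drule I, elim conjE,
    simp only: list.map sum_list.Cons sum_list.Nil fst_conv snd_conv; linarith)
 show "c_coef P s * (\<i> * of_int k * W 6) - b_coef P s * (\<i> * of_int k * W 3) = f 6"
  using 6 by (simp add: t W_def f_def algebra_simps eq_diff_eq)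
 have 7: "(\<Sum>p\<leftarrow>[(1, %z. UY z $ 3), (xi1 P, %z. Uth z $ 1), (xi2 P, %z. Uth z $ 2), (- 1, %z. F z $ 7)].
   of_real (fst p) * coef (cplx (snd p)) k x) = 0"
  by (rule L, simp add: n, drule I, elim conjE,
    simp only: list.map sum_list.Cons sum_list.Nil fst_conv snd_conv; linarith)
 show "V 3 + xi1 P * (\<i> * of_int k * W 1) + xi2 P * (\<i> * of_int k * W 2) = f 7"
  using 7 by (simp add: t W_def f_def V_def algebra_simps eq_diff_eq)
 have 8: "(\<Sum>p\<leftarrow>[(1, %z. UY z $ 6), (xi1 P, %z. Uth z $ 4), (xi2 P, %z. Uth z $ 5), (- 1, F8)].
   of_real (fst p) * coef (cplx (snd p)) k x) = 0"
  by (rule L, simp add: n, drule I, elim conjE,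
    simp only: list.map sum_list.Cons sum_list.Nil fst_conv snd_conv; linarith)
 show "V 6 + xi1 P * (\<i> * of_int k * W 4) + xi2 P * (\<i> * of_int k * W 5) = f8"
  using 8 by (simp add: t W_def f8_def V_def algebra_simps eq_diff_eq)
qed

text \<open>The combination on the left solves an equation whose homogeneous solutions grow like
 \<open>exp (|k| |Y|)\<close>. Being bounded, it is the integral of its right-hand side, and this
 right-hand side is the pairing with \<open>L_vec\<close>.\<close>

lemma mode_identity:
 assumes T: "T > 0" and U: "smooth6 T s 0 U" "smooth6 T s 0 UY" "smooth6 T s 0 Uth"
  and dY: "partial6 T s e_Y U UY" and dth: "partial6 T s e_theta U Uth"
  and F: "smooth6 T s 0 F" and F8: "smooth6 T s 0 F8"
  and int: "!!x. x \<in> dom6 T s ==> interior_eq P s (UY x) (Uth x) (F x) (F8 x)"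
  and comp: "compatible P T s F F8"
  and \<xi>: "(xi1 P)\<^sup>2 + (xi2 P)\<^sup>2 = 1" and k: "k \<noteq> 0" and x: "x \<in> dom6 T s"
 shows "of_real (tau P) * (of_real (c_coef P s) * coef (cplx (%z. U z $ 3)) k x
    - of_real (b_coef P s) * coef (cplx (%z. U z $ 6)) k x
    + \<i> * of_real (sg s) * of_int (sgn k) * coef (cplx (%z. U z $ 7)) k x)
   - 2 * of_real (b_coef P s) * \<i> / of_int k * coef (cplx (%z. F z $ 6)) k x
  = of_real (sg s) * mode_integral P s F k x"
proof -
 obtain FY where FY: "smooth6 T s 0 FY" "partial6 T s e_Y F FY"
  using smooth_fun_deriv[OF F Basis_e(1)] by metis
 obtain Fth where Fth: "smooth6 T s 0 Fth" "partial6 T s e_theta F Fth"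
  using smooth_fun_deriv[OF F Basis_e(2)] by metis
 obtain F8th where F8th: "smooth6 T s 0 F8th" "partial6 T s e_theta F8 F8th"
  using smooth_fun_deriv[OF F8 Basis_e(2)] by metis
 define Z where "Z x = of_real (tau P) * (of_real (c_coef P s) * coef (cplx (%z. U z $ 3)) k x
    - of_real (b_coef P s) * coef (cplx (%z. U z $ 6)) k x
    + \<i> * of_real (sg s) * of_int (sgn k) * coef (cplx (%z. U z $ 7)) k x)
   - 2 * of_real (b_coef P s) * \<i> / of_int k * coef (cplx (%z. F z $ 6)) k x" for x
 define ZY where "ZY x = of_real (tau P) * (of_real (c_coef P s) * coef (cplx (%z. UY z $ 3)) k x
    - of_real (b_coef P s) * coef (cplx (%z. UY z $ 6)) k x
    + \<i> * of_real (sg s) * of_int (sgn k) * coef (cplx (%z. UY z $ 7)) k x)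
   - 2 * of_real (b_coef P s) * \<i> / of_int k * coef (cplx (%z. FY z $ 6)) k x" for x
 define N where "N x = - of_real (sg s) * cinner7 (L_vec P s k) (\<chi> i. coef (cplx (%z. F z $ i)) k x)" for x
 note sU = coef_nth_smooth[OF T U(1)] and sF = coef_nth_smooth[OF T F]
 have sZ: "smooth6 T s 0 Z"
  unfolding Z_def[abs_def]
  by (intro smooth6_diff[OF order_refl] smooth6_add[OF T order_refl] smooth6_cmult[OF T order_refl] sU sF)
 have sN: "smooth6 T s 0 N"
  unfolding N_def[abs_def] cinner7_L_vec vec_lambda_beta
  by (intro smooth6_diff[OF order_refl] smooth6_add[OF T order_refl] smooth6_cmult[OF T order_refl] sF)
 have dZ: "partial6 T s e_Y Z ZY"
  unfolding Z_def[abs_def] ZY_def[abs_def]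
  by (intro has_partial_diff has_partial_add has_partial_cmult coef_nth_e_Y[OF T U(1,2) dY] coef_nth_e_Y[OF T F FY])
 have ode: "of_real (sg s) * ZY y = of_real (freq k) * Z y + N y" if y: "y \<in> dom6 T s" for y
 proof -
  have d: "(\<Sum>p\<leftarrow>[(1, %z. FY z $ 6), (xi1 P, %z. Fth z $ 4), (xi2 P, %z. Fth z $ 5), (- tau P, F8th)].
   of_real (fst p) * coef (cplx (snd p)) k y) = 0"
  proof (rule coef_lincomb[OF T order_refl _ _ y])
   fix y assume y: "y \<in> dom6 T s"
   show "(\<Sum>p\<leftarrow>[(1, %z. FY z $ 6), (xi1 P, %z. Fth z $ 4), (xi2 P, %z. Fth z $ 5), (- tau P, F8th)]. fst p * snd p y) = 0"
    using comp y d_Y3_eq[OF T has_partial_nth[OF FY(2)] y] d_theta_eq[OF T has_partial_nth[OF Fth(2)] y] d_theta_eq[OF T F8th(2) y]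
    unfolding compatible_def by force
  qed (use smooth6_nth[OF FY(1) order_refl] smooth6_nth[OF Fth(1) order_refl] F8th(1) in auto)
  have d': "coef (cplx (%z. FY z $ 6)) k y + xi1 P * (\<i> * of_int k * coef (cplx (%z. F z $ 4)) k y)
    + xi2 P * (\<i> * of_int k * coef (cplx (%z. F z $ 5)) k y) - tau P * (\<i> * of_int k * coef (cplx F8) k y) = 0"
   using d coef_nth_e_theta[OF T F Fth y, of _ k]
    coef_theta[OF T order_refl smooth6_cplx[OF T order_refl F8] smooth6_cplx[OF T order_refl F8th(1)] has_partial_cplx[OF F8th(2)] y, of k]
   by (simp add: algebra_simps)
  note m = interior_modes[OF T U dY dth F F8 int y refl refl refl refl, where k = k]
  show ?thesis
   unfolding ZY_def Z_def N_def cinner7_L_vec vec_lambda_beta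
   using mode_algebra[where s = s, OF m(1-3) m(7,8) d' a_coef_def b_coef_def \<xi> k] by simp
 qed
 have "Z x = - (LINT r:{0..}|lborel. of_real (exp (- (freq k * r))) * N (ray s x r))"
  by (rule bounded_growing_mode[OF T sZ sN dZ _ ode x]) (use k in auto)
 also have "\<dots> = - (LINT r:{0..}|lborel. (- of_real (sg s)) * (of_real (exp (- (freq k * r))) *
    cinner7 (L_vec P s k) (\<chi> i. coef (cplx (%z. F z $ i)) k (ray s x r))))"
  unfolding N_def by (simp add: mult_ac)
 also have "\<dots> = of_real (sg s) * mode_integral P s F k x"
  unfolding set_integral_mult_right by simp
 finally show ?thesis unfolding Z_def .
qed

lemma compatible_zero: "T > 0 ==> compatible P T s (%_. 0) (%_. 0)"
 unfolding compatible_def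
 using d_Y3_eq[OF _ has_partial_const[where c = "0::real"]] d_theta_eq[OF _ has_partial_const[where c = "0::real"]] by simp

lemma solve_two_by_two:
 fixes X Y p :: complex and b c :: real
 assumes "c * X - b * Y = p" "c * Y - b * X = 0" "c\<^sup>2 - b\<^sup>2 \<noteq> 0"
 shows "X = c * p / of_real (c\<^sup>2 - b\<^sup>2)" "Y = b * p / of_real (c\<^sup>2 - b\<^sup>2)"
proof -
 have 0: "complex_of_real (c\<^sup>2 - b\<^sup>2) \<noteq> 0" using assms(3) by (simp only: of_real_eq_0_iff) simp
 have "of_real (c\<^sup>2 - b\<^sup>2) * X = c * (c * X - b * Y) + b * (c * Y - b * X)"
  by (simp add: power2_eq_square algebra_simps)
 then have "of_real (c\<^sup>2 - b\<^sup>2) * X = c * p" using assms(1,2) by simp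
 moreover have "X = of_real (c\<^sup>2 - b\<^sup>2) * X / of_real (c\<^sup>2 - b\<^sup>2)"
  using nonzero_mult_div_cancel_left[OF 0] by (rule sym)
 ultimately show "X = c * p / of_real (c\<^sup>2 - b\<^sup>2)" by simp
 have "of_real (c\<^sup>2 - b\<^sup>2) * Y = b * (c * X - b * Y) + c * (c * Y - b * X)"
  by (simp add: power2_eq_square algebra_simps)
 then have "of_real (c\<^sup>2 - b\<^sup>2) * Y = b * p" using assms(1,2) by simp
 moreover have "Y = of_real (c\<^sup>2 - b\<^sup>2) * Y / of_real (c\<^sup>2 - b\<^sup>2)"
  using nonzero_mult_div_cancel_left[OF 0] by (rule sym)
 ultimately show "Y = b * p / of_real (c\<^sup>2 - b\<^sup>2)" by simp
qed

text \<open>Without sources, the oscillating modes are the multiples of \<open>R_vec\<close> that decay like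
 \<open>exp (- |k| |Y|)\<close>.\<close>

lemma homogeneous_modes:
 assumes T: "T > 0" and U: "smooth6 T s 0 U" "smooth6 T s 0 UY" "smooth6 T s 0 Uth"
  and dY: "partial6 T s e_Y U UY" and dth: "partial6 T s e_theta U Uth"
  and int: "!!x. x \<in> dom6 T s ==> interior_eq P s (UY x) (Uth x) 0 0"
  and \<Delta>: "(c_coef P s)\<^sup>2 - (b_coef P s)\<^sup>2 \<noteq> 0" and \<xi>: "(xi1 P)\<^sup>2 + (xi2 P)\<^sup>2 = 1"
  and \<tau>: "tau P \<noteq> 0" and k: "k \<noteq> 0" and x: "x \<in> dom6 T s"
 shows "coef (cplx (%z. U z $ i)) k x
   = - coef (cplx (%z. U z $ 7)) k (at_Y 0 x) / of_real ((c_coef P s)\<^sup>2 - (b_coef P s)\<^sup>2)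
    * of_real (exp (- (sg s * freq k * Y_of x))) * R_vec P s k $ i"
proof -
 define c b where "c = c_coef P s" and "b = b_coef P s"
 define W where "W i = coef (cplx (%z. U z $ i)) k" for i
 define V where "V i = coef (cplx (%z. UY z $ i)) k" for i
 have s0: "smooth6 T s 0 (%_. 0 :: real^7)" "smooth6 T s 0 (%_. 0 :: real)"
  by (rule smooth_family_const[OF weight_decay[OF order_refl], where K = 1]; simp add: decay_alt)+
 have c0: "coef (%_. 0) k y = 0" for y by (simp add: coef_def cfour_const)
 have ik: "\<i> * of_int k \<noteq> (0 :: complex)" using k by simp
 have z: "of_real c * W 3 y - of_real b * W 6 y + \<i> * of_real (sg s) * of_int (sgn k) * W 7 y = 0" if y: "y \<in> dom6 T s" for y
 proof -
  have "cinner7 (L_vec P s k) (\<chi> i. 0) = 0" by (simp add: cinner7_def)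
  then show ?thesis
   using mode_identity[OF T U dY dth s0 int compatible_zero[OF T] \<xi> k y] \<tau>
   by (simp add: c0 W_def c_def b_def)
 qed
 have m: "c * W 1 y - b * W 4 y = - (xi1 P * W 7 y)" "c * W 2 y - b * W 5 y = - (xi2 P * W 7 y)"
  "V 7 y = - (\<i> * of_int k * (c * W 3 y - b * W 6 y))"
  "c * W 4 y - b * W 1 y = 0" "c * W 5 y - b * W 2 y = 0" "c * W 6 y - b * W 3 y = 0"
  if y: "y \<in> dom6 T s" for y
 proof -
  note mm = interior_modes[OF T U dY dth s0 int y refl refl refl refl, where k = k, unfolded zero_index of_real_0 c0, folded W_def V_def c_def b_def]
  have f: "p * (\<i> * of_int k * q) = (\<i> * of_int k) * (p * q)" for p q :: complex by simp
  have "(\<i> * of_int k) * (c * W 1 y - b * W 4 y + xi1 P * W 7 y) = 0"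
   using mm(1) by (simp add: algebra_simps)
  then have "c * W 1 y - b * W 4 y + xi1 P * W 7 y = 0" using ik by (simp only: mult_eq_0_iff) simp
  then show "c * W 1 y - b * W 4 y = - (xi1 P * W 7 y)" by (simp add: eq_neg_iff_add_eq_0)
  have "(\<i> * of_int k) * (c * W 2 y - b * W 5 y + xi2 P * W 7 y) = 0"
   using mm(2) by (simp add: algebra_simps)
  then have "c * W 2 y - b * W 5 y + xi2 P * W 7 y = 0" using ik by (simp only: mult_eq_0_iff) simp
  then show "c * W 2 y - b * W 5 y = - (xi2 P * W 7 y)" by (simp add: eq_neg_iff_add_eq_0)
  have "V 7 y + (\<i> * of_int k * (c * W 3 y - b * W 6 y)) = 0"
   using mm(3) by (simp add: algebra_simps)
  then show "V 7 y = - (\<i> * of_int k * (c * W 3 y - b * W 6 y))" by (simp only: eq_neg_iff_add_eq_0)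
  have "(\<i> * of_int k) * (c * W 4 y - b * W 1 y) = 0" using mm(4) by (simp add: algebra_simps)
  then show "c * W 4 y - b * W 1 y = 0" using ik by (simp only: mult_eq_0_iff) simp
  have "(\<i> * of_int k) * (c * W 5 y - b * W 2 y) = 0" using mm(5) by (simp add: algebra_simps)
  then show "c * W 5 y - b * W 2 y = 0" using ik by (simp only: mult_eq_0_iff) simp
  have "(\<i> * of_int k) * (c * W 6 y - b * W 3 y) = 0" using mm(6) by (simp add: algebra_simps)
  then show "c * W 6 y - b * W 3 y = 0" using ik by (simp only: mult_eq_0_iff) simp
 qed
 define w where "w y = - (\<i> * of_real (sg s) * of_int (sgn k) * W 7 y)" for y
 have w: "of_real c * W 3 y - of_real b * W 6 y = w y" if y: "y \<in> dom6 T s" for y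
  using z[OF y] by (simp only: w_def eq_neg_iff_add_eq_0)
 have V7: "V 7 y = - of_real (sg s * freq k) * W 7 y" if y: "y \<in> dom6 T s" for y
 proof -
  have "\<i> * K * (- (\<i> * g * S * Z)) = K * S * g * (Z :: complex)" for K g S Z
   using mult.assoc[of "\<i>" "\<i>" "K * S * g * Z"] by (simp add: mult_ac)
  then have "V 7 y = - (of_int k * of_int (sgn k) * of_real (sg s) * W 7 y)"
   unfolding m(3)[OF y] w[OF y] w_def by (simp only: mult.assoc)
  then show ?thesis using k by (cases k "0::int" rule: linorder_cases) simp_all
 qed
 have W7: "W 7 x = W 7 (at_Y 0 x) * of_real (exp (- (sg s * freq k * Y_of x)))"
 proof -
  define E :: "pt6 => complex" where "E y = of_real (exp (sg s * freq k * Y_of y))" for y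
  have dW: "partial6 T s e_Y (W 7) (V 7)"
   unfolding W_def V_def by (rule coef_nth_e_Y[OF T U(1,2) dY])
  have dE: "partial6 T s e_Y E (%y. of_real (sg s * freq k) * E y)"
   unfolding has_partial_def
  proof
   fix y
   have "((%h. exp (sg s * freq k * (Y_of y + h))) has_real_derivative
     sg s * freq k * exp (sg s * freq k * Y_of y)) (at 0 within {h. y + h *\<^sub>R e_Y \<in> dom6 T s})"
    by (auto intro!: derivative_eq_intros)
   then have "((%h. complex_of_real (exp (sg s * freq k * (Y_of y + h)))) has_vector_derivative
     of_real (sg s * freq k * exp (sg s * freq k * Y_of y))) (at 0 within {h. y + h *\<^sub>R e_Y \<in> dom6 T s})"
    by (intro has_vector_derivative_of_real) (simp add: has_real_derivative_iff_has_vector_derivative)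
   then show "((%h. E (y + h *\<^sub>R e_Y)) has_vector_derivative of_real (sg s * freq k) * E y) (at 0 within {h. y + h *\<^sub>R e_Y \<in> dom6 T s})"
    by (simp add: E_def Y_of_shift)
  qed
  have "E (at_Y 0 x) * W 7 (at_Y 0 x) = E x * W 7 x"
   by (rule Y_constant[OF has_partial_mult[OF dE dW] _ x]) (simp_all add: V7)
  moreover have "E (at_Y 0 x) = 1" by (simp add: E_def)
  moreover have "E x * of_real (exp (- (sg s * freq k * Y_of x))) = 1"
   by (simp add: E_def of_real_mult[symmetric] exp_add[symmetric] del: of_real_mult)
  ultimately show ?thesis by (simp add: mult.commute mult.left_commute)
 qed
 define D where "D = complex_of_real (c\<^sup>2 - b\<^sup>2)"
 have \<Delta>': "c\<^sup>2 - b\<^sup>2 \<noteq> 0" using \<Delta> by (simp add: c_def b_def)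
 then have D0: "D \<noteq> 0" unfolding D_def by (simp only: of_real_eq_0_iff) simp
 note s2 = solve_two_by_two[OF _ _ \<Delta>', folded D_def]
 have s14: "W 1 x = c * (- (xi1 P * W 7 x)) / D" "W 4 x = b * (- (xi1 P * W 7 x)) / D"
  by (rule s2[OF m(1)[OF x] m(4)[OF x]])+
 have s25: "W 2 x = c * (- (xi2 P * W 7 x)) / D" "W 5 x = b * (- (xi2 P * W 7 x)) / D"
  by (rule s2[OF m(2)[OF x] m(5)[OF x]])+
 have s36: "W 3 x = c * w x / D" "W 6 x = b * w x / D"
  by (rule s2[OF w[OF x] m(6)[OF x]])+
 have "W i x = - W 7 x / D * R_vec P s k $ i"
  using exhaust_7[of i]
 proof (elim disjE)
  assume "i = 7"
  moreover have "W 7 x = - W 7 x / D * (- D)" using D0 by simp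
  moreover have "R_vec P s k $ 7 = - D" by (simp add: R_vec_def Let_def D_def c_def b_def)
  ultimately show ?thesis by simp
 qed (simp_all add: s14 s25 s36 w_def R_vec_def Let_def c_def b_def)
 then show ?thesis
  unfolding W7 by (simp add: W_def D_def c_def b_def)
qed

section \<open>The function spaces and the boundary traces in fast variables\<close>

definition under6 :: "(pt5 => 'b) => pt6 => 'b" where
 "under6 f = (%(t,y1,y2,y3,Y,th). f (t,y1,y2,y3,th))"

definition bdry6 :: "(pt4 => 'b) => pt6 => 'b" where
 "bdry6 g = (%(t,y1,y2,y3,Y,th). g (t,y1,y2,th))"

lemma under6_apply [simp]: "under6 f (t,y1,y2,y3,Y,th) = f (t,y1,y2,y3,th)"
 and bdry6_apply [simp]: "bdry6 g (t,y1,y2,y3,Y,th) = g (t,y1,y2,th)"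
 by (simp_all add: under6_def bdry6_def)

lemma under6_at_Y [simp]: "under6 f (at_Y r x) = under6 f x"
 by (cases x) (simp add: at_Y_def)

lemma decomposes_smooth6:
 fixes U :: "pt6 => 'b::real_normed_vector"
 assumes "decomposes T s U Ub Us"
 obtains \<delta> where "\<delta> > 0" "smooth6 T s 0 (under6 Ub)" "smooth6 T s \<delta> Us"
  "!!x. x \<in> dom6 T s ==> U x = under6 Ub x + Us x"
proof -
 have 1: "Ub \<in> S_under T s" and 2: "Us \<in> S_star T s" and 3: "\<forall>(t,y1,y2,y3,Y3,th) \<in> dom6 T s.
    U (t,y1,y2,y3,Y3,th) = Ub (t,y1,y2,y3,th) + Us (t,y1,y2,y3,Y3,th)"
  using assms unfolding decomposes_def by blast+
 obtain \<delta> where "\<delta> > 0" "smooth6 T s \<delta> Us" by (rule S_star_smooth6[OF 2])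
 moreover have "U x = under6 Ub x + Us x" if "x \<in> dom6 T s" for x
  using bspec[OF 3 that] by (cases x) simp
 ultimately show ?thesis
  using that S_under_smooth6[OF 1] unfolding under6_def by blast
qed

lemma decomposesI:
 fixes f :: "pt6 => 'b::euclidean_space"
 assumes T: "T > 0" and \<delta>: "\<delta> > 0" and f: "smooth6 T s 0 f" and Y: "!!x. f (at_Y 0 x) = f x"
  and g: "smooth6 T s \<delta> g"
 shows "decomposes T s (%x. f x + g x) (%(t,y1,y2,y3,th). f (t,y1,y2,y3,0,th)) g"
proof -
 have Y0: "f (t,y1,y2,y3,0,th) = f (t,y1,y2,y3,Y,th)" for t y1 y2 y3 Y th
  using Y[of "(t,y1,y2,y3,Y,th)"] by (simp add: at_Y_def)
 have "\<forall>x\<in>dom6 T s. case x of (t,y1,y2,y3,Y,th) =>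
   f (t,y1,y2,y3,Y,th) + g (t,y1,y2,y3,Y,th) = f (t,y1,y2,y3,0,th) + g (t,y1,y2,y3,Y,th)"
 proof
  fix x :: pt6
  obtain t y1 y2 y3 Y th where x: "x = (t,y1,y2,y3,Y,th)" by (cases x)
  show "case x of (t,y1,y2,y3,Y,th) =>
   f (t,y1,y2,y3,Y,th) + g (t,y1,y2,y3,Y,th) = f (t,y1,y2,y3,0,th) + g (t,y1,y2,y3,Y,th)"
   unfolding x using Y0[of t y1 y2 y3 th Y] by simp
 qed
 then show ?thesis
  unfolding decomposes_def using smooth6_S_under[OF T f] smooth6_S_star[OF T \<delta> g] by simp
qed

lemma smooth6_partials:
 assumes "smooth6 T s \<delta> U"
 obtains UY Uth where "smooth6 T s \<delta> UY" "smooth6 T s \<delta> Uth"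
  "partial6 T s e_Y U UY" "partial6 T s e_theta U Uth"
 using smooth_fun_deriv[OF assms Basis_e(1)] smooth_fun_deriv[OF assms Basis_e(2)] by metis

lemma theta_partial_at_Y:
 assumes inv: "!!r x. f (at_Y r x) = f x" and d: "partial6 T s e_theta f f'"
  and x: "x \<in> dom6 T s" and r: "0 \<le> sg s * r"
 shows "f' (at_Y r x) = f' x"
proof -
 have "at_Y r x \<in> dom6 T s" using x r by (simp add: at_Y_dom6)
 then have "((%h. f (at_theta h (at_Y r x))) has_vector_derivative f' (at_theta (theta_of x) (at_Y r x))) (at (theta_of x))"
  by (rule slice_has_vector_derivative[OF d])
 moreover have "at_theta h (at_Y r x) = at_Y r (at_theta h x)" for h
  by (cases x) (simp add: at_theta_def at_Y_def)
 ultimately have "((%h. f (at_theta h x)) has_vector_derivative f' (at_Y r x)) (at (theta_of x))"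
  by (simp add: inv)
 moreover have "((%h. f (at_theta h x)) has_vector_derivative f' x) (at (theta_of x))"
  using slice_has_vector_derivative[OF d x, of "theta_of x"] by simp
 ultimately show ?thesis by (rule vector_derivative_unique_at)
qed

text \<open>Only the values along one fast circle enter, so the lemma applies to functions that
 agree on the interface alone.\<close>

lemma theta_primitive_unique:
 assumes T: "T > 0" and f: "smooth6 T s 0 f" "smooth6 T s 0 f'" "partial6 T s e_theta f f'"
  and g: "smooth6 T s 0 g" "smooth6 T s 0 g'" "partial6 T s e_theta g g'"
  and x: "x \<in> dom6 T s" and eq: "!!r. f' (at_theta r x) = g' (at_theta r x)"
 shows "f x - mean f x = g x - mean g x"
proof -
 have "theta_prim f' x = theta_prim g' x"
  unfolding theta_prim_def modulate_def coef_def eq ..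
 then show ?thesis
  using theta_prim_of_derivative[OF T order_refl f x] theta_prim_of_derivative[OF T order_refl g x] by simp
qed

lemma coef_fourier: "coef (cplx f) k (t,y1,y2,y3,Y,th) = fourier (%th. f (t,y1,y2,y3,Y,th)) k"
 by (simp add: coef_def fourier_eq_cfour at_theta_def)

lemma d_theta_bdry_eq:
 assumes d: "partial6 T s e_theta (bdry6 g) g'" and t: "t \<in> {0..T}"
 shows "d_theta_bdry T g (t,y1,y2,th) = g' (t,y1,y2,0,0,th)"
proof -
 have x: "(t,y1,y2,0,0,th) \<in> dom6 T s" using t by (simp add: dom6_def cslab_def chalf_def)
 have "((%h. bdry6 g ((t,y1,y2,0,0,th) + h *\<^sub>R e_theta)) has_vector_derivative g' (t,y1,y2,0,0,th))
   (at 0 within {h. (t,y1,y2,0,0,th) + h *\<^sub>R e_theta \<in> dom6 T s})"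
  using d x unfolding has_partial_def by blast
 moreover have "{h. (t,y1,y2,0,0,th) + h *\<^sub>R e_theta \<in> dom6 T s} = UNIV"
  using t by (simp add: dom6_def cslab_def chalf_def e_theta_def)
 ultimately have "((%h. g (t,y1,y2,th + h)) has_vector_derivative g' (t,y1,y2,0,0,th)) (at 0)"
  by (simp add: e_theta_def)
 then show ?thesis
  using t by (simp add: d_theta_bdry_def partial_deriv_def dom4_def vector_derivative_at)
qed

section \<open>The interior equations on the closed domain\<close>

lemma closed_interior_eq:
 "closed {p :: (real^7) \<times> (real^7) \<times> (real^7) \<times> real.
   interior_eq P s (fst p) (fst (snd p)) (fst (snd (snd p))) (snd (snd (snd p)))}"
 unfolding interior_iff Let_def
 by (intro closed_Collect_conj closed_Collect_eq continuous_intros)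

text \<open>Both sides of the equations are continuous up to the boundary, and interior points are
 dense.\<close>

lemma fast_equations:
 assumes T: "T > 0" and U: "smooth6 T s 0 UY" "smooth6 T s 0 Uth"
  and d: "partial6 T s e_Y U UY" "partial6 T s e_theta U Uth"
  and F: "smooth6 T s 0 F" "smooth6 T s 0 F8"
 shows "(\<forall>t\<in>{0..T}. \<forall>y1 y2. \<forall>y3\<in>slab s. \<forall>Y3\<in>half s. \<forall>th.
    fast_op P T s U (t,y1,y2,y3,Y3,th) = F (t,y1,y2,y3,Y3,th) \<and>
    fast_div P T s U (t,y1,y2,y3,Y3,th) = F8 (t,y1,y2,y3,Y3,th))
   \<longleftrightarrow> (\<forall>x\<in>dom6 T s. interior_eq P s (UY x) (Uth x) (F x) (F8 x))" (is "?L \<longleftrightarrow> ?R")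
proof
 assume L: ?L
 show ?R
 proof
  fix x assume x: "x \<in> dom6 T s"
  obtain t y1 y2 y3 Y th where xe: "x = (t,y1,y2,y3,Y,th)" by (cases x)
  obtain X where X: "!!n. X n \<in> {0..T} \<times> UNIV \<times> UNIV \<times> slab s \<times> half s \<times> UNIV"
   "X \<longlonglongrightarrow> x" "!!n. X n \<in> dom6 T s"
   using interior_approx[OF x[unfolded xe]] unfolding xe by metis
  let ?p = "%x. (UY x, Uth x, F x, F8 x)"
  have lim: "(%n. h (X n)) \<longlonglongrightarrow> h x" if "smooth6 T s 0 h" for h :: "pt6 => 'c::real_normed_vector"
   using smooth_family_continuous[OF that weight_decay[OF order_refl] coord_box_dom6[OF T]] x X(2,3)
   by (simp add: continuous_on_sequentially o_def)
  have tend: "(%n. ?p (X n)) \<longlonglongrightarrow> ?p x"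
   by (intro tendsto_Pair lim U F)
  have ie: "interior_eq P s (UY z) (Uth z) (F z) (F8 z)" if "z \<in> range X" for z
  proof -
   have z: "z \<in> dom6 T s" using that X(3) by blast
   obtain n where n: "z = X n" using \<open>z \<in> range X\<close> by blast
   obtain t y1 y2 y3 Y th where ze: "z = (t,y1,y2,y3,Y,th)" by (cases z)
   have "fast_op P T s U z = F z \<and> fast_div P T s U z = F8 z"
    using L X(1)[of n] unfolding n[symmetric] ze by simp
   then show ?thesis using fast_interior[OF T d z] by metis
  qed
  have "?p x \<in> {p. interior_eq P s (fst p) (fst (snd p)) (fst (snd (snd p))) (snd (snd (snd p)))}"
  proof (rule closed_sequentially[OF closed_interior_eq _ tend])
   fix n
   show "?p (X n) \<in> {p. interior_eq P s (fst p) (fst (snd p)) (fst (snd (snd p))) (snd (snd (snd p)))}"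
    unfolding mem_Collect_eq fst_conv snd_conv by (rule ie) (rule rangeI)
  qed
  then show "interior_eq P s (UY x) (Uth x) (F x) (F8 x)" unfolding mem_Collect_eq fst_conv snd_conv .
 qed
next
 assume R: ?R
 have "(t,y1,y2,y3,Y,th) \<in> dom6 T s" if "t \<in> {0..T}" "y3 \<in> slab s" "Y \<in> half s" for t y1 y2 y3 Y th
  using that by (auto simp: dom6_def slab_def half_def cslab_def chalf_def)
 then show ?L using R fast_interior[OF T d] by metis
qed

text \<open>The residual of the first part does not depend on \<open>Y\<close>, that of the second
 part decays, and they add up to zero.\<close>

lemma compatible_split:
 assumes T: "T > 0" and \<delta>: "\<delta> > 0" and Fb: "smooth6 T s 0 Fb" "!!r x. Fb (at_Y r x) = Fb x"
  and Fs: "smooth6 T s \<delta> Fs" and F8b: "smooth6 T s 0 F8b" "!!r x. F8b (at_Y r x) = F8b x"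
  and F8s: "smooth6 T s \<delta> F8s"
  and F: "!!x. x \<in> dom6 T s ==> F x = Fb x + Fs x" and F8: "!!x. x \<in> dom6 T s ==> F8 x = F8b x + F8s x"
  and comp: "compatible P T s F F8"
 shows "compatible P T s Fb F8b" "compatible P T s Fs F8s"
proof -
 have \<delta>0: "\<delta> \<ge> 0" using \<delta> by simp
 obtain Fbth where Fbth: "partial6 T s e_theta Fb Fbth"
  using smooth6_partials[OF Fb(1)] by metis
 obtain F8bth where F8bth: "partial6 T s e_theta F8b F8bth"
  using smooth6_partials[OF F8b(1)] by metis
 obtain FsY Fsth where Fs': "smooth6 T s \<delta> FsY" "smooth6 T s \<delta> Fsth"
  "partial6 T s e_Y Fs FsY" "partial6 T s e_theta Fs Fsth"
  by (rule smooth6_partials[OF Fs])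
 obtain F8sth where F8s': "smooth6 T s \<delta> F8sth" "partial6 T s e_theta F8s F8sth"
  using smooth6_partials[OF F8s] by metis
 define f where "f x = xi1 P * Fbth x $ 4 + xi2 P * Fbth x $ 5 - tau P * F8bth x" for x
 define g where "g x = FsY x $ 6 + xi1 P * Fsth x $ 4 + xi2 P * Fsth x $ 5 - tau P * F8sth x" for x
 note Fb6 = has_partial_nth[OF Y_free_has_partial[of Fb, OF Fb(2)], of _ 6]
 note b = has_partial_nth[OF Fbth] and st = has_partial_nth[OF Fs'(4)]
 have g: "smooth6 T s \<delta> g"
  unfolding g_def[abs_def]
  by (intro smooth6_diff[OF \<delta>0] smooth6_add[OF T \<delta>0] smooth6_cmult[OF T \<delta>0] smooth6_nth[OF _ \<delta>0] Fs' F8s')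
 have "f x + g x = 0" if x: "x \<in> dom6 T s" for x
 proof -
  have dY: "d_Y3 T s (%z. F z $ 6) x = 0 + FsY x $ 6"
   by (rule d_Y3_eq[OF T has_partial_cong[OF has_partial_add[OF Fb6 has_partial_nth[OF Fs'(3)]]] x]) (simp_all add: F)
  have dth: "d_theta T s (%z. F z $ i) x = Fbth x $ i + Fsth x $ i" for i
   by (rule d_theta_eq[OF T has_partial_cong[OF has_partial_add[OF b st]] x]) (simp_all add: F)
  have d8: "d_theta T s F8 x = F8bth x + F8sth x"
   by (rule d_theta_eq[OF T has_partial_cong[OF has_partial_add[OF F8bth F8s'(2)]] x]) (simp_all add: F8)
  show ?thesis
   using bspec[OF comp[unfolded compatible_def] x] unfolding f_def g_def dY dth d8 distrib_left by linarith
 qed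
 moreover have "f (at_Y (sg s * r) x) = f x" if "x \<in> dom6 T s" "0 \<le> r" for r x
  unfolding f_def using theta_partial_at_Y[OF Fb(2) Fbth that(1)] theta_partial_at_Y[OF F8b(2) F8bth that(1)] that(2) by simp
 ultimately have z: "f x = 0" "g x = 0" if "x \<in> dom6 T s" for x
  using decomposition_unique[OF \<delta> g, of f x] that by blast+
 show "compatible P T s Fb F8b"
  unfolding compatible_def
  using z(1) d_Y3_eq[OF T Fb6] d_theta_eq[OF T b] d_theta_eq[OF T F8bth] by (simp add: f_def)
 show "compatible P T s Fs F8s"
  unfolding compatible_def
  using z(2) d_Y3_eq[OF T has_partial_nth[OF Fs'(3)]] d_theta_eq[OF T st] d_theta_eq[OF T F8s'(2)] by (simp add: g_def)
qed

definition y3_of :: "pt6 => real" where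
 "y3_of = (%(t,y1,y2,y3,Y,th). y3)"

text \<open>The factor \<open>1 - sg s * y\<^sub>3\<close> equals one on the interface and zero on the outer boundary.\<close>

lemma smooth6_cutoff:
 fixes f :: "pt6 => real"
 assumes T: "T > 0" and f: "smooth6 T s 0 f"
 shows "smooth6 T s 0 (%x. (1 - sg s * y3_of x) * f x)"
proof -
 let ?Q = "%\<zeta>. \<exists>f g :: pt6 => real. smooth6 T s 0 f \<and> smooth6 T s 0 g \<and> \<zeta> = (%_::unit. %x. (1 - sg s * y3_of x) * f x + g x)"
 have y3: "norm (1 - sg s * y3_of x) \<le> 1" if "x \<in> dom6 T s" for x
  using that by (cases x) (auto simp: dom6_def cslab_def y3_of_def)
 have "smooth6 T s 0 (%x. 0 * f x)" by (rule smooth6_cmult[OF T order_refl f])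
 then have "?Q (%_ x. (1 - sg s * y3_of x) * f x)"
  using f by (intro exI[of _ f] exI[of _ "%x. 0 * f x"]) simp
 then show ?thesis
 proof (rule smooth_family_closed[where Q = ?Q])
  fix \<zeta> n assume "?Q \<zeta>"
  then obtain f g :: "pt6 => real" where fg: "smooth6 T s 0 f" "smooth6 T s 0 g" "\<zeta> = (%_ x. (1 - sg s * y3_of x) * f x + g x)" by blast
  obtain A where A: "A \<ge> 0" "!!x. x \<in> dom6 T s ==> norm (f x) \<le> A"
   using smooth_family_bound1[OF fg(1) weight_decay[OF order_refl]] by metis
  obtain B where B: "B \<ge> 0" "!!x. x \<in> dom6 T s ==> norm (g x) \<le> B"
   using smooth_family_bound1[OF fg(2) weight_decay[OF order_refl]] by metis
  have "norm (\<zeta> i x) \<le> A + B" if "x \<in> dom6 T s" for i x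
   unfolding fg(3)
   using norm_triangle_mono[OF mult_mono[OF y3[OF that] A(2)[OF that], folded norm_mult] B(2)[OF that]] by simp
  then show "\<exists>C. \<forall>i. \<forall>x\<in>dom6 T s. 1 ^ n * norm (\<zeta> i x) \<le> C * decay s 0 x"
   by (intro exI[of _ "A + B"]) (simp add: decay_alt)
 next
  fix \<zeta> :: "unit => pt6 => real" and p i x assume "?Q \<zeta>" and p: "p \<in> per6" and x: "x \<in> dom6 T s"
  then obtain f g :: "pt6 => real" where fg: "smooth6 T s 0 f" "smooth6 T s 0 g" "\<zeta> = (%_ x. (1 - sg s * y3_of x) * f x + g x)" by blast
  have "y3_of (x + p) = y3_of x" using p by (cases x) (auto simp: y3_of_def per6_def)
  then show "\<zeta> i (x + p) = \<zeta> i x"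
   unfolding fg(3) using smooth_family_periodic[OF fg(1) p x] smooth_family_periodic[OF fg(2) p x] by simp
 next
  fix \<zeta> :: "unit => pt6 => real" and b :: pt6 assume "?Q \<zeta>" and b: "b \<in> Basis"
  then obtain f g :: "pt6 => real" where fg: "smooth6 T s 0 f" "smooth6 T s 0 g" "\<zeta> = (%_ x. (1 - sg s * y3_of x) * f x + g x)" by blast
  obtain f' where f': "smooth6 T s 0 f'" "partial6 T s b f f'" using smooth_fun_deriv[OF fg(1) b] .
  obtain g' where g': "smooth6 T s 0 g'" "partial6 T s b g g'" using smooth_fun_deriv[OF fg(2) b] .
  have lin: "y3_of (x + h *\<^sub>R b) = y3_of x + h * y3_of b" for x h
   by (cases x; cases b) (simp add: y3_of_def)
  have cut: "partial6 T s b (%x. 1 - sg s * y3_of x) (%_. - sg s * y3_of b)"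
   unfolding has_partial_def lin by (auto intro!: derivative_eq_intros simp: has_real_derivative_iff_has_vector_derivative[symmetric])
  have "partial6 T s b (\<zeta> i) (%x. (1 - sg s * y3_of x) * f' x + ((- sg s * y3_of b) * f x + g' x))" for i
   unfolding fg(3)
   by (rule has_partial_cong[OF has_partial_add[OF has_partial_mult[OF cut f'(2)] g'(2)]]) (simp_all add: add.assoc)
  moreover have "smooth6 T s 0 (%x. (- sg s * y3_of b) * f x + g' x)"
   by (intro smooth6_add[OF T order_refl] smooth6_cmult[OF T order_refl] fg g')
  ultimately show "\<exists>\<zeta>'. ?Q \<zeta>' \<and> (\<forall>i. partial6 T s b (\<zeta> i) (\<zeta>' i))"
   using f'(1) by (intro exI[of _ "%_ x. (1 - sg s * y3_of x) * f' x + ((- sg s * y3_of b) * f x + g' x)"] conjI) blast+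
 qed
qed

section \<open>Necessary conditions\<close>

lemma smooth6_cong:
 assumes f: "smooth6 T s \<delta> f" and eq: "!!x. x \<in> dom6 T s ==> g x = f x"
 shows "smooth6 T s \<delta> g"
proof (rule smooth_familyI)
 show "\<exists>C. \<forall>i::unit. \<forall>x\<in>dom6 T s. 1 ^ n * norm (g x) \<le> C * decay s \<delta> x" for n
  using f eq by (cases rule: smooth_family.cases) simp
 show "g (x + p) = g x" if "p \<in> per6" "x \<in> dom6 T s" for p x
  using smooth_family_periodic[OF f that] eq[OF that(2)] eq dom6_translate[OF that(1), of x T s] that(2) by simp
 show "\<exists>\<phi>'. smooth_family (dom6 T s) per6 (%_::unit. 1) (decay s \<delta>) \<phi>' \<and> (\<forall>i. partial6 T s b g (\<phi>' i))"
  if b: "b \<in> Basis" for b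
 proof -
  obtain f' where f': "smooth6 T s \<delta> f'" "partial6 T s b f f'" using smooth_fun_deriv[OF f b] .
  have "partial6 T s b g f'" by (rule has_partial_cong[OF f'(2)]) (simp_all add: eq)
  with f'(1) show ?thesis by (intro exI[of _ "%_. f'"]) simp
 qed
qed

text \<open>The equations up to the boundary; the derivatives are unique, so the existential
 quantifier chooses nothing.\<close>

definition solves :: "mhd_params => real => side => (pt6 => real^7) => (pt6 => real^7) => (pt6 => real) => bool" where
 "solves P T s U F F8 \<longleftrightarrow> (\<exists>UY Uth. smooth6 T s 0 UY \<and> smooth6 T s 0 Uth \<and>
   partial6 T s e_Y U UY \<and> partial6 T s e_theta U Uth \<and>
   (\<forall>x\<in>dom6 T s. interior_eq P s (UY x) (Uth x) (F x) (F8 x)))"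

lemma solvesD:
 assumes T: "T > 0" and "solves P T s U F F8" and d: "partial6 T s e_Y U UY" "partial6 T s e_theta U Uth"
  and x: "x \<in> dom6 T s"
 shows "interior_eq P s (UY x) (Uth x) (F x) (F8 x)"
proof -
 obtain VY Vth where V: "partial6 T s e_Y U VY" "partial6 T s e_theta U Vth"
  "\<forall>x\<in>dom6 T s. interior_eq P s (VY x) (Vth x) (F x) (F8 x)"
  using assms(2) unfolding solves_def by blast
 have "UY x = VY x" "Uth x = Vth x"
  using has_partial_unique[OF coord_box_dom6[OF T] Basis_e(1) d(1) V(1) x]
   has_partial_unique[OF coord_box_dom6[OF T] Basis_e(2) d(2) V(2) x] by blast+
 then show ?thesis using V(3) x by simp
qed

lemma solves_iff:
 assumes T: "T > 0" and U: "smooth6 T s 0 U" and F: "smooth6 T s 0 F" "smooth6 T s 0 F8"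
 shows "solves P T s U F F8 \<longleftrightarrow> (\<forall>t\<in>{0..T}. \<forall>y1 y2. \<forall>y3\<in>slab s. \<forall>Y3\<in>half s. \<forall>th.
    fast_op P T s U (t,y1,y2,y3,Y3,th) = F (t,y1,y2,y3,Y3,th) \<and>
    fast_div P T s U (t,y1,y2,y3,Y3,th) = F8 (t,y1,y2,y3,Y3,th))"
proof -
 obtain UY Uth where U': "smooth6 T s 0 UY" "smooth6 T s 0 Uth"
  "partial6 T s e_Y U UY" "partial6 T s e_theta U Uth"
  by (rule smooth6_partials[OF U])
 have "solves P T s U F F8 \<longleftrightarrow> (\<forall>x\<in>dom6 T s. interior_eq P s (UY x) (Uth x) (F x) (F8 x))"
  using solvesD[OF T _ U'(3,4)] U' unfolding solves_def by metis
 then show ?thesis using fast_equations[OF T U' F] by simp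
qed

text \<open>The decomposition of the function spaces, with both parts as functions of all six
 variables and with an explicit decay rate.\<close>

definition splits :: "real => side => real => (pt6 => 'b::real_normed_vector) => (pt6 => 'b) => (pt6 => 'b) => bool" where
 "splits T s \<delta> U Ub Us \<longleftrightarrow> smooth6 T s 0 Ub \<and> (\<forall>r x. Ub (at_Y r x) = Ub x) \<and> smooth6 T s \<delta> Us \<and>
   (\<forall>x\<in>dom6 T s. U x = Ub x + Us x)"

lemma splitsD:
 assumes "splits T s \<delta> U Ub Us"
 shows "smooth6 T s 0 Ub" "Ub (at_Y r x) = Ub x" "smooth6 T s \<delta> Us" "x \<in> dom6 T s ==> U x = Ub x + Us x"
 using assms unfolding splits_def by blast+

lemma decomposes_splits:
 assumes "decomposes T s U Ub Us"
 obtains \<delta> where "\<delta> > 0" "!!\<delta>'. 0 < \<delta>' ==> \<delta>' \<le> \<delta> ==> splits T s \<delta>' U (under6 Ub) Us"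
proof -
 obtain \<delta> where d: "\<delta> > 0" "smooth6 T s 0 (under6 Ub)" "smooth6 T s \<delta> Us"
  "!!x. x \<in> dom6 T s ==> U x = under6 Ub x + Us x" by (rule decomposes_smooth6[OF assms]) (rule that)
 have "splits T s \<delta>' U (under6 Ub) Us" if "0 < \<delta>'" "\<delta>' \<le> \<delta>" for \<delta>'
  unfolding splits_def using d(2,4) smooth6_mono[OF d(3) less_imp_le[OF that(1)] that(2)] by simp
 then show ?thesis using that d(1) by blast
qed

lemma splits_smooth:
 assumes T: "T > 0" and \<delta>: "\<delta> > 0" and U: "splits T s \<delta> U Ub Us"
 shows "smooth6 T s 0 U"
proof -
 note D = splitsD[OF U]
 have "smooth6 T s 0 Us" using smooth6_mono[OF D(3) order_refl] \<delta> by simp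
 from smooth6_add[OF T order_refl D(1) this] show ?thesis by (rule smooth6_cong) (rule D(4))
qed

lemma splits_nth:
 assumes "splits T s \<delta> U Ub Us" "\<delta> > 0"
 shows "splits T s \<delta> (%x. U x $ i) (%x. Ub x $ i) (%x. Us x $ i)"
 using assms smooth6_nth[of T s 0 Ub i] smooth6_nth[of T s \<delta> Us i] unfolding splits_def by simp

lemma splits_mean:
 fixes f :: "pt6 => real"
 assumes T: "T > 0" and \<delta>: "\<delta> > 0" and f: "splits T s \<delta> f fb fs" and x: "x \<in> dom6 T s"
 shows "mean f x = mean fb x + mean fs x"
proof -
 note D = splitsD[OF f]
 have s0: "smooth6 T s 0 fs" using smooth6_mono[OF D(3) order_refl] \<delta> by simp
 have "mean f x = mean (%x. fb x + fs x) x"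
  unfolding mean_def by (subst coef_cong[where g = "cplx (%x. fb x + fs x)"]) (use D(4) x in simp_all)
 also have "\<dots> = mean fb x + mean fs x" by (rule mean_add[OF T order_refl D(1) s0 x])
 finally show ?thesis .
qed

text \<open>A function of the split form that is a \<open>th\<close>-derivative has mean zero, and then so have both
 of its parts, because the mean of the first does not decay.\<close>

lemma split_theta_derivative:
 fixes f :: "pt6 => real"
 assumes T: "T > 0" and \<delta>: "\<delta> > 0" and h: "splits T s \<delta> h hb hs"
  and f: "smooth6 T s 0 f" "partial6 T s e_theta f h" and x: "x \<in> dom6 T s"
 shows "mean hb x = 0" "mean hs x = 0"
proof -
 note D = splitsD[OF h]
 have "mean hb y + mean hs y = 0" if y: "y \<in> dom6 T s" for y
  using splits_mean[OF T \<delta> h y] mean_theta_derivative[OF T order_refl f(1) splits_smooth[OF T \<delta> h] f(2) y] by simp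
 moreover have "mean hb (at_Y (sg s * r) y) = mean hb y" for r y
  by (rule mean_at_Y) (rule D(2))
 ultimately show "mean hb x = 0" "mean hs x = 0"
  using decomposition_unique[OF \<delta> smooth6_mean[OF T less_imp_le[OF \<delta>] D(3)], of "mean hb" x] x by blast+
qed

lemma mean_combination:
 assumes T: "T > 0" and \<delta>: "\<delta> \<ge> 0" and s: "smooth6 T s \<delta> f" "smooth6 T s \<delta> g" "smooth6 T s \<delta> h" and x: "x \<in> dom6 T s"
 shows "mean (%x. f x - u * g x + v * h x) x = mean f x - u * mean g x + v * mean h x"
proof -
 have "mean (%x. f x + ((- u) * g x + v * h x)) x = mean f x + ((- u) * mean g x + v * mean h x)"
  using mean_add[OF T \<delta> s(1) smooth6_add[OF T \<delta> smooth6_cmult[OF T \<delta> s(2)] smooth6_cmult[OF T \<delta> s(3)]] x, of "- u" v]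
   mean_add[OF T \<delta> smooth6_cmult[OF T \<delta> s(2)] smooth6_cmult[OF T \<delta> s(3)] x, of "- u" v]
  by (simp only: mean_cmult[OF T \<delta>])
 then show ?thesis by (simp add: algebra_simps)
qed

lemma splits_combination:
 fixes f :: "pt6 => real"
 assumes T: "T > 0" and \<delta>: "\<delta> > 0" and "splits T s \<delta> f fb fs" "splits T s \<delta> g gb gs" "splits T s \<delta> h hb hs"
 shows "splits T s \<delta> (%x. f x - u * g x + v * h x) (%x. fb x - u * gb x + v * hb x) (%x. fs x - u * gs x + v * hs x)"
proof -
 have "smooth6 T s 0 (%x. fb x - u * gb x + v * hb x)"
  by (intro smooth6_add[OF T] smooth6_diff smooth6_cmult[OF T] order_refl splitsD(1)[OF assms(3)] splitsD(1)[OF assms(4)] splitsD(1)[OF assms(5)])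
 moreover have "smooth6 T s \<delta> (%x. fs x - u * gs x + v * hs x)"
  by (intro smooth6_add[OF T] smooth6_diff smooth6_cmult[OF T] less_imp_le[OF \<delta>] splitsD(3)[OF assms(3)] splitsD(3)[OF assms(4)] splitsD(3)[OF assms(5)])
 ultimately show ?thesis
  unfolding splits_def using splitsD(2,4)[OF assms(3)] splitsD(2,4)[OF assms(4)] splitsD(2,4)[OF assms(5)]
  by (simp add: algebra_simps)
qed

text \<open>Each of the stated combinations of sources is a derivative along \<open>th\<close> on
 the whole domain, up to the normal derivatives in the third and in the divergence equations, which
 come from the decaying part alone.\<close>

lemma solution_means:
 assumes T: "T > 0" and \<delta>: "\<delta> > 0" and U: "splits T s \<delta> U Ub Us" and F: "splits T s \<delta> F Fb Fs"
  and F8: "splits T s \<delta> F8 F8b F8s" and sol: "solves P T s U F F8"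
  and UsY: "smooth6 T s \<delta> UsY" "partial6 T s e_Y Us UsY" and x: "x \<in> dom6 T s"
 shows "mean_vec Fb x = 0" "mean F8b x = 0"
  "vel1 P s * mean (%z. Fs z $ 7) x - mag1 P s * mean F8s x = mean (%z. Fs z $ 1) x"
  "vel2 P s * mean (%z. Fs z $ 7) x - mag2 P s * mean F8s x = mean (%z. Fs z $ 2) x"
  "mag1 P s * mean (%z. Fs z $ 7) x - vel1 P s * mean F8s x = mean (%z. Fs z $ 4) x"
  "mag2 P s * mean (%z. Fs z $ 7) x - vel2 P s * mean F8s x = mean (%z. Fs z $ 5) x"
  "mean (%z. UsY z $ 7) x = mean (%z. Fs z $ 3) x"
  "mean (%z. UsY z $ 3) x = mean (%z. Fs z $ 7) x"
  "mean (%z. UsY z $ 6) x = mean F8s x"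
proof -
 have \<delta>0: "\<delta> \<ge> 0" using \<delta> by simp
 have U0: "smooth6 T s 0 U" by (rule splits_smooth[OF T \<delta> U])
 obtain Uth where Uth: "partial6 T s e_theta U Uth" using smooth6_partials[OF U0] by metis
 have UY: "partial6 T s e_Y U UsY"
  using has_partial_cong[OF has_partial_add[OF Y_free_has_partial[of Ub] UsY(2)], of U UsY] splitsD(2,4)[OF U] by simp
 have I: "c_coef P s * Uth x$1 - b_coef P s * Uth x$4 + xi1 P * Uth x$7 = F x$1 - vel1 P s * F x$7 + mag1 P s * F8 x"
   "c_coef P s * Uth x$2 - b_coef P s * Uth x$5 + xi2 P * Uth x$7 = F x$2 - vel2 P s * F x$7 + mag2 P s * F8 x"
   "UsY x$7 + c_coef P s * Uth x$3 - b_coef P s * Uth x$6 = F x$3"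
   "c_coef P s * Uth x$4 - b_coef P s * Uth x$1 = F x$4 - mag1 P s * F x$7 + vel1 P s * F8 x"
   "c_coef P s * Uth x$5 - b_coef P s * Uth x$2 = F x$5 - mag2 P s * F x$7 + vel2 P s * F8 x"
   "UsY x$3 + xi1 P * Uth x$1 + xi2 P * Uth x$2 = F x$7"
   "UsY x$6 + xi1 P * Uth x$4 + xi2 P * Uth x$5 = F8 x" if "x \<in> dom6 T s" for x
  using solvesD[OF T sol UY Uth that] unfolding interior_iff Let_def by blast+
 note Fi = splits_nth[OF F \<delta>]
 have z: "splits T s \<delta> (%_. 0) (%_. 0 :: real) (%_. 0)"
  unfolding splits_def using smooth6_cmult[OF T \<delta>0 smooth6_nth[OF UsY(1) \<delta>0], of 0] smooth6_cmult[OF T order_refl smooth6_nth[OF U0 order_refl], of 0]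
  by simp
 have Y: "splits T s \<delta> (%x. UsY x $ i) (%_. 0) (%x. UsY x $ i)" for i
  using z smooth6_nth[OF UsY(1) \<delta>0, of i] unfolding splits_def by simp
 note sU = smooth6_add[OF T order_refl] smooth6_diff[OF order_refl] smooth6_cmult[OF T order_refl] smooth6_nth[OF U0 order_refl]
 note dU = has_partial_add has_partial_diff has_partial_cmult has_partial_nth[OF Uth]
 have 1: "mean (%x. Fb x $ i - u * Fb x $ 7 + v * F8b x) x = 0" "mean (%x. Fs x $ i - u * Fs x $ 7 + v * F8s x) x = 0"
  if eq: "!!x. x \<in> dom6 T s ==> p * Uth x $ l - r * Uth x $ m + w * Uth x $ 7 = F x $ i - u * F x $ 7 + v * F8 x"
  for i l m u v p r w
 proof -
  let ?f = "%x. p * U x $ l - r * U x $ m + w * U x $ 7"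
  have "partial6 T s e_theta ?f (%x. p * Uth x $ l - r * Uth x $ m + w * Uth x $ 7)"
   by (intro dU)
  then have d: "partial6 T s e_theta ?f (%x. F x $ i - u * F x $ 7 + v * F8 x)"
   by (rule has_partial_cong) (simp_all add: eq)
  have f: "smooth6 T s 0 ?f" by (intro sU)
  show "mean (%x. Fb x $ i - u * Fb x $ 7 + v * F8b x) x = 0" "mean (%x. Fs x $ i - u * Fs x $ 7 + v * F8s x) x = 0"
   using split_theta_derivative[OF T \<delta> splits_combination[OF T \<delta> Fi Fi F8] f d x] .
 qed
 have 2: "mean fb x = 0" "mean fs x = mean (%x. UsY x $ i) x"
  if g: "smooth6 T s 0 g" "partial6 T s e_theta g g'" "!!x. x \<in> dom6 T s ==> g' x = f x - UsY x $ i" and f: "splits T s \<delta> f fb fs"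
  for f fb fs g g' and i
 proof -
  have sp: "splits T s \<delta> (%x. f x - 1 * UsY x $ i + 0 * 0) (%x. fb x - 1 * 0 + 0 * 0) (%x. fs x - 1 * UsY x $ i + 0 * 0)"
   by (rule splits_combination[OF T \<delta> f Y z])
  have dp: "partial6 T s e_theta g (%x. f x - 1 * UsY x $ i + 0 * 0)"
   by (rule has_partial_cong[OF g(2)]) (simp_all add: g(3))
  show "mean fb x = 0" using split_theta_derivative(1)[OF T \<delta> sp g(1) dp x] by simp
  show "mean fs x = mean (%x. UsY x $ i) x"
   using split_theta_derivative(2)[OF T \<delta> sp g(1) dp x]
    mean_combination[OF T \<delta>0 splitsD(3)[OF f] smooth6_nth[OF UsY(1) \<delta>0] splitsD(3)[OF z] x, of 1 i 0] by simp
 qed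
 have e3: "mean (%x. Fb x $ 3) x = 0" "mean (%x. Fs x $ 3) x = mean (%x. UsY x $ 7) x"
  by (rule 2[OF _ _ _ Fi, of "%x. c_coef P s * U x$3 - b_coef P s * U x$6" "%x. c_coef P s * Uth x$3 - b_coef P s * Uth x$6"],
    intro sU, intro dU, simp add: I(3)[symmetric])+
 have e7: "mean (%x. Fb x $ 7) x = 0" "mean (%x. Fs x $ 7) x = mean (%x. UsY x $ 3) x"
  by (rule 2[OF _ _ _ Fi, of "%x. xi1 P * U x$1 + xi2 P * U x$2" "%x. xi1 P * Uth x$1 + xi2 P * Uth x$2"],
    intro sU, intro dU, simp add: I(6)[symmetric])+
 have e8: "mean F8b x = 0" "mean F8s x = mean (%x. UsY x $ 6) x"
  by (rule 2[OF _ _ _ F8, of "%x. xi1 P * U x$4 + xi2 P * U x$5" "%x. xi1 P * Uth x$4 + xi2 P * Uth x$5"],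
    intro sU, intro dU, simp add: I(7)[symmetric])+
 have I6: "F x $ 6 = c_coef P s * Uth x$6 - b_coef P s * Uth x$3" if "x \<in> dom6 T s" for x
  using solvesD[OF T sol UY Uth that] unfolding interior_iff Let_def by simp
 have e6: "mean (%x. Fb x $ 6 - 0 * Fb x $ 7 + 0 * F8b x) x = 0"
  by (rule 1[where p = "c_coef P s" and l = 6 and r = "b_coef P s" and m = 3 and w = 0]) (simp add: I6)
 note combb = mean_combination[OF T order_refl splitsD(1)[OF Fi] splitsD(1)[OF Fi] splitsD(1)[OF F8] x]
  and combs = mean_combination[OF T \<delta>0 splitsD(3)[OF Fi] splitsD(3)[OF Fi] splitsD(3)[OF F8] x]
 have e1: "mean (%x. Fb x $ 1 - vel1 P s * Fb x $ 7 + mag1 P s * F8b x) x = 0" "mean (%x. Fs x $ 1 - vel1 P s * Fs x $ 7 + mag1 P s * F8s x) x = 0"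
  by (rule 1[OF I(1)], assumption)+
 have e2: "mean (%x. Fb x $ 2 - vel2 P s * Fb x $ 7 + mag2 P s * F8b x) x = 0" "mean (%x. Fs x $ 2 - vel2 P s * Fs x $ 7 + mag2 P s * F8s x) x = 0"
  by (rule 1[OF I(2)], assumption)+
 have e4: "mean (%x. Fb x $ 4 - mag1 P s * Fb x $ 7 + vel1 P s * F8b x) x = 0" "mean (%x. Fs x $ 4 - mag1 P s * Fs x $ 7 + vel1 P s * F8s x) x = 0"
  by (rule 1[where p = "c_coef P s" and l = 4 and r = "b_coef P s" and m = 1 and w = 0], simp add: I(4))+
 have e5: "mean (%x. Fb x $ 5 - mag2 P s * Fb x $ 7 + vel2 P s * F8b x) x = 0" "mean (%x. Fs x $ 5 - mag2 P s * Fs x $ 7 + vel2 P s * F8s x) x = 0"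
  by (rule 1[where p = "c_coef P s" and l = 5 and r = "b_coef P s" and m = 2 and w = 0], simp add: I(5))+
 show "mean_vec Fb x = 0"
  using e1(1) e2(1) e3(1) e4(1) e5(1) e6 e7(1) e8(1)
  unfolding combb by (simp add: vec_eq_iff forall_7 mean_vec_def)
 show "mean F8b x = 0" by (rule e8(1))
 show "vel1 P s * mean (%z. Fs z $ 7) x - mag1 P s * mean F8s x = mean (%z. Fs z $ 1) x"
  "vel2 P s * mean (%z. Fs z $ 7) x - mag2 P s * mean F8s x = mean (%z. Fs z $ 2) x"
  "mag1 P s * mean (%z. Fs z $ 7) x - vel1 P s * mean F8s x = mean (%z. Fs z $ 4) x"
  "mag2 P s * mean (%z. Fs z $ 7) x - vel2 P s * mean F8s x = mean (%z. Fs z $ 5) x"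
  using e1(2) e2(2) e4(2) e5(2) unfolding combs by linarith+
 show "mean (%z. UsY z $ 7) x = mean (%z. Fs z $ 3) x"
  "mean (%z. UsY z $ 3) x = mean (%z. Fs z $ 7) x"
  "mean (%z. UsY z $ 6) x = mean F8s x"
  using e3(2) e7(2) e8(2) by simp_all
qed

text \<open>Inserting the equations for the sources leaves mixed second derivatives of
 \<open>U\<close>, which cancel in pairs.\<close>

lemma solution_compatible:
 assumes T: "T > 0" and U: "smooth6 T s 0 U" and sol: "solves P T s U F F8"
 shows "compatible P T s F F8"
proof -
 obtain UY Uth where U': "smooth6 T s 0 UY" "smooth6 T s 0 Uth"
  "partial6 T s e_Y U UY" "partial6 T s e_theta U Uth"
  by (rule smooth6_partials[OF U])
 obtain UYth where UYth: "smooth6 T s 0 UYth" "partial6 T s e_theta UY UYth"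
  using smooth6_partials[OF U'(1)] by metis
 obtain UthY Uthth where Uth': "smooth6 T s 0 UthY" "partial6 T s e_Y Uth UthY" "partial6 T s e_theta Uth Uthth"
  using smooth6_partials[OF U'(2)] by metis
 note n = smooth6_nth[OF _ order_refl] and p = has_partial_nth
 have I: "F x$4 = c_coef P s * Uth x$4 - b_coef P s * Uth x$1 + mag1 P s * (UY x$3 + xi1 P * Uth x$1 + xi2 P * Uth x$2)
    - vel1 P s * (UY x$6 + xi1 P * Uth x$4 + xi2 P * Uth x$5)"
   "F x$5 = c_coef P s * Uth x$5 - b_coef P s * Uth x$2 + mag2 P s * (UY x$3 + xi1 P * Uth x$1 + xi2 P * Uth x$2)
    - vel2 P s * (UY x$6 + xi1 P * Uth x$4 + xi2 P * Uth x$5)"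
   "F x$6 = c_coef P s * Uth x$6 - b_coef P s * Uth x$3"
   "F8 x = UY x$6 + xi1 P * Uth x$4 + xi2 P * Uth x$5" if "x \<in> dom6 T s" for x
  using solvesD[OF T sol U'(3,4) that] unfolding interior_iff Let_def by simp_all
 note dd = has_partial_add has_partial_diff has_partial_cmult p[OF UYth(2)] p[OF Uth'(2)] p[OF Uth'(3)]
 show ?thesis
  unfolding compatible_def
 proof
  fix x assume x: "x \<in> dom6 T s"
  have comm: "UthY x $ i = UYth x $ i" for i
   by (rule mixed_partials_commute[OF T order_refl n[OF U] n[OF U'(1)] n[OF U'(2)] n[OF UYth(1)] n[OF Uth'(1)]
      p[OF U'(3)] p[OF U'(4)] p[OF UYth(2)] p[OF Uth'(2)] x])
  have 4: "d_theta T s (%z. F z $ 4) x = c_coef P s * Uthth x$4 - b_coef P s * Uthth x$1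
    + mag1 P s * (UYth x$3 + xi1 P * Uthth x$1 + xi2 P * Uthth x$2) - vel1 P s * (UYth x$6 + xi1 P * Uthth x$4 + xi2 P * Uthth x$5)"
   by (rule d_theta_eq[OF T has_partial_cong x, OF _ I(1) refl]) (intro dd)
  have 5: "d_theta T s (%z. F z $ 5) x = c_coef P s * Uthth x$5 - b_coef P s * Uthth x$2
    + mag2 P s * (UYth x$3 + xi1 P * Uthth x$1 + xi2 P * Uthth x$2) - vel2 P s * (UYth x$6 + xi1 P * Uthth x$4 + xi2 P * Uthth x$5)"
   by (rule d_theta_eq[OF T has_partial_cong x, OF _ I(2) refl]) (intro dd)
  have 6: "d_Y3 T s (%z. F z $ 6) x = c_coef P s * UthY x$6 - b_coef P s * UthY x$3"
   by (rule d_Y3_eq[OF T has_partial_cong x, OF _ I(3) refl]) (intro dd)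
  have 8: "d_theta T s F8 x = UYth x$6 + xi1 P * Uthth x$4 + xi2 P * Uthth x$5"
   by (rule d_theta_eq[OF T has_partial_cong x, OF _ I(4) refl]) (intro dd)
  show "d_Y3 T s (%z. F z $ 6) x + xi1 P * d_theta T s (%z. F z $ 4) x + xi2 P * d_theta T s (%z. F z $ 5) x
    - tau P * d_theta T s F8 x = 0"
   unfolding 4 5 6 8 comm c_coef_def a_coef_def b_coef_def by (simp add: algebra_simps)
 qed
qed

section \<open>Boundary conditions and the jump of the pressure\<close>

lemma half_integral:
 fixes h :: "real => complex"
 shows "(LINT Y:half s|lborel. h Y) = (LINT r:{0..}|lborel. h (sg s * r))"
proof -
 have "(LINT Y:half s|lborel. h Y)
   = \<bar>sg s\<bar> *\<^sub>R (LINT r|lborel. indicator (half s) (0 + sg s * r) *\<^sub>R h (0 + sg s * r))"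
  unfolding set_lebesgue_integral_def by (rule lborel_integral_real_affine) (cases s; simp)
 also have "\<dots> = (LINT r|lborel. indicator {0<..} r *\<^sub>R h (sg s * r))"
  by (simp add: half_def indicator_def)
 also have "\<dots> = (LINT r|lborel. indicator {0..} r *\<^sub>R h (sg s * r))"
  by (rule integral_discrete_difference[of "{0}"]) (auto simp: indicator_def)
 finally show ?thesis unfolding set_lebesgue_integral_def .
qed

text \<open>Both half lines are parametrized by the distance to the interface.\<close>

lemma solvability_integral:
 "(LINT Y3:half s|lborel. of_real (exp (- of_int \<bar>k\<bar> * (sg s * Y3))) *
    cinner7 (L_vec P s k) (vfourier (%th. F (t,y1,y2,0,Y3,th)) k))
  = (LINT r:{0..}|lborel. of_real (exp (- (freq k * r))) *
    cinner7 (L_vec P s k) (\<chi> i. coef (cplx (%z. F z $ i)) k ((t,y1,y2,0,0,th) + (sg s * r) *\<^sub>R e_Y)))"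
 unfolding half_integral by (simp add: e_Y_def coef_fourier vfourier_def)

text \<open>The boundary conditions determine \<open>u\<^sub>3\<close> and \<open>H\<^sub>3\<close>
 up to multiples of \<open>c\<close> and \<open>b\<close>, which cancel in \<open>c H\<^sub>3 - b
 u\<^sub>3\<close>. The derivative of this quantity along \<open>th\<close> is the sixth
 source.\<close>

lemma trace_compatibility:
 assumes T: "T > 0" and U: "smooth6 T s 0 U" and sol: "solves P T s U F F8" and x: "x \<in> dom6 T s"
  and g: "partial6 T s e_theta g3 g3th" "partial6 T s e_theta g6 g6th"
  and tr: "!!r. U (at_theta r x) $ 3 = g3 (at_theta r x) + c_coef P s * d (at_theta r x)"
   "!!r. U (at_theta r x) $ 6 = g6 (at_theta r x) + b_coef P s * d (at_theta r x)"
 shows "F x $ 6 = c_coef P s * g6th x - b_coef P s * g3th x"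
proof -
 obtain UY Uth where U': "partial6 T s e_Y U UY" "partial6 T s e_theta U Uth"
  using smooth6_partials[OF U] by metis
 let ?r = "theta_of x"
 let ?f = "%x. c_coef P s * U x $ 6 - b_coef P s * U x $ 3" and ?g = "%x. c_coef P s * g6 x - b_coef P s * g3 x"
 have "partial6 T s e_theta ?f (%x. c_coef P s * Uth x $ 6 - b_coef P s * Uth x $ 3)"
  by (intro has_partial_diff has_partial_cmult has_partial_nth U')
 from slice_has_vector_derivative[OF this x, of ?r]
 have 1: "((%r. ?f (at_theta r x)) has_vector_derivative c_coef P s * Uth x $ 6 - b_coef P s * Uth x $ 3) (at ?r)" by simp
 have "partial6 T s e_theta ?g (%x. c_coef P s * g6th x - b_coef P s * g3th x)"
  by (intro has_partial_diff has_partial_cmult g)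
 from slice_has_vector_derivative[OF this x, of ?r]
 have 2: "((%r. ?g (at_theta r x)) has_vector_derivative c_coef P s * g6th x - b_coef P s * g3th x) (at ?r)" by simp
 have "?f (at_theta r x) = ?g (at_theta r x)" for r
  unfolding tr by (simp add: algebra_simps)
 with 1 have "((%r. ?g (at_theta r x)) has_vector_derivative c_coef P s * Uth x $ 6 - b_coef P s * Uth x $ 3) (at ?r)" by simp
 then have "c_coef P s * Uth x $ 6 - b_coef P s * Uth x $ 3 = c_coef P s * g6th x - b_coef P s * g3th x"
  using 2 by (rule vector_derivative_unique_at)
 then show ?thesis
  using solvesD[OF T sol U' x] unfolding interior_iff Let_def by simp
qed

text \<open>The identity for bounded modes with the boundary values of \<open>u\<^sub>3\<close>,
 \<open>H\<^sub>3\<close> inserted; the term with \<open>F\<^sub>6\<close> is known from the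
 boundary data as well.\<close>

lemma mode_trace:
 assumes T: "T > 0" and U: "smooth6 T s 0 U" and F: "smooth6 T s 0 F" "smooth6 T s 0 F8"
  and sol: "solves P T s U F F8" and \<xi>: "(xi1 P)\<^sup>2 + (xi2 P)\<^sup>2 = 1" and k: "k \<noteq> 0" and x: "x \<in> dom6 T s"
  and g: "smooth6 T s 0 g3" "smooth6 T s 0 g6" "smooth6 T s 0 d"
  and tr: "!!r. U (at_theta r x) $ 3 = g3 (at_theta r x) + c_coef P s * d (at_theta r x)"
   "!!r. U (at_theta r x) $ 6 = g6 (at_theta r x) + b_coef P s * d (at_theta r x)"
 shows "of_real (sg s) * mode_integral P s F k x
   = of_real (tau P) * (of_real (c_coef P s) * coef (cplx g3) k x - of_real (b_coef P s) * coef (cplx g6) k x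
     + of_real ((c_coef P s)\<^sup>2 - (b_coef P s)\<^sup>2) * coef (cplx d) k x
     + \<i> * of_real (sg s) * of_int (sgn k) * coef (cplx (%z. U z $ 7)) k x)
    + 2 * of_real (b_coef P s) * (of_real (c_coef P s) * coef (cplx g6) k x - of_real (b_coef P s) * coef (cplx g3) k x)"
proof -
 obtain UY Uth where U': "smooth6 T s 0 UY" "smooth6 T s 0 Uth"
  "partial6 T s e_Y U UY" "partial6 T s e_theta U Uth"
  by (rule smooth6_partials[OF U])
 define c b where "c = c_coef P s" and "b = b_coef P s"
 have lin: "coef (cplx h) k x = coef (cplx f) k x + of_real p * coef (cplx d) k x"
  if "!!r. h (at_theta r x) = f (at_theta r x) + p * d (at_theta r x)" "smooth6 T s 0 f" for f h p
 proof -
  have "coef (cplx h) k x = coef (%z. cplx f z + of_real p * cplx d z) k x"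
   unfolding coef_def by (simp add: that(1))
  then show ?thesis
   using coef_add[OF T order_refl smooth6_cplx[OF T order_refl that(2)]
     smooth6_cmult[OF T order_refl smooth6_cplx[OF T order_refl g(3)]] x, where k = k]
   by (simp add: coef_cmult)
 qed
 note c3 = lin[OF tr(1) g(1)] and c6 = lin[OF tr(2) g(2)]
 have "coef (cplx (%z. F z $ 6)) k x
   = \<i> * of_int k * (of_real c * coef (cplx (%z. U z $ 6)) k x - of_real b * coef (cplx (%z. U z $ 3)) k x)"
  using interior_modes(6)[OF T U U' F solvesD[OF T sol U'(3,4)] x refl refl refl refl, where k = k]
  by (simp add: c_def b_def algebra_simps)
 also have "\<dots> = \<i> * of_int k * (of_real c * coef (cplx g6) k x - of_real b * coef (cplx g3) k x)"
  unfolding c3 c6 c_def b_def by (simp add: algebra_simps)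
 finally have F6: "coef (cplx (%z. F z $ 6)) k x = \<i> * of_int k * (of_real c * coef (cplx g6) k x - of_real b * coef (cplx g3) k x)" .
 have "2 * of_real b * \<i> / of_int k * (\<i> * of_int k * z) = - (2 * of_real b * z)" for z :: complex
  using k by (simp add: field_simps)
 note F6' = this[of "of_real c * coef (cplx g6) k x - of_real b * coef (cplx g3) k x", folded F6]
 show ?thesis
  apply (subst mode_identity[OF T U U' F solvesD[OF T sol U'(3,4)] solution_compatible[OF T U sol] \<xi> k x, symmetric], assumption)
  unfolding F6'[unfolded b_def] c3 c6 by (simp add: c_def b_def power2_eq_square algebra_simps)
qed

text \<open>The front \<open>d\<close> occurs with the factor \<open>c\<^sup>2 - b\<^sup>2\<close>
 on either side, and the two factors add up to zero.\<close>

lemma jump_algebra: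
 fixes Ip Im g1 g2 g3 g4 g5 d Up Um S :: complex
 assumes p: "Ip = of_real (tau P) * (of_real (c_coef P Plus) * g1 - of_real (b_coef P Plus) * g2
     + of_real ((c_coef P Plus)\<^sup>2 - (b_coef P Plus)\<^sup>2) * d + \<i> * S * Up)
    + 2 * of_real (b_coef P Plus) * (of_real (c_coef P Plus) * g2 - of_real (b_coef P Plus) * g1)"
  and m: "- Im = of_real (tau P) * (of_real (c_coef P Minus) * g3 - of_real (b_coef P Minus) * g4
     + of_real ((c_coef P Minus)\<^sup>2 - (b_coef P Minus)\<^sup>2) * d - \<i> * S * Um)
    + 2 * of_real (b_coef P Minus) * (of_real (c_coef P Minus) * g4 - of_real (b_coef P Minus) * g3)"
  and rel: "(c_coef P Plus)\<^sup>2 + (c_coef P Minus)\<^sup>2 = (b_coef P Plus)\<^sup>2 + (b_coef P Minus)\<^sup>2"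
 shows "Ip - Im + of_real (ell1 P Plus) * g1 + of_real (ell2 P Plus) * g2
   + of_real (ell1 P Minus) * g3 + of_real (ell2 P Minus) * g4 - \<i> * of_real (tau P) * S * g5
  = \<i> * of_real (tau P) * S * (Up - Um - g5)"
proof -
 define cp bp cm bm \<tau> where "cp = complex_of_real (c_coef P Plus)" and "bp = complex_of_real (b_coef P Plus)"
  and "cm = complex_of_real (c_coef P Minus)" and "bm = complex_of_real (b_coef P Minus)" and "\<tau> = complex_of_real (tau P)"
 have rel': "cp\<^sup>2 + cm\<^sup>2 = bp\<^sup>2 + bm\<^sup>2"
  using arg_cong[OF rel, of complex_of_real] by (simp add: cp_def bp_def cm_def bm_def)
 have a: "a_coef P s = c_coef P s - tau P" for s by (simp add: c_coef_def)
 have l: "of_real (ell1 P Plus) = 2 * bp\<^sup>2 - \<tau> * cp" "of_real (ell2 P Plus) = - (2 * cp - \<tau>) * bp"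
  "of_real (ell1 P Minus) = 2 * bm\<^sup>2 - \<tau> * cm" "of_real (ell2 P Minus) = - (2 * cm - \<tau>) * bm"
  unfolding ell1_def ell2_def a by (simp_all add: cp_def bp_def cm_def bm_def \<tau>_def)
 have p': "Ip = \<tau> * (cp * g1 - bp * g2 + (cp\<^sup>2 - bp\<^sup>2) * d + \<i> * S * Up) + 2 * bp * (cp * g2 - bp * g1)"
  using p by (simp add: cp_def bp_def \<tau>_def)
 have m': "Im = - (\<tau> * (cm * g3 - bm * g4 + (cm\<^sup>2 - bm\<^sup>2) * d - \<i> * S * Um) + 2 * bm * (cm * g4 - bm * g3))"
  using m by (simp add: cm_def bm_def \<tau>_def minus_equation_iff[of Im])
 have d: "cp\<^sup>2 - bp\<^sup>2 = - (cm\<^sup>2 - bm\<^sup>2)" using rel' by (simp add: algebra_simps)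
 show ?thesis
  unfolding l p' m' d \<tau>_def[symmetric] by (simp add: algebra_simps power2_eq_square)
qed

section \<open>A particular solution\<close>

text \<open>Averaged over \<open>th\<close>, compatibility says that the mean of the sixth component
 is constant in \<open>Y\<close>.\<close>

lemma compatible_mean_zero:
 assumes T: "T > 0" and \<delta>: "\<delta> > 0" and F: "smooth6 T s \<delta> F" and F8: "smooth6 T s \<delta> F8"
  and comp: "compatible P T s F F8" and x: "x \<in> dom6 T s"
 shows "mean (%z. F z $ 6) x = 0"
proof -
 have \<delta>0: "\<delta> \<ge> 0" using \<delta> by simp
 obtain FY Fth where F': "smooth6 T s \<delta> FY" "smooth6 T s \<delta> Fth"
  "partial6 T s e_Y F FY" "partial6 T s e_theta F Fth"
  by (rule smooth6_partials[OF F])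
 obtain F8th where F8': "smooth6 T s \<delta> F8th" "partial6 T s e_theta F8 F8th"
  using smooth6_partials[OF F8] by metis
 note n = smooth6_nth[OF F \<delta>0] smooth6_nth[OF F'(1) \<delta>0] smooth6_nth[OF F'(2) \<delta>0] and p = has_partial_nth
 have z: "mean (%z. FY z $ 6) y = 0" if y: "y \<in> dom6 T s" for y
 proof -
  have "(\<Sum>p\<leftarrow>[(1, %z. FY z $ 6), (xi1 P, %z. Fth z $ 4), (xi2 P, %z. Fth z $ 5), (- tau P, F8th)]. fst p * mean (snd p) y) = 0"
  proof (rule mean_lincomb[OF T \<delta>0 _ _ y])
   fix y assume y: "y \<in> dom6 T s"
   show "(\<Sum>p\<leftarrow>[(1, %z. FY z $ 6), (xi1 P, %z. Fth z $ 4), (xi2 P, %z. Fth z $ 5), (- tau P, F8th)]. fst p * snd p y) = 0"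
    using bspec[OF comp[unfolded compatible_def] y] d_Y3_eq[OF T p[OF F'(3)] y] d_theta_eq[OF T p[OF F'(4)] y] d_theta_eq[OF T F8'(2) y]
    by simp
  qed (use n F8' in simp)
  moreover have "mean (%z. Fth z $ i) y = 0" for i
   by (rule mean_theta_derivative[OF T \<delta>0 n(1) n(3) p[OF F'(4)] y])
  moreover have "mean F8th y = 0"
   by (rule mean_theta_derivative[OF T \<delta>0 F8 F8' y])
  ultimately show ?thesis by simp
 qed
 show ?thesis
 proof (rule decaying_constant_zero[OF \<delta> smooth6_mean[OF T \<delta>0 n(1)] x])
  fix r :: real assume "0 \<le> r"
  then show "mean (%z. F z $ 6) (at_Y (sg s * r) x) = mean (%z. F z $ 6) x"
   by (intro Y_constant[OF has_partial_mean[OF T \<delta>0 n(1) n(2) p[OF F'(3)]] z x]) simp_all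
 qed
qed

lemma mean_complex_zero:
 assumes T: "T > 0" and \<delta>: "\<delta> \<ge> 0" and z: "smooth6 T s \<delta> z" and x: "x \<in> dom6 T s" and 0: "coef z 0 x = 0"
 shows "mean (%x. Re (z x)) x = 0" "mean (%x. Im (z x)) x = 0"
proof -
 note r = smooth6_cplx[OF T \<delta> smooth6_Re[OF T \<delta> z]] and i = smooth6_cplx[OF T \<delta> smooth6_Im[OF T \<delta> z]]
 have "coef z 0 x = coef (%x. cplx (%x. Re (z x)) x + \<i> * cplx (%x. Im (z x)) x) 0 x"
  by (simp add: complex_eq[symmetric])
 also have "\<dots> = of_real (mean (%x. Re (z x)) x) + \<i> * of_real (mean (%x. Im (z x)) x)"
  unfolding coef_add[OF T \<delta> r smooth6_cmult[OF T \<delta> i] x] coef_cmult coef_mean ..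
 finally show "mean (%x. Re (z x)) x = 0" "mean (%x. Im (z x)) x = 0"
  unfolding 0 by (simp_all add: complex_eq_iff)
qed

text \<open>Without dependence on \<open>Y\<close> the Cauchy-Riemann system decouples: it
 prescribes the derivatives of \<open>q\<close> and of \<open>w\<close> along
 \<open>th\<close>.\<close>

lemma underline_solution:
 assumes T: "T > 0" and F: "smooth6 T s 0 F" "!!r x. F (at_Y r x) = F x" and F8: "smooth6 T s 0 F8" "!!r x. F8 (at_Y r x) = F8 x"
  and comp: "compatible P T s F F8"
  and \<Delta>: "(c_coef P s)\<^sup>2 - (b_coef P s)\<^sup>2 \<noteq> 0" and \<xi>: "(xi1 P)\<^sup>2 + (xi2 P)\<^sup>2 = 1"
 obtains w q Lth where "smooth6 T s 0 w" "smooth6 T s 0 q" "smooth6 T s 0 Lth"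
  "!!r x. w (at_Y r x) = w x" "!!r x. q (at_Y r x) = q x"
  "partial6 T s e_theta (lift P s F F8 w q) Lth"
  "!!x. x \<in> dom6 T s ==> interior_eq P s 0 (Lth x) (F x - mean_vec F x) (F8 x - mean F8 x)"
  "!!x. x \<in> dom6 T s ==> mean w x = 0" "!!x. x \<in> dom6 T s ==> mean q x = 0"
proof -
 define w where "w = theta_prim (%x. F x $ 3)"
 define q where "q x = - 1 * theta_prim (source P s F F8) x" for x
 note F3 = smooth6_nth[OF F(1) order_refl, of 3] and S = smooth6_source[OF T order_refl F(1) F8(1), of P]
 have sm: "smooth6 T s 0 w" "smooth6 T s 0 q"
  unfolding w_def q_def[abs_def] by (intro smooth6_theta_prim[OF T order_refl F3] smooth6_cmult[OF T order_refl] smooth6_theta_prim[OF T order_refl S])+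
 have inv: "w (at_Y r x) = w x" "q (at_Y r x) = q x" for r x
  unfolding w_def q_def by (simp_all add: theta_prim_at_Y F F8 source_def)
 have dth: "partial6 T s e_theta w (%x. F x $ 3 - mean (%x. F x $ 3) x)"
   "partial6 T s e_theta q (%x. - 1 * (source P s F F8 x - mean (source P s F F8) x))"
  unfolding w_def q_def[abs_def]
  by (intro theta_prim_e_theta[OF T order_refl F3] has_partial_cmult theta_prim_e_theta[OF T order_refl S])+
 obtain Lth where L: "smooth6 T s 0 Lth" "partial6 T s e_theta (lift P s F F8 w q) Lth"
  using smooth6_partials[OF smooth6_lift[OF T order_refl F(1) F8(1) sm]] by metis
 have "interior_eq P s 0 (Lth x) (F x - mean_vec F x) (F8 x - mean F8 x)" if x: "x \<in> dom6 T s" for x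
  by (rule lift_solves[OF T order_refl F(1) F8(1) sm Y_free_has_partial[of w, OF inv(1)] dth(1) Y_free_has_partial[of q, OF inv(2)] dth(2)
     comp _ _ \<Delta> \<xi> Y_free_has_partial L(2) x]) (simp_all add: lift_at_Y F F8 inv)
 moreover have "mean w x = 0" "mean q x = 0" if x: "x \<in> dom6 T s" for x
  unfolding w_def q_def[abs_def] mean_cmult[OF T order_refl] by (simp_all add: mean_theta_prim[OF T order_refl _ x] F3 S)
 ultimately show ?thesis using that[OF sm L(1) inv L(2)] by blast
qed

text \<open>In \<open>z = w + \<i> sg s q\<close> the system for \<open>w\<close> and
 \<open>q\<close> is a single complex equation, and the boundary value of \<open>w\<close> can be
 prescribed up to its mean.\<close>

lemma star_solution:
 assumes T: "T > 0" and \<delta>: "\<delta> > 0" "\<delta> \<le> 1 / 2" and F: "smooth6 T s \<delta> F" and F8: "smooth6 T s \<delta> F8"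
  and w0: "smooth6 T s 0 w0" and comp: "compatible P T s F F8"
  and \<Delta>: "(c_coef P s)\<^sup>2 - (b_coef P s)\<^sup>2 \<noteq> 0" and \<xi>: "(xi1 P)\<^sup>2 + (xi2 P)\<^sup>2 = 1"
 obtains w q LY Lth where "smooth6 T s \<delta> w" "smooth6 T s \<delta> q" "smooth6 T s \<delta> LY" "smooth6 T s \<delta> Lth"
  "partial6 T s e_Y (lift P s F F8 w q) LY" "partial6 T s e_theta (lift P s F F8 w q) Lth"
  "!!x. x \<in> dom6 T s ==> interior_eq P s (LY x) (Lth x) (F x - mean_vec F x) (F8 x - mean F8 x)"
  "!!x. x \<in> dom6 T s ==> mean w x = 0" "!!x. x \<in> dom6 T s ==> mean q x = 0"
  "!!x. x \<in> dom6 T s ==> w (at_Y 0 x) = w0 (at_Y 0 x) - mean w0 (at_Y 0 x)"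
proof -
 have \<delta>0: "\<delta> \<ge> 0" using \<delta>(1) by simp
 note F3 = smooth6_nth[OF F \<delta>0, of 3] and S = smooth6_source[OF T \<delta>0 F F8, of P]
 note cF3 = smooth6_cplx[OF T \<delta>0 F3] and cS = smooth6_cplx[OF T \<delta>0 S]
 define M where "M x = of_real (sg s) * cplx (source P s F F8) x + \<i> * cplx (%x. F x $ 3) x" for x
 have M: "smooth6 T s \<delta> M"
  unfolding M_def[abs_def] by (intro smooth6_add[OF T \<delta>0] smooth6_cmult[OF T \<delta>0] cF3 cS)
 have M0: "coef M 0 x = of_real (sg s) * of_real (mean (source P s F F8) x) + \<i> * of_real (mean (%x. F x $ 3) x)" if x: "x \<in> dom6 T s" for x
  unfolding M_def[abs_def] coef_add[OF T \<delta>0 smooth6_cmult[OF T \<delta>0 cS] smooth6_cmult[OF T \<delta>0 cF3] x] coef_cmult coef_mean ..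
 obtain z zY zth where z: "smooth6 T s \<delta> z" "smooth6 T s \<delta> zY" "smooth6 T s \<delta> zth"
  "partial6 T s e_Y z zY" "partial6 T s e_theta z zth"
  and cr: "!!x. x \<in> dom6 T s ==> of_real (sg s) * zY x + \<i> * zth x = M x - coef M 0 x"
  and z0: "!!x. x \<in> dom6 T s ==> coef z 0 x = 0"
  and tr: "!!x. x \<in> dom6 T s ==> Re (z (at_Y 0 x)) = w0 (at_Y 0 x) - mean w0 (at_Y 0 x)"
  by (rule solve_cauchy_riemann[OF T \<delta> M w0]) (rule that)
 define w where "w x = Re (z x)" for x
 define q where "q x = sg s * Im (z x)" for x
 have sm: "smooth6 T s \<delta> w" "smooth6 T s \<delta> q"
  unfolding w_def[abs_def] q_def[abs_def] by (intro smooth6_Re[OF T \<delta>0] smooth6_cmult[OF T \<delta>0] smooth6_Im[OF T \<delta>0] z)+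
 have dw: "partial6 T s e_Y w (%x. Re (zY x))" "partial6 T s e_theta w (%x. Re (zth x))"
  and dq: "partial6 T s e_Y q (%x. sg s * Im (zY x))" "partial6 T s e_theta q (%x. sg s * Im (zth x))"
  unfolding w_def[abs_def] q_def[abs_def] by (intro has_partial_Re has_partial_cmult has_partial_Im z)+
 obtain LY Lth where L: "smooth6 T s \<delta> LY" "smooth6 T s \<delta> Lth" "partial6 T s e_Y (lift P s F F8 w q) LY"
  "partial6 T s e_theta (lift P s F F8 w q) Lth"
  by (rule smooth6_partials[OF smooth6_lift[OF T \<delta>0 F F8 sm]])
 have cr1: "Re (zY x) - sg s * Im (zth x) = source P s F F8 x - mean (source P s F F8) x"
  and cr2: "sg s * Im (zY x) + Re (zth x) = F x $ 3 - mean (%z. F z $ 3) x" if x: "x \<in> dom6 T s" for x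
 proof -
  have "sg s * Re (zY x) - Im (zth x) = sg s * (source P s F F8 x - mean (source P s F F8) x)"
   using arg_cong[OF cr[OF x], of Re] M0[OF x] by (simp add: M_def right_diff_distrib)
  then have "sg s * (sg s * Re (zY x) - Im (zth x)) = sg s * (sg s * (source P s F F8 x - mean (source P s F F8) x))" by simp
  then show "Re (zY x) - sg s * Im (zth x) = source P s F F8 x - mean (source P s F F8) x"
   by (simp only: right_diff_distrib sg_square)
  show "sg s * Im (zY x) + Re (zth x) = F x $ 3 - mean (%z. F z $ 3) x"
   using arg_cong[OF cr[OF x], of Im] M0[OF x] by (simp add: M_def)
 qed
 have "interior_eq P s (LY x) (Lth x) (F x - mean_vec F x) (F8 x - mean F8 x)" if x: "x \<in> dom6 T s" for x
  by (rule lift_solves[OF T \<delta>0 F F8 sm dw dq comp cr1 cr2 \<Delta> \<xi> L(3,4) x])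
 moreover have "mean w x = 0" "mean q x = 0" if x: "x \<in> dom6 T s" for x
  using mean_complex_zero[OF T \<delta>0 z(1) x z0[OF x]] unfolding w_def[abs_def] q_def[abs_def] mean_cmult[OF T \<delta>0] by simp_all
 ultimately show ?thesis using that[OF sm L] tr unfolding w_def by blast
qed

text \<open>The state has four parts. Two of them invert the oscillating sources independent of
 \<open>Y\<close> and decaying in \<open>Y\<close>, the latter with the boundary value of
 \<open>w\<close> chosen so that together with the known \<open>c H\<^sub>3 - b u\<^sub>3\<close>
 it produces the required traces. The third integrates the mean of the decaying sources from
 infinity, and the fourth corrects the mean traces and is cut off towards the outer
 boundary.\<close>

lemma particular_solution:
 assumes T: "T > 0" and \<delta>: "\<delta> > 0" "\<delta> \<le> 1 / 2" and F: "splits T s \<delta> F Fb Fs" and F8: "splits T s \<delta> F8 F8b F8s"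
  and comp: "compatible P T s F F8"
  and mb: "!!x. x \<in> dom6 T s ==> mean_vec Fb x = 0" "!!x. x \<in> dom6 T s ==> mean F8b x = 0"
  and mc: "!!x. x \<in> dom6 T s ==> vel1 P s * mean (%z. Fs z $ 7) x - mag1 P s * mean F8s x = mean (%z. Fs z $ 1) x"
   "!!x. x \<in> dom6 T s ==> vel2 P s * mean (%z. Fs z $ 7) x - mag2 P s * mean F8s x = mean (%z. Fs z $ 2) x"
   "!!x. x \<in> dom6 T s ==> mag1 P s * mean (%z. Fs z $ 7) x - vel1 P s * mean F8s x = mean (%z. Fs z $ 4) x"
   "!!x. x \<in> dom6 T s ==> mag2 P s * mean (%z. Fs z $ 7) x - vel2 P s * mean F8s x = mean (%z. Fs z $ 5) x"
  and g: "smooth6 T s 0 g3" "smooth6 T s 0 g6" "smooth6 T s 0 g7"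
   "!!r x. g3 (at_Y r x) = g3 x" "!!r x. g6 (at_Y r x) = g6 x" "!!r x. g7 (at_Y r x) = g7 x"
  and gth: "smooth6 T s 0 g3th" "smooth6 T s 0 g6th" "partial6 T s e_theta g3 g3th" "partial6 T s e_theta g6 g6th"
  and tr: "!!x. x \<in> dom6 T s ==> y3_of x = 0 ==> Y_of x = 0 ==> F x $ 6 = c_coef P s * g6th x - b_coef P s * g3th x"
  and \<Delta>: "(c_coef P s)\<^sup>2 - (b_coef P s)\<^sup>2 \<noteq> 0" and \<xi>: "(xi1 P)\<^sup>2 + (xi2 P)\<^sup>2 = 1"
 obtains U Ub Us where "splits T s \<delta> U Ub Us" "solves P T s U F F8" "U = (%x. Ub x + Us x)"
  "!!x. x \<in> dom6 T s ==> y3_of x = 0 ==> Y_of x = 0 ==> U x $ 3 = g3 x \<and> U x $ 6 = g6 x \<and> mean (%z. U z $ 7) x = mean g7 x"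
  "!!x i. x \<in> dom6 T s ==> i \<in> {1,2,4,5} ==> mean (%z. U z $ i) x = 0"
  "!!x. x \<in> dom6 T s ==> y3_of x = sg s ==> mean_vec Ub x = 0"
proof -
 have \<delta>0: "\<delta> \<ge> 0" using \<delta>(1) by simp
 note Fb = splitsD(1,2)[OF F] and Fs = splitsD(3)[OF F] and F8b = splitsD(1,2)[OF F8] and F8s = splitsD(3)[OF F8]
 have co: "compatible P T s Fb F8b" "compatible P T s Fs F8s"
  by (rule compatible_split[OF T \<delta>(1) Fb Fs F8b F8s splitsD(4)[OF F] splitsD(4)[OF F8] comp], assumption, assumption)+
 define c b where "c = c_coef P s" and "b = b_coef P s"
 obtain wb qb Lbth where wb: "smooth6 T s 0 wb" "smooth6 T s 0 qb" "smooth6 T s 0 Lbth"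
  and inv: "!!r x. wb (at_Y r x) = wb x" "!!r x. qb (at_Y r x) = qb x"
  and Lbth: "partial6 T s e_theta (lift P s Fb F8b wb qb) Lbth"
  and intb: "!!x. x \<in> dom6 T s ==> interior_eq P s 0 (Lbth x) (Fb x - mean_vec Fb x) (F8b x - mean F8b x)"
  and mwb: "!!x. x \<in> dom6 T s ==> mean wb x = 0" "!!x. x \<in> dom6 T s ==> mean qb x = 0"
  by (rule underline_solution[OF T Fb F8b co(1) \<Delta> \<xi>]) (rule that)
 define Lb where "Lb = lift P s Fb F8b wb qb"
 have Lb: "smooth6 T s 0 Lb" "Lb (at_Y r x) = Lb x" for r x
  unfolding Lb_def using smooth6_lift[OF T order_refl Fb(1) F8b(1) wb(1,2)] by (simp_all add: lift_at_Y Fb(2) F8b(2) inv)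
 define w0 where "w0 x = c * g3 x - b * g6 x - wb x" for x
 have w0: "smooth6 T s 0 w0"
  unfolding w0_def[abs_def] by (intro smooth6_diff smooth6_cmult[OF T] order_refl g wb)
 obtain ws qs LsY Lsth where ws: "smooth6 T s \<delta> ws" "smooth6 T s \<delta> qs" "smooth6 T s \<delta> LsY" "smooth6 T s \<delta> Lsth"
  and dLs: "partial6 T s e_Y (lift P s Fs F8s ws qs) LsY" "partial6 T s e_theta (lift P s Fs F8s ws qs) Lsth"
  and ints: "!!x. x \<in> dom6 T s ==> interior_eq P s (LsY x) (Lsth x) (Fs x - mean_vec Fs x) (F8s x - mean F8s x)"
  and mws: "!!x. x \<in> dom6 T s ==> mean ws x = 0" "!!x. x \<in> dom6 T s ==> mean qs x = 0"
  and wtr: "!!x. x \<in> dom6 T s ==> ws (at_Y 0 x) = w0 (at_Y 0 x) - mean w0 (at_Y 0 x)"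
  by (rule star_solution[OF T \<delta> Fs F8s w0 co(2) \<Delta> \<xi>]) (rule that)
 define Ls where "Ls = lift P s Fs F8s ws qs"
 have Ls: "smooth6 T s \<delta> Ls" unfolding Ls_def by (rule smooth6_lift[OF T \<delta>0 Fs F8s ws(1,2)])
 \<comment> \<open>the mean of the decaying part\<close>
 note n = smooth6_nth[OF Fs \<delta>0]
 define p3 p6 p7 where "p3 = decay_prim s (%x. Fs x $ 7)" and "p6 = decay_prim s F8s" and "p7 = decay_prim s (%x. Fs x $ 3)"
 note p = decay_prim[OF T \<delta>(1) n[of 7], folded p3_def] decay_prim[OF T \<delta>(1) F8s, folded p6_def] decay_prim[OF T \<delta>(1) n[of 3], folded p7_def]
 define M where "M x = (vector [0, 0, p3 x, 0, 0, p6 x, p7 x] :: real^7)" for x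
 have z: "smooth6 T s \<delta> (%_. 0 :: real)" using smooth6_cmult[OF T \<delta>0 p(1), of 0] by simp
 have M: "smooth6 T s \<delta> M" unfolding M_def[abs_def] by (intro smooth6_vector7[OF \<delta>0] z p)
 obtain MY where MY: "smooth6 T s \<delta> MY" "partial6 T s e_Y M MY" using smooth6_partials[OF M] by metis
 have MY': "MY x $ 3 = mean (%x. Fs x $ 7) x" "MY x $ 6 = mean F8s x" "MY x $ 7 = mean (%x. Fs x $ 3) x"
  if x: "x \<in> dom6 T s" for x
  using has_partial_unique[OF coord_box_dom6[OF T] Basis_e(1) has_partial_nth[OF MY(2), of 3, unfolded M_def vector_7] p(2) x]
   has_partial_unique[OF coord_box_dom6[OF T] Basis_e(1) has_partial_nth[OF MY(2), of 6, unfolded M_def vector_7] p(5) x]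
   has_partial_unique[OF coord_box_dom6[OF T] Basis_e(1) has_partial_nth[OF MY(2), of 7, unfolded M_def vector_7] p(8) x] by blast+
 have Mth: "M (at_theta r x) = M x" for r x by (simp add: M_def p)
 have intM: "interior_eq P s (MY x) 0 (mean_vec Fs x) (mean F8s x)" if x: "x \<in> dom6 T s" for x
  unfolding interior_iff Let_def using MY'[OF x] mc[OF x] compatible_mean_zero[OF T \<delta>(1) Fs F8s co(2) x]
  by (simp add: mean_vec_def)
 \<comment> \<open>a correction of the mean boundary values, independent of the fast variables\<close>
 define cut where "cut h f x = (1 - sg s * y3_of x) * (mean h x - f (at_Y 0 x))" for h f :: "pt6 => real" and x
 have cut: "smooth6 T s 0 (cut h f)" if "smooth6 T s 0 h" "smooth6 T s \<delta> f" for h f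
  unfolding cut_def[abs_def] by (intro smooth6_cutoff[OF T] smooth6_diff[OF order_refl] smooth6_mean[OF T order_refl] that smooth_at_Y0[OF _ \<delta>0])
 have y3: "y3_of (at_Y r x) = y3_of x" "y3_of (at_theta r x) = y3_of x" for r x
  by (cases x; simp add: y3_of_def at_Y_def at_theta_def)+
 have cY: "cut h f (at_Y r x) = cut h f x" if "!!r x. h (at_Y r x) = h x" for h f r x
  unfolding cut_def y3 by (simp add: mean_at_Y that)
 have cth: "cut h f (at_theta r x) = cut h f x" if "!!r x. f (at_theta r x) = f x" for h f r x
  unfolding cut_def y3 by (simp add: that flip: at_theta_at_Y)
 define K where "K x = (vector [0, 0, cut g3 p3 x, 0, 0, cut g6 p6 x, cut g7 p7 x] :: real^7)" for x
 have z0: "smooth6 T s 0 (%_. 0 :: real)" using smooth6_cmult[OF T order_refl g(1), of 0] by simp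
 have K: "smooth6 T s 0 K" unfolding K_def[abs_def] by (intro smooth6_vector7[OF order_refl] z0 cut g p)
 have KY: "K (at_Y r x) = K x" and Kth: "K (at_theta r x) = K x" for r x
  by (simp_all add: K_def cY g cth p)
 define Ub Us U where "Ub x = Lb x + K x" and "Us x = Ls x + M x" and "U x = Ub x + Us x" for x
 have Ub: "smooth6 T s 0 Ub" and Us: "smooth6 T s \<delta> Us"
  unfolding Ub_def[abs_def] Us_def[abs_def] by (intro smooth6_add[OF T] order_refl \<delta>0 Lb K Ls M)+
 have sU: "splits T s \<delta> U Ub Us"
  unfolding splits_def using Ub Us by (simp add: U_def Ub_def Lb KY)
 have "solves P T s U F F8"
  unfolding solves_def
 proof (intro exI conjI ballI)
  let ?UY = "%x. (0 + 0) + (LsY x + MY x)" and ?Uth = "%x. (Lbth x + 0) + (Lsth x + 0)"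
  have d0: "smooth6 T s 0 f" if "smooth6 T s \<delta> f" for f :: "pt6 => real^7" using smooth6_mono[OF that order_refl \<delta>0] .
  show "smooth6 T s 0 ?UY" using d0[OF smooth6_add[OF T \<delta>0 ws(3) MY(1)]] by simp
  show "smooth6 T s 0 ?Uth" using smooth6_add[OF T order_refl wb(3) d0[OF ws(4)]] by simp
  show "partial6 T s e_Y U ?UY"
   unfolding U_def[abs_def] Ub_def[abs_def] Us_def[abs_def]
   by (intro has_partial_add Y_free_has_partial Lb(2) KY MY(2) dLs[folded Ls_def])
  show "partial6 T s e_theta U ?Uth"
   unfolding U_def[abs_def] Ub_def[abs_def] Us_def[abs_def]
   by (intro has_partial_add theta_free_has_partial Kth Mth dLs[folded Ls_def] Lbth[folded Lb_def])
  fix x assume x: "x \<in> dom6 T s"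
  have "interior_eq P s (0::real^7) 0 0 0" by (simp add: interior_iff Let_def)
  from interior_add[OF interior_add[OF intb[OF x] this] interior_add[OF ints[OF x] intM[OF x]]]
  show "interior_eq P s (?UY x) (?Uth x) (F x) (F8 x)"
   using mb[OF x] splitsD(4)[OF F x] splitsD(4)[OF F8 x] by simp
 qed
 moreover have mean: "mean (%z. Ub z $ i) x = K x $ i" "mean (%z. U z $ i) x = K x $ i + M x $ i" if x: "x \<in> dom6 T s" for i x
 proof -
  have "mean (%z. Lb z $ i) x = 0" "mean (%z. Ls z $ i) x = 0"
   using lift_mean_zero[OF T order_refl Fb(1) F8b(1) wb(1,2) x mwb[OF x]] lift_mean_zero[OF T \<delta>0 Fs F8s ws(1,2) x mws[OF x]]
   unfolding Lb_def Ls_def by (simp_all add: mean_vec_def vec_eq_iff)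
  moreover have "mean (%z. K z $ i) x = K x $ i" "mean (%z. M z $ i) x = M x $ i"
   by (rule theta_free_mean; simp add: Kth Mth)+
  ultimately have 1: "mean (%z. Ub z $ i) x = K x $ i" and 2: "mean (%z. Us z $ i) x = M x $ i"
   using mean_add[OF T order_refl smooth6_nth[OF Lb(1) order_refl] smooth6_nth[OF K order_refl] x, of i i]
    mean_add[OF T \<delta>0 smooth6_nth[OF Ls \<delta>0] smooth6_nth[OF M \<delta>0] x, of i i]
   by (simp_all add: Ub_def[abs_def] Us_def[abs_def])
  show "mean (%z. Ub z $ i) x = K x $ i" by (rule 1)
  show "mean (%z. U z $ i) x = K x $ i + M x $ i"
   using splits_mean[OF T \<delta>(1) splits_nth[OF sU \<delta>(1)] x, of i] 1 2 by simp
 qed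
 moreover have "U x $ 3 = g3 x \<and> U x $ 6 = g6 x \<and> mean (%z. U z $ 7) x = mean g7 x"
  if x: "x \<in> dom6 T s" and y: "y3_of x = 0" and Y: "Y_of x = 0" for x
 proof -
  have at: "at_Y 0 x = x" using at_Y_Y_of[of x] Y by simp
  let ?g3 = "g3 x - mean g3 x" and ?g6 = "g6 x - mean g6 x"
  note F6 = smooth6_nth[OF Fb(1) order_refl, of 6] smooth6_mono[OF smooth6_nth[OF Fs \<delta>0, of 6] order_refl \<delta>0]
  define \<beta> where "\<beta> x = theta_prim (%x. Fb x $ 6) x + theta_prim (%x. Fs x $ 6) x" for x
  have "\<beta> x - mean \<beta> x = (c * g6 x - b * g3 x) - mean (%x. c * g6 x - b * g3 x) x"
  proof (rule theta_primitive_unique[OF T _ _ _ _ _ _ x])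
   show "smooth6 T s 0 \<beta>"
    unfolding \<beta>_def[abs_def] by (intro smooth6_add[OF T order_refl] smooth6_theta_prim[OF T order_refl] F6)
   show "partial6 T s e_theta \<beta> (%x. (Fb x $ 6 - mean (%x. Fb x $ 6) x) + (Fs x $ 6 - mean (%x. Fs x $ 6) x))"
    unfolding \<beta>_def[abs_def] by (intro has_partial_add theta_prim_e_theta[OF T order_refl] F6)
   show "smooth6 T s 0 (%x. (Fb x $ 6 - mean (%x. Fb x $ 6) x) + (Fs x $ 6 - mean (%x. Fs x $ 6) x))"
    by (intro smooth6_add[OF T] smooth6_diff smooth6_mean[OF T] order_refl F6)
   show "smooth6 T s 0 (%x. c * g6 x - b * g3 x)" "smooth6 T s 0 (%x. c * g6th x - b * g3th x)"
    by (intro smooth6_diff smooth6_cmult[OF T] order_refl g gth)+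
   show "partial6 T s e_theta (%x. c * g6 x - b * g3 x) (%x. c * g6th x - b * g3th x)"
    by (intro has_partial_diff has_partial_cmult gth)
   fix r
   have x': "at_theta r x \<in> dom6 T s" "y3_of (at_theta r x) = 0" "Y_of (at_theta r x) = 0" using x y Y y3 by simp_all
   have "mean (%x. Fb x $ 6) (at_theta r x) = 0" using arg_cong[OF mb(1)[OF x], of "%v. v $ 6"] by (simp add: mean_vec_def)
   moreover have "mean (%x. Fs x $ 6) (at_theta r x) = 0"
    using compatible_mean_zero[OF T \<delta>(1) Fs F8s co(2) x] by simp
   ultimately show "(Fb (at_theta r x) $ 6 - mean (%x. Fb x $ 6) (at_theta r x)) + (Fs (at_theta r x) $ 6 - mean (%x. Fs x $ 6) (at_theta r x))
     = c * g6th (at_theta r x) - b * g3th (at_theta r x)"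
    using tr[OF x'] splitsD(4)[OF F x'(1)] by (simp add: c_def b_def)
  qed
  moreover have "mean \<beta> x = 0"
   unfolding \<beta>_def[abs_def]
   using mean_add[OF T order_refl smooth6_theta_prim[OF T order_refl F6(1)] smooth6_theta_prim[OF T order_refl F6(2)] x]
    mean_theta_prim[OF T order_refl F6(1) x] mean_theta_prim[OF T order_refl F6(2) x] by simp
  moreover have "mean (%x. c * g6 x - b * g3 x) x = c * mean g6 x - b * mean g3 x"
   using mean_combination[OF T order_refl smooth6_cmult[OF T order_refl g(2)] g(1) g(1) x, of c b 0] mean_cmult[OF T order_refl, of c g6 x] by simp
  ultimately have \<beta>: "\<beta> x = c * ?g6 - b * ?g3" by (simp add: algebra_simps)
  have "mean w0 x = c * mean g3 x - b * mean g6 x - mean wb x"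
   using mean_combination[OF T order_refl smooth6_cmult[OF T order_refl g(1)] g(2) wb(1) x, of c b "- 1"] mean_cmult[OF T order_refl, of c g3 x]
   by (simp add: w0_def[abs_def])
  then have w: "wb x + ws x = c * ?g3 - b * ?g6"
   using wtr[OF x] mwb(1)[OF x] unfolding at w0_def by (simp add: algebra_simps)
  have D: "c\<^sup>2 - b\<^sup>2 \<noteq> 0" using \<Delta> by (simp add: c_def b_def)
  have "Lb x $ 3 + Ls x $ 3 = (c * (wb x + ws x) + b * \<beta> x) / (c\<^sup>2 - b\<^sup>2)"
   unfolding Lb_def Ls_def lift_nth \<beta>_def c_def[symmetric] b_def[symmetric] by (simp add: add_divide_distrib[symmetric] algebra_simps)
  also have "\<dots> = ((c\<^sup>2 - b\<^sup>2) * ?g3) / (c\<^sup>2 - b\<^sup>2)"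
   unfolding w \<beta> by (simp add: power2_eq_square algebra_simps)
  also have "\<dots> = ?g3" using D by simp
  finally have L3: "Lb x $ 3 + Ls x $ 3 = ?g3" .
  have "Lb x $ 6 + Ls x $ 6 = (c * \<beta> x + b * (wb x + ws x)) / (c\<^sup>2 - b\<^sup>2)"
   unfolding Lb_def Ls_def lift_nth \<beta>_def c_def[symmetric] b_def[symmetric] by (simp add: add_divide_distrib[symmetric] algebra_simps)
  also have "\<dots> = ((c\<^sup>2 - b\<^sup>2) * ?g6) / (c\<^sup>2 - b\<^sup>2)"
   unfolding w \<beta> by (simp add: power2_eq_square algebra_simps)
  also have "\<dots> = ?g6" using D by simp
  finally have L6: "Lb x $ 6 + Ls x $ 6 = ?g6" .
  have KM: "K x $ 3 + M x $ 3 = mean g3 x" "K x $ 6 + M x $ 6 = mean g6 x" "K x $ 7 + M x $ 7 = mean g7 x"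
   by (simp_all add: K_def M_def cut_def y at)
  show ?thesis
   using L3 L6 KM mean(2)[OF x, of 7] by (simp add: U_def Ub_def Us_def)
 qed
 moreover have "mean (%z. U z $ i) x = 0" if "x \<in> dom6 T s" "i \<in> {1,2,4,5}" for x i
  using that(2) mean(2)[OF that(1), of i] by (auto simp: K_def M_def)
 moreover have "mean_vec Ub x = 0" if "x \<in> dom6 T s" "y3_of x = sg s" for x
  unfolding mean_vec_def mean(1)[OF that(1)] by (simp add: vec_eq_iff forall_7 K_def cut_def that(2))
 ultimately show ?thesis using that[OF sU] U_def by blast
qed

section \<open>Solutions of the homogeneous problem\<close>

lemma has_sum_vec:
 fixes f :: "'i => complex^'n"
 assumes "!!i. ((%k. f k $ i) has_sum S $ i) A"
 shows "(f has_sum S) A"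
 using assms unfolding has_sum_def by (auto intro!: vec_tendstoI)

text \<open>The amplitude of a source-free mode, read off from the pressure at the interface: the
 last entry of \<open>R_vec\<close> is \<open>b\<^sup>2 - c\<^sup>2\<close>.\<close>

definition free_mode :: "mhd_params => side => (pt6 => real^7) => int => pt6 => complex" where
 "free_mode P s V k x = - coef (cplx (%z. V z $ 7)) k (at_Y 0 x) / of_real ((c_coef P s)\<^sup>2 - (b_coef P s)\<^sup>2)"

lemma homogeneous_coef:
 assumes T: "T > 0" and V: "smooth6 T s 0 V" and sol: "solves P T s V (%_. 0) (%_. 0)"
  and \<Delta>: "(c_coef P s)\<^sup>2 - (b_coef P s)\<^sup>2 \<noteq> 0" and \<xi>: "(xi1 P)\<^sup>2 + (xi2 P)\<^sup>2 = 1"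
  and \<tau>: "tau P \<noteq> 0" and k: "k \<noteq> 0" and x: "x \<in> dom6 T s"
 shows "coef (cplx (%z. V z $ i)) k x
  = free_mode P s V k x * of_real (exp (- (sg s * freq k * Y_of x))) * R_vec P s k $ i"
proof -
 obtain VY Vth where V': "smooth6 T s 0 VY" "smooth6 T s 0 Vth"
  "partial6 T s e_Y V VY" "partial6 T s e_theta V Vth"
  by (rule smooth6_partials[OF V])
 show ?thesis
  unfolding free_mode_def
  by (rule homogeneous_modes[OF T V V' solvesD[OF T sol V'(3,4)] \<Delta> \<xi> \<tau> k x])
qed

text \<open>The normal derivatives of these means are means of sources, hence zero, and the means
 decay.\<close>

lemma homogeneous_star_means:
 assumes T: "T > 0" and \<delta>: "\<delta> > 0" and V: "splits T s \<delta> V Vb Vs" and sol: "solves P T s V (%_. 0) (%_. 0)"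
  and x: "x \<in> dom6 T s"
 shows "mean (%z. Vs z $ 3) x = 0" "mean (%z. Vs z $ 6) x = 0" "mean (%z. Vs z $ 7) x = 0"
proof -
 have \<delta>0: "\<delta> \<ge> 0" using \<delta> by simp
 obtain VsY where VsY: "smooth6 T s \<delta> VsY" "partial6 T s e_Y Vs VsY"
  using smooth6_partials[OF splitsD(3)[OF V]] by metis
 note n = smooth6_nth[OF splitsD(3)[OF V] \<delta>0] and nY = smooth6_nth[OF VsY(1) \<delta>0]
 have z: "splits T s \<delta> (%_. 0 :: real) (%_. 0) (%_. 0)"
  unfolding splits_def using smooth6_cmult[OF T order_refl smooth6_nth[OF splitsD(1)[OF V] order_refl], of 0] smooth6_cmult[OF T \<delta>0 n, of 0] by simp
 have "smooth6 T s \<delta>' (%_. 0 :: real^7)" if "smooth6 T s \<delta>' (%_. 0 :: real)" "\<delta>' \<ge> 0" for \<delta>'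
  using smooth6_vector7[OF that(2) that(1) that(1) that(1) that(1) that(1) that(1) that(1)]
  by (rule smooth6_cong) (simp add: vec_eq_iff forall_7)
 then have zv: "splits T s \<delta> (%_. 0 :: real^7) (%_. 0) (%_. 0)"
  using z \<delta>0 unfolding splits_def by simp
 have m0: "mean (%_. 0) y = 0" for y by (simp add: mean_def coef_def cfour_const)
 note m = solution_means(7-9)[OF T \<delta> V zv z sol VsY, unfolded zero_index m0]
 have "mean (%z. Vs z $ i) x = 0" if "!!y. y \<in> dom6 T s ==> mean (%z. VsY z $ i) y = 0" for i
 proof (rule decaying_constant_zero[OF \<delta> smooth6_mean[OF T \<delta>0 n] x])
  fix r :: real assume "0 \<le> r"
  then show "mean (%z. Vs z $ i) (at_Y (sg s * r) x) = mean (%z. Vs z $ i) x"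
   by (intro Y_constant[OF has_partial_mean[OF T \<delta>0 n nY has_partial_nth[OF VsY(2)]] that x]) simp_all
 qed
 then show "mean (%z. Vs z $ 3) x = 0" "mean (%z. Vs z $ 6) x = 0" "mean (%z. Vs z $ 7) x = 0"
  using m by blast+
qed

text \<open>Fourier inversion in each component; the mode \<open>k = 0\<close> is moved to the
 left-hand side.\<close>

lemma homogeneous_expansion:
 assumes T: "T > 0" and \<delta>: "\<delta> > 0" and V: "splits T s \<delta> V Vb Vs" and sol: "solves P T s V (%_. 0) (%_. 0)"
  and \<Delta>: "(c_coef P s)\<^sup>2 - (b_coef P s)\<^sup>2 \<noteq> 0" and \<xi>: "(xi1 P)\<^sup>2 + (xi2 P)\<^sup>2 = 1"
  and \<tau>: "tau P \<noteq> 0" and x: "x \<in> dom6 T s"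
 shows "((%k. (free_mode P s V k x * exp (of_real (- sg s * of_int \<bar>k\<bar> * Y_of x) + \<i> * of_int k * of_real (theta_of x))) *s R_vec P s k)
   has_sum cvec (V x - mean_vec Vb x
    - vector [mean (%z. Vs z $ 1) x, mean (%z. Vs z $ 2) x, 0, mean (%z. Vs z $ 4) x, mean (%z. Vs z $ 5) x, 0, 0])) (UNIV - {0})"
proof (rule has_sum_vec)
 fix i :: 7
 have V0: "smooth6 T s 0 V" by (rule splits_smooth[OF T \<delta> V])
 let ?f = "cplx (%z. V z $ i)"
 have "((%k. modulate (%k x. (if k = 0 then 0 else 1) * coef ?f k x) k x) has_sum (?f x - coef ?f 0 x)) UNIV"
  by (rule inversion_without_mean[OF T order_refl smooth6_cplx[OF T order_refl smooth6_nth[OF V0 order_refl]] x])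
 then have "((%k. ((free_mode P s V k x * exp (of_real (- sg s * of_int \<bar>k\<bar> * Y_of x) + \<i> * of_int k * of_real (theta_of x))) *s R_vec P s k) $ i)
   has_sum (?f x - coef ?f 0 x)) (UNIV - {0})"
 proof (rule iffD1[OF has_sum_cong_neutral, rotated -1])
  fix k :: int assume "k \<in> UNIV \<inter> (UNIV - {0})"
  then have k: "k \<noteq> 0" by simp
  show "modulate (%k x. (if k = 0 then 0 else 1) * coef ?f k x) k x
    = ((free_mode P s V k x * exp (of_real (- sg s * of_int \<bar>k\<bar> * Y_of x) + \<i> * of_int k * of_real (theta_of x))) *s R_vec P s k) $ i"
   unfolding modulate_def homogeneous_coef[OF T V0 sol \<Delta> \<xi> \<tau> k x] mode_def exp_add
   using k by (simp add: exp_of_real[symmetric] mult_ac)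
 qed (auto simp: modulate_def)
 moreover have "mean_vec Vb x $ i + vector [mean (%z. Vs z $ 1) x, mean (%z. Vs z $ 2) x, 0, mean (%z. Vs z $ 4) x, mean (%z. Vs z $ 5) x, 0, 0] $ i
   = mean (%z. V z $ i) x"
  unfolding splits_mean[OF T \<delta> splits_nth[OF V \<delta>] x]
  using exhaust_7[of i] homogeneous_star_means[OF T \<delta> V sol x] by (auto simp: mean_vec_def)
 then have "cvec (V x - mean_vec Vb x
    - vector [mean (%z. Vs z $ 1) x, mean (%z. Vs z $ 2) x, 0, mean (%z. Vs z $ 4) x, mean (%z. Vs z $ 5) x, 0, 0]) $ i
   = ?f x - coef ?f 0 x"
  by (simp add: cvec_def coef_mean algebra_simps flip: of_real_add)
 ultimately show "((%k. ((free_mode P s V k x * exp (of_real (- sg s * of_int \<bar>k\<bar> * Y_of x) + \<i> * of_int k * of_real (theta_of x))) *s R_vec P s k) $ i)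
   has_sum cvec (V x - mean_vec Vb x
    - vector [mean (%z. Vs z $ 1) x, mean (%z. Vs z $ 2) x, 0, mean (%z. Vs z $ 4) x, mean (%z. Vs z $ 5) x, 0, 0]) $ i) (UNIV - {0})"
  by simp
qed

text \<open>As \<open>c\<close> and \<open>b\<close> do not both vanish, the traces of
 \<open>u\<^sub>3\<close> and \<open>H\<^sub>3\<close> determine the amplitude.\<close>

lemma free_mode_trace:
 assumes T: "T > 0" and V: "smooth6 T s 0 V" and sol: "solves P T s V (%_. 0) (%_. 0)"
  and \<Delta>: "(c_coef P s)\<^sup>2 - (b_coef P s)\<^sup>2 \<noteq> 0" and \<xi>: "(xi1 P)\<^sup>2 + (xi2 P)\<^sup>2 = 1"
  and \<tau>: "tau P \<noteq> 0" and k: "k \<noteq> 0" and x: "x \<in> dom6 T s" and Y: "Y_of x = 0"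
  and tr: "coef (cplx (%z. V z $ 3)) k x = of_real (c_coef P s) * (\<i> * of_int k * h)"
   "coef (cplx (%z. V z $ 6)) k x = of_real (b_coef P s) * (\<i> * of_int k * h)"
 shows "free_mode P s V k x = of_real (sg s) * of_int \<bar>k\<bar> * h"
proof -
 let ?\<gamma> = "free_mode P s V k x" and ?e = "\<i> * of_real (sg s) * of_int (sgn k)"
 note h = homogeneous_coef[OF T V sol \<Delta> \<xi> \<tau> k x, unfolded Y]
 have "of_real (c_coef P s) * (?\<gamma> * ?e) = of_real (c_coef P s) * (\<i> * of_int k * h)"
  "of_real (b_coef P s) * (?\<gamma> * ?e) = of_real (b_coef P s) * (\<i> * of_int k * h)"
  using h[of 3, symmetric] h[of 6, symmetric] unfolding tr by (simp_all add: R_vec_def Let_def mult_ac)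
 moreover have "c_coef P s \<noteq> 0 \<or> b_coef P s \<noteq> 0" using \<Delta> by auto
 ultimately have "?\<gamma> * ?e = \<i> * of_int k * h"
  unfolding mult_cancel_left of_real_eq_0_iff by blast
 then have 1: "?\<gamma> * ?e * (- ?e) = \<i> * of_int k * h * (- ?e)" by simp
 have 2: "?\<gamma> * ?e * (- ?e) = ?\<gamma>" and 3: "\<i> * of_int k * h * (- ?e) = of_real (sg s) * of_int \<bar>k\<bar> * h"
  using k by (cases s; cases k "0::int" rule: linorder_cases; simp add: mult.assoc; simp add: algebra_simps)+
 show ?thesis by (rule trans[OF trans[OF 2[symmetric] 1] 3])
qed

section \<open>The fast problem\<close>

text \<open>Positions of the boundary values of the normal velocity and the normal magnetic field.\<close>

fun vel_idx :: "side => 5" where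
 "vel_idx Plus = 1" | "vel_idx Minus = 3"

fun mag_idx :: "side => 5" where
 "mag_idx Plus = 2" | "mag_idx Minus = 4"

lemma all_sides: "(\<forall>s. Q s) \<longleftrightarrow> Q Plus \<and> Q Minus"
 by (metis side.exhaust)

lemma bdry_op_iff:
 "bdry_op P Up Um d = g \<longleftrightarrow> Up$3 = g$1 + c_coef P Plus * d \<and> Up$6 = g$2 + b_coef P Plus * d \<and>
   Um$3 = g$3 + c_coef P Minus * d \<and> Um$6 = g$4 + b_coef P Minus * d \<and> Up$7 - Um$7 = g$5"
 by (auto simp: bdry_op_def vec_eq_iff forall_5)

lemma bdry6_nth: "bdry6 (%z. g z $ i) = (%x. bdry6 g x $ i)"
 by (rule ext) (simp add: bdry6_def split: prod.split)

lemma bdry6_at_Y [simp]: "bdry6 g (at_Y r x) = bdry6 g x"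
 by (cases x) (simp add: at_Y_def)

lemma fourier_mean: "fourier (%th. f (t,y1,y2,y3,Y,th)) 0 = of_real (mean f (t,y1,y2,y3,Y,th'))"
 using coef_fourier[of f 0 t y1 y2 y3 Y th'] coef_mean[of f "(t,y1,y2,y3,Y,th')"] by simp

lemma trace_point: "t \<in> {0..T} ==> (t,y1,y2,0,0,th) \<in> dom6 T s"
 by (simp add: dom6_def cslab_def chalf_def)

abbreviation solvability_form :: "mhd_params => (side => pt6 => real^7) => (pt4 => real^5) =>
  real => real => real => int => complex" where
 "solvability_form P F G t y1 y2 k \<equiv>
   (LINT Y3:half Plus|lborel. of_real (exp (- of_int \<bar>k\<bar> * Y3)) *
    cinner7 (L_vec P Plus k) (vfourier (%th. F Plus (t,y1,y2,0,Y3,th)) k))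
   - (LINT Y3:half Minus|lborel. of_real (exp (of_int \<bar>k\<bar> * Y3)) *
    cinner7 (L_vec P Minus k) (vfourier (%th. F Minus (t,y1,y2,0,Y3,th)) k))
   + of_real (ell1 P Plus) * vfourier (%th. G (t,y1,y2,th)) k $ 1
   + of_real (ell2 P Plus) * vfourier (%th. G (t,y1,y2,th)) k $ 2
   + of_real (ell1 P Minus) * vfourier (%th. G (t,y1,y2,th)) k $ 3
   + of_real (ell2 P Minus) * vfourier (%th. G (t,y1,y2,th)) k $ 4
   - \<i> * of_real (tau P) * of_int (sgn k) * vfourier (%th. G (t,y1,y2,th)) k $ 5"

locale fast_data =
 fixes P :: mhd_params and T :: real
  and F Fs :: "side => pt6 => real^7" and Fb :: "side => pt5 => real^7"
  and F8 F8s :: "side => pt6 => real" and F8b :: "side => pt5 => real"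
  and G :: "pt4 => real^5"
 assumes T: "T > 0" and \<xi>: "(xi1 P)\<^sup>2 + (xi2 P)\<^sup>2 = 1" and \<tau>: "tau P \<noteq> 0"
  and \<Delta>: "!!s. (c_coef P s)\<^sup>2 - (b_coef P s)\<^sup>2 \<noteq> 0"
  and rel: "(c_coef P Plus)\<^sup>2 + (c_coef P Minus)\<^sup>2 = (b_coef P Plus)\<^sup>2 + (b_coef P Minus)\<^sup>2"
  and F: "!!s. decomposes T s (F s) (Fb s) (Fs s)"
  and F8: "!!s. decomposes T s (F8 s) (F8b s) (F8s s)"
  and G: "G \<in> H_bdry T"
begin

lemma sources_split:
 obtains \<delta> where "\<delta> > 0" "\<delta> \<le> 1 / 2" "splits T s \<delta> (F s) (under6 (Fb s)) (Fs s)" "splits T s \<delta> (F8 s) (under6 (F8b s)) (F8s s)"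
proof -
 obtain d where d: "d > 0" "!!\<delta>. 0 < \<delta> ==> \<delta> \<le> d ==> splits T s \<delta> (F s) (under6 (Fb s)) (Fs s)"
  by (rule decomposes_splits[OF F]) (rule that)
 obtain e where e: "e > 0" "!!\<delta>. 0 < \<delta> ==> \<delta> \<le> e ==> splits T s \<delta> (F8 s) (under6 (F8b s)) (F8s s)"
  by (rule decomposes_splits[OF F8]) (rule that)
 show ?thesis
  by (rule that[of "min (min d e) (1 / 2)"]) (use d e in auto)
qed

lemma smooth_sources: "smooth6 T s 0 (F s)" "smooth6 T s 0 (F8 s)"
 by (rule sources_split[of s], rule splits_smooth[OF T], assumption, assumption)+

lemma smooth_G: "smooth6 T s 0 (%x. bdry6 G x $ i)"
 using smooth6_nth[OF H_bdry_smooth6[OF G] order_refl] by (simp only: bdry6_def)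

text \<open>The form in (e) equals the mismatch between the pressure jump and
 \<open>G\<^sub>5\<close>, for any state that satisfies the other equations. This serves both
 directions of the equivalence.\<close>

lemma solvability_jump:
 assumes U: "!!s. smooth6 T s 0 (U s)" and sol: "!!s. solves P T s (U s) (F s) (F8 s)"
  and d: "!!s. smooth6 T s 0 (d s)"
  and dc: "coef (cplx (d Plus)) k (t,y1,y2,0,0,0) = coef (cplx (d Minus)) k (t,y1,y2,0,0,0)"
  and tr: "!!s r. U s (t,y1,y2,0,0,r) $ 3 = G (t,y1,y2,r) $ vel_idx s + c_coef P s * d s (t,y1,y2,0,0,r)"
   "!!s r. U s (t,y1,y2,0,0,r) $ 6 = G (t,y1,y2,r) $ mag_idx s + b_coef P s * d s (t,y1,y2,0,0,r)"
  and t: "t \<in> {0..T}" and k: "k \<noteq> 0"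
 shows "solvability_form P F G t y1 y2 k
   = \<i> * of_real (tau P) * of_int (sgn k) * (fourier (%th. U Plus (t,y1,y2,0,0,th) $ 7) k
     - fourier (%th. U Minus (t,y1,y2,0,0,th) $ 7) k - fourier (%th. G (t,y1,y2,th) $ 5) k)"
proof -
 let ?x = "(t,y1,y2,0,0,0) :: pt6"
 have x: "?x \<in> dom6 T s" for s using t by (rule trace_point)
 have tr3: "U s (at_theta r ?x) $ 3 = bdry6 G (at_theta r ?x) $ vel_idx s + c_coef P s * d s (at_theta r ?x)"
  and tr6: "U s (at_theta r ?x) $ 6 = bdry6 G (at_theta r ?x) $ mag_idx s + b_coef P s * d s (at_theta r ?x)" for r s
  by (simp_all add: at_theta_def tr)
 note m = mode_trace[OF T U smooth_sources sol \<xi> k x smooth_G smooth_G d tr3 tr6]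
 have g: "coef (cplx (%x. bdry6 G x $ i)) k ?x = vfourier (%th. G (t,y1,y2,th)) k $ i" for i
  by (simp add: coef_fourier vfourier_def)
 have J: "(LINT Y3:half Plus|lborel. of_real (exp (- of_int \<bar>k\<bar> * Y3)) *
      cinner7 (L_vec P Plus k) (vfourier (%th. F Plus (t,y1,y2,0,Y3,th)) k))
   = (LINT r:{0..}|lborel. of_real (exp (- (freq k * r))) *
    cinner7 (L_vec P Plus k) (\<chi> i. coef (cplx (%z. F Plus z $ i)) k (?x + (sg Plus * r) *\<^sub>R e_Y)))"
  "(LINT Y3:half Minus|lborel. of_real (exp (of_int \<bar>k\<bar> * Y3)) *
      cinner7 (L_vec P Minus k) (vfourier (%th. F Minus (t,y1,y2,0,Y3,th)) k))
   = (LINT r:{0..}|lborel. of_real (exp (- (freq k * r))) *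
    cinner7 (L_vec P Minus k) (\<chi> i. coef (cplx (%z. F Minus z $ i)) k (?x + (sg Minus * r) *\<^sub>R e_Y)))"
  using solvability_integral[of Plus k P "F Plus" t y1 y2 0] solvability_integral[of Minus k P "F Minus" t y1 y2 0] by simp_all
 have p: "fourier (%th. U s (t,y1,y2,0,0,th) $ 7) k = coef (cplx (%z. U s z $ 7)) k ?x" for s
  by (simp add: coef_fourier)
 have 5: "fourier (%th. G (t,y1,y2,th) $ 5) k = vfourier (%th. G (t,y1,y2,th)) k $ 5"
  by (simp add: vfourier_def)
 show ?thesis
  unfolding J p 5
  by (rule jump_algebra[OF _ _ rel, where d = "coef (cplx (d Plus)) k ?x"])
    (use m[of Plus] m[of Minus] in \<open>simp_all add: g dc del: of_real_power of_real_diff\<close>)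
qed

definition side_solution :: "side => (pt6 => real^7) => (pt6 => real^7) => (pt6 => real^7) => real => bool" where
 "side_solution s U Ub Us \<delta> \<longleftrightarrow> \<delta> > 0 \<and> splits T s \<delta> U Ub Us \<and>
   splits T s \<delta> (F s) (under6 (Fb s)) (Fs s) \<and> splits T s \<delta> (F8 s) (under6 (F8b s)) (F8s s) \<and> solves P T s U (F s) (F8 s)"

lemma solution_sides:
 assumes "fast_solution P T F F8 G U \<psi>"
 obtains Ub \<delta> Us \<psi>th where "!!s. side_solution s (U s) (Ub s) (Us s) (\<delta> s)"
  "!!s. smooth6 T s 0 (\<psi>th s)" "!!s. partial6 T s e_theta (bdry6 \<psi>) (\<psi>th s)"
  "!!s k t y1 y2 th. t \<in> {0..T} ==> coef (cplx (\<psi>th s)) k (t,y1,y2,0,0,th) = \<i> * of_int k * fourier (%th. \<psi> (t,y1,y2,th)) k"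
  "!!s t y1 y2 r. t \<in> {0..T} ==> U s (t,y1,y2,0,0,r) $ 3 = G (t,y1,y2,r) $ vel_idx s + c_coef P s * \<psi>th s (t,y1,y2,0,0,r)"
  "!!s t y1 y2 r. t \<in> {0..T} ==> U s (t,y1,y2,0,0,r) $ 6 = G (t,y1,y2,r) $ mag_idx s + b_coef P s * \<psi>th s (t,y1,y2,0,0,r)"
  "!!t y1 y2 r. t \<in> {0..T} ==> U Plus (t,y1,y2,0,0,r) $ 7 - U Minus (t,y1,y2,0,0,r) $ 7 = G (t,y1,y2,r) $ 5"
proof -
 have S: "U s \<in> S_sum T s" for s using assms unfolding fast_solution_def by blast
 have \<psi>: "smooth6 T s 0 (bdry6 \<psi>)" for s
  using assms H_bdry_smooth6[of \<psi> T s] unfolding fast_solution_def bdry6_def by blast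
 have "\<exists>\<psi>th. smooth6 T s 0 \<psi>th \<and> partial6 T s e_theta (bdry6 \<psi>) \<psi>th" for s
  using smooth6_partials[OF \<psi>] by metis
 then obtain \<psi>th where \<psi>th: "!!s. smooth6 T s 0 (\<psi>th s)" "!!s. partial6 T s e_theta (bdry6 \<psi>) (\<psi>th s)"
  by metis
 have "\<exists>Ub Us \<delta>. side_solution s (U s) Ub Us \<delta>" for s
 proof -
  obtain Ub Us where "decomposes T s (U s) Ub Us" using S unfolding S_sum_def by blast
  then obtain d where d: "d > 0" "!!\<delta>. 0 < \<delta> ==> \<delta> \<le> d ==> splits T s \<delta> (U s) (under6 Ub) Us"
   by (rule decomposes_splits) (rule that)
  obtain e where e: "e > 0" "!!\<delta>. 0 < \<delta> ==> \<delta> \<le> e ==> splits T s \<delta> (F s) (under6 (Fb s)) (Fs s)"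
   by (rule decomposes_splits[OF F]) (rule that)
  obtain f where f: "f > 0" "!!\<delta>. 0 < \<delta> ==> \<delta> \<le> f ==> splits T s \<delta> (F8 s) (under6 (F8b s)) (F8s s)"
   by (rule decomposes_splits[OF F8]) (rule that)
  let ?\<delta> = "min d (min e f)"
  have \<delta>: "?\<delta> > 0" using d(1) e(1) f(1) by simp
  have "solves P T s (U s) (F s) (F8 s)"
   using assms solves_iff[OF T splits_smooth[OF T d(1) d(2)[OF d(1) order_refl]] smooth_sources, of P]
   unfolding fast_solution_def fast_problem_def by blast
  moreover have "splits T s ?\<delta> (U s) (under6 Ub) Us" by (rule d(2)[OF \<delta>]) simp
  moreover have "splits T s ?\<delta> (F s) (under6 (Fb s)) (Fs s)" by (rule e(2)[OF \<delta>]) simp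
  moreover have "splits T s ?\<delta> (F8 s) (under6 (F8b s)) (F8s s)" by (rule f(2)[OF \<delta>]) simp
  ultimately have "side_solution s (U s) (under6 Ub) Us ?\<delta>"
   unfolding side_solution_def using \<delta> by blast
  then show ?thesis by blast
 qed
 then obtain Ub Us \<delta> where sol: "!!s. side_solution s (U s) (Ub s) (Us s) (\<delta> s)" by metis
 have B: "bdry_op P (U Plus (t,y1,y2,0,0,th)) (U Minus (t,y1,y2,0,0,th)) (d_theta_bdry T \<psi> (t,y1,y2,th)) = G (t,y1,y2,th)"
  if "t \<in> {0..T}" for t y1 y2 th
  using assms that unfolding fast_solution_def fast_problem_def by blast
 show ?thesis
 proof (rule that[OF sol \<psi>th])
  fix t y1 y2 r th :: real and s :: side and k :: int assume t: "t \<in> {0..T}"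
  show "coef (cplx (\<psi>th s)) k (t,y1,y2,0,0,th) = \<i> * of_int k * fourier (%th. \<psi> (t,y1,y2,th)) k"
   using coef_theta[OF T order_refl smooth6_cplx[OF T order_refl \<psi>] smooth6_cplx[OF T order_refl \<psi>th(1)]
     has_partial_cplx[OF \<psi>th(2)] trace_point[OF t, where s = s and th = th and ?y1.0 = y1 and ?y2.0 = y2], where k = k]
   by (simp add: coef_fourier)
  have "U s (t,y1,y2,0,0,r) $ 3 = G (t,y1,y2,r) $ vel_idx s + c_coef P s * \<psi>th s (t,y1,y2,0,0,r) \<and>
   U s (t,y1,y2,0,0,r) $ 6 = G (t,y1,y2,r) $ mag_idx s + b_coef P s * \<psi>th s (t,y1,y2,0,0,r)"
   using B[OF t, of y1 y2 r] d_theta_bdry_eq[OF \<psi>th(2) t, of y1 y2 r s] unfolding bdry_op_iff by (cases s) simp_all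
  then show "U s (t,y1,y2,0,0,r) $ 3 = G (t,y1,y2,r) $ vel_idx s + c_coef P s * \<psi>th s (t,y1,y2,0,0,r)"
   "U s (t,y1,y2,0,0,r) $ 6 = G (t,y1,y2,r) $ mag_idx s + b_coef P s * \<psi>th s (t,y1,y2,0,0,r)" by blast+
  show "U Plus (t,y1,y2,0,0,r) $ 7 - U Minus (t,y1,y2,0,0,r) $ 7 = G (t,y1,y2,r) $ 5"
   using B[OF t, of y1 y2 r] unfolding bdry_op_iff by blast
 qed
qed

lemma cond_a_iff:
 assumes Gth: "!!s i. partial6 T s e_theta (%x. bdry6 G x $ i) (Gth s i)"
 shows "cond_a P T F G \<longleftrightarrow> (\<forall>s. \<forall>t\<in>{0..T}. \<forall>y1 y2 th. F s (t,y1,y2,0,0,th) $ 6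
   = c_coef P s * Gth s (mag_idx s) (t,y1,y2,0,0,th) - b_coef P s * Gth s (vel_idx s) (t,y1,y2,0,0,th))"
proof -
 have "d_theta_bdry T (%z. G z $ i) (t,y1,y2,th) = Gth s i (t,y1,y2,0,0,th)" if "t \<in> {0..T}" for t y1 y2 th i s
  using d_theta_bdry_eq[OF _ that, of s "%z. G z $ i" "Gth s i"] Gth unfolding bdry6_nth by blast
 note eq = this[where s = Plus] this[where s = Minus]
 show ?thesis
  unfolding cond_a_def all_sides by (auto simp: eq[symmetric])
qed

lemma cond_b_iff:
 "cond_b T Fb F8b \<longleftrightarrow> (\<forall>s. \<forall>x\<in>dom6 T s. mean_vec (under6 (Fb s)) x = 0 \<and> mean (under6 (F8b s)) x = 0)"
proof -
 have e: "vfourier (%th. Fb s (t,y1,y2,y3,th)) 0 = 0 \<and> fourier (%th. F8b s (t,y1,y2,y3,th)) 0 = 0 \<longleftrightarrow>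
   mean_vec (under6 (Fb s)) (t,y1,y2,y3,Y,th') = 0 \<and> mean (under6 (F8b s)) (t,y1,y2,y3,Y,th') = 0" for s t y1 y2 y3 Y th'
  using fourier_mean[of "%z. under6 (Fb s) z $ i" t y1 y2 y3 Y th' for i] fourier_mean[of "under6 (F8b s)" t y1 y2 y3 Y th']
  by (simp add: vec_eq_iff vfourier_def mean_vec_def)
 show ?thesis
 proof (intro iffI allI ballI)
  fix s and x :: pt6 assume B: "cond_b T Fb F8b" and x: "x \<in> dom6 T s"
  obtain t y1 y2 y3 Y th where xe: "x = (t,y1,y2,y3,Y,th)" by (cases x)
  have "t \<in> {0..T}" "y3 \<in> cslab s" using x unfolding xe by (simp_all add: dom6_def)
  then show "mean_vec (under6 (Fb s)) x = 0 \<and> mean (under6 (F8b s)) x = 0"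
   using B unfolding cond_b_def xe e[symmetric] by blast
 next
  assume R: "\<forall>s. \<forall>x\<in>dom6 T s. mean_vec (under6 (Fb s)) x = 0 \<and> mean (under6 (F8b s)) x = 0"
  show "cond_b T Fb F8b"
   unfolding cond_b_def e[where Y = 0 and th' = 0] using R by (simp add: dom6_def chalf_def)
 qed
qed

lemma cond_c_iff:
 "cond_c P T Fs F8s \<longleftrightarrow> (\<forall>s. \<forall>x\<in>dom6 T s.
   vel1 P s * mean (%z. Fs s z $ 7) x - mag1 P s * mean (F8s s) x = mean (%z. Fs s z $ 1) x \<and>
   vel2 P s * mean (%z. Fs s z $ 7) x - mag2 P s * mean (F8s s) x = mean (%z. Fs s z $ 2) x \<and>
   mag1 P s * mean (%z. Fs s z $ 7) x - vel1 P s * mean (F8s s) x = mean (%z. Fs s z $ 4) x \<and>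
   mag2 P s * mean (%z. Fs s z $ 7) x - vel2 P s * mean (F8s s) x = mean (%z. Fs s z $ 5) x)"
  (is "_ \<longleftrightarrow> (\<forall>s. \<forall>x\<in>dom6 T s. ?Q s x)")
proof -
 have m: "vfourier (%th. Fs s (t,y1,y2,y3,Y,th)) 0 $ i = of_real (mean (%z. Fs s z $ i) (t,y1,y2,y3,Y,th'))"
  "fourier (%th. F8s s (t,y1,y2,y3,Y,th)) 0 = of_real (mean (F8s s) (t,y1,y2,y3,Y,th'))" for s i t y1 y2 y3 Y th'
  using fourier_mean[of "%z. Fs s z $ i" t y1 y2 y3 Y th'] fourier_mean[of "F8s s" t y1 y2 y3 Y th'] by (simp_all add: vfourier_def)
 have "cond_c P T Fs F8s \<longleftrightarrow> (\<forall>s. \<forall>t\<in>{0..T}. \<forall>y1 y2. \<forall>y3\<in>cslab s. \<forall>Y\<in>chalf s. ?Q s (t,y1,y2,y3,Y,0))"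
  unfolding cond_c_def Let_def m[where th' = 0] by (simp only: of_real_eq_iff flip: of_real_mult of_real_diff)
 moreover have "?Q s (t,y1,y2,y3,Y,th) = ?Q s (t,y1,y2,y3,Y,0)" for s t y1 y2 y3 Y th
  using mean_at_theta[of _ 0 "(t,y1,y2,y3,Y,th)"] by (simp add: at_theta_def)
 ultimately show ?thesis
  by (fastforce simp: dom6_def)
qed

lemma G_theta:
 obtains Gth where "!!s i. partial6 T s e_theta (%x. bdry6 G x $ i) (Gth s i)" "!!s i. smooth6 T s 0 (Gth s i)"
proof -
 have "\<exists>g'. partial6 T s e_theta (%x. bdry6 G x $ i) g' \<and> smooth6 T s 0 g'" for s i
  using smooth6_partials[OF smooth_G] by metis
 then show ?thesis using that by metis
qed

lemma conditions_necessary: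
 assumes "fast_solution P T F F8 G U \<psi>"
 shows "cond_a P T F G" "cond_b T Fb F8b" "cond_c P T Fs F8s" "cond_d P T F F8" "cond_e P T F G"
proof -
 obtain Ub \<delta> Us \<psi>th where side: "!!s. side_solution s (U s) (Ub s) (Us s) (\<delta> s)"
  and \<psi>th: "!!s. smooth6 T s 0 (\<psi>th s)"
  and \<psi>c: "!!s k t y1 y2 th. t \<in> {0..T} ==> coef (cplx (\<psi>th s)) k (t,y1,y2,0,0,th) = \<i> * of_int k * fourier (%th. \<psi> (t,y1,y2,th)) k"
  and tr: "!!s t y1 y2 r. t \<in> {0..T} ==> U s (t,y1,y2,0,0,r) $ 3 = G (t,y1,y2,r) $ vel_idx s + c_coef P s * \<psi>th s (t,y1,y2,0,0,r)"
   "!!s t y1 y2 r. t \<in> {0..T} ==> U s (t,y1,y2,0,0,r) $ 6 = G (t,y1,y2,r) $ mag_idx s + b_coef P s * \<psi>th s (t,y1,y2,0,0,r)"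
  and q: "!!t y1 y2 r. t \<in> {0..T} ==> U Plus (t,y1,y2,0,0,r) $ 7 - U Minus (t,y1,y2,0,0,r) $ 7 = G (t,y1,y2,r) $ 5"
  by (rule solution_sides[OF assms]) (rule that)
 note sd = side[unfolded side_solution_def, THEN conjunct1] side[unfolded side_solution_def, THEN conjunct2, THEN conjunct1]
  side[unfolded side_solution_def, THEN conjunct2, THEN conjunct2, THEN conjunct1]
  side[unfolded side_solution_def, THEN conjunct2, THEN conjunct2, THEN conjunct2, THEN conjunct1]
  side[unfolded side_solution_def, THEN conjunct2, THEN conjunct2, THEN conjunct2, THEN conjunct2]
 have U0: "smooth6 T s 0 (U s)" for s by (rule splits_smooth[OF T sd(1,2)])
 obtain Gth where Gth: "!!s i. partial6 T s e_theta (%x. bdry6 G x $ i) (Gth s i)" by (rule G_theta) (rule that)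
 show "cond_a P T F G"
  unfolding cond_a_iff[OF Gth]
 proof (intro allI ballI)
  fix s y1 y2 th and t :: real assume t: "t \<in> {0..T}"
  show "F s (t,y1,y2,0,0,th) $ 6 = c_coef P s * Gth s (mag_idx s) (t,y1,y2,0,0,th) - b_coef P s * Gth s (vel_idx s) (t,y1,y2,0,0,th)"
   by (rule trace_compatibility[OF T U0 sd(5) trace_point[OF t] Gth Gth, where d = "\<psi>th s"]) (simp_all only: at_theta_def prod.case bdry6_apply tr[OF t])
 qed
 have means: "mean_vec (under6 (Fb s)) x = 0" "mean (under6 (F8b s)) x = 0"
  "vel1 P s * mean (%z. Fs s z $ 7) x - mag1 P s * mean (F8s s) x = mean (%z. Fs s z $ 1) x"
  "vel2 P s * mean (%z. Fs s z $ 7) x - mag2 P s * mean (F8s s) x = mean (%z. Fs s z $ 2) x"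
  "mag1 P s * mean (%z. Fs s z $ 7) x - vel1 P s * mean (F8s s) x = mean (%z. Fs s z $ 4) x"
  "mag2 P s * mean (%z. Fs s z $ 7) x - vel2 P s * mean (F8s s) x = mean (%z. Fs s z $ 5) x"
  if x: "x \<in> dom6 T s" for s x
 proof -
  obtain UsY where UsY: "smooth6 T s (\<delta> s) UsY" "partial6 T s e_Y (Us s) UsY"
   using smooth6_partials[OF splitsD(3)[OF sd(2)]] by metis
  note m = solution_means[OF T sd UsY x]
  show "mean_vec (under6 (Fb s)) x = 0" "mean (under6 (F8b s)) x = 0"
   "vel1 P s * mean (%z. Fs s z $ 7) x - mag1 P s * mean (F8s s) x = mean (%z. Fs s z $ 1) x"
   "vel2 P s * mean (%z. Fs s z $ 7) x - mag2 P s * mean (F8s s) x = mean (%z. Fs s z $ 2) x"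
   "mag1 P s * mean (%z. Fs s z $ 7) x - vel1 P s * mean (F8s s) x = mean (%z. Fs s z $ 4) x"
   "mag2 P s * mean (%z. Fs s z $ 7) x - vel2 P s * mean (F8s s) x = mean (%z. Fs s z $ 5) x"
   by (rule m)+
 qed
 then show "cond_b T Fb F8b" "cond_c P T Fs F8s"
  unfolding cond_b_iff cond_c_iff by blast+
 show "cond_d P T F F8"
  using solution_compatible[OF T U0 sd(5)] unfolding cond_d_def compatible_def by blast
 have "solvability_form P F G t y1 y2 k = 0" if t: "t \<in> {0..T}" and k: "k \<noteq> 0" for t y1 y2 k
 proof -
  have "smooth6 T s 0 (%x. U s x $ 7)" for s using smooth6_nth[OF U0] by simp
  note cont = slice_continuous[OF T order_refl smooth6_cplx[OF T order_refl this] trace_point[OF t], unfolded at_theta_def prod.case]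
  have "fourier (%th. G (t,y1,y2,th) $ 5) k = fourier (%th. U Plus (t,y1,y2,0,0,th) $ 7) k - fourier (%th. U Minus (t,y1,y2,0,0,th) $ 7) k"
   unfolding q[OF t, symmetric] fourier_eq_cfour of_real_diff by (rule cfour_diff[OF cont cont])
  then show ?thesis
   using solvability_jump[where d = \<psi>th, OF U0 sd(5) \<psi>th _ tr(1)[OF t] tr(2)[OF t] t k, of y1 y2] \<psi>c[OF t]
   by simp
 qed
 then show "cond_e P T F G" unfolding cond_e_def Let_def by blast
qed

end

context fast_data
begin

definition particular :: "side => (pt6 => real^7) => (pt6 => real^7) => (pt6 => real^7) => real => bool" where
 "particular s U Ub Us \<delta> \<longleftrightarrow> side_solution s U Ub Us \<delta> \<and> U = (%x. Ub x + Us x) \<and>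
   (\<forall>t\<in>{0..T}. \<forall>y1 y2 th. U (t,y1,y2,0,0,th) $ 3 = G (t,y1,y2,th) $ vel_idx s \<and> U (t,y1,y2,0,0,th) $ 6 = G (t,y1,y2,th) $ mag_idx s \<and>
    mean (%z. U z $ 7) (t,y1,y2,0,0,th) = (if s = Plus then mean (%x. bdry6 G x $ 5) (t,y1,y2,0,0,th) else 0)) \<and>
   (\<forall>x\<in>dom6 T s. \<forall>i\<in>{1,2,4,5}. mean (%z. U z $ i) x = 0) \<and>
   (\<forall>x\<in>dom6 T s. y3_of x = sg s \<longrightarrow> mean_vec Ub x = 0)"

lemma particular_trace:
 assumes "particular s U Ub Us \<delta>" "t \<in> {0..T}"
 shows "U (t,y1,y2,0,0,th) $ 3 = G (t,y1,y2,th) $ vel_idx s" "U (t,y1,y2,0,0,th) $ 6 = G (t,y1,y2,th) $ mag_idx s"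
  "mean (%z. U z $ 7) (t,y1,y2,0,0,th) = (if s = Plus then mean (%x. bdry6 G x $ 5) (t,y1,y2,0,0,th) else 0)"
 using assms unfolding particular_def by blast+

lemma particular_exists:
 assumes a: "cond_a P T F G" and b: "cond_b T Fb F8b" and c: "cond_c P T Fs F8s" and d: "cond_d P T F F8"
 shows "\<exists>U Ub Us \<delta>. particular s U Ub Us \<delta>"
proof -
 obtain \<delta> where \<delta>: "\<delta> > 0" "\<delta> \<le> 1 / 2" and Fsp: "splits T s \<delta> (F s) (under6 (Fb s)) (Fs s)" "splits T s \<delta> (F8 s) (under6 (F8b s)) (F8s s)"
  by (rule sources_split[of s]) (rule that)
 obtain Gth where Gth: "!!s i. partial6 T s e_theta (%x. bdry6 G x $ i) (Gth s i)" "!!s i. smooth6 T s 0 (Gth s i)"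
  by (rule G_theta) (rule that)
 note mb = b[unfolded cond_b_iff, rule_format, THEN conjunct1] b[unfolded cond_b_iff, rule_format, THEN conjunct2]
 have mc: "vel1 P s * mean (%z. Fs s z $ 7) x - mag1 P s * mean (F8s s) x = mean (%z. Fs s z $ 1) x"
  "vel2 P s * mean (%z. Fs s z $ 7) x - mag2 P s * mean (F8s s) x = mean (%z. Fs s z $ 2) x"
  "mag1 P s * mean (%z. Fs s z $ 7) x - vel1 P s * mean (F8s s) x = mean (%z. Fs s z $ 4) x"
  "mag2 P s * mean (%z. Fs s z $ 7) x - vel2 P s * mean (F8s s) x = mean (%z. Fs s z $ 5) x"
  if "x \<in> dom6 T s" for x
  using c[unfolded cond_c_iff] that by blast+
 have comp: "compatible P T s (F s) (F8 s)"
  using d unfolding cond_d_def compatible_def by blast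
 define g7 where "g7 x = (if s = Plus then 1 else 0) * bdry6 G x $ 5" for x
 have g7: "smooth6 T s 0 g7" unfolding g7_def[abs_def] by (rule smooth6_cmult[OF T order_refl smooth_G])
 have mg7: "mean g7 x = (if s = Plus then mean (%x. bdry6 G x $ 5) x else 0)" for x
  unfolding g7_def[abs_def] mean_cmult[OF T order_refl] by simp
 have tr: "F s x $ 6 = c_coef P s * Gth s (mag_idx s) x - b_coef P s * Gth s (vel_idx s) x"
  if "x \<in> dom6 T s" "y3_of x = 0" "Y_of x = 0" for x
 proof -
  obtain t y1 y2 y3 Y th where xe: "x = (t,y1,y2,y3,Y,th)" by (cases x)
  show ?thesis
   using a that unfolding cond_a_iff[OF Gth(1)] xe by (simp add: y3_of_def Y_of_def dom6_def)
 qed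
 obtain U Ub Us where U: "splits T s \<delta> U Ub Us" "solves P T s U (F s) (F8 s)" "U = (%x. Ub x + Us x)"
  and trU: "!!x. x \<in> dom6 T s ==> y3_of x = 0 ==> Y_of x = 0 ==>
    U x $ 3 = bdry6 G x $ vel_idx s \<and> U x $ 6 = bdry6 G x $ mag_idx s \<and> mean (%z. U z $ 7) x = mean g7 x"
  and mU: "!!x i. x \<in> dom6 T s ==> i \<in> {1,2,4,5} ==> mean (%z. U z $ i) x = 0"
  and mUb: "!!x. x \<in> dom6 T s ==> y3_of x = sg s ==> mean_vec Ub x = 0"
 proof (rule particular_solution[OF T \<delta> Fsp comp mb mc smooth_G smooth_G g7 _ _ _ Gth(2) Gth(2) Gth(1) Gth(1) tr \<Delta> \<xi>])
  show "bdry6 G (at_Y r x) $ vel_idx s = bdry6 G x $ vel_idx s" "bdry6 G (at_Y r x) $ mag_idx s = bdry6 G x $ mag_idx s"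
   "g7 (at_Y r x) = g7 x" for r x by (simp_all add: g7_def)
 qed (rule that | assumption)+
 have "particular s U Ub Us \<delta>"
  unfolding particular_def side_solution_def
 proof (intro conjI ballI allI impI)
  fix t y1 y2 th :: real assume t: "t \<in> {0..T}"
  have "y3_of (t,y1,y2,0,0,th) = 0" "Y_of (t,y1,y2,0,0,th) = 0" by (simp_all add: y3_of_def Y_of_def)
  note r = trU[OF trace_point[OF t] this, unfolded mg7 bdry6_apply]
  show "U (t,y1,y2,0,0,th) $ 3 = G (t,y1,y2,th) $ vel_idx s" "U (t,y1,y2,0,0,th) $ 6 = G (t,y1,y2,th) $ mag_idx s"
   "mean (%z. U z $ 7) (t,y1,y2,0,0,th) = (if s = Plus then mean (%x. bdry6 G x $ 5) (t,y1,y2,0,0,th) else 0)"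
   using r by blast+
 qed (use U \<delta> Fsp mU mUb in blast)+
 then show ?thesis by blast
qed

text \<open>The oscillating modes of the jump are right by (e). The mean is right because on the
 upper side the mean pressure was prescribed as that of \<open>G\<^sub>5\<close> and on the lower
 side as zero.\<close>

lemma pressure_jump:
 assumes e: "cond_e P T F G" and U: "!!s. particular s (U s) (Ub s) (Us s) (\<delta> s)" and t: "t \<in> {0..T}"
 shows "U Plus (t,y1,y2,0,0,th) $ 7 - U Minus (t,y1,y2,0,0,th) $ 7 = G (t,y1,y2,th) $ 5"
proof -
 have side: "side_solution s (U s) (Ub s) (Us s) (\<delta> s)" for s using U[of s] unfolding particular_def by blast
 have U0: "smooth6 T s 0 (U s)" for s
  using side[of s] splits_smooth[OF T] unfolding side_solution_def by blast
 have sol: "solves P T s (U s) (F s) (F8 s)" for s using side[of s] unfolding side_solution_def by blast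
 have tr: "U s (t,y1,y2,0,0,r) $ 3 = G (t,y1,y2,r) $ vel_idx s + c_coef P s * 0"
  "U s (t,y1,y2,0,0,r) $ 6 = G (t,y1,y2,r) $ mag_idx s + b_coef P s * 0" for s r
  by (simp_all only: particular_trace[OF U t] mult_zero_right add_0_right)
 have z: "smooth6 T s 0 (%_. 0 :: real)" for s
  using smooth6_cmult[OF T order_refl smooth_G[of s 1], of 0] by simp
 have s7: "smooth6 T s 0 (%x. U s x $ 7)" for s using smooth6_nth[OF U0 order_refl] .
 note cont = slice_continuous[OF T order_refl smooth6_cplx[OF T order_refl s7] trace_point[OF t], unfolded at_theta_def prod.case]
  slice_continuous[OF T order_refl smooth6_cplx[OF T order_refl smooth_G] trace_point[OF t, of _ _ _ Plus], unfolded at_theta_def prod.case bdry6_apply]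
 note per = slice_periodic[OF T order_refl s7 trace_point[OF t], unfolded at_theta_def prod.case]
  slice_periodic[OF T order_refl smooth_G trace_point[OF t, of _ _ _ Plus], unfolded at_theta_def prod.case bdry6_apply]
 let ?h = "%r. complex_of_real (U Plus (t,y1,y2,0,0,r) $ 7) - of_real (U Minus (t,y1,y2,0,0,r) $ 7) - of_real (G (t,y1,y2,r) $ 5)"
 have "?h th = 0"
 proof (rule fourier_uniqueness[where g = ?h])
  show "continuous_on UNIV ?h" by (intro continuous_on_diff cont)
  show "?h (r + 2 * pi) = ?h r" for r by (simp add: per)
  fix k
  have h: "cfour ?h k = fourier (%r. U Plus (t,y1,y2,0,0,r) $ 7) k - fourier (%r. U Minus (t,y1,y2,0,0,r) $ 7) k - fourier (%r. G (t,y1,y2,r) $ 5) k"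
   unfolding fourier_eq_cfour
   by (subst cfour_diff; (intro continuous_on_diff cont)?; subst cfour_diff; (intro cont)?; simp)
  show "cfour ?h k = 0"
  proof (cases "k = 0")
   case True
   have "mean (%z. U Plus z $ 7) (t,y1,y2,0,0,0) = mean (%x. bdry6 G x $ 5) (t,y1,y2,0,0,0)"
    "mean (%z. U Minus z $ 7) (t,y1,y2,0,0,0) = 0"
    by (simp_all add: particular_trace[OF U t])
   then show ?thesis
    using h[unfolded True] True fourier_mean[of "%z. U Plus z $ 7" t y1 y2 0 0 0] fourier_mean[of "%z. U Minus z $ 7" t y1 y2 0 0 0]
     fourier_mean[of "%x. bdry6 G x $ 5" t y1 y2 0 0 0] by simp
  next
   case False
   have "\<i> * of_real (tau P) * of_int (sgn k) * cfour ?h k = 0"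
    unfolding h solvability_jump[where d = "%_ _. 0", OF U0 sol z refl tr t False, symmetric]
    using e t False unfolding cond_e_def Let_def by blast
   moreover have "\<i> * complex_of_real (tau P) * of_int (sgn k) \<noteq> 0"
    using \<tau> False by (simp add: sgn_eq_0_iff)
   ultimately show ?thesis by (simp only: mult_eq_0_iff) simp
  qed
 qed
 then have "complex_of_real (U Plus (t,y1,y2,0,0,th) $ 7 - U Minus (t,y1,y2,0,0,th) $ 7 - G (t,y1,y2,th) $ 5) = 0" by simp
 then show ?thesis unfolding of_real_eq_0_iff by simp
qed

lemma particular_fast_solution:
 assumes e: "cond_e P T F G" and U: "!!s. particular s (U s) (Ub s) (Us s) (\<delta> s)"
 shows "fast_solution P T F F8 G U (%_. 0)"
  "decomposes T s (U s) (%(t,y1,y2,y3,th). Ub s (t,y1,y2,y3,0,th)) (Us s)"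
proof -
 have side: "\<delta> s > 0" "splits T s (\<delta> s) (U s) (Ub s) (Us s)" "solves P T s (U s) (F s) (F8 s)" "U s = (%x. Ub s x + Us s x)" for s
  using U[of s] unfolding particular_def side_solution_def by blast+
 have dec: "decomposes T s (U s) (%(t,y1,y2,y3,th). Ub s (t,y1,y2,y3,0,th)) (Us s)" for s
  unfolding side(4) by (rule decomposesI[OF T side(1) splitsD(1,2)[OF side(2)] splitsD(3)[OF side(2)]])
 then show "decomposes T s (U s) (%(t,y1,y2,y3,th). Ub s (t,y1,y2,y3,0,th)) (Us s)" .
 have d0: "d_theta_bdry T (%_. 0 :: real) (t,y1,y2,th) = 0" if "t \<in> {0..T}" for t y1 y2 th
  using d_theta_bdry_eq[of T Plus "%_. 0" "%_. 0 :: real", OF _ that] has_partial_const[of "dom6 T Plus" e_theta "0 :: real"]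
  by (simp add: bdry6_def split_def)
 have "bdry_op P (U Plus (t,y1,y2,0,0,th)) (U Minus (t,y1,y2,0,0,th)) (d_theta_bdry T (%_. 0) (t,y1,y2,th)) = G (t,y1,y2,th)"
  if "t \<in> {0..T}" for t y1 y2 th
  unfolding bdry_op_iff using pressure_jump[OF e U that, of y1 y2 th] that
  by (simp only: particular_trace[OF U that] vel_idx.simps mag_idx.simps d0[OF that] mult_zero_right add_0_right)
 moreover note solves_iff[OF T splits_smooth[OF T side(1,2)] smooth_sources, THEN iffD1, OF side(3)]
 ultimately show "fast_solution P T F F8 G U (%_. 0)"
  unfolding fast_solution_def fast_problem_def S_sum_def using dec zero_in_H_bdry[OF T] by blast
qed

lemma solves_diff:
 assumes U: "smooth6 T s 0 U" "solves P T s U f g" and W: "smooth6 T s 0 W" "solves P T s W f g"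
 shows "solves P T s (%x. U x - W x) (%_. 0) (%_. 0)"
proof -
 obtain UY Uth where U': "smooth6 T s 0 UY" "smooth6 T s 0 Uth" "partial6 T s e_Y U UY" "partial6 T s e_theta U Uth"
  by (rule smooth6_partials[OF U(1)])
 obtain WY Wth where W': "smooth6 T s 0 WY" "smooth6 T s 0 Wth" "partial6 T s e_Y W WY" "partial6 T s e_theta W Wth"
  by (rule smooth6_partials[OF W(1)])
 show ?thesis
  unfolding solves_def
 proof (intro exI conjI ballI)
  show "smooth6 T s 0 (%x. UY x - WY x)" "smooth6 T s 0 (%x. Uth x - Wth x)"
   by (intro smooth6_diff order_refl U' W')+
  show "partial6 T s e_Y (%x. U x - W x) (%x. UY x - WY x)" "partial6 T s e_theta (%x. U x - W x) (%x. Uth x - Wth x)"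
   by (intro has_partial_diff U' W')+
  show "interior_eq P s (UY x - WY x) (Uth x - Wth x) 0 0" if "x \<in> dom6 T s" for x
   using interior_diff[OF solvesD[OF T U(2) U'(3,4) that] solvesD[OF T W(2) W'(3,4) that]] by simp
 qed
qed

text \<open>The difference of two solutions has no sources, its normal traces are \<open>c\<close>
 and \<open>b\<close> times the derivative of the front, and its pressure is continuous across the
 interface.\<close>

lemma solution_represented:
 assumes e: "cond_e P T F G" and UU: "!!s. particular s (UU s) (UUb s) (UUs s) (\<epsilon> s)"
  and U: "fast_solution P T F F8 G U \<psi>"
 shows "represented_by P T UU U \<psi>"
proof -
 obtain Ub \<delta>' Us \<psi>th where side: "!!s. side_solution s (U s) (Ub s) (Us s) (\<delta>' s)"
  and \<psi>th: "!!s. smooth6 T s 0 (\<psi>th s)"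
  and \<psi>c: "!!s k t y1 y2 th. t \<in> {0..T} ==> coef (cplx (\<psi>th s)) k (t,y1,y2,0,0,th) = \<i> * of_int k * fourier (%th. \<psi> (t,y1,y2,th)) k"
  and tr: "!!s t y1 y2 r. t \<in> {0..T} ==> U s (t,y1,y2,0,0,r) $ 3 = G (t,y1,y2,r) $ vel_idx s + c_coef P s * \<psi>th s (t,y1,y2,0,0,r)"
   "!!s t y1 y2 r. t \<in> {0..T} ==> U s (t,y1,y2,0,0,r) $ 6 = G (t,y1,y2,r) $ mag_idx s + b_coef P s * \<psi>th s (t,y1,y2,0,0,r)"
  and q: "!!t y1 y2 r. t \<in> {0..T} ==> U Plus (t,y1,y2,0,0,r) $ 7 - U Minus (t,y1,y2,0,0,r) $ 7 = G (t,y1,y2,r) $ 5"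
  by (rule solution_sides[OF U]) (rule that)
 define \<delta> where "\<delta> s = min (\<delta>' s) (\<epsilon> s)" for s
 define V where "V s x = U s x - UU s x" for s x
 define Vb where "Vb s x = Ub s x - UUb s x" for s x
 define Vs where "Vs s x = Us s x - UUs s x" for s x
 have \<delta>': "\<delta>' s > 0" and sU: "splits T s (\<delta>' s) (U s) (Ub s) (Us s)" and solU: "solves P T s (U s) (F s) (F8 s)" for s
  using side[of s] unfolding side_solution_def by blast+
 have \<epsilon>: "\<epsilon> s > 0" and sUU: "splits T s (\<epsilon> s) (UU s) (UUb s) (UUs s)" and solUU: "solves P T s (UU s) (F s) (F8 s)" for s
  using UU[of s] unfolding particular_def side_solution_def by blast+
 have \<delta>: "\<delta> s > 0" "\<delta> s \<ge> 0" for s using \<delta>'[of s] \<epsilon>[of s] by (simp_all add: \<delta>_def)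
 have "smooth6 T s 0 (Vb s)" for s
  unfolding Vb_def[abs_def] by (intro smooth6_diff order_refl splitsD(1)[OF sU] splitsD(1)[OF sUU])
 moreover have "smooth6 T s (\<delta> s) (Vs s)" for s
  unfolding Vs_def[abs_def]
  by (intro smooth6_diff \<delta>(2) smooth6_mono[OF splitsD(3)[OF sU]] smooth6_mono[OF splitsD(3)[OF sUU]]) (simp_all add: \<delta>_def)
 ultimately have V: "splits T s (\<delta> s) (V s) (Vb s) (Vs s)" for s
  using splitsD(2,4)[OF sU] splitsD(2,4)[OF sUU] unfolding splits_def by (simp add: V_def Vb_def Vs_def)
 have V0: "smooth6 T s 0 (V s)" for s by (rule splits_smooth[OF T \<delta>(1) V])
 have sol: "solves P T s (V s) (%_. 0) (%_. 0)" for s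
  unfolding V_def[abs_def]
  by (rule solves_diff[OF splits_smooth[OF T \<delta>' sU] solU splits_smooth[OF T \<epsilon> sUU] solUU])
 have trV: "V s (t,y1,y2,0,0,r) $ 3 = c_coef P s * \<psi>th s (t,y1,y2,0,0,r)" "V s (t,y1,y2,0,0,r) $ 6 = b_coef P s * \<psi>th s (t,y1,y2,0,0,r)"
  if "t \<in> {0..T}" for s t y1 y2 r
  unfolding V_def by (simp_all only: vector_minus_component tr[OF that] particular_trace[OF UU that] add_diff_cancel_left')
 have qV: "V Plus (t,y1,y2,0,0,r) $ 7 = V Minus (t,y1,y2,0,0,r) $ 7" if "t \<in> {0..T}" for t y1 y2 r
  using q[OF that, of y1 y2 r] pressure_jump[OF e UU that, of y1 y2 r] unfolding V_def by simp
 have cV: "coef (cplx (%z. V s z $ 3)) k (t,y1,y2,0,0,th) = of_real (c_coef P s) * (\<i> * of_int k * fourier (%th. \<psi> (t,y1,y2,th)) k)"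
   "coef (cplx (%z. V s z $ 6)) k (t,y1,y2,0,0,th) = of_real (b_coef P s) * (\<i> * of_int k * fourier (%th. \<psi> (t,y1,y2,th)) k)"
  if "t \<in> {0..T}" for s k t y1 y2 th
  unfolding \<psi>c[OF that, symmetric, where s = s and th = th] by (simp_all add: coef_def at_theta_def trV[OF that] cfour_cmult)
 have mVb: "mean (%z. Vb s z $ i) x = mean (%z. V s z $ i) x" if "x \<in> dom6 T s" "i \<in> {3,6,7}" for s i x
  using splits_mean[OF T \<delta>(1) splits_nth[OF V \<delta>(1)] that(1), of i] homogeneous_star_means[OF T \<delta>(1) V sol that(1)] that(2) by auto
 define star where "star i s = (%(t,y1,y2,y3,Y). mean (%z. Vs s z $ i) (t,y1,y2,y3,Y,0))" for i :: 7 and s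
 have free: "f (t,y1,y2,y3,Y,0) = f (t,y1,y2,y3,Y,th)" if "!!r x. f (at_theta r x) = f x" for f :: "pt6 => 'c" and t y1 y2 y3 Y th
  using that[of 0 "(t,y1,y2,y3,Y,th)"] by (simp add: at_theta_def)
 have starS: "(%(t,y1,y2,y3,Y3,th). star i s (t,y1,y2,y3,Y3)) \<in> S_star T s" for i s
 proof -
  have "mean (%z. Vs s z $ i) \<in> S_star T s"
   by (rule smooth6_S_star[OF T \<delta>(1) smooth6_mean[OF T \<delta>(2) smooth6_nth[OF splitsD(3)[OF V] \<delta>(2)]]])
  moreover have "(%(t,y1,y2,y3,Y3,th). star i s (t,y1,y2,y3,Y3)) = mean (%z. Vs s z $ i)"
  proof
   fix x :: pt6
   obtain t y1 y2 y3 Y th where "x = (t,y1,y2,y3,Y,th)" by (cases x)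
   then show "(case x of (t,y1,y2,y3,Y3,th) => star i s (t,y1,y2,y3,Y3)) = mean (%z. Vs s z $ i) x"
    using free[of "mean (%z. Vs s z $ i)" t y1 y2 y3 Y th] by (simp add: star_def)
  qed
  ultimately show ?thesis by simp
 qed
 have mv: "mean_vec (Vb s) (t,y1,y2,y3,Y,th) = mean_vec (Vb s) (t,y1,y2,y3,0,0)" for s t y1 y2 y3 Y th
 proof -
  have "mean_vec (Vb s) (at_Y 0 (at_theta 0 (t,y1,y2,y3,Y,th))) = mean_vec (Vb s) (t,y1,y2,y3,Y,th)"
   by (simp add: mean_vec_def mean_at_Y splitsD(2)[OF V])
  then show ?thesis by (simp add: at_Y_def at_theta_def)
 qed
 have mvs: "smooth6 T s 0 (mean_vec (Vb s))" for s
 proof -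
  note n = smooth6_mean[OF T order_refl smooth6_nth[OF splitsD(1)[OF V] order_refl]]
  show ?thesis
   by (rule smooth6_cong[OF smooth6_vector7[OF order_refl n n n n n n n]]) (simp add: mean_vec_def vec_eq_iff forall_7)
 qed
 let ?Uh = "%s (t,y1,y2,y3). mean_vec (Vb s) (t,y1,y2,y3,0,0)"
 let ?\<gamma> = "%s (t,y1,y2,y3) k. free_mode P s (V s) k (t,y1,y2,y3,0,0)"
 have fm: "free_mode P s (V s) k (t,y1,y2,y3,Y,th) = free_mode P s (V s) k (t,y1,y2,y3,0,0)" for s k t y1 y2 y3 Y th
  using coef_at_theta[of "cplx (%z. V s z $ 7)" k 0 "(t,y1,y2,y3,0,th)"]
  by (simp add: free_mode_def at_Y_def at_theta_def)
 show ?thesis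
  unfolding represented_by_def
 proof (rule exI[of _ ?Uh], rule exI[of _ "star 1"], rule exI[of _ "star 2"], rule exI[of _ "star 4"], rule exI[of _ "star 5"],
   rule exI[of _ ?\<gamma>], intro conjI)
  show "\<forall>s. (%(t,y1,y2,y3,th). ?Uh s (t,y1,y2,y3)) \<in> S_under T s"
  proof
   fix s
   have "(%(t,y1,y2,y3,th). mean_vec (Vb s) (t,y1,y2,y3,0,th)) \<in> S_under T s"
    by (rule smooth6_S_under[OF T mvs])
   then show "(%(t,y1,y2,y3,th). ?Uh s (t,y1,y2,y3)) \<in> S_under T s"
    by (subst (asm) mv) simp
  qed
  show "\<forall>s. \<forall>v\<in>{star 1 s, star 2 s, star 4 s, star 5 s}. (%(t,y1,y2,y3,Y3,th). v (t,y1,y2,y3,Y3)) \<in> S_star T s"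
   using starS by blast
  show "\<forall>s. \<forall>(t,y1,y2,y3,Y3,th) \<in> dom6 T s.
      ((%k. (?\<gamma> s (t,y1,y2,y3) k * exp (of_real (- sg s * of_int \<bar>k\<bar> * Y3) + \<i> * of_int k * of_real th)) *s R_vec P s k)
       has_sum cvec (U s (t,y1,y2,y3,Y3,th) - UU s (t,y1,y2,y3,Y3,th) - ?Uh s (t,y1,y2,y3)
          - vector [star 1 s (t,y1,y2,y3,Y3), star 2 s (t,y1,y2,y3,Y3), 0,
               star 4 s (t,y1,y2,y3,Y3), star 5 s (t,y1,y2,y3,Y3), 0, 0])) (UNIV - {0})"
  proof (intro allI ballI)
   fix s and x :: pt6 assume x: "x \<in> dom6 T s"
   obtain t y1 y2 y3 Y th where xe: "x = (t,y1,y2,y3,Y,th)" by (cases x)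
   have st: "mean (%z. Vs s z $ i) x = star i s (t,y1,y2,y3,Y)" for i
    using free[of "mean (%z. Vs s z $ i)" t y1 y2 y3 Y th] by (simp add: star_def xe)
   have YT: "Y_of x = Y" "theta_of x = th" by (simp_all add: xe Y_of_def theta_of_def)
   note h = homogeneous_expansion[OF T \<delta>(1) V sol \<Delta> \<xi> \<tau> x, unfolded YT st V_def[of s x]]
   show "case x of (t,y1,y2,y3,Y3,th) =>
      ((%k. (?\<gamma> s (t,y1,y2,y3) k * exp (of_real (- sg s * of_int \<bar>k\<bar> * Y3) + \<i> * of_int k * of_real th)) *s R_vec P s k)
       has_sum cvec (U s (t,y1,y2,y3,Y3,th) - UU s (t,y1,y2,y3,Y3,th) - ?Uh s (t,y1,y2,y3)
          - vector [star 1 s (t,y1,y2,y3,Y3), star 2 s (t,y1,y2,y3,Y3), 0,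
               star 4 s (t,y1,y2,y3,Y3), star 5 s (t,y1,y2,y3,Y3), 0, 0])) (UNIV - {0})"
    using h unfolding xe mv[of s t y1 y2 y3 Y th] fm[of s _ t y1 y2 y3 Y th] prod.case .
  qed
  show "\<forall>s. \<forall>t\<in>{0..T}. \<forall>y1 y2 k. k \<noteq> 0 \<longrightarrow> ?\<gamma> s (t,y1,y2,0) k = of_real (sg s) * of_int \<bar>k\<bar> * fourier (%th. \<psi> (t,y1,y2,th)) k"
   unfolding prod.case
   by (intro allI ballI impI free_mode_trace[OF T V0 sol \<Delta> \<xi> \<tau> _ trace_point]) (simp_all add: Y_of_def cV)
  show "\<forall>s. \<forall>t\<in>{0..T}. \<forall>y1 y2. \<forall>y3\<in>cslab s. \<forall>k. k \<noteq> 0 \<longrightarrow> ?\<gamma> s (t,y1,y2,y3) (- k) = cnj (?\<gamma> s (t,y1,y2,y3) k)"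
   by (simp add: free_mode_def coef_cnj_real)
  show "\<forall>t\<in>{0..T}. \<forall>y1 y2. (\<forall>s. ?Uh s (t,y1,y2,0) $ 3 = 0 \<and> ?Uh s (t,y1,y2,0) $ 6 = 0) \<and> ?Uh Plus (t,y1,y2,0) $ 7 = ?Uh Minus (t,y1,y2,0) $ 7"
  proof (intro ballI allI conjI)
   fix t y1 y2 :: real assume t: "t \<in> {0..T}"
   note m = mVb[OF trace_point[OF t]]
   have "mean (%z. V s z $ 3) (t,y1,y2,0,0,0) = 0" "mean (%z. V s z $ 6) (t,y1,y2,0,0,0) = 0" for s
    using cV[OF t, of s 0 y1 y2 0] by (simp_all add: mean_def)
   then show "?Uh s (t,y1,y2,0) $ 3 = 0" "?Uh s (t,y1,y2,0) $ 6 = 0" for s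
    by (simp_all add: mean_vec_def m)
   have "mean (%z. V Plus z $ 7) (t,y1,y2,0,0,0) = mean (%z. V Minus z $ 7) (t,y1,y2,0,0,0)"
    by (simp add: mean_def coef_def at_theta_def qV[OF t])
   then show "?Uh Plus (t,y1,y2,0) $ 7 = ?Uh Minus (t,y1,y2,0) $ 7"
    by (simp add: mean_vec_def m)
  qed
 qed
qed

end

theorem theorem3p1:
  fixes P :: mhd_params and T :: real and p q :: int
    and F Fs :: "side \<Rightarrow> pt6 \<Rightarrow> real^7" and Fb :: "side \<Rightarrow> pt5 \<Rightarrow> real^7"
    and F8 F8s :: "side \<Rightarrow> pt6 \<Rightarrow> real" and F8b :: "side \<Rightarrow> pt5 \<Rightarrow> real"
    and G :: "pt4 \<Rightarrow> real^5"
  assumes "T > 0"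
    and stability:
      "(norm (cross3 (H0 P Plus) (u0 P Plus - u0 P Minus)))\<^sup>2
       + (norm (cross3 (H0 P Minus) (u0 P Plus - u0 P Minus)))\<^sup>2
       < 2 * (norm (cross3 (H0 P Plus) (H0 P Minus)))\<^sup>2"
    and "(p, q) \<noteq> (0, 0)"
    and "xi1 P = of_int p / sqrt ((of_int p)\<^sup>2 + (of_int q)\<^sup>2)"
    and "xi2 P = of_int q / sqrt ((of_int p)\<^sup>2 + (of_int q)\<^sup>2)"
    and "\<bar>a_coef P Plus - a_coef P Minus\<bar> \<noteq> \<bar>b_coef P Plus - b_coef P Minus\<bar>"
    and "\<bar>a_coef P Plus - a_coef P Minus\<bar> \<noteq> \<bar>b_coef P Plus + b_coef P Minus\<bar>"
    and "(c_coef P Plus)\<^sup>2 + (c_coef P Minus)\<^sup>2 = (b_coef P Plus)\<^sup>2 + (b_coef P Minus)\<^sup>2"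
    and "tau P \<noteq> 0"
    and F: "\<And>s. decomposes T s (F s) (Fb s) (Fs s)"
    and F8: "\<And>s. decomposes T s (F8 s) (F8b s) (F8s s)"
    and G: "G \<in> H_bdry T"
  shows
    "((\<exists>U \<psi>. fast_solution P T F F8 G U \<psi>) \<longleftrightarrow>
        cond_a P T F G \<and> cond_b T Fb F8b \<and> cond_c P T Fs F8s \<and> cond_d P T F F8 \<and> cond_e P T F G)
     \<and>
     (cond_a P T F G \<and> cond_b T Fb F8b \<and> cond_c P T Fs F8s \<and> cond_d P T F F8 \<and> cond_e P T F G
      \<longrightarrow>
      (\<exists>UU UUb UUs.
         fast_solution P T F F8 G UU (\<lambda>_. 0) \<and>
         (\<forall>s. decomposes T s (UU s) (UUb s) (UUs s)) \<and>
         (\<forall>s. \<forall>t\<in>{0..T}. \<forall>y1 y2. \<forall>y3\<in>cslab s. \<forall>Y3\<in>chalf s.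
            proj_Pi (vfourier (\<lambda>\<theta>. UU s (t,y1,y2,y3,Y3,\<theta>)) 0) = 0) \<and>
         (\<forall>s. \<forall>t\<in>{0..T}. \<forall>y1 y2.
            vfourier (\<lambda>\<theta>. UUb s (t,y1,y2,sg s,\<theta>)) 0 = 0) \<and>
         (\<forall>U \<psi>. fast_solution P T F F8 G U \<psi> \<longrightarrow> represented_by P T UU U \<psi>)))"
proof -
 have "of_int p ^ 2 + of_int q ^ 2 \<noteq> (0 :: real)"
  using assms(3) by (simp add: sum_power2_eq_zero_iff)
 then have \<xi>: "(xi1 P)\<^sup>2 + (xi2 P)\<^sup>2 = 1"
  unfolding assms(4,5) power_divide by (simp add: add_divide_distrib[symmetric])
 \<comment> \<open>\<open>c\<^sup>2 = b\<^sup>2\<close> on one side forces it on the other, and then \<open>a\<^sup>+ - a\<^sup>- = c\<^sup>+ - c\<^sup>- = \<plusminus>(b\<^sup>+ \<plusminus> b\<^sup>-)\<close>\<close>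
 have dich: "\<bar>x\<bar> = \<bar>u - v\<bar> \<or> \<bar>x\<bar> = \<bar>u + v\<bar>" if "x = c - d" "c\<^sup>2 = u\<^sup>2" "d\<^sup>2 = v\<^sup>2" for x c d u v :: real
  using that unfolding power2_eq_iff by (elim disjE) (simp_all add: abs_if)
 have \<Delta>: "(c_coef P s)\<^sup>2 - (b_coef P s)\<^sup>2 \<noteq> 0" for s
 proof
  assume "(c_coef P s)\<^sup>2 - (b_coef P s)\<^sup>2 = 0"
  then have "(c_coef P Plus)\<^sup>2 = (b_coef P Plus)\<^sup>2 \<and> (c_coef P Minus)\<^sup>2 = (b_coef P Minus)\<^sup>2"
   using assms(8) by (cases s) simp_all
  then show False
   using dich[of "a_coef P Plus - a_coef P Minus" "c_coef P Plus" "c_coef P Minus" "b_coef P Plus" "b_coef P Minus"] assms(6,7) by (simp add: c_coef_def)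
 qed
 interpret fast_data P T F Fs Fb F8 F8s F8b G
  by unfold_locales (use assms \<xi> \<Delta> in simp_all)
 let ?C = "cond_a P T F G \<and> cond_b T Fb F8b \<and> cond_c P T Fs F8s \<and> cond_d P T F F8 \<and> cond_e P T F G"
 have nec: "?C" if "fast_solution P T F F8 G U \<psi>" for U \<psi>
  using conditions_necessary[OF that] by blast
 have suf: "\<exists>UU UUb UUs. fast_solution P T F F8 G UU (%_. 0) \<and>
     (\<forall>s. decomposes T s (UU s) (UUb s) (UUs s)) \<and>
     (\<forall>s. \<forall>t\<in>{0..T}. \<forall>y1 y2. \<forall>y3\<in>cslab s. \<forall>Y3\<in>chalf s.
      proj_Pi (vfourier (%th. UU s (t,y1,y2,y3,Y3,th)) 0) = 0) \<and>
     (\<forall>s. \<forall>t\<in>{0..T}. \<forall>y1 y2.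
      vfourier (%th. UUb s (t,y1,y2,sg s,th)) 0 = 0) \<and>
     (\<forall>U \<psi>. fast_solution P T F F8 G U \<psi> \<longrightarrow> represented_by P T UU U \<psi>)" if C: ?C
 proof -
  have "\<forall>s. \<exists>U Ub Us \<delta>. particular s U Ub Us \<delta>" using particular_exists C by blast
  then obtain U Ub Us \<delta> where U: "!!s. particular s (U s) (Ub s) (Us s) (\<delta> s)" by metis
  have e: "cond_e P T F G" using C by blast
  show ?thesis
  proof (rule exI[of _ U], rule exI[of _ "%s (t,y1,y2,y3,th). Ub s (t,y1,y2,y3,0,th)"], rule exI[of _ Us], intro conjI)
   show "fast_solution P T F F8 G U (%_. 0)" by (rule particular_fast_solution(1)[OF e U])
   show "\<forall>s. decomposes T s (U s) (%(t,y1,y2,y3,th). Ub s (t,y1,y2,y3,0,th)) (Us s)"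
    using particular_fast_solution(2)[OF e U] by blast
   show "\<forall>U' \<psi>. fast_solution P T F F8 G U' \<psi> \<longrightarrow> represented_by P T U U' \<psi>"
    using solution_represented[OF e U] by blast
   show "\<forall>s. \<forall>t\<in>{0..T}. \<forall>y1 y2. \<forall>y3\<in>cslab s. \<forall>Y3\<in>chalf s. proj_Pi (vfourier (%th. U s (t,y1,y2,y3,Y3,th)) 0) = 0"
   proof (intro allI ballI)
    fix s y1 y2 and t y3 Y3 :: real assume "t \<in> {0..T}" "y3 \<in> cslab s" "Y3 \<in> chalf s"
    then have "(t,y1,y2,y3,Y3,0) \<in> dom6 T s" by (simp add: dom6_def)
    then have "mean (%z. U s z $ i) (t,y1,y2,y3,Y3,0) = 0" if "i \<in> {1,2,4,5}" for i
     using U[of s] that unfolding particular_def by blast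
    then show "proj_Pi (vfourier (%th. U s (t,y1,y2,y3,Y3,th)) 0) = 0"
     using fourier_mean[of "%z. U s z $ i" t y1 y2 y3 Y3 0 for i]
     by (simp add: proj_Pi_def vfourier_def vec_eq_iff forall_7)
   qed
   show "\<forall>s. \<forall>t\<in>{0..T}. \<forall>y1 y2. vfourier (%th. case (t,y1,y2,sg s,th) of (t,y1,y2,y3,th) => Ub s (t,y1,y2,y3,0,th)) 0 = 0"
   proof (intro allI ballI)
    fix s y1 y2 and t :: real assume "t \<in> {0..T}"
    then have "(t,y1,y2,sg s,0,0) \<in> dom6 T s" by (simp add: dom6_def cslab_def chalf_def)
    moreover have "y3_of (t,y1,y2,sg s,0,0) = sg s" by (simp add: y3_of_def)
    ultimately have "mean_vec (Ub s) (t,y1,y2,sg s,0,0) = 0"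
     using U[of s] unfolding particular_def by blast
    then show "vfourier (%th. case (t,y1,y2,sg s,th) of (t,y1,y2,y3,th) => Ub s (t,y1,y2,y3,0,th)) 0 = 0"
     using fourier_mean[of "%z. Ub s z $ i" t y1 y2 "sg s" 0 0 for i]
     by (simp add: vfourier_def vec_eq_iff mean_vec_def)
   qed
  qed
 qed
 show ?thesis
  using nec suf by blast
qed

end
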